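(* Let $0<\alpha<n$. Suppose that $p(\cdot)\in LH$, $0<p^-\le p^+\le1$ and $\frac1{q(x)}=\frac1{p(x)}-\frac\alpha n$ for any $x\in\mathbb R^n$. (a) If $0<q^-\le q^+\le1$, then there exists a constant $C$ such that $\|I^{loc}_\alpha(f)\|_{bmo^{p(\cdot)}}\le C\|f\|_{bmo^{q(\cdot)}}$ for all $f\in bmo^{q(\cdot)}$. (b) If $p^+<1<q^-\le q^+<\infty$, then there exists a constant $C$ such that $\|I^{loc}_\alpha(f)\|_{bmo^{p(\cdot)}}\le C\|f\|_{L^{q'(\cdot)}}$ for all $f\in L^{q'(\cdot)}$, where $\frac1{q(x)}+\frac1{q'(x)}=1$.
   Context: $n$ is the dimension of $\mathbb R^n$; $\mathbb N=\{0,1,2,\dots\}$. For measurable $p(\cdot):\mathbb R^n\to(0,\infty)$ put $p^-=\inf_{x}p(x)$, $p^+=\sup_x p(x)$ (similarly $q^\pm$). $p(\cdot)\in LH$ means that there is $C>0$ with $|p(x)-p(y)|\le \frac{C}{-\log|x-y|}$ for $|x-y|\le 1/2$ and $|p(x)-p(y)|\le\frac{C}{\log(|x|+e)}$ for $|y|\ge|x|$. $L^{p(\cdot)}$ is the set of measurable $f$ on $\mathbb R^n$ with $\int|\varepsilon f(x)|^{p(x)}dx<\infty$ for some $\varepsilon>0$, with quasi-norm $\|f\|_{L^{p(\cdot)}}=\inf\{\lambda>0:\int(|f(x)|/\lambda)^{p(x)}dx\le1\}$. Local variable Campanato space. Let $p(\cdot)\in LH$ with $0<p^-\le p^+\le1$.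 Fix a constant exponent $r\in(1,\infty)$, $r'=r/(r-1)$, and an integer $d\ge d_{p(\cdot)}\equiv\min\{d\in\mathbb N:p^-(n+d+1)>n\}$. $\mathcal P_d$ is the space of polynomials on $\mathbb R^n$ of degree at most $d$; for $g\in L^1_{loc}$ and a cube $Q$, $P_Qg$ is the unique element of $\mathcal P_d$ with $\int_Q(g(x)-P_Qg(x))R(x)dx=0$ for all $R\in\mathcal P_d$. Then $$\|f\|_{bmo^{p(\cdot)}}=\sup_{|Q|<1}\frac{|Q|}{\|\chi_Q\|_{L^{p(\cdot)}}}\left(\frac1{|Q|}\int_Q|f-P_Qf|^{r'}dx\right)^{1/r'}+\sup_{|Q|\ge1}\frac{|Q|}{\|\chi_Q\|_{L^{p(\cdot)}}}\left(\frac1{|Q|}\int_Q|f|^{r'}dx\right)^{1/r'},$$ suprema over cubes $Q\subset\mathbb R^n$, and $bmo^{p(\cdot)}=\{f\in L^1_{loc}:\|f\|_{bmo^{p(\cdot)}}<\infty\}$. The space $bmo^{q(\cdot)}$ is defined in the same way with $q(\cdot)$ in place of $p(\cdot)$ (and $d\ge d_{q(\cdot)}$). Local fractional integral. Let $\phi_0\in C_c^\infty(\mathbb R^n)$ with $\phi_0\equiv1$ on $Q(0,1)$ and $\operatorname{supp}\phi_0\subset Q(0,2)$, where $Q(x,\ell)$ is the closed cube centered at $x$ with side length $\ell$. For $\alpha\in[0,n)$ and $f\in L^1_{loc}$, $$I^{loc}_\alpha(f)(x)=\int_{\mathbb R^n}\frac{\phi_0(y)}{|y|^{n-\alpha}}f(x-y)\,dy.$$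 *)

theory Defs
  imports "HOL-Analysis.Analysis"
begin

section \<open>Variable exponents\<close>

definition var_exponent :: "(real^'n::finite \<Rightarrow> real) \<Rightarrow> bool" where
  "var_exponent p \<longleftrightarrow> p \<in> borel_measurable lebesgue \<and> (\<forall>x. 0 < p x)"

text \<open>The bounds live in the extended reals: there \<open>exp_sup p < \<infinity>\<close> expresses boundedness,
  whereas the real-valued supremum of an unbounded set is an unspecified number.\<close>

definition exp_inf :: "(real^'n::finite \<Rightarrow> real) \<Rightarrow> ereal" where
  "exp_inf p = (INF x. ereal (p x))"

definition exp_sup :: "(real^'n::finite \<Rightarrow> real) \<Rightarrow> ereal" where
  "exp_sup p = (SUP x. ereal (p x))"

definition LH :: "(real^'n::finite \<Rightarrow> real) set" where
  "LH = {p. var_exponent p \<and>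
     (\<exists>C>0. (\<forall>x y. 0 < norm (x - y) \<and> norm (x - y) \<le> 1 / 2 \<longrightarrow>
                   \<bar>p x - p y\<bar> \<le> C / (- ln (norm (x - y)))) \<and>
            (\<forall>x y. norm x \<le> norm y \<longrightarrow> \<bar>p x - p y\<bar> \<le> C / ln (norm x + exp 1)))}"


section \<open>Variable Lebesgue spaces\<close>

definition Lvar :: "(real^'n::finite \<Rightarrow> real) \<Rightarrow> (real^'n \<Rightarrow> complex) set" where
  "Lvar p = {f. f \<in> borel_measurable lebesgue \<and>
     (\<exists>\<epsilon>>0. (\<integral>\<^sup>+x. ennreal ((\<epsilon> * norm (f x)) powr p x) \<partial>lebesgue) < \<infinity>)}"

definition Lvar_norm ::
    "(real^'n::finite \<Rightarrow> real) \<Rightarrow> (real^'n \<Rightarrow> 'b::real_normed_vector) \<Rightarrow> ennreal" where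
  "Lvar_norm p f =
     Inf (ennreal ` {t. 0 < t \<and>
       (\<integral>\<^sup>+x. ennreal ((norm (f x) / t) powr p x) \<partial>lebesgue) \<le> 1})"

definition L1_loc :: "(real^'n::finite \<Rightarrow> complex) set" where
  "L1_loc = {f. \<forall>K. compact K \<longrightarrow> set_integrable lebesgue K f}"


section \<open>Cubes and polynomials\<close>

definition cube :: "real^'n::finite \<Rightarrow> real \<Rightarrow> (real^'n) set" where
  "cube x l = cbox (\<chi> i. x $ i - l / 2) (\<chi> i. x $ i + l / 2)"

definition cubes :: "(real^'n::finite) set set" where
  "cubes = {Q. \<exists>x l. 0 < l \<and> Q = cube x l}"

definition multi_indices :: "nat \<Rightarrow> ('n::finite \<Rightarrow> nat) set" where
  "multi_indices d = {\<beta>. (\<Sum>i\<in>UNIV. \<beta> i) \<le> d}"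

lemma finite_multi_indices: "finite (multi_indices d :: ('n::finite \<Rightarrow> nat) set)"
proof (rule finite_subset)
  show "(multi_indices d :: ('n \<Rightarrow> nat) set) \<subseteq> PiE UNIV (\<lambda>_. {..d})"
  proof
    fix \<beta> :: "'n \<Rightarrow> nat" assume "\<beta> \<in> multi_indices d"
    moreover have "\<beta> i \<le> (\<Sum>i\<in>UNIV. \<beta> i)" for i
      by (rule member_le_sum) auto
    ultimately show "\<beta> \<in> PiE UNIV (\<lambda>_. {..d})"
      by (auto simp: multi_indices_def intro: order_trans)
  qed
  show "finite (PiE (UNIV :: 'n set) (\<lambda>_. {..d}))"
    by (rule finite_PiE) auto
qed

definition poly_space :: "nat \<Rightarrow> (real^'n::finite \<Rightarrow> complex) set" where
  "poly_space d = {P. \<exists>c. P = (\<lambda>x. \<Sum>\<beta>\<in>multi_indices d.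
                               c \<beta> * of_real (\<Prod>i\<in>UNIV. (x $ i) ^ \<beta> i))}"

definition poly_proj ::
    "nat \<Rightarrow> (real^'n::finite) set \<Rightarrow> (real^'n \<Rightarrow> complex) \<Rightarrow> real^'n \<Rightarrow> complex" where
  "poly_proj d Q g = (THE P. P \<in> poly_space d \<and>
     (\<forall>R\<in>poly_space d. (LINT x:Q|lebesgue. (g x - P x) * R x) = 0))"


section \<open>Local variable Campanato spaces\<close>

definition min_degree :: "(real^'n::finite \<Rightarrow> real) \<Rightarrow> nat" where
  "min_degree p = (LEAST d. exp_inf p * ereal (real (CARD('n) + d + 1)) > ereal (real CARD('n)))"

text \<open>Power of an extended nonnegative number, for an exponent \<open>s > 0\<close>.\<close>

definition ennreal_pow :: "ennreal \<Rightarrow> real \<Rightarrow> ennreal" where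
  "ennreal_pow a s = (if a = \<infinity> then \<infinity> else ennreal (enn2real a powr s))"

definition mean_norm :: "real \<Rightarrow> (real^'n::finite) set \<Rightarrow> (real^'n \<Rightarrow> complex) \<Rightarrow> ennreal" where
  "mean_norm s Q f =
     ennreal_pow ((\<integral>\<^sup>+x\<in>Q. ennreal (norm (f x) powr s) \<partial>lebesgue) / emeasure lebesgue Q) (1 / s)"

definition bmo_norm ::
    "(real^'n::finite \<Rightarrow> real) \<Rightarrow> real \<Rightarrow> nat \<Rightarrow> (real^'n \<Rightarrow> complex) \<Rightarrow> ennreal" where
  "bmo_norm p r d f = (let r' = r / (r - 1) in
     (SUP Q\<in>{Q\<in>cubes. emeasure lebesgue Q < 1}.
        emeasure lebesgue Q / Lvar_norm p (indicat_real Q)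
          * mean_norm r' Q (\<lambda>x. f x - poly_proj d Q f x)) +
     (SUP Q\<in>{Q\<in>cubes. emeasure lebesgue Q \<ge> 1}.
        emeasure lebesgue Q / Lvar_norm p (indicat_real Q) * mean_norm r' Q f))"

definition bmo :: "(real^'n::finite \<Rightarrow> real) \<Rightarrow> real \<Rightarrow> nat \<Rightarrow> (real^'n \<Rightarrow> complex) set" where
  "bmo p r d = {f \<in> L1_loc. bmo_norm p r d f < \<infinity>}"


section \<open>Local fractional integrals\<close>

fun C_k :: "nat \<Rightarrow> (real^'n::finite \<Rightarrow> 'b::real_normed_vector) \<Rightarrow> bool" where
  "C_k 0 f \<longleftrightarrow> continuous_on UNIV f"
| "C_k (Suc k) f \<longleftrightarrow> f differentiable_on UNIV \<and>
     (\<forall>i. C_k k (\<lambda>x. frechet_derivative f (at x) (axis i 1)))"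

definition C_infinity :: "(real^'n::finite \<Rightarrow> 'b::real_normed_vector) \<Rightarrow> bool" where
  "C_infinity f \<longleftrightarrow> (\<forall>k. C_k k f)"

definition local_cutoff :: "(real^'n::finite \<Rightarrow> complex) \<Rightarrow> bool" where
  "local_cutoff \<phi> \<longleftrightarrow> C_infinity \<phi> \<and> (\<forall>x\<in>cube 0 1. \<phi> x = 1) \<and> closure {x. \<phi> x \<noteq> 0} \<subseteq> cube 0 2"

definition I_loc ::
    "(real^'n::finite \<Rightarrow> complex) \<Rightarrow> real \<Rightarrow> (real^'n \<Rightarrow> complex) \<Rightarrow> real^'n \<Rightarrow> complex" where
  "I_loc \<phi> \<alpha> f x =
     (LINT y|lebesgue. \<phi> y / of_real (norm y powr (real CARD('n) - \<alpha>)) * f (x - y))"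

end

theory Submission
  imports Defs
begin

text \<open>
  Both estimates are proved directly, without the duality between local Hardy spaces and
  \<open>bmo\<close>. Put \<open>\<sigma>(x) = n (1 / q(x) - 1)\<close>, so that \<open>\<sigma>(x) + \<alpha> = n (1 / p(x) - 1)\<close>. By log-Holder
  continuity, \<open>|Q| / ||\<chi>_Q||\<close> is comparable to a power of the side length of \<open>Q\<close>, with the exponent
  of the centre of \<open>Q\<close> if \<open>Q\<close> is small and with the exponent of a point of maximal norm if
  \<open>Q\<close> is large. The claim for a small cube \<open>Q\<close> of side \<open>l\<close> and centre \<open>x\<close> thus
  becomes: on \<open>Q\<close>, the potential is within \<open>O(l^(\<sigma>(x) + \<alpha>))\<close> of a polynomial of degree at
  most \<open>d\<close>. Subtract from \<open>f\<close> a polynomial \<open>R\<close> that approximates it near \<open>Q\<close>; the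
  potential of \<open>R\<close> is again a polynomial. The part of \<open>f - R\<close> near \<open>Q\<close> is estimated by
  Young's inequality (in (b), where \<open>R = 0\<close>, by a pointwise bound), and for the part away from
  \<open>Q\<close> the kernel is replaced by its Taylor polynomial of degree \<open>d\<close>. Since
  \<open>\<sigma>(x) + \<alpha> < d + 1\<close> with a uniform gap, the resulting dyadic sums converge.
\<close>

subsection \<open>Cubes\<close>

text \<open>Locality keeps the chains of cubes short: for \<open>x\<close> in a cube of side at most
  1, only the values of \<open>f\<close> in the concentric cube of side 3 matter, so each dyadic
  chain stops at a side between 3 and 8. At that side the norm of \<open>bmo\<close> controls
  \<open>f\<close> itself, which lets the chain end in the zero polynomial. The bound \<sigma>(x) +
  \<alpha> < d + 1 comes from \<open>min_degree p\<close>, since \<sigma>(x) + \<alpha> is at most n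
  (1 / p^- - 1). A small loss in the exponent is unavoidable, because the coefficient sums stop
  being geometric when \<sigma>(x) is an integer; the gap pays for it. In (b), \<sigma> is negative
  and \<open>f\<close> has no oscillation estimate to exploit; there p^+ < 1 gives \<sigma>(x) +
  \<alpha> \<ge> n (1 / p^+ - 1) > 0, and this positivity makes the potential bounded at every
  point. Finally, \<open>f\<close> is only Lebesgue measurable whereas Tonelli's theorem is applied
  to Borel functions; a Borel version of \<open>f\<close> has the same potential at every
  point.\<close>

lemma mem_cube_iff: "y \<in> cube x l \<longleftrightarrow> infnorm (y - x) \<le> l / 2"
proof -
  have "y \<in> cube x l \<longleftrightarrow> (\<forall>i. \<bar>(y - x) $ i\<bar> \<le> l / 2)"
  proof -
    have "(x $ i - l / 2 \<le> y $ i \<and> y $ i \<le> x $ i + l / 2) = (\<bar>(y - x) $ i\<bar> \<le> l / 2)" for i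
      unfolding vector_minus_component abs_le_iff by (rule iffI; linarith)
    then show ?thesis by (simp add: cube_def mem_box_cart)
  qed
  also have "\<dots> \<longleftrightarrow> infnorm (y - x) \<le> l / 2"
  proof
    assume *: "\<forall>i. \<bar>(y - x) $ i\<bar> \<le> l / 2"
    have "infnorm (y - x) \<in> (\<lambda>i. \<bar>(y - x) \<bullet> i\<bar>) ` Basis"
      unfolding infnorm_Max by (intro Max_in) auto
    then obtain b where b: "b \<in> Basis" "infnorm (y - x) = \<bar>(y - x) \<bullet> b\<bar>" by auto
    then show "infnorm (y - x) \<le> l / 2"
      using * by (auto simp: Basis_vec_def inner_axis)
  next
    assume "infnorm (y - x) \<le> l / 2"
    then show "\<forall>i. \<bar>(y - x) $ i\<bar> \<le> l / 2"
      using component_le_infnorm_cart[of "y - x"] by (meson order_trans)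
  qed
  finally show ?thesis .
qed

lemma cube_borel [measurable]: "cube x l \<in> sets borel"
  unfolding cube_def by simp

lemma cube_lebesgue [measurable]: "cube x l \<in> sets lebesgue"
  unfolding cube_def by simp

lemma compact_cube: "compact (cube x l)"
  unfolding cube_def by simp

lemma cube_mono: "s \<le> t \<Longrightarrow> cube x s \<subseteq> cube x t"
  by (auto simp: mem_cube_iff)

lemma emeasure_cube:
  assumes "0 \<le> l"
  shows "emeasure lborel (cube (x::real^'n::finite) l) = ennreal (l ^ CARD('n))"
proof -
  have "(\<chi> i. x $ i - l / 2) \<bullet> b \<le> (\<chi> i. x $ i + l / 2) \<bullet> b" if "b \<in> Basis" for b :: "real^'n"
    using that assms by (auto simp: Basis_vec_def inner_axis)
  then have "emeasure lborel (cube x l)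
      = (\<Prod>b\<in>Basis. ((\<chi> i. x $ i + l / 2) - (\<chi> i. x $ i - l / 2)) \<bullet> b)"
    unfolding cube_def by (rule emeasure_lborel_cbox)
  also have "(\<Prod>b\<in>Basis. ((\<chi> i. x $ i + l / 2) - (\<chi> i. x $ i - l / 2)) \<bullet> b)
      = (\<Prod>b\<in>(Basis :: (real^'n) set). l)"
    by (intro prod.cong refl) (auto simp: Basis_vec_def inner_axis)
  finally show ?thesis by simp
qed

lemma norm_le_card_infnorm: "norm (x::real^'n::finite) \<le> real CARD('n) * infnorm x"
proof -
  have "norm x \<le> (\<Sum>i\<in>UNIV. \<bar>x $ i\<bar>)" by (rule norm_le_l1_cart)
  also have "\<dots> \<le> (\<Sum>i\<in>(UNIV::'n set). infnorm x)"
    by (intro sum_mono component_le_infnorm_cart)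
  finally show ?thesis by simp
qed

lemma bounded_imp_subset_cube:
  assumes "bounded (K :: (real^'n::finite) set)"
  obtains l where "1 \<le> l" "K \<subseteq> cube 0 l"
proof -
  obtain B where B: "\<And>x. x \<in> K \<Longrightarrow> norm x \<le> B"
    using assms by (auto simp: bounded_iff)
  have "K \<subseteq> cube 0 (max 1 (2 * B))"
    using order_trans[OF infnorm_le_norm B] by (fastforce simp: mem_cube_iff)
  then show thesis using that[of "max 1 (2 * B)"] by auto
qed

subsection \<open>Polynomials\<close>

definition mpow :: "('n \<Rightarrow> nat) \<Rightarrow> real^'n::finite \<Rightarrow> real" where
  "mpow \<beta> x = (\<Prod>i\<in>UNIV. (x $ i) ^ \<beta> i)"

abbreviation msize :: "('n::finite \<Rightarrow> nat) \<Rightarrow> nat" where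
  "msize \<beta> \<equiv> (\<Sum>i\<in>UNIV. \<beta> i)"

lemma multi_indices_iff: "\<beta> \<in> multi_indices d \<longleftrightarrow> msize \<beta> \<le> d"
  by (simp add: multi_indices_def)

declare finite_multi_indices [simp]

lemma poly_space_iff:
  "P \<in> poly_space d \<longleftrightarrow> (\<exists>c. \<forall>x. P x = (\<Sum>\<beta>\<in>multi_indices d. c \<beta> * of_real (mpow \<beta> x)))"
  by (auto simp: poly_space_def mpow_def fun_eq_iff)

lemma poly_spaceI:
  "(\<And>x. P x = (\<Sum>\<beta>\<in>multi_indices d. c \<beta> * of_real (mpow \<beta> x))) \<Longrightarrow> P \<in> poly_space d"
  by (auto simp: poly_space_iff)

lemma continuous_on_mpow [continuous_intros]:
  "continuous_on S g \<Longrightarrow> continuous_on S (\<lambda>x. mpow \<beta> (g x))"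
  unfolding mpow_def by (intro continuous_intros)

lemma mpow_scale: "mpow \<beta> (t *\<^sub>R x) = t ^ msize \<beta> * mpow \<beta> x"
  by (simp add: mpow_def power_mult_distrib prod.distrib power_sum)

lemma abs_mpow_le: "\<bar>mpow \<beta> x\<bar> \<le> infnorm x ^ msize \<beta>"
proof -
  have "\<bar>mpow \<beta> x\<bar> = (\<Prod>i\<in>UNIV. \<bar>x $ i\<bar> ^ \<beta> i)"
    by (simp add: mpow_def abs_prod power_abs)
  also have "\<dots> \<le> (\<Prod>i\<in>UNIV. infnorm x ^ \<beta> i)"
    by (intro prod_mono) (auto intro!: power_mono component_le_infnorm_cart)
  finally show ?thesis by (simp add: power_sum)
qed

text \<open>A polynomial in \<open>x\<close> whose coefficients are continuous functions of
  \<open>y\<close>. Translates R (x - y) have this form, and integrating it in \<open>y\<close>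
  against a compactly supported kernel leaves a polynomial in \<open>x\<close>.\<close>

definition param_poly :: "nat \<Rightarrow> (real^'n::finite \<Rightarrow> real^'n \<Rightarrow> complex) \<Rightarrow> bool" where
  "param_poly d F \<longleftrightarrow> (\<exists>h. (\<forall>\<gamma>. continuous_on UNIV (h \<gamma>)) \<and>
     (\<forall>x y. F x y = (\<Sum>\<gamma>\<in>multi_indices d. h \<gamma> y * of_real (mpow \<gamma> x))))"

lemma param_poly_mono:
  assumes "param_poly d F" "d \<le> e"
  shows "param_poly e F"
proof -
  obtain h where h: "\<And>\<gamma>. continuous_on UNIV (h \<gamma>)"
    "\<And>x y. F x y = (\<Sum>\<gamma>\<in>multi_indices d. h \<gamma> y * of_real (mpow \<gamma> x))"
    using assms(1) unfolding param_poly_def by blast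
  have sub: "multi_indices d \<subseteq> (multi_indices e :: ('a \<Rightarrow> nat) set)"
    using assms(2) by (auto simp: multi_indices_iff)
  have "F x y = (\<Sum>\<gamma>\<in>multi_indices e. (if msize \<gamma> \<le> d then h \<gamma> y else 0) * of_real (mpow \<gamma> x))" for x y
    unfolding h(2) by (rule sum.mono_neutral_cong_left[OF _ sub]) (auto simp: multi_indices_iff)
  moreover have "continuous_on UNIV (\<lambda>y. if msize \<gamma> \<le> d then h \<gamma> y else 0)" for \<gamma>
    using h(1) by (cases "msize \<gamma> \<le> d") auto
  ultimately show ?thesis unfolding param_poly_def
    by (intro exI[of _ "\<lambda>\<gamma> y. if msize \<gamma> \<le> d then h \<gamma> y else 0"]) auto
qed

lemma param_poly_add:
  assumes "param_poly d F" "param_poly d G"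
  shows "param_poly d (\<lambda>x y. F x y + G x y)"
proof -
  obtain h k where "\<And>\<gamma>. continuous_on UNIV (h \<gamma>)"
    "\<And>x y. F x y = (\<Sum>\<gamma>\<in>multi_indices d. h \<gamma> y * of_real (mpow \<gamma> x))"
    "\<And>\<gamma>. continuous_on UNIV (k \<gamma>)"
    "\<And>x y. G x y = (\<Sum>\<gamma>\<in>multi_indices d. k \<gamma> y * of_real (mpow \<gamma> x))"
    using assms unfolding param_poly_def by blast
  then show ?thesis unfolding param_poly_def
    by (intro exI[of _ "\<lambda>\<gamma> y. h \<gamma> y + k \<gamma> y"])
       (auto intro!: continuous_intros simp: sum.distrib distrib_right)
qed

lemma param_poly_coeff_mult:
  assumes "param_poly d F" "continuous_on UNIV g"
  shows "param_poly d (\<lambda>x y. g y * F x y)"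
proof -
  obtain h where "\<And>\<gamma>. continuous_on UNIV (h \<gamma>)"
    "\<And>x y. F x y = (\<Sum>\<gamma>\<in>multi_indices d. h \<gamma> y * of_real (mpow \<gamma> x))"
    using assms unfolding param_poly_def by blast
  then show ?thesis using assms(2) unfolding param_poly_def
    by (intro exI[of _ "\<lambda>\<gamma> y. g y * h \<gamma> y"])
       (auto intro!: continuous_intros simp: sum_distrib_left mult.assoc)
qed

lemma param_poly_coord_mult:
  assumes "param_poly d F"
  shows "param_poly (Suc d) (\<lambda>x y. of_real (x $ i) * F x y)"
proof -
  obtain h where h: "\<And>\<gamma>. continuous_on UNIV (h \<gamma>)"
    "\<And>x y. F x y = (\<Sum>\<gamma>\<in>multi_indices d. h \<gamma> y * of_real (mpow \<gamma> x))"
    using assms unfolding param_poly_def by blast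
  define up :: "('a \<Rightarrow> nat) \<Rightarrow> ('a \<Rightarrow> nat)" where "up \<gamma> = \<gamma>(i := Suc (\<gamma> i))" for \<gamma>
  define dn :: "('a \<Rightarrow> nat) \<Rightarrow> ('a \<Rightarrow> nat)" where "dn \<gamma> = \<gamma>(i := \<gamma> i - 1)" for \<gamma>
  \<comment> \<open>Exponents with \<gamma> i = 0 are outside the range of \<open>up\<close>. On
    them the truncated subtraction in \<open>dn\<close> would return \<gamma> itself, so their
    coefficient is set to 0 separately.\<close>
  define h' where "h' \<gamma> y = (if \<gamma> i = 0 then 0 else h (dn \<gamma>) y)" for \<gamma> y
  have dnup [simp]: "dn (up \<gamma>) = \<gamma>" for \<gamma> by (auto simp: up_def dn_def)
  have updn: "up (dn \<gamma>) = \<gamma>" if "\<gamma> i \<noteq> 0" for \<gamma> using that by (auto simp: up_def dn_def)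
  have sz: "msize (up \<gamma>) = Suc (msize \<gamma>)" for \<gamma>
    by (simp add: up_def sum.remove[of UNIV i])
  have mp: "mpow (up \<gamma>) x = x $ i * mpow \<gamma> x" for \<gamma> and x :: "real^'a"
    by (simp add: up_def mpow_def prod.remove[of UNIV i])
  have inj: "inj_on up (multi_indices d)" by (rule inj_on_inverseI[of _ dn]) simp
  have "of_real (x $ i) * F x y = (\<Sum>\<gamma>\<in>multi_indices (Suc d). h' \<gamma> y * of_real (mpow \<gamma> x))" for x y
  proof -
    have "(\<Sum>\<gamma>\<in>multi_indices (Suc d). h' \<gamma> y * of_real (mpow \<gamma> x))
        = (\<Sum>\<gamma>\<in>up ` multi_indices d. h' \<gamma> y * of_real (mpow \<gamma> x))"
    proof (rule sum.mono_neutral_cong_right)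
      show "up ` multi_indices d \<subseteq> multi_indices (Suc d)"
        by (auto simp: multi_indices_iff sz)
      have "\<gamma> i = 0" if "\<gamma> \<in> multi_indices (Suc d) - up ` multi_indices d" for \<gamma>
      proof (rule ccontr)
        assume "\<gamma> i \<noteq> 0"
        with updn have *: "\<gamma> = up (dn \<gamma>)" by simp
        then have "msize \<gamma> = Suc (msize (dn \<gamma>))" using sz by metis
        then have "dn \<gamma> \<in> multi_indices d" using that by (auto simp: multi_indices_iff)
        then show False using that * by blast
      qed
      then show "\<forall>\<gamma>\<in>multi_indices (Suc d) - up ` multi_indices d. h' \<gamma> y * of_real (mpow \<gamma> x) = 0"
        by (simp add: h'_def)
    qed auto
    also have "\<dots> = (\<Sum>\<gamma>\<in>multi_indices d. h' (up \<gamma>) y * of_real (mpow (up \<gamma>) x))"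
      by (simp add: sum.reindex[OF inj])
    also have "\<dots> = of_real (x $ i) * F x y"
      unfolding h(2) sum_distrib_left by (intro sum.cong refl) (simp add: mp h'_def, simp add: up_def)
    finally show ?thesis by simp
  qed
  moreover have "continuous_on UNIV (h' \<gamma>)" for \<gamma>
    unfolding h'_def by (cases "\<gamma> i = 0") (auto intro: h)
  ultimately show ?thesis unfolding param_poly_def by (intro exI[of _ h']) auto
qed

lemma param_poly_one: "param_poly 0 (\<lambda>x y. 1)"
proof -
  have "multi_indices 0 = {\<lambda>_::'a. 0::nat}" by (auto simp: multi_indices_iff)
  then show ?thesis unfolding param_poly_def
    by (intro exI[of _ "\<lambda>_ _. 1"]) (auto simp: mpow_def)
qed

lemma param_poly_zero: "param_poly d (\<lambda>x y. 0)"
  using param_poly_coeff_mult[OF param_poly_mono[OF param_poly_one, of d], of "\<lambda>_. 0"] by simp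

lemma param_poly_sum:
  "finite A \<Longrightarrow> (\<And>a. a \<in> A \<Longrightarrow> param_poly d (F a)) \<Longrightarrow> param_poly d (\<lambda>x y. \<Sum>a\<in>A. F a x y)"
  by (induction A rule: finite_induct) (auto intro: param_poly_zero param_poly_add)

text \<open>Powers of x - y are built from this one linear factor at a time, which replaces a
  multinomial expansion.\<close>

lemma param_poly_shift_mult:
  assumes "param_poly d F"
  shows "param_poly (Suc d) (\<lambda>x y. of_real ((x - y) $ i) * F x y)"
proof -
  have "param_poly (Suc d) (\<lambda>x y. of_real (x $ i) * F x y + (- of_real (y $ i)) * F x y)"
    by (intro param_poly_add param_poly_coord_mult param_poly_coeff_mult
        param_poly_mono[OF assms] assms continuous_intros) auto
  moreover have "(\<lambda>x y. of_real (x $ i) * F x y + (- of_real (y $ i)) * F x y)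
      = (\<lambda>x y. of_real ((x - y) $ i) * F x y)"
    by (simp add: fun_eq_iff algebra_simps)
  ultimately show ?thesis by simp
qed

lemma param_poly_list:
  "param_poly (length is) (\<lambda>x y. of_real (\<Prod>i\<leftarrow>is. (x - y) $ i))"
proof (induction "is")
  case Nil
  then show ?case using param_poly_one by simp
next
  case (Cons i "is")
  from param_poly_shift_mult[OF this, of i] show ?case by simp
qed

lemma param_poly_mpow: "param_poly (msize \<beta>) (\<lambda>x y. of_real (mpow \<beta> (x - y)))"
proof -
  have "param_poly (\<Sum>i\<in>S. \<beta> i) (\<lambda>x y. of_real (\<Prod>i\<in>S. ((x - y) $ i) ^ \<beta> i))" if "finite S" for S
    using that
  proof (induction S rule: finite_induct)
    case empty
    then show ?case using param_poly_one by simp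
  next
    case (insert i S)
    have "param_poly (k + (\<Sum>i\<in>S. \<beta> i))
       (\<lambda>x y. of_real (((x - y) $ i) ^ k * (\<Prod>i\<in>S. ((x - y) $ i) ^ \<beta> i)))" for k
    proof (induction k)
      case 0
      then show ?case using insert.IH by simp
    next
      case (Suc k)
      from param_poly_shift_mult[OF this, of i] show ?case by (simp add: mult.assoc)
    qed
    from this[of "\<beta> i"] show ?case using insert.hyps by simp
  qed
  from this[of UNIV] show ?thesis by (simp add: mpow_def)
qed

lemma param_poly_translate:
  assumes "P \<in> poly_space d"
  shows "param_poly d (\<lambda>x y. P (x - y))"
proof -
  obtain c where c: "\<And>x. P x = (\<Sum>\<beta>\<in>multi_indices d. c \<beta> * of_real (mpow \<beta> x))"
    using assms by (auto simp: poly_space_iff)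
  have "param_poly d (\<lambda>x y. c \<beta> * of_real (mpow \<beta> (x - y)))" if "\<beta> \<in> multi_indices d" for \<beta>
    using that
    by (intro param_poly_coeff_mult[of d _ "\<lambda>_. c \<beta>"] param_poly_mono[OF param_poly_mpow])
       (auto simp: multi_indices_iff)
  then show ?thesis unfolding c by (intro param_poly_sum) auto
qed

lemma param_poly_section: "param_poly d F \<Longrightarrow> (\<lambda>x. F x y) \<in> poly_space d"
proof -
  assume "param_poly d F"
  then obtain h where "\<And>x y. F x y = (\<Sum>\<gamma>\<in>multi_indices d. h \<gamma> y * of_real (mpow \<gamma> x))"
    unfolding param_poly_def by blast
  then show ?thesis by (intro poly_spaceI[where c="\<lambda>\<gamma>. h \<gamma> y"])
qed

section \<open>Closure properties of the polynomial spaces and linear independence of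
  monomials\<close>

lemma poly_space_translate: "P \<in> poly_space d \<Longrightarrow> (\<lambda>x. P (x - a)) \<in> poly_space d"
  using param_poly_section[OF param_poly_translate] .

lemma poly_space_centered:
  assumes "P \<in> poly_space d"
  obtains c where "\<And>x. P x = (\<Sum>\<beta>\<in>multi_indices d. c \<beta> * of_real (mpow \<beta> (x - a)))"
proof -
  obtain c where "\<And>x. P (x - (-a)) = (\<Sum>\<beta>\<in>multi_indices d. c \<beta> * of_real (mpow \<beta> x))"
    using poly_space_translate[OF assms, of "-a"] unfolding poly_space_iff by blast
  from this[of "_ - a"] show thesis by (intro that[of c]) simp
qed

lemma poly_space_centeredI:
  assumes "\<And>x. P x = (\<Sum>\<beta>\<in>multi_indices d. c \<beta> * of_real (mpow \<beta> (x - a)))"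
  shows "P \<in> poly_space d"
proof -
  have "(\<lambda>x. \<Sum>\<beta>\<in>multi_indices d. c \<beta> * of_real (mpow \<beta> x)) \<in> poly_space d"
    by (rule poly_spaceI) auto
  from poly_space_translate[OF this, of a] show ?thesis unfolding assms[symmetric] by simp
qed

lemma poly_space_zero: "(\<lambda>x. 0) \<in> poly_space d"
  by (rule poly_spaceI[where c="\<lambda>_. 0"]) simp

lemma poly_space_add:
  assumes "P \<in> poly_space d" "R \<in> poly_space d"
  shows "(\<lambda>x. P x + R x) \<in> poly_space d"
proof -
  obtain c e where "\<And>x. P x = (\<Sum>\<beta>\<in>multi_indices d. c \<beta> * of_real (mpow \<beta> x))"
     "\<And>x. R x = (\<Sum>\<beta>\<in>multi_indices d. e \<beta> * of_real (mpow \<beta> x))"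
    using assms by (auto simp: poly_space_iff)
  then show ?thesis
    by (intro poly_spaceI[where c="\<lambda>\<beta>. c \<beta> + e \<beta>"]) (auto simp: sum.distrib distrib_right)
qed

lemma poly_space_cmult:
  assumes "P \<in> poly_space d"
  shows "(\<lambda>x. a * P x) \<in> poly_space d"
proof -
  obtain c where "\<And>x. P x = (\<Sum>\<beta>\<in>multi_indices d. c \<beta> * of_real (mpow \<beta> x))"
    using assms by (auto simp: poly_space_iff)
  then show ?thesis
    by (intro poly_spaceI[where c="\<lambda>\<beta>. a * c \<beta>"]) (auto simp: sum_distrib_left mult.assoc)
qed

lemma poly_space_diff:
  assumes "P \<in> poly_space d" "R \<in> poly_space d"
  shows "(\<lambda>x. P x - R x) \<in> poly_space d"
  using poly_space_add[OF assms(1) poly_space_cmult[OF assms(2), of "-1"]] by simp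

lemma poly_space_sum:
  "finite A \<Longrightarrow> (\<And>a. a \<in> A \<Longrightarrow> F a \<in> poly_space d) \<Longrightarrow> (\<lambda>x. \<Sum>a\<in>A. F a x) \<in> poly_space d"
  by (induction A rule: finite_induct) (auto intro: poly_space_zero poly_space_add)

lemma poly_space_continuous: "P \<in> poly_space d \<Longrightarrow> continuous_on S P"
proof -
  assume "P \<in> poly_space d"
  then obtain c where "\<And>x. P x = (\<Sum>\<beta>\<in>multi_indices d. c \<beta> * of_real (mpow \<beta> x))"
    by (auto simp: poly_space_iff)
  then have "P = (\<lambda>x. \<Sum>\<beta>\<in>multi_indices d. c \<beta> * of_real (mpow \<beta> x))" by auto
  then show ?thesis by (auto intro!: continuous_intros)
qed

lemma poly_space_borel: "P \<in> poly_space d \<Longrightarrow> P \<in> borel_measurable borel"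
  by (rule borel_measurable_continuous_onI[OF poly_space_continuous])

text \<open>Induction on the number of variables: with the others fixed, the sum is a polynomial in
  one variable that vanishes on an interval, so each of its coefficients is zero, a nonzero
  polynomial having finitely many roots.\<close>

lemma mpow_lin_indep:
  fixes a :: "('n::finite \<Rightarrow> nat) \<Rightarrow> real"
  assumes "finite B" and "\<And>y. y \<in> cube 0 1 \<Longrightarrow> (\<Sum>\<beta>\<in>B. a \<beta> * mpow \<beta> y) = 0" and "\<beta> \<in> B"
  shows "a \<beta> = 0"
proof -
  \<comment> \<open>The induction runs over the set \<open>S\<close> of variables that occur.
    Injectivity of the restriction to \<open>S\<close> says that the monomials of \<open>B\<close>
    remain distinct when only these variables are kept; for empty \<open>S\<close> it leaves at most
    one monomial, the constant 1.\<close>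
  have *: "\<forall>\<beta>\<in>B. a \<beta> = 0"
    if "finite S" "finite B" "inj_on (\<lambda>\<beta>. restrict \<beta> S) B"
       "\<And>z::'n \<Rightarrow> real. (\<forall>i. \<bar>z i\<bar> \<le> 1 / 2) \<Longrightarrow> (\<Sum>\<beta>\<in>B. a \<beta> * (\<Prod>i\<in>S. z i ^ \<beta> i)) = 0" for S B
    using that
  proof (induction S arbitrary: B rule: finite_induct)
    case empty
    from empty(2) have "\<And>x y. x \<in> B \<Longrightarrow> y \<in> B \<Longrightarrow> x = y"
      by (auto simp: inj_on_def restrict_def)
    then have "B = {} \<or> (\<exists>b. B = {b})" by blast
    then show ?case using empty(3)[of "\<lambda>_. 0"] by auto
  next
    case (insert i S)
    define m where "m = Max (insert 0 ((\<lambda>\<beta>. \<beta> i) ` B))"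
    have m: "\<beta> i \<le> m" if "\<beta> \<in> B" for \<beta>
      unfolding m_def using that insert.prems(1) by (intro Max_ge) auto
    \<comment> \<open>Slices of \<open>B\<close> with a fixed exponent of the variable
      \<open>i\<close>. The slice for \<open>k\<close> gives the coefficient of t^k, and within a
      slice the exponents over \<open>S\<close> alone still separate the indices.\<close>
    define B' where "B' k = {\<beta>\<in>B. \<beta> i = k}" for k
    have van: "(\<Sum>\<beta>\<in>B' k. a \<beta> * (\<Prod>j\<in>S. z j ^ \<beta> j)) = 0"
      if z: "\<forall>j. \<bar>z j\<bar> \<le> 1 / 2" and k: "k \<le> m" for k z
    proof (rule ccontr)
      define c where "c k = (\<Sum>\<beta>\<in>B' k. a \<beta> * (\<Prod>j\<in>S. z j ^ \<beta> j))" for k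
      assume "(\<Sum>\<beta>\<in>B' k. a \<beta> * (\<Prod>j\<in>S. z j ^ \<beta> j)) \<noteq> 0"
      then have "c k \<noteq> 0" by (simp add: c_def)
      have "(\<Sum>k\<le>m. c k * t ^ k) = 0" if t: "\<bar>t\<bar> \<le> 1 / 2" for t
      proof -
        have "0 = (\<Sum>\<beta>\<in>B. a \<beta> * (\<Prod>j\<in>insert i S. (z(i := t)) j ^ \<beta> j))"
          using insert.prems(3)[of "z(i := t)"] z t by simp
        also have "\<dots> = (\<Sum>\<beta>\<in>B. a \<beta> * (\<Prod>j\<in>S. z j ^ \<beta> j) * t ^ \<beta> i)"
        proof (intro sum.cong refl)
          fix \<beta>
          have "(\<Prod>j\<in>S. (z(i := t)) j ^ \<beta> j) = (\<Prod>j\<in>S. z j ^ \<beta> j)"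
            using insert.hyps(2) by (intro prod.cong) auto
          then show "a \<beta> * (\<Prod>j\<in>insert i S. (z(i := t)) j ^ \<beta> j) = a \<beta> * (\<Prod>j\<in>S. z j ^ \<beta> j) * t ^ \<beta> i"
            using insert.hyps by simp
        qed
        also have "\<dots> = (\<Sum>k\<le>m. \<Sum>\<beta>\<in>{\<beta>\<in>B. \<beta> i = k}. a \<beta> * (\<Prod>j\<in>S. z j ^ \<beta> j) * t ^ \<beta> i)"
          using m insert.prems(1) by (intro sum.group[symmetric]) auto
        also have "\<dots> = (\<Sum>k\<le>m. c k * t ^ k)"
          unfolding c_def B'_def sum_distrib_right by (intro sum.cong refl) auto
        finally show ?thesis by simp
      qed
      then have "{0..1/2} \<subseteq> {t. (\<Sum>k\<le>m. c k * t ^ k) = 0}" by auto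
      moreover have "finite {t. (\<Sum>k\<le>m. c k * t ^ k) = 0}"
        using polyfun_finite_roots[of c m] \<open>c k \<noteq> 0\<close> k by blast
      ultimately have "finite {0..1/2::real}" by (rule finite_subset)
      then show False by (simp add: infinite_Icc)
    qed
    show ?case
    proof
      fix \<beta> assume "\<beta> \<in> B"
      have "\<forall>\<beta>\<in>B' (\<beta> i). a \<beta> = 0"
      proof (rule insert.IH)
        show "inj_on (\<lambda>\<beta>. restrict \<beta> S) (B' (\<beta> i))"
        proof (rule inj_onI)
          fix x y assume xy: "x \<in> B' (\<beta> i)" "y \<in> B' (\<beta> i)" "restrict x S = restrict y S"
          then have "restrict x (insert i S) = restrict y (insert i S)"
            by (auto simp: B'_def restrict_def fun_eq_iff split: if_splits)
          then show "x = y" using inj_onD[OF insert.prems(2), of x y] xy by (auto simp: B'_def)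
        qed
      qed (use van[OF _ m[OF \<open>\<beta> \<in> B\<close>]] insert.prems(1) in \<open>auto simp: B'_def\<close>)
      then show "a \<beta> = 0" using \<open>\<beta> \<in> B\<close> by (auto simp: B'_def)
    qed
  qed
  have "(\<Sum>\<beta>\<in>B. a \<beta> * (\<Prod>i\<in>UNIV. z i ^ \<beta> i)) = 0" if "\<forall>i. \<bar>z i\<bar> \<le> 1 / 2" for z
  proof -
    have "- (1 / 2) \<le> z i \<and> z i \<le> 1 / 2" for i using that[rule_format, of i] by linarith
    then have "(\<chi> i. z i) \<in> cube 0 1" by (simp add: cube_def mem_box_cart)
    from assms(2)[OF this] show ?thesis by (simp add: mpow_def)
  qed
  then have "\<forall>\<beta>\<in>B. a \<beta> = 0" using *[of UNIV B] assms(1) by (auto simp: restrict_UNIV)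
  then show ?thesis using assms(3) by blast
qed

subsection \<open>Projection onto polynomials\<close>

text \<open>Bordering: when an index \<open>k\<close> is added, the row \<open>u\<close> is
  orthogonal to all old columns, and its product \<open>g\<close> with column \<open>k\<close> is
  the Schur complement. It is positive because it equals the quadratic form at \<open>u\<close>.
  Divided by \<open>g\<close>, the row \<open>u\<close> becomes the new row of the inverse, and the
  old rows are corrected by multiples of it.\<close>

lemma gram_left_inverse:
  fixes G :: "'a \<Rightarrow> 'a \<Rightarrow> real"
  assumes "finite B"
    and pos: "\<And>a. (\<exists>b\<in>B. a b \<noteq> 0) \<Longrightarrow> 0 < (\<Sum>b\<in>B. \<Sum>c\<in>B. a b * a c * G b c)"
  shows "\<exists>W. \<forall>b\<in>B. \<forall>c\<in>B. (\<Sum>e\<in>B. W b e * G e c) = (if b = c then 1 else 0)"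
  using assms
proof (induction B rule: finite_induct)
  case empty
  then show ?case by simp
next
  case (insert k B)
  have "0 < (\<Sum>b\<in>B. \<Sum>c\<in>B. a b * a c * G b c)" if "\<exists>b\<in>B. a b \<noteq> 0" for a
  proof -
    define a' where "a' = a(k := 0)"
    have "0 < (\<Sum>b\<in>insert k B. \<Sum>c\<in>insert k B. a' b * a' c * G b c)"
      using that insert.hyps by (intro insert.prems) (auto simp: a'_def)
    also have "\<dots> = (\<Sum>b\<in>B. \<Sum>c\<in>B. a' b * a' c * G b c)"
      using insert.hyps by (simp add: a'_def)
    also have "\<dots> = (\<Sum>b\<in>B. \<Sum>c\<in>B. a b * a c * G b c)"
      using insert.hyps by (intro sum.cong refl) (auto simp: a'_def)
    finally show ?thesis .
  qed
  from insert.IH[OF this] obtain W where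
    W: "\<And>b c. b \<in> B \<Longrightarrow> c \<in> B \<Longrightarrow> (\<Sum>e\<in>B. W b e * G e c) = (if b = c then 1 else 0)"
    by blast
  define p where "p e = (\<Sum>b\<in>B. G k b * W b e)" for e
  define u where "u e = (if e = k then 1 else - p e)" for e
  have p: "(\<Sum>e\<in>B. p e * G e c) = G k c" if "c \<in> B" for c
  proof -
    have "(\<Sum>e\<in>B. p e * G e c) = (\<Sum>e\<in>B. \<Sum>b\<in>B. G k b * (W b e * G e c))"
      by (simp add: p_def sum_distrib_right mult.assoc)
    also have "\<dots> = (\<Sum>b\<in>B. G k b * (\<Sum>e\<in>B. W b e * G e c))"
      by (subst sum.swap) (simp add: sum_distrib_left)
    also have "\<dots> = (\<Sum>b\<in>B. if b = c then G k b else 0)"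
      using W[OF _ that] by (intro sum.cong refl) simp
    finally show ?thesis using that insert.hyps by simp
  qed
  have uB: "(\<Sum>e\<in>B. u e * g e) = - (\<Sum>e\<in>B. p e * g e)" for g
    unfolding sum_negf[symmetric] using insert.hyps by (intro sum.cong refl) (auto simp: u_def)
  have u0: "(\<Sum>e\<in>insert k B. u e * G e c) = 0" if "c \<in> B" for c
    using insert.hyps uB[of "\<lambda>e. G e c"] p[OF that] by (simp add: u_def)
  define g where "g = (\<Sum>e\<in>insert k B. u e * G e k)"
  have "0 < (\<Sum>b\<in>insert k B. \<Sum>c\<in>insert k B. u b * u c * G b c)"
    by (intro insert.prems) (auto simp: u_def)
  also have "\<dots> = (\<Sum>c\<in>insert k B. u c * (\<Sum>b\<in>insert k B. u b * G b c))"
    by (subst sum.swap) (simp only: sum_distrib_left mult_ac)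
  also have "\<dots> = u k * g + (\<Sum>c\<in>B. u c * (\<Sum>b\<in>insert k B. u b * G b c))"
    unfolding g_def using insert.hyps by (subst (1) sum.insert) auto
  also have "(\<Sum>c\<in>B. u c * (\<Sum>b\<in>insert k B. u b * G b c)) = 0"
    using u0 by (intro sum.neutral) simp
  finally have g: "0 < g" by (simp add: u_def)
  \<comment> \<open>The entry that row \<open>b\<close> of \<open>W\<close>, extended by 0, produces
    in column \<open>k\<close>. Subtracting \<open>om b\<close> times the new row removes it and
    leaves the columns of \<open>B\<close> as they were.\<close>
  define om where "om b = (\<Sum>e\<in>B. W b e * G e k)" for b
  define W' where "W' b e = (if b = k then u e / g
      else (if e = k then 0 else W b e) - om b * (u e / g))" for b e
  have usum: "(\<Sum>e\<in>insert k B. u e / g * G e c) = (if c = k then 1 else 0)" if "c \<in> insert k B" for c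
  proof -
    have "(\<Sum>e\<in>insert k B. u e / g * G e c) = (\<Sum>e\<in>insert k B. u e * G e c) / g"
      unfolding sum_divide_distrib by (intro sum.cong refl) simp
    then show ?thesis using that u0[of c] g g_def insert.hyps by (cases "c = k") auto
  qed
  have "(\<Sum>e\<in>insert k B. W' b e * G e c) = (if b = c then 1 else 0)"
    if b: "b \<in> insert k B" and c: "c \<in> insert k B" for b c
  proof (cases "b = k")
    case True
    then show ?thesis using usum[OF c] by (simp add: W'_def)
  next
    case False
    then have bB: "b \<in> B" using b by auto
    have "(\<Sum>e\<in>insert k B. W' b e * G e c) =
       (\<Sum>e\<in>insert k B. (if e = k then 0 else W b e) * G e c) - om b * (\<Sum>e\<in>insert k B. u e / g * G e c)"
      using False unfolding sum_distrib_left sum_subtractf[symmetric]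
      by (intro sum.cong refl) (simp add: W'_def algebra_simps)
    also have "(\<Sum>e\<in>insert k B. (if e = k then 0 else W b e) * G e c) = (\<Sum>e\<in>B. W b e * G e c)"
      using insert.hyps by (simp, intro sum.cong refl, auto)
    finally show ?thesis
      using False usum[OF c] W[OF bB, of c] c by (auto simp: om_def)
  qed
  then show ?case by blast
qed

section \<open>Integration over cubes and affine changes of variables\<close>

lemma set_integrable_continuous_cube:
  fixes f :: "real^'n::finite \<Rightarrow> 'b::euclidean_space"
  assumes "continuous_on UNIV f"
  shows "set_integrable lebesgue (cube x t) f"
  unfolding cube_def
  by (rule absolutely_integrable_continuous) (use assms continuous_on_subset in blast)

lemma integral_lborel_affine:
  fixes f :: "'a::euclidean_space \<Rightarrow> 'b::{banach,second_countable_topology}"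
  assumes "f \<in> borel_measurable borel" "c \<noteq> 0"
  shows "(LINT y|lborel. f y) = \<bar>c\<bar> ^ DIM('a) *\<^sub>R (LINT y|lborel. f (x + c *\<^sub>R y))"
proof -
  have [measurable]: "f \<in> borel_measurable borel" by fact
  have "(LINT y|lborel. f y) = (LINT y|density (distr lborel borel (\<lambda>y. x + c *\<^sub>R y)) (\<lambda>_. ennreal (\<bar>c\<bar>^DIM('a))). f y)"
    using lborel_affine[OF assms(2), of x] by (metis ennreal_power abs_ge_zero)
  also have "\<dots> = (LINT y|distr lborel borel (\<lambda>y. x + c *\<^sub>R y). \<bar>c\<bar>^DIM('a) *\<^sub>R f y)"
    by (rule integral_density) auto
  also have "\<dots> = (LINT y|lborel. \<bar>c\<bar>^DIM('a) *\<^sub>R f (x + c *\<^sub>R y))"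
    by (rule integral_distr) auto
  finally show ?thesis by simp
qed

lemma nn_integral_lborel_affine:
  fixes f :: "'a::euclidean_space \<Rightarrow> ennreal"
  assumes "f \<in> borel_measurable borel" "c \<noteq> 0"
  shows "(\<integral>\<^sup>+y. f y \<partial>lborel) = ennreal (\<bar>c\<bar> ^ DIM('a)) * (\<integral>\<^sup>+y. f (x + c *\<^sub>R y) \<partial>lborel)"
proof -
  have [measurable]: "f \<in> borel_measurable borel" by fact
  have "(\<integral>\<^sup>+y. f y \<partial>lborel) = (\<integral>\<^sup>+y. f y \<partial>density (distr lborel borel (\<lambda>y. x + c *\<^sub>R y)) (\<lambda>_. ennreal (\<bar>c\<bar>^DIM('a))))"
    using lborel_affine[OF assms(2), of x] by (metis ennreal_power abs_ge_zero)
  also have "\<dots> = (\<integral>\<^sup>+y. ennreal (\<bar>c\<bar>^DIM('a)) * f y \<partial>distr lborel borel (\<lambda>y. x + c *\<^sub>R y))"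
    by (rule nn_integral_density) auto
  also have "\<dots> = (\<integral>\<^sup>+y. ennreal (\<bar>c\<bar>^DIM('a)) * f (x + c *\<^sub>R y) \<partial>lborel)"
    by (rule nn_integral_distr) auto
  finally show ?thesis by (simp add: nn_integral_cmult)
qed

lemma set_integral_cube_rescale:
  fixes f :: "real^'n::finite \<Rightarrow> real"
  assumes f: "continuous_on UNIV f" and t: "0 < t"
  shows "(LINT y:cube x t|lebesgue. f ((1 / t) *\<^sub>R (y - x))) = t ^ CARD('n) * (LINT y:cube 0 1|lebesgue. f y)"
proof -
  have [measurable]: "f \<in> borel_measurable borel" by (rule borel_measurable_continuous_onI[OF f])
  have ind: "indicator (cube x t) (x + t *\<^sub>R y) = (indicator (cube 0 1) y :: real)" for y
  proof -
    have "infnorm (t *\<^sub>R y) = t * infnorm y" using t by (simp add: infnorm_mul)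
    then show ?thesis using t by (auto simp: indicator_def mem_cube_iff)
  qed
  have "(LINT y:cube x t|lebesgue. f ((1 / t) *\<^sub>R (y - x)))
      = (LINT y|lborel. indicator (cube x t) y *\<^sub>R f ((1 / t) *\<^sub>R (y - x)))"
    unfolding set_lebesgue_integral_def by (rule integral_completion) measurable
  also have "\<dots> = t ^ CARD('n) *\<^sub>R (LINT y|lborel. indicator (cube x t) (x + t *\<^sub>R y)
       *\<^sub>R f ((1 / t) *\<^sub>R (x + t *\<^sub>R y - x)))"
    by (subst integral_lborel_affine[where c=t and x=x]) (use t in auto)
  also have "(LINT y|lborel. indicator (cube x t) (x + t *\<^sub>R y) *\<^sub>R f ((1 / t) *\<^sub>R (x + t *\<^sub>R y - x)))
     = (LINT y|lborel. indicator (cube 0 1) y *\<^sub>R f y)"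
    unfolding ind using t by simp
  also have "\<dots> = (LINT y:cube 0 1|lebesgue. f y)"
    unfolding set_lebesgue_integral_def by (rule integral_completion[symmetric]) measurable
  finally show ?thesis by simp
qed

lemma set_integral_sum_finite:
  fixes f :: "'i \<Rightarrow> 'a \<Rightarrow> 'b::{banach,second_countable_topology}"
  assumes "\<And>i. i \<in> I \<Longrightarrow> set_integrable M A (f i)"
  shows "(LINT x:A|M. (\<Sum>i\<in>I. f i x)) = (\<Sum>i\<in>I. LINT x:A|M. f i x)"
  using assms unfolding set_lebesgue_integral_def set_integrable_def scaleR_sum_right
  by (intro Bochner_Integration.integral_sum) auto

text \<open>The quadratic form is the integral of P^2 over the unit cube, where P has the
  coefficients \<open>a\<close>. If it were zero, continuity would make P vanish on the cube,
  against the linear independence of the monomials.\<close>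

lemma mpow_gram_pos:
  fixes a :: "('n::finite \<Rightarrow> nat) \<Rightarrow> real"
  assumes "finite B" "\<exists>b\<in>B. a b \<noteq> 0"
  shows "0 < (\<Sum>b\<in>B. \<Sum>c\<in>B. a b * a c * (LINT y:cube 0 1|lebesgue. mpow b y * mpow c y))"
proof -
  define P where "P y = (\<Sum>b\<in>B. a b * mpow b y)" for y :: "real^'n"
  have contP: "continuous_on S P" for S
    unfolding P_def by (intro continuous_intros)
  have sq: "(P y)\<^sup>2 = (\<Sum>b\<in>B. \<Sum>c\<in>B. a b * a c * (mpow b y * mpow c y))" for y
    by (simp add: P_def power2_eq_square sum_product mult_ac)
  have eq: "(\<Sum>b\<in>B. \<Sum>c\<in>B. a b * a c * (LINT y:cube 0 1|lebesgue. mpow b y * mpow c y))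
      = (LINT y:cube 0 1|lebesgue. (P y)\<^sup>2)"
  proof -
    have i: "set_integrable lebesgue (cube 0 1) (\<lambda>y. mpow b y * mpow c y)" for b c :: "'n \<Rightarrow> nat"
      by (intro set_integrable_continuous_cube continuous_intros)
    have i2: "set_integrable lebesgue (cube 0 1) (\<lambda>y. \<Sum>c\<in>B. a b * a c * (mpow b y * mpow c y))" for b
      by (intro set_integrable_continuous_cube continuous_intros)
    show ?thesis unfolding sq
      by (simp only: set_integral_sum_finite i2 set_integrable_mult_right[OF i]
          set_integral_mult_right)
  qed
  have "(LINT y:cube 0 1|lebesgue. (P y)\<^sup>2) = integral (cube 0 1) (\<lambda>y. (P y)\<^sup>2)"
    by (intro set_lebesgue_integral_eq_integral set_integrable_continuous_cube continuous_intros contP)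
  moreover have "integral (cube 0 1) (\<lambda>y. (P y)\<^sup>2) \<noteq> 0"
  proof
    assume 0: "integral (cube 0 1) (\<lambda>y. (P y)\<^sup>2) = 0"
    have "box (\<chi> i. (0::real^'n) $ i - 1 / 2) (\<chi> i. (0::real^'n) $ i + 1 / 2) \<noteq> {}"
      by (auto simp: box_ne_empty Basis_vec_def inner_axis)
    then have "\<forall>y\<in>cube 0 1. (P y)\<^sup>2 = 0"
      using 0 integral_cbox_eq_0_iff[of "\<chi> i. (0::real^'n) $ i - 1 / 2" "\<chi> i. (0::real^'n) $ i + 1 / 2" "\<lambda>y. (P y)\<^sup>2"]
      unfolding cube_def by (auto intro!: continuous_intros contP)
    then have "\<And>b. b \<in> B \<Longrightarrow> a b = 0"
      using mpow_lin_indep[OF assms(1), of a] by (auto simp: P_def)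
    then show False using assms(2) by blast
  qed
  moreover have "0 \<le> (LINT y:cube 0 1|lebesgue. (P y)\<^sup>2)"
    unfolding set_lebesgue_integral_def by (rule Bochner_Integration.integral_nonneg) auto
  ultimately show ?thesis unfolding eq by linarith
qed

text \<open>\<open>W\<close> is the inverse of the Gram matrix of the monomials on the unit cube.
  Affine rescaling carries the relation to any cube at the cost of the factor
  \<open>t ^ CARD('n)\<close>, so a single matrix serves all cubes; the uniformity of all later
  constants for polynomials rests on this.\<close>

lemma dual_basis:
  obtains W :: "('n::finite \<Rightarrow> nat) \<Rightarrow> ('n \<Rightarrow> nat) \<Rightarrow> real" where
    "\<And>b c x t. b \<in> multi_indices d \<Longrightarrow> c \<in> multi_indices d \<Longrightarrow> 0 < t \<Longrightarrow>
       (LINT y:cube x t|lebesgue. (\<Sum>e\<in>multi_indices d. W b e * mpow e ((1 / t) *\<^sub>R (y - x)))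
          * mpow c ((1 / t) *\<^sub>R (y - x))) = (if b = c then t ^ CARD('n) else 0)"
proof -
  let ?B = "multi_indices d :: ('n \<Rightarrow> nat) set"
  obtain W where W: "\<And>b c. b \<in> ?B \<Longrightarrow> c \<in> ?B \<Longrightarrow>
     (\<Sum>e\<in>?B. W b e * (LINT y:cube 0 1|lebesgue. mpow e y * mpow c y)) = (if b = c then 1 else 0)"
    using gram_left_inverse[OF finite_multi_indices mpow_gram_pos[OF finite_multi_indices], of d] by blast
  show thesis
  proof (rule that[of W])
    fix b c :: "'n \<Rightarrow> nat" and x :: "real^'n" and t :: real
    assume bc: "b \<in> ?B" "c \<in> ?B" and t: "0 < t"
    have i: "set_integrable lebesgue (cube 0 1) (\<lambda>y. mpow b y * mpow c y)" for b c :: "'n \<Rightarrow> nat"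
      by (intro set_integrable_continuous_cube continuous_intros)
    have "(LINT y:cube x t|lebesgue. (\<Sum>e\<in>?B. W b e * mpow e ((1 / t) *\<^sub>R (y - x))) * mpow c ((1 / t) *\<^sub>R (y - x)))
       = t ^ CARD('n) * (LINT y:cube 0 1|lebesgue. (\<Sum>e\<in>?B. W b e * mpow e y) * mpow c y)"
      by (rule set_integral_cube_rescale[OF _ t, where f="\<lambda>y. (\<Sum>e\<in>?B. W b e * mpow e y) * mpow c y"])
         (intro continuous_intros)
    also have "(LINT y:cube 0 1|lebesgue. (\<Sum>e\<in>?B. W b e * mpow e y) * mpow c y)
       = (LINT y:cube 0 1|lebesgue. (\<Sum>e\<in>?B. W b e * (mpow e y * mpow c y)))"
      by (simp only: sum_distrib_right mult.assoc)
    also have "\<dots> = (if b = c then 1 else 0)"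
      using W[OF bc] by (simp only: set_integral_sum_finite set_integrable_mult_right[OF i] set_integral_mult_right)
    finally show "(LINT y:cube x t|lebesgue. (\<Sum>e\<in>?B. W b e * mpow e ((1 / t) *\<^sub>R (y - x)))
          * mpow c ((1 / t) *\<^sub>R (y - x))) = (if b = c then t ^ CARD('n) else 0)"
      by simp
  qed
qed

section \<open>Dual functions and projections, uniformly over all cubes\<close>

lemma poly_space_scaled:
  assumes "P \<in> poly_space d" "0 < t"
  obtains c where "\<And>y. P y = (\<Sum>\<beta>\<in>multi_indices d. c \<beta> * of_real (mpow \<beta> ((1 / t) *\<^sub>R (y - x))))"
proof -
  obtain c where c: "\<And>y. P y = (\<Sum>\<beta>\<in>multi_indices d. c \<beta> * of_real (mpow \<beta> (y - x)))"
    using poly_space_centered[OF assms(1)] by blast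
  show thesis
    by (rule that[of "\<lambda>\<beta>. c \<beta> * of_real (t ^ msize \<beta>)"])
       (use assms(2) in \<open>simp add: c mpow_scale power_divide\<close>)
qed

lemma poly_space_scaledI:
  "(\<lambda>y. \<Sum>\<beta>\<in>multi_indices d. c \<beta> * of_real (mpow \<beta> ((1 / t) *\<^sub>R (y - x)))) \<in> poly_space d"
  by (rule poly_space_centeredI[where a=x and c="\<lambda>\<beta>. c \<beta> * of_real ((1 / t) ^ msize \<beta>)"])
     (simp add: mpow_scale mult.assoc)

lemma abs_mpow_scaled_le1:
  assumes "0 < t" "y \<in> cube x t"
  shows "\<bar>mpow \<beta> ((1 / t) *\<^sub>R (y - x))\<bar> \<le> 1"
proof -
  have "infnorm ((1 / t) *\<^sub>R (y - x)) \<le> 1"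
    unfolding infnorm_mul using assms by (simp add: mem_cube_iff field_simps)
  then have "infnorm ((1 / t) *\<^sub>R (y - x)) ^ msize \<beta> \<le> 1"
    by (intro power_le_one infnorm_pos_le)
  with abs_mpow_le show ?thesis by (rule order_trans)
qed

lemma set_integrable_mult_bounded:
  fixes f g :: "'a \<Rightarrow> complex"
  assumes f: "set_integrable M A f" and g: "g \<in> borel_measurable M"
    and B: "\<And>x. x \<in> A \<Longrightarrow> norm (g x) \<le> B"
  shows "set_integrable M A (\<lambda>x. f x * g x)"
  unfolding set_integrable_def
proof (rule Bochner_Integration.integrable_bound)
  show "integrable M (\<lambda>x. B * norm (indicator A x *\<^sub>R f x))"
    using f unfolding set_integrable_def by (intro integrable_mult_right integrable_norm)
  have "(\<lambda>x. (indicator A x *\<^sub>R f x) * g x) \<in> borel_measurable M"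
    using f g unfolding set_integrable_def by (intro borel_measurable_times) auto
  then show "(\<lambda>x. indicator A x *\<^sub>R (f x * g x)) \<in> borel_measurable M" by simp
  show "AE x in M. norm (indicator A x *\<^sub>R (f x * g x)) \<le> norm (B * norm (indicator A x *\<^sub>R f x))"
  proof (rule AE_I2)
    fix x
    show "norm (indicator A x *\<^sub>R (f x * g x)) \<le> norm (B * norm (indicator A x *\<^sub>R f x))"
    proof (cases "x \<in> A")
      case True
      have "norm (f x) * norm (g x) \<le> norm (f x) * \<bar>B\<bar>"
        using B[OF True] by (intro mult_left_mono) auto
      then show ?thesis using True by (simp add: norm_mult abs_mult mult.commute)
    qed auto
  qed
qed

lemma norm_set_integral_mult_le:
  fixes f g :: "'a \<Rightarrow> complex"
  assumes f: "set_integrable M A f" and g: "g \<in> borel_measurable M"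
    and B: "\<And>x. x \<in> A \<Longrightarrow> norm (g x) \<le> B" and "0 \<le> B" and A: "A \<in> sets M"
  shows "ennreal (norm (LINT x:A|M. f x * g x)) \<le> ennreal B * (\<integral>\<^sup>+x\<in>A. ennreal (norm (f x)) \<partial>M)"
proof -
  have "ennreal (norm (LINT x:A|M. f x * g x)) \<le> (\<integral>\<^sup>+x. ennreal (norm (indicator A x *\<^sub>R (f x * g x))) \<partial>M)"
    unfolding set_lebesgue_integral_def
    using set_integrable_mult_bounded[OF f g B] unfolding set_integrable_def
    by (rule integral_norm_bound_ennreal)
  also have "\<dots> \<le> (\<integral>\<^sup>+x. ennreal B * (ennreal (norm (f x)) * indicator A x) \<partial>M)"
  proof (rule nn_integral_mono)
    fix x
    show "ennreal (norm (indicator A x *\<^sub>R (f x * g x))) \<le> ennreal B * (ennreal (norm (f x)) * indicator A x)"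
    proof (cases "x \<in> A")
      case True
      have "norm (f x) * norm (g x) \<le> B * norm (f x)"
        using mult_left_mono[OF B[OF True], of "norm (f x)"] by (simp add: mult.commute)
      then show ?thesis using True \<open>0 \<le> B\<close>
        by (simp add: norm_mult ennreal_mult[symmetric] ennreal_leI)
    qed auto
  qed
  also have "\<dots> = ennreal B * (\<integral>\<^sup>+x\<in>A. ennreal (norm (f x)) \<partial>M)"
  proof (rule nn_integral_cmult)
    have "(\<lambda>x. indicator A x *\<^sub>R f x) \<in> borel_measurable M"
      using f unfolding set_integrable_def by auto
    then have "(\<lambda>x. ennreal (norm (indicator A x *\<^sub>R f x))) \<in> borel_measurable M"
      by (rule measurable_compose[OF _ measurable_compose[OF borel_measurable_norm measurable_ennreal]])
    also have "(\<lambda>x. ennreal (norm (indicator A x *\<^sub>R f x))) = (\<lambda>x. ennreal (norm (f x)) * indicator A x)"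
      by (auto simp: fun_eq_iff indicator_def)
    finally show "(\<lambda>x. ennreal (norm (f x)) * indicator A x) \<in> borel_measurable M" .
  qed
  finally show ?thesis .
qed

text \<open>The functions \<open>w b\<close> are biorthogonal to the rescaled monomials. These are
  at most 1 on the cube, so the entries of the matrix from \<open>dual_basis\<close> bound
  \<open>w b\<close> there, independently of centre and side.\<close>

lemma poly_dual:
  obtains w :: "('n::finite \<Rightarrow> nat) \<Rightarrow> real^'n \<Rightarrow> real \<Rightarrow> real^'n \<Rightarrow> complex" and K :: real where
    "0 < K"
    "\<And>b x t. w b x t \<in> poly_space d"
    "\<And>b x t y. b \<in> multi_indices d \<Longrightarrow> 0 < t \<Longrightarrow> y \<in> cube x t \<Longrightarrow> norm (w b x t y) \<le> K"
    "\<And>b c x t. b \<in> multi_indices d \<Longrightarrow> c \<in> multi_indices d \<Longrightarrow> 0 < t \<Longrightarrow>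
       (LINT y:cube x t|lebesgue. of_real (mpow c ((1 / t) *\<^sub>R (y - x))) * w b x t y)
         = (if b = c then of_real (t ^ CARD('n)) else 0)"
proof -
  obtain W :: "('n \<Rightarrow> nat) \<Rightarrow> ('n \<Rightarrow> nat) \<Rightarrow> real" where
    W: "\<And>b c x t. b \<in> multi_indices d \<Longrightarrow> c \<in> multi_indices d \<Longrightarrow> 0 < t \<Longrightarrow>
       (LINT y:cube x t|lebesgue. (\<Sum>e\<in>multi_indices d. W b e * mpow e ((1 / t) *\<^sub>R (y - x)))
          * mpow c ((1 / t) *\<^sub>R (y - x))) = (if b = c then t ^ CARD('n) else 0)"
    by (rule dual_basis[of d], rule that)
  define K where "K = 1 + (\<Sum>b\<in>multi_indices d. \<Sum>e\<in>multi_indices d. \<bar>W b e\<bar>)"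
  define w where "w b x t y = complex_of_real (\<Sum>e\<in>multi_indices d. W b e * mpow e ((1 / t) *\<^sub>R (y - x)))" for b x t y
  show thesis
  proof (rule that[of K w])
    show "0 < K" unfolding K_def by (intro add_pos_nonneg sum_nonneg) auto
    show "w b x t \<in> poly_space d" for b x t
      using poly_space_scaledI[where c="\<lambda>e. of_real (W b e)" and d=d and x=x and t=t] by (simp add: w_def[abs_def])
    fix b :: "'n \<Rightarrow> nat" and x :: "real^'n" and t :: real assume b: "b \<in> multi_indices d" and t: "0 < t"
    show "norm (w b x t y) \<le> K" if y: "y \<in> cube x t" for y
    proof -
      have "norm (w b x t y) \<le> (\<Sum>e\<in>multi_indices d. \<bar>W b e * mpow e ((1 / t) *\<^sub>R (y - x))\<bar>)"
        unfolding w_def norm_of_real by (rule sum_abs)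
      also have "\<dots> \<le> (\<Sum>e\<in>multi_indices d. \<bar>W b e\<bar>)"
        using abs_mpow_scaled_le1[OF t y] by (intro sum_mono) (simp add: abs_mult mult_left_le)
      also have "\<dots> \<le> (\<Sum>b\<in>multi_indices d. \<Sum>e\<in>multi_indices d. \<bar>W b e\<bar>)"
        using b by (intro member_le_sum[where f="\<lambda>b. \<Sum>e\<in>multi_indices d. \<bar>W b e\<bar>"] sum_nonneg) auto
      finally show ?thesis by (simp add: K_def)
    qed
    fix c :: "'n \<Rightarrow> nat" assume c: "c \<in> multi_indices d"
    have "(LINT y:cube x t|lebesgue. of_real (mpow c ((1 / t) *\<^sub>R (y - x))) * w b x t y)
      = (LINT y:cube x t|lebesgue. complex_of_real ((\<Sum>e\<in>multi_indices d. W b e * mpow e ((1 / t) *\<^sub>R (y - x)))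
          * mpow c ((1 / t) *\<^sub>R (y - x))))"
      unfolding w_def of_real_mult by (subst mult.commute) (rule refl)
    also have "\<dots> = of_real (LINT y:cube x t|lebesgue. (\<Sum>e\<in>multi_indices d. W b e * mpow e ((1 / t) *\<^sub>R (y - x)))
          * mpow c ((1 / t) *\<^sub>R (y - x)))"
      by (rule set_integral_complex_of_real)
    also have "\<dots> = (if b = c then of_real (t ^ CARD('n)) else 0)"
      unfolding W[OF b c t] by simp
    finally show "(LINT y:cube x t|lebesgue. of_real (mpow c ((1 / t) *\<^sub>R (y - x))) * w b x t y)
         = (if b = c then of_real (t ^ CARD('n)) else 0)" .
  qed
qed

lemma lebesgue_borel_measurable:
  "f \<in> borel_measurable borel \<Longrightarrow> f \<in> borel_measurable lebesgue"
  by (rule measurable_completion) simp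

text \<open>Integration against the bounded function \<open>w b\<close> extracts the coefficient
  \<open>c b\<close>. Coefficients refer to the variable rescaled to the cube, which is why one
  \<open>K\<close> serves every cube; for powers of y - x the bound has to be rescaled according to
  the degree.\<close>

lemma poly_coefficient_bound:
  obtains K :: real where "0 < K"
    "\<And>(x::real^'n::finite) t (c :: _ \<Rightarrow> complex) b. 0 < t \<Longrightarrow> b \<in> multi_indices d \<Longrightarrow>
       ennreal (t ^ CARD('n) * norm (c b)) \<le> ennreal K * (\<integral>\<^sup>+y\<in>cube x t.
         ennreal (norm (\<Sum>\<beta>\<in>multi_indices d. c \<beta> * of_real (mpow \<beta> ((1 / t) *\<^sub>R (y - x))))) \<partial>lborel)"
proof -
  obtain w :: "('n \<Rightarrow> nat) \<Rightarrow> real^'n \<Rightarrow> real \<Rightarrow> real^'n \<Rightarrow> complex" and K :: real where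
    w: "0 < K" "\<And>b x t. w b x t \<in> poly_space d"
    "\<And>b x t y. b \<in> multi_indices d \<Longrightarrow> 0 < t \<Longrightarrow> y \<in> cube x t \<Longrightarrow> norm (w b x t y) \<le> K"
    "\<And>b c x t. b \<in> multi_indices d \<Longrightarrow> c \<in> multi_indices d \<Longrightarrow> 0 < t \<Longrightarrow>
       (LINT y:cube x t|lebesgue. of_real (mpow c ((1 / t) *\<^sub>R (y - x))) * w b x t y)
         = (if b = c then of_real (t ^ CARD('n)) else 0)"
    by (rule poly_dual[of d], rule that)
  show thesis
  proof (rule that[OF w(1)])
    fix x :: "real^'n" and t :: real and c and b :: "'n \<Rightarrow> nat"
    assume t: "0 < t" and b: "b \<in> multi_indices d"
    let ?P = "\<lambda>y. \<Sum>\<beta>\<in>multi_indices d. c \<beta> * of_real (mpow \<beta> ((1 / t) *\<^sub>R (y - x))) :: complex"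
    have cont: "continuous_on UNIV (w b x t)" by (rule poly_space_continuous[OF w(2)])
    have "(LINT y:cube x t|lebesgue. ?P y * w b x t y)
        = (LINT y:cube x t|lebesgue. \<Sum>\<beta>\<in>multi_indices d. c \<beta> * (of_real (mpow \<beta> ((1 / t) *\<^sub>R (y - x))) * w b x t y))"
      by (simp only: sum_distrib_right mult.assoc)
    also have "\<dots> = (\<Sum>\<beta>\<in>multi_indices d. c \<beta> * (LINT y:cube x t|lebesgue. of_real (mpow \<beta> ((1 / t) *\<^sub>R (y - x))) * w b x t y))"
      by (subst set_integral_sum_finite)
         (auto intro!: set_integrable_continuous_cube continuous_intros cont)
    also have "\<dots> = (\<Sum>\<beta>\<in>multi_indices d. if \<beta> = b then c b * of_real (t ^ CARD('n)) else 0)"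
      by (intro sum.cong refl) (simp add: w(4)[OF b _ t])
    also have "\<dots> = c b * of_real (t ^ CARD('n))" using b by simp
    finally have eq: "(LINT y:cube x t|lebesgue. ?P y * w b x t y) = c b * of_real (t ^ CARD('n))" .
    have "ennreal (norm (LINT y:cube x t|lebesgue. ?P y * w b x t y))
       \<le> ennreal K * (\<integral>\<^sup>+y\<in>cube x t. ennreal (norm (?P y)) \<partial>lebesgue)"
      using w(1) w(3)[OF b t]
      by (intro norm_set_integral_mult_le set_integrable_continuous_cube continuous_intros
          lebesgue_borel_measurable poly_space_borel[OF w(2)]) auto
    then show "ennreal (t ^ CARD('n) * norm (c b)) \<le> ennreal K * (\<integral>\<^sup>+y\<in>cube x t. ennreal (norm (?P y)) \<partial>lborel)"
      using t unfolding eq nn_integral_completion by (simp add: norm_mult norm_power mult.commute)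
  qed
qed

text \<open>\<open>poly_proj\<close> is a definite description, so nothing is known of it before
  existence and uniqueness. Existence comes from an explicit formula with the dual functions, which
  also yields the bound; an arbitrary polynomial \<open>T\<close> may be subtracted because the
  projection fixes polynomials.\<close>

lemma poly_proj_bound:
  obtains K :: real where "0 < K"
    "\<And>(x::real^'n::finite) t g. 0 < t \<Longrightarrow> set_integrable lebesgue (cube x t) g \<Longrightarrow>
        poly_proj d (cube x t) g \<in> poly_space d"
    "\<And>(x::real^'n::finite) t g T y. 0 < t \<Longrightarrow> set_integrable lebesgue (cube x t) g \<Longrightarrow> T \<in> poly_space d \<Longrightarrow>
        y \<in> cube x t \<Longrightarrow>
        ennreal (t ^ CARD('n) * norm (poly_proj d (cube x t) g y - T y))
          \<le> ennreal K * (\<integral>\<^sup>+y\<in>cube x t. ennreal (norm (g y - T y)) \<partial>lborel)"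
proof -
  obtain w :: "('n \<Rightarrow> nat) \<Rightarrow> real^'n \<Rightarrow> real \<Rightarrow> real^'n \<Rightarrow> complex" and K :: real where
    w: "0 < K" "\<And>b x t. w b x t \<in> poly_space d"
    "\<And>b x t y. b \<in> multi_indices d \<Longrightarrow> 0 < t \<Longrightarrow> y \<in> cube x t \<Longrightarrow> norm (w b x t y) \<le> K"
    "\<And>b c x t. b \<in> multi_indices d \<Longrightarrow> c \<in> multi_indices d \<Longrightarrow> 0 < t \<Longrightarrow>
       (LINT y:cube x t|lebesgue. of_real (mpow c ((1 / t) *\<^sub>R (y - x))) * w b x t y)
         = (if b = c then of_real (t ^ CARD('n)) else 0)"
    by (rule poly_dual[of d], rule that)
  define B where "B = (multi_indices d :: ('n \<Rightarrow> nat) set)"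
  have fB: "finite B" by (simp add: B_def)
  define m where "m b x t y = complex_of_real (mpow b ((1 / t) *\<^sub>R (y - x)))" for b t and x y :: "real^'n"
  have m1: "norm (m b x t y) \<le> 1" if "0 < t" "y \<in> cube x t" for b x t y
    using abs_mpow_scaled_le1[OF that] by (simp add: m_def)
  have m_cont: "continuous_on S (m b x t)" for S b x t
    unfolding m_def by (intro continuous_intros)
  have w_cont: "continuous_on S (w b x t)" for S b x t
    by (rule poly_space_continuous[OF w(2)])
  have m_meas: "m b x t \<in> borel_measurable lebesgue" for b x t
    by (intro lebesgue_borel_measurable borel_measurable_continuous_onI m_cont)
  \<comment> \<open>Expansion in a biorthogonal system: the moments of \<open>g\<close> against the
    monomials become the coefficients of the dual functions, so \<open>p\<close> and
    \<open>g\<close> have equal moments.\<close>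
  define p where "p x t g y = (\<Sum>b\<in>B. (LINT z:cube x t|lebesgue. g z * m b x t z) / of_real (t ^ CARD('n)) * w b x t y)"
    for x :: "real^'n" and t g y
  have p_poly: "p x t g \<in> poly_space d" for x :: "real^'n" and t g
    unfolding p_def[abs_def] by (intro poly_space_sum fB poly_space_cmult w(2))
  have int_gR: "set_integrable lebesgue (cube x t) (\<lambda>y. g y * R y)"
    if g: "set_integrable lebesgue (cube x t) g" and R: "continuous_on UNIV R"
    for x t and g R :: "real^'n \<Rightarrow> complex"
  proof -
    have "bounded (R ` cube x t)"
      by (intro compact_imp_bounded compact_continuous_image compact_cube continuous_on_subset[OF R]) auto
    then obtain B where "\<And>y. y \<in> cube x t \<Longrightarrow> norm (R y) \<le> B" by (auto simp: bounded_iff)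
    then show ?thesis
      by (intro set_integrable_mult_bounded[OF g] lebesgue_borel_measurable borel_measurable_continuous_onI R)
  qed
  have orth_m: "(LINT y:cube x t|lebesgue. (g y - p x t g y) * m c x t y) = 0"
    if t: "0 < t" and g: "set_integrable lebesgue (cube x t) g" and c: "c \<in> B" for x :: "real^'n" and t g c
  proof -
    have i: "set_integrable lebesgue (cube x t) (\<lambda>y. m c x t y * w b x t y)" for b
      by (intro set_integrable_continuous_cube continuous_intros w_cont m_cont)
    have "(LINT y:cube x t|lebesgue. p x t g y * m c x t y)
       = (LINT y:cube x t|lebesgue. \<Sum>b\<in>B. (LINT z:cube x t|lebesgue. g z * m b x t z) / of_real (t ^ CARD('n))
            * (m c x t y * w b x t y))"
      by (simp only: p_def sum_distrib_right sum_distrib_left mult_ac)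
    also have "\<dots> = (\<Sum>b\<in>B. (LINT z:cube x t|lebesgue. g z * m b x t z) / of_real (t ^ CARD('n))
            * (LINT y:cube x t|lebesgue. m c x t y * w b x t y))"
      by (simp only: set_integral_sum_finite set_integrable_mult_right[OF i] set_integral_mult_right)
    also have "\<dots> = (\<Sum>b\<in>B. if b = c then (LINT z:cube x t|lebesgue. g z * m c x t z) else 0)"
      using w(4)[OF _ _ t, of _ c x] c t by (intro sum.cong refl) (auto simp: B_def m_def)
    also have "\<dots> = (LINT z:cube x t|lebesgue. g z * m c x t z)" using c fB by simp
    finally have 1: "(LINT y:cube x t|lebesgue. p x t g y * m c x t y) = (LINT z:cube x t|lebesgue. g z * m c x t z)" .
    have "(LINT y:cube x t|lebesgue. (g y - p x t g y) * m c x t y)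
       = (LINT y:cube x t|lebesgue. g y * m c x t y - p x t g y * m c x t y)"
      by (simp only: left_diff_distrib)
    also have "\<dots> = 0"
      by (subst set_integral_diff(2)[OF int_gR[OF g m_cont]])
         (auto intro!: m_cont set_integrable_continuous_cube continuous_intros
           poly_space_continuous[OF p_poly] simp: 1)
    finally show ?thesis .
  qed
  have orth: "(LINT y:cube x t|lebesgue. (g y - p x t g y) * R y) = 0"
    if t: "0 < t" and g: "set_integrable lebesgue (cube x t) g" and R: "R \<in> poly_space d" for x :: "real^'n" and t g R
  proof -
    obtain c where c: "\<And>y. R y = (\<Sum>\<beta>\<in>B. c \<beta> * m \<beta> x t y)"
      using poly_space_scaled[OF R t] unfolding B_def m_def by blast
    have "set_integrable lebesgue (cube x t) (\<lambda>y. (g y - p x t g y))"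
      by (intro set_integral_diff(1) g set_integrable_continuous_cube poly_space_continuous[OF p_poly])
    note i = int_gR[OF this m_cont]
    have "(LINT y:cube x t|lebesgue. (g y - p x t g y) * R y)
       = (LINT y:cube x t|lebesgue. \<Sum>\<beta>\<in>B. c \<beta> * ((g y - p x t g y) * m \<beta> x t y))"
      by (simp only: c sum_distrib_left mult.left_commute)
    also have "\<dots> = (\<Sum>\<beta>\<in>B. c \<beta> * (LINT y:cube x t|lebesgue. (g y - p x t g y) * m \<beta> x t y))"
      by (simp only: set_integral_sum_finite set_integrable_mult_right[OF i] set_integral_mult_right)
    also have "\<dots> = 0" using orth_m[OF t g] by (intro sum.neutral) simp
    finally show ?thesis .
  qed
  \<comment> \<open>Pairing P - P' with the dual function \<open>w b\<close> returns its coefficient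
    of index \<open>b\<close>, and the two orthogonality relations make that pairing zero.\<close>
  have uniq: "P = P'"
    if t: "0 < t" and g: "set_integrable lebesgue (cube x t) g" and P: "P \<in> poly_space d" and P': "P' \<in> poly_space d"
      and o: "\<And>R. R \<in> poly_space d \<Longrightarrow> (LINT y:cube x t|lebesgue. (g y - P y) * R y) = 0"
      and o': "\<And>R. R \<in> poly_space d \<Longrightarrow> (LINT y:cube x t|lebesgue. (g y - P' y) * R y) = 0"
    for x :: "real^'n" and t g P P'
  proof -
    obtain c where c: "\<And>y. P y - P' y = (\<Sum>\<beta>\<in>B. c \<beta> * m \<beta> x t y)"
      using poly_space_scaled[OF poly_space_diff[OF P P'] t] unfolding B_def m_def by blast
    have "c b = 0" if b: "b \<in> B" for b
    proof -
      have i: "set_integrable lebesgue (cube x t) (\<lambda>y. m \<beta> x t y * w b x t y)" for \<beta>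
        by (intro set_integrable_continuous_cube continuous_intros w_cont m_cont)
      have iP: "set_integrable lebesgue (cube x t) (\<lambda>y. (g y - P y) * w b x t y)" if "P \<in> poly_space d" for P
        by (intro int_gR set_integral_diff(1) g set_integrable_continuous_cube
            poly_space_continuous[OF that] w_cont)
      have "(LINT y:cube x t|lebesgue. (P y - P' y) * w b x t y)
        = (LINT y:cube x t|lebesgue. (g y - P' y) * w b x t y - (g y - P y) * w b x t y)"
        by (simp only: left_diff_distrib) (simp add: algebra_simps)
      also have "\<dots> = 0"
        by (subst set_integral_diff(2)[OF iP[OF P'] iP[OF P]]) (simp add: o o' w(2))
      finally have "0 = (LINT y:cube x t|lebesgue. \<Sum>\<beta>\<in>B. c \<beta> * (m \<beta> x t y * w b x t y))"
        by (simp only: c sum_distrib_right mult.assoc)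
      also have "\<dots> = (\<Sum>\<beta>\<in>B. c \<beta> * (LINT y:cube x t|lebesgue. m \<beta> x t y * w b x t y))"
        by (simp only: set_integral_sum_finite set_integrable_mult_right[OF i] set_integral_mult_right)
      also have "\<dots> = (\<Sum>\<beta>\<in>B. if \<beta> = b then c b * of_real (t ^ CARD('n)) else 0)"
        using w(4)[OF _ _ t, of b _ x] b by (intro sum.cong refl) (auto simp: B_def m_def)
      also have "\<dots> = c b * of_real (t ^ CARD('n))" using b fB by simp
      finally show ?thesis using t by simp
    qed
    then have "P y - P' y = 0" for y unfolding c by (intro sum.neutral) auto
    then show ?thesis by auto
  qed
  have proj: "poly_proj d (cube x t) g = p x t g"
    if t: "0 < t" and g: "set_integrable lebesgue (cube x t) g" for x :: "real^'n" and t g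
    unfolding poly_proj_def
    by (rule the_equality) (use p_poly orth[OF t g] uniq[OF t g] in blast)+
  \<comment> \<open>The left side satisfies the orthogonality relations of the projection of g - T,
    so uniqueness identifies the two; the bound then only has to be proved for T = 0.\<close>
  have shift: "p x t g y - T y = p x t (\<lambda>y. g y - T y) y"
    if t: "0 < t" and g: "set_integrable lebesgue (cube x t) g" and T: "T \<in> poly_space d" for x :: "real^'n" and t g T y
  proof -
    have gT: "set_integrable lebesgue (cube x t) (\<lambda>y. g y - T y)"
      by (intro set_integral_diff(1) g set_integrable_continuous_cube poly_space_continuous[OF T])
    have "(\<lambda>y. p x t g y - T y) = p x t (\<lambda>y. g y - T y)"
      by (rule uniq[OF t gT poly_space_diff[OF p_poly T] p_poly]) (use orth[OF t g] orth[OF t gT] in auto)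
    then show ?thesis by (simp add: fun_eq_iff)
  qed
  define K' where "K' = 1 + real (card B) * K"
  show thesis
  proof (rule that[of K'])
    show "0 < K'" using w(1) by (simp add: K'_def add_pos_nonneg)
    show "poly_proj d (cube x t) g \<in> poly_space d" if "0 < t" "set_integrable lebesgue (cube x t) g" for x :: "real^'n" and t g
      using proj[OF that] p_poly by simp
    fix x :: "real^'n" and t :: real and g T :: "real^'n \<Rightarrow> complex" and y
    assume t: "0 < t" and g: "set_integrable lebesgue (cube x t) g" and T: "T \<in> poly_space d" and y: "y \<in> cube x t"
    have gT: "set_integrable lebesgue (cube x t) (\<lambda>y. g y - T y)"
      by (intro set_integral_diff(1) g set_integrable_continuous_cube poly_space_continuous[OF T])
    let ?I = "\<integral>\<^sup>+y\<in>cube x t. ennreal (norm (g y - T y)) \<partial>lebesgue"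
    have "norm (p x t (\<lambda>y. g y - T y) y)
      \<le> (\<Sum>b\<in>B. norm (LINT z:cube x t|lebesgue. (g z - T z) * m b x t z) / t ^ CARD('n) * norm (w b x t y))"
      unfolding p_def using t by (intro order_trans[OF norm_sum] sum_mono) (simp add: norm_mult norm_divide norm_power)
    also have "\<dots> \<le> (\<Sum>b\<in>B. norm (LINT z:cube x t|lebesgue. (g z - T z) * m b x t z) / t ^ CARD('n) * K)"
      using t y w(3) by (intro sum_mono mult_left_mono) (auto simp: B_def)
    finally have "t ^ CARD('n) * norm (p x t (\<lambda>y. g y - T y) y)
      \<le> t ^ CARD('n) * (\<Sum>b\<in>B. norm (LINT z:cube x t|lebesgue. (g z - T z) * m b x t z) / t ^ CARD('n) * K)"
      using t by (intro mult_left_mono) auto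
    also have "\<dots> = (\<Sum>b\<in>B. K * norm (LINT z:cube x t|lebesgue. (g z - T z) * m b x t z))"
      unfolding sum_distrib_left using t by (intro sum.cong refl) (simp add: field_simps)
    finally have "ennreal (t ^ CARD('n) * norm (p x t (\<lambda>y. g y - T y) y))
      \<le> ennreal (\<Sum>b\<in>B. K * norm (LINT z:cube x t|lebesgue. (g z - T z) * m b x t z))"
      by (rule ennreal_leI)
    also have "\<dots> = (\<Sum>b\<in>B. ennreal K * ennreal (norm (LINT z:cube x t|lebesgue. (g z - T z) * m b x t z)))"
      using w(1) by (subst sum_ennreal[symmetric]) (auto simp: ennreal_mult)
    also have "\<dots> \<le> (\<Sum>b\<in>B. ennreal K * (ennreal 1 * ?I))"
      by (intro sum_mono mult_left_mono norm_set_integral_mult_le[OF gT m_meas m1[OF t]]) auto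
    also have "\<dots> = ennreal (real (card B) * K) * ?I"
      using w(1) by (simp add: ennreal_mult mult.assoc ennreal_of_nat_eq_real_of_nat)
    also have "\<dots> \<le> ennreal K' * ?I"
      by (intro mult_right_mono ennreal_leI) (auto simp: K'_def)
    finally show "ennreal (t ^ CARD('n) * norm (poly_proj d (cube x t) g y - T y))
          \<le> ennreal K' * (\<integral>\<^sup>+y\<in>cube x t. ennreal (norm (g y - T y)) \<partial>lborel)"
      unfolding proj[OF t g] shift[OF t g T] nn_integral_completion .
  qed
qed

subsection \<open>Kernel estimates\<close>

text \<open>Symbol estimates up to order \<open>N\<close> near the origin: the derivatives of order \<open>m \<le> N\<close> are
  \<open>O(norm y powr (a - m))\<close> on the punctured ball of radius \<open>\<rho>\<close>.\<close>

fun symbol_est :: "nat \<Rightarrow> real \<Rightarrow> real \<Rightarrow> (real^'n::finite \<Rightarrow> complex) \<Rightarrow> bool" where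
  "symbol_est 0 a \<rho> f \<longleftrightarrow> (\<exists>C. \<forall>y. y \<noteq> 0 \<and> norm y < \<rho> \<longrightarrow> norm (f y) \<le> C * norm y powr a)"
| "symbol_est (Suc N) a \<rho> f \<longleftrightarrow> (\<exists>C. \<forall>y. y \<noteq> 0 \<and> norm y < \<rho> \<longrightarrow> norm (f y) \<le> C * norm y powr a) \<and>
     (\<exists>D. (\<forall>y. y \<noteq> 0 \<and> norm y < \<rho> \<longrightarrow> (f has_derivative (\<lambda>h. \<Sum>i\<in>UNIV. of_real (h $ i) * D i y)) (at y)) \<and>
          (\<forall>i. symbol_est N (a - 1) \<rho> (D i)))"

lemma symbol_est_bound: "symbol_est N a \<rho> f \<Longrightarrow> \<exists>C. \<forall>y. y \<noteq> 0 \<and> norm y < \<rho> \<longrightarrow> norm (f y) \<le> C * norm y powr a"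
  by (cases N) auto

lemma symbol_est_Suc_D: "symbol_est (Suc N) a \<rho> f \<Longrightarrow> symbol_est N a \<rho> f"
proof (induction N arbitrary: a f)
  case (Suc N)
  then obtain D where
    "\<forall>y. y \<noteq> 0 \<and> norm y < \<rho> \<longrightarrow> (f has_derivative (\<lambda>h. \<Sum>i\<in>UNIV. of_real (h $ i) * D i y)) (at y)"
    "\<forall>i. symbol_est (Suc N) (a - 1) \<rho> (D i)"
    by (subst (asm) (2) symbol_est.simps) blast
  then show ?case using Suc.IH symbol_est_bound[OF Suc.prems] by (subst symbol_est.simps) blast
qed auto

lemma symbol_est_add: "symbol_est N a \<rho> f \<Longrightarrow> symbol_est N a \<rho> g \<Longrightarrow> symbol_est N a \<rho> (\<lambda>y. f y + g y)"
proof (induction N arbitrary: a f g)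
  have bd: "\<exists>C. \<forall>y. y \<noteq> 0 \<and> norm y < \<rho> \<longrightarrow> norm (f y + g y) \<le> C * norm y powr a"
    if fg: "symbol_est N a \<rho> f" "symbol_est N a \<rho> g" for N a and f g :: "real^'a \<Rightarrow> complex"
  proof -
    obtain C1 C2 where
      "\<And>y. y \<noteq> 0 \<and> norm y < \<rho> \<Longrightarrow> norm (f y) \<le> C1 * norm y powr a"
      "\<And>y. y \<noteq> 0 \<and> norm y < \<rho> \<Longrightarrow> norm (g y) \<le> C2 * norm y powr a"
      using symbol_est_bound[OF fg(1)] symbol_est_bound[OF fg(2)] by blast
    then show ?thesis
      by (intro exI[of _ "C1 + C2"]) (auto intro!: norm_triangle_le add_mono simp: distrib_right)
  qed
  {
  case 0
  then show ?case using bd[of 0] by simp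
next
  case (Suc N)
  from Suc.prems obtain D E where
    "\<And>y. y \<noteq> 0 \<and> norm y < \<rho> \<Longrightarrow> (f has_derivative (\<lambda>h. \<Sum>i\<in>UNIV. of_real (h $ i) * D i y)) (at y)"
    "\<And>i. symbol_est N (a - 1) \<rho> (D i)"
    "\<And>y. y \<noteq> 0 \<and> norm y < \<rho> \<Longrightarrow> (g has_derivative (\<lambda>h. \<Sum>i\<in>UNIV. of_real (h $ i) * E i y)) (at y)"
    "\<And>i. symbol_est N (a - 1) \<rho> (E i)" by auto
  note DE = this
  have "((\<lambda>y. f y + g y) has_derivative (\<lambda>h. \<Sum>i\<in>UNIV. of_real (h $ i) * (D i y + E i y))) (at y)"
    if "y \<noteq> 0 \<and> norm y < \<rho>" for y
    using has_derivative_add[OF DE(1)[OF that] DE(3)[OF that]] by (simp add: sum.distrib distrib_left)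
  then show ?case using Suc.IH DE(2,4) bd[OF Suc.prems]
    by (simp only: symbol_est.simps) (intro conjI exI[of _ "\<lambda>i y. D i y + E i y"]; blast)
  }
qed

text \<open>The product rule produces terms of orders a + (b - 1) and (a - 1) + b. The factor that
  is not differentiated enters them with one derivative fewer than is known for it.\<close>

lemma symbol_est_mult: "symbol_est N a \<rho> f \<Longrightarrow> symbol_est N b \<rho> g \<Longrightarrow> symbol_est N (a + b) \<rho> (\<lambda>y. f y * g y)"
proof (induction N arbitrary: a b f g)
  have bd: "\<exists>C. \<forall>y. y \<noteq> 0 \<and> norm y < \<rho> \<longrightarrow> norm (f y * g y) \<le> C * norm y powr (a + b)"
    if fg: "symbol_est N a \<rho> f" "symbol_est N b \<rho> g" for N a b and f g :: "real^'a \<Rightarrow> complex"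
  proof -
    obtain C1 C2 where C: 
      "\<And>y. y \<noteq> 0 \<and> norm y < \<rho> \<Longrightarrow> norm (f y) \<le> C1 * norm y powr a"
      "\<And>y. y \<noteq> 0 \<and> norm y < \<rho> \<Longrightarrow> norm (g y) \<le> C2 * norm y powr b"
      using symbol_est_bound[OF fg(1)] symbol_est_bound[OF fg(2)] by blast
    have "norm (f y * g y) \<le> (C1 * C2) * norm y powr (a + b)" if y: "y \<noteq> 0 \<and> norm y < \<rho>" for y
    proof -
      have "norm (f y * g y) \<le> (C1 * norm y powr a) * (C2 * norm y powr b)"
        unfolding norm_mult
        by (intro mult_mono C[OF y] norm_ge_zero order_trans[OF norm_ge_zero C(1)[OF y]])
      then show ?thesis by (simp add: powr_add mult_ac)
    qed
    then show ?thesis by blast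
  qed
  {
    case 0
    then show ?case using bd[of 0] by simp
  next
    case (Suc N)
    from Suc.prems obtain D E where
      DE: "\<And>y. y \<noteq> 0 \<and> norm y < \<rho> \<Longrightarrow> (f has_derivative (\<lambda>h. \<Sum>i\<in>UNIV. of_real (h $ i) * D i y)) (at y)"
      "\<And>i. symbol_est N (a - 1) \<rho> (D i)"
      "\<And>y. y \<noteq> 0 \<and> norm y < \<rho> \<Longrightarrow> (g has_derivative (\<lambda>h. \<Sum>i\<in>UNIV. of_real (h $ i) * E i y)) (at y)"
      "\<And>i. symbol_est N (b - 1) \<rho> (E i)" by auto
    have "((\<lambda>y. f y * g y) has_derivative (\<lambda>h. \<Sum>i\<in>UNIV. of_real (h $ i) * (f y * E i y + D i y * g y))) (at y)"
      if "y \<noteq> 0 \<and> norm y < \<rho>" for y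
      using has_derivative_mult[OF DE(1)[OF that] DE(3)[OF that]]
      by (simp add: sum.distrib distrib_left sum_distrib_left sum_distrib_right mult_ac)
    moreover have "symbol_est N (a + b - 1) \<rho> (\<lambda>y. f y * E i y + D i y * g y)" for i
    proof (rule symbol_est_add)
      show "symbol_est N (a + b - 1) \<rho> (\<lambda>y. f y * E i y)"
        using Suc.IH[OF symbol_est_Suc_D[OF Suc.prems(1)] DE(4)[of i]] by (simp add: add_diff_eq)
      show "symbol_est N (a + b - 1) \<rho> (\<lambda>y. D i y * g y)"
        using Suc.IH[OF DE(2)[of i] symbol_est_Suc_D[OF Suc.prems(2)]] by (simp add: algebra_simps)
    qed
    ultimately show ?case using bd[OF Suc.prems]
      by (simp only: symbol_est.simps) (intro conjI exI[of _ "\<lambda>i y. f y * E i y + D i y * g y"]; blast)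
  }
qed

lemma symbol_est_zero: "symbol_est N a \<rho> (\<lambda>y. 0)"
proof (induction N arbitrary: a)
  case 0
  show ?case by (auto intro!: exI[of _ 0])
next
  case (Suc N)
  show ?case unfolding symbol_est.simps
    by (intro conjI exI[of _ 0] exI[of _ "\<lambda>_ _. 0"]) (use Suc in auto)
qed

lemma symbol_est_const: "symbol_est N 0 \<rho> (\<lambda>y. c)"
proof (cases N)
  case 0
  then show ?thesis by (auto intro!: exI[of _ "norm c"])
next
  case (Suc N)
  show ?thesis unfolding Suc symbol_est.simps
    by (intro conjI exI[of _ "norm c"] exI[of _ "\<lambda>_ _. 0"]) (auto intro: symbol_est_zero)
qed

lemma symbol_est_coord: "symbol_est N 1 \<rho> (\<lambda>y. of_real (y $ j))"
proof -
  have bd: "\<exists>C. \<forall>y. y \<noteq> 0 \<and> norm y < \<rho> \<longrightarrow> norm (of_real (y $ j) :: complex) \<le> C * norm y powr 1"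
    by (intro exI[of _ 1]) (auto intro: component_le_norm_cart)
  show ?thesis
  proof (cases N)
    case 0
    with bd show ?thesis by simp
  next
    case (Suc N)
    have "((\<lambda>y. of_real (y $ j)) has_derivative
        (\<lambda>h. \<Sum>i\<in>UNIV. of_real (h $ i) * (if i = j then 1 else 0 :: complex))) (at y)" for y
    proof -
      have "(\<lambda>h. \<Sum>i\<in>UNIV. of_real (h $ i) * (if i = j then 1 else 0 :: complex)) = (\<lambda>h. of_real (h $ j))"
        by (auto simp: fun_eq_iff if_distrib cong: if_cong)
      then show ?thesis
        by (simp add: bounded_linear_imp_has_derivative bounded_linear_compose[OF bounded_linear_of_real]
            bounded_linear_vec_nth)
    qed
    moreover have "symbol_est N (1 - 1) \<rho> (\<lambda>y. if i = j then 1 else 0)" for i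
      using symbol_est_const[of N \<rho> "if i = j then 1 else 0"] by simp
    ultimately show ?thesis using bd unfolding Suc symbol_est.simps
      by (intro conjI exI[of _ "\<lambda>i y. if i = j then 1 else 0"] allI impI) blast+
  qed
qed

text \<open>The partial derivative is a y_i |y|^(a - 2), a product of symbols of orders 0, 1 and a -
  2. The last is again a power of the norm, so the induction is over all exponents at once.\<close>

lemma symbol_est_norm_powr: "symbol_est N a \<rho> (\<lambda>y :: real^'n::finite. of_real (norm y powr a))"
proof (induction N arbitrary: a)
  case 0
  show ?case by (auto intro!: exI[of _ 1])
next
  case (Suc N)
  let ?D = "\<lambda>i (y :: real^'n). of_real a * (of_real (y $ i) * of_real (norm y powr (a - 2))) :: complex"
  have "((\<lambda>y. of_real (norm y powr a) :: complex) has_derivative (\<lambda>h. \<Sum>i\<in>UNIV. of_real (h $ i) * ?D i y)) (at y)"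
    if y: "y \<noteq> 0" for y
  proof -
    have "((\<lambda>y. norm y powr a) has_derivative (\<lambda>h. a * (y \<bullet> h) * norm y powr (a - 2))) (at y)"
    proof -
      have "((\<lambda>y. norm y powr a) has_derivative
          (\<lambda>h. norm y powr a * ((h \<bullet> sgn y) * a / norm y))) (at y)"
        using has_derivative_powr[OF has_derivative_norm[OF y] has_derivative_const[of a]] y by simp
      moreover have "norm y powr a * ((h \<bullet> sgn y) * a / norm y) = a * (y \<bullet> h) * norm y powr (a - 2)" for h
        using y by (simp add: sgn_div_norm powr_diff inner_commute power2_eq_square field_simps)
      ultimately show ?thesis by simp
    qed
    from bounded_linear.has_derivative[OF bounded_linear_of_real[where 'a=complex] this]
    have "((\<lambda>y. of_real (norm y powr a) :: complex) has_derivative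
        (\<lambda>h. of_real (a * (y \<bullet> h) * norm y powr (a - 2)))) (at y)" .
    moreover have "of_real (a * (y \<bullet> h) * norm y powr (a - 2)) = (\<Sum>i\<in>UNIV. of_real (h $ i) * ?D i y)" for h
      unfolding inner_vec_def by (simp add: sum_distrib_left sum_distrib_right mult_ac)
    ultimately show ?thesis by simp
  qed
  moreover have "symbol_est N (a - 1) \<rho> (?D i)" for i
  proof -
    have "symbol_est N (0 + (1 + (a - 2))) \<rho> (?D i)"
      by (intro symbol_est_mult symbol_est_const symbol_est_coord) (rule Suc)
    moreover have "0 + (1 + (a - 2)) = a - 1" by simp
    ultimately show ?thesis by metis
  qed
  ultimately show ?case unfolding symbol_est.simps
    by (intro conjI exI[of _ 1] exI[of _ ?D]) auto
qed

lemma has_derivative_cart_expand: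
  fixes f :: "real^'n::finite \<Rightarrow> complex"
  assumes "f differentiable (at y)"
  shows "(f has_derivative (\<lambda>h. \<Sum>i\<in>UNIV. of_real (h $ i) * frechet_derivative f (at y) (axis i 1))) (at y)"
proof -
  let ?L = "frechet_derivative f (at y)"
  have d: "(f has_derivative ?L) (at y)" using assms frechet_derivative_works by blast
  have lin: "linear ?L" by (rule has_derivative_linear[OF d])
  have "?L h = (\<Sum>i\<in>UNIV. of_real (h $ i) * ?L (axis i 1))" for h
  proof -
    have "?L h = ?L (\<Sum>i\<in>UNIV. h $ i *\<^sub>R axis i 1)"
      by (simp add: basis_expansion scalar_mult_eq_scaleR[symmetric])
    also have "\<dots> = (\<Sum>i\<in>UNIV. h $ i *\<^sub>R ?L (axis i 1))"
      by (simp add: linear_sum[OF lin] linear_cmul[OF lin])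
    finally show ?thesis by (simp add: scaleR_conv_of_real)
  qed
  then have "?L = (\<lambda>h. \<Sum>i\<in>UNIV. of_real (h $ i) * ?L (axis i 1))" by (rule ext)
  with d show ?thesis by metis
qed

text \<open>On a bounded ball the derivatives are bounded, and |y|^(-m) is bounded below by
  \<rho>^(-m). Every \<open>m\<close> is allowed because the recursion in \<open>symbol_est\<close>
  lowers the order with each derivative; m = 0 is the case that is applied to the cutoff.\<close>

lemma C_k_symbol_est:
  assumes "C_k N f" "0 < \<rho>"
  shows "symbol_est N (- real m) \<rho> f"
  using assms(1)
proof (induction N arbitrary: f m)
  have bd: "\<exists>C. \<forall>y. y \<noteq> 0 \<and> norm y < \<rho> \<longrightarrow> norm (f y) \<le> C * norm y powr (- real m)"
    if f: "continuous_on UNIV f" for f :: "real^'a \<Rightarrow> complex" and m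
  proof -
    have "bounded (f ` cball 0 \<rho>)"
      by (intro compact_imp_bounded compact_continuous_image continuous_on_subset[OF f]) auto
    then obtain B where B: "\<And>y. norm y \<le> \<rho> \<Longrightarrow> norm (f y) \<le> B" by (fastforce simp: bounded_iff)
    have "norm (f y) \<le> (B * \<rho> ^ m) * norm y powr (- real m)" if "y \<noteq> 0" "norm y < \<rho>" for y
    proof -
      have B0: "0 \<le> B" using order_trans[OF norm_ge_zero B[of 0]] assms(2) by simp
      have "norm (f y) * norm y ^ m \<le> B * \<rho> ^ m"
        using that B0 B[of y] by (intro mult_mono power_mono) auto
      then show ?thesis using that by (simp add: powr_minus powr_realpow field_simps)
    qed
    then show ?thesis by blast
  qed
  {
    case 0
    then show ?case using bd by simp
  next
    case (Suc N)
    have diff: "f differentiable (at y)" for y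
      using Suc.prems by (simp add: differentiable_on_def)
    have "continuous_on UNIV f" using Suc.prems by (simp add: differentiable_imp_continuous_on)
    moreover have "symbol_est N (- real m - 1) \<rho> (\<lambda>x. frechet_derivative f (at x) (axis i 1))" for i
      using Suc.IH[of "\<lambda>x. frechet_derivative f (at x) (axis i 1)" "Suc m"] Suc.prems
      by simp (metis add.commute add_uminus_conv_diff minus_add_distrib)
    ultimately show ?case using bd[of f m] has_derivative_cart_expand[OF diff] unfolding symbol_est.simps
      by (intro conjI exI[of _ "\<lambda>i x. frechet_derivative f (at x) (axis i 1)"]) auto
  }
qed

text \<open>Unrolls the nested quantifiers of \<open>symbol_est\<close> into one family of iterated
  partial derivatives with one constant. Lists record the order of differentiation, so that equality
  of mixed partials never enters.\<close>

lemma symbol_est_partials: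
  assumes "symbol_est N a \<rho> f"
  obtains D :: "'n list \<Rightarrow> real^'n::finite \<Rightarrow> complex" and C :: real where
    "D [] = f" "0 \<le> C"
    "\<And>is y. length is < N \<Longrightarrow> y \<noteq> 0 \<Longrightarrow> norm y < \<rho> \<Longrightarrow>
       (D is has_derivative (\<lambda>h. \<Sum>i\<in>UNIV. of_real (h $ i) * D (is @ [i]) y)) (at y)"
    "\<And>is y. length is \<le> N \<Longrightarrow> y \<noteq> 0 \<Longrightarrow> norm y < \<rho> \<Longrightarrow>
       norm (D is y) \<le> C * norm y powr (a - real (length is))"
proof -
  have "\<exists>D C. D [] = f \<and> 0 \<le> C \<and>
    (\<forall>is y. length is < N \<and> y \<noteq> 0 \<and> norm y < \<rho> \<longrightarrow>
       (D is has_derivative (\<lambda>h. \<Sum>i\<in>UNIV. of_real (h $ i) * D (is @ [i]) y)) (at y)) \<and>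
    (\<forall>is y. length is \<le> N \<and> y \<noteq> 0 \<and> norm y < \<rho> \<longrightarrow>
       norm (D is y) \<le> C * norm y powr (a - real (length is)))"
    using assms
  proof (induction N arbitrary: f a)
    case 0
    then obtain C where "\<And>y. y \<noteq> 0 \<and> norm y < \<rho> \<Longrightarrow> norm (f y) \<le> C * norm y powr a" by auto
    note C = this
    have "norm (f y) \<le> \<bar>C\<bar> * norm y powr a" if "y \<noteq> 0 \<and> norm y < \<rho>" for y
      using C[OF that] mult_right_mono[OF abs_ge_self[of C], of "norm y powr a"] by simp
    then show ?case by (intro exI[of _ "\<lambda>_. f"] exI[of _ "\<bar>C\<bar>"]) auto
  next
    case (Suc N)
    from Suc.prems obtain C0 D0 where
      C0: "\<And>y. y \<noteq> 0 \<and> norm y < \<rho> \<Longrightarrow> norm (f y) \<le> C0 * norm y powr a" and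
      D0: "\<And>y. y \<noteq> 0 \<and> norm y < \<rho> \<Longrightarrow> (f has_derivative (\<lambda>h. \<Sum>i\<in>UNIV. of_real (h $ i) * D0 i y)) (at y)" and
      D0s: "\<And>i. symbol_est N (a - 1) \<rho> (D0 i)" by auto
    have "\<forall>i. \<exists>D C. D [] = D0 i \<and> 0 \<le> C \<and>
      (\<forall>is y. length is < N \<and> y \<noteq> 0 \<and> norm y < \<rho> \<longrightarrow>
         (D is has_derivative (\<lambda>h. \<Sum>i\<in>UNIV. of_real (h $ i) * D (is @ [i]) y)) (at y)) \<and>
      (\<forall>is y. length is \<le> N \<and> y \<noteq> 0 \<and> norm y < \<rho> \<longrightarrow>
         norm (D is y) \<le> C * norm y powr (a - 1 - real (length is)))"
      using Suc.IH[OF D0s] by blast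
    from choice[OF this] obtain D1 where "\<forall>i. \<exists>C. D1 i [] = D0 i \<and> 0 \<le> C \<and>
      (\<forall>is y. length is < N \<and> y \<noteq> 0 \<and> norm y < \<rho> \<longrightarrow>
         (D1 i is has_derivative (\<lambda>h. \<Sum>j\<in>UNIV. of_real (h $ j) * D1 i (is @ [j]) y)) (at y)) \<and>
      (\<forall>is y. length is \<le> N \<and> y \<noteq> 0 \<and> norm y < \<rho> \<longrightarrow>
         norm (D1 i is y) \<le> C * norm y powr (a - 1 - real (length is)))" by blast
    from choice[OF this] obtain C1 where D1: "\<And>i. D1 i [] = D0 i" "\<And>i. 0 \<le> C1 i"
      "\<And>i is y. length is < N \<and> y \<noteq> 0 \<and> norm y < \<rho> \<Longrightarrow>
         (D1 i is has_derivative (\<lambda>h. \<Sum>j\<in>UNIV. of_real (h $ j) * D1 i (is @ [j]) y)) (at y)"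
      "\<And>i is y. length is \<le> N \<and> y \<noteq> 0 \<and> norm y < \<rho> \<Longrightarrow>
         norm (D1 i is y) \<le> C1 i * norm y powr (a - 1 - real (length is))" by blast
    \<comment> \<open>The head of the list is the derivative taken first, and the tail selects from
      the family of that partial derivative. Extending the list at its end is one more
      differentiation in either description.\<close>
    define D where "D is = (case is of [] \<Rightarrow> f | i # js \<Rightarrow> D1 i js)" for "is"
    define C where "C = \<bar>C0\<bar> + (\<Sum>i\<in>UNIV. C1 i)"
    have C_ge: "\<bar>C0\<bar> \<le> C" "C1 i \<le> C" for i
      using member_le_sum[of i UNIV C1] D1(2) by (auto simp: C_def sum_nonneg add_increasing)
    have der: "(D is has_derivative (\<lambda>h. \<Sum>i\<in>UNIV. of_real (h $ i) * D (is @ [i]) y)) (at y)"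
      if "length is < Suc N \<and> y \<noteq> 0 \<and> norm y < \<rho>" for "is" y
    proof (cases "is")
      case Nil
      then show ?thesis using D0[of y] D1(1) that by (simp add: D_def)
    next
      case (Cons i js)
      then show ?thesis using D1(3)[of js y i] that by (simp add: D_def)
    qed
    have bd: "norm (D is y) \<le> C * norm y powr (a - real (length is))"
      if "length is \<le> Suc N \<and> y \<noteq> 0 \<and> norm y < \<rho>" for "is" y
    proof (cases "is")
      case Nil
      have "norm (f y) \<le> C0 * norm y powr a" using C0 that by blast
      also have "\<dots> \<le> C * norm y powr a" using C_ge(1) by (intro mult_right_mono) auto
      finally show ?thesis using Nil by (simp add: D_def)
    next
      case (Cons i js)
      have "norm (D1 i js y) \<le> C1 i * norm y powr (a - 1 - real (length js))"
        using D1(4)[of js y i] that Cons by simp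
      also have "\<dots> \<le> C * norm y powr (a - 1 - real (length js))"
        using C_ge(2) by (intro mult_right_mono) auto
      finally show ?thesis using Cons by (simp add: D_def algebra_simps)
    qed
    have "D [] = f" "0 \<le> C" using C_ge(1) by (auto simp: D_def)
    then show ?case using der bd by (intro exI[of _ D] exI[of _ C]) blast
  qed
  then show thesis using that by blast
qed

section \<open>Taylor's formula away from a singularity at the origin\<close>

definition lists_of_length :: "nat \<Rightarrow> 'a list set" where
  "lists_of_length m = {is. length is = m}"

lemma finite_lists_of_length [simp]: "finite (lists_of_length m :: 'a::finite list set)"
  using finite_lists_length_eq[of "UNIV :: 'a set" m] by (simp add: lists_of_length_def)

lemma card_lists_of_length: "card (lists_of_length m :: 'a::finite list set) = CARD('a) ^ m"
  using card_lists_length_eq[of "UNIV :: 'a set" m] by (simp add: lists_of_length_def)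

lemma sum_lists_of_length_Suc:
  fixes F :: "'a::finite list \<Rightarrow> 'b::comm_monoid_add"
  shows "(\<Sum>is\<in>lists_of_length (Suc m). F is) = (\<Sum>is\<in>lists_of_length m. \<Sum>i\<in>UNIV. F (is @ [i]))"
proof -
  have "(\<Sum>is\<in>lists_of_length m. \<Sum>i\<in>UNIV. F (is @ [i]))
      = (\<Sum>(is, i)\<in>lists_of_length m \<times> UNIV. F (is @ [i]))"
    by (rule sum.cartesian_product)
  also have "\<dots> = (\<Sum>is\<in>lists_of_length (Suc m). F is)"
  proof (rule sum.reindex_bij_witness[where j="\<lambda>(is, i). is @ [i]" and i="\<lambda>is. (butlast is, last is)"])
    fix "is" :: "'a list" assume "is \<in> lists_of_length (Suc m)"
    then have "is \<noteq> []" "length is = Suc m" by (auto simp: lists_of_length_def)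
    then show "(case (butlast is, last is) of (is, i) \<Rightarrow> is @ [i]) = is"
      "(butlast is, last is) \<in> lists_of_length m \<times> UNIV"
      by (auto simp: lists_of_length_def)
  qed (auto simp: lists_of_length_def)
  finally show ?thesis ..
qed

lemma abs_prod_list_nth_le:
  "\<bar>\<Prod>i\<leftarrow>is. (h::real^'n::finite) $ i\<bar> \<le> norm h ^ length is"
proof (induction "is")
  case (Cons i "is")
  then show ?case by (auto simp: abs_mult intro!: mult_mono component_le_norm_cart)
qed simp

text \<open>Taylor's formula with integral remainder on the segment from \<open>w\<close> to w + h.
  The segment must keep the distance \<open>c * norm w\<close> from the origin, where
  \<open>f\<close> is singular; as a \<le> d + 1, the bound on the derivatives of order d + 1 is
  worst at the smallest distance.\<close>

lemma symbol_est_taylor: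
  fixes f :: "real^'n::finite \<Rightarrow> complex"
  assumes "symbol_est (Suc d) a \<rho> f" "a \<le> real (Suc d)"
  obtains D :: "'n list \<Rightarrow> real^'n \<Rightarrow> complex" and C :: real where "0 \<le> C"
    "\<And>is y. length is \<le> d \<Longrightarrow> y \<noteq> 0 \<Longrightarrow> norm y < \<rho> \<Longrightarrow> isCont (D is) y"
    "\<And>is y. length is \<le> d \<Longrightarrow> y \<noteq> 0 \<Longrightarrow> norm y < \<rho> \<Longrightarrow>
       norm (D is y) \<le> C * norm y powr (a - real (length is))"
    "\<And>w h c. w \<noteq> 0 \<Longrightarrow> 0 < c \<Longrightarrow>
       (\<forall>\<theta>\<in>{0..1}. c * norm w \<le> norm (w + \<theta> *\<^sub>R h) \<and> norm (w + \<theta> *\<^sub>R h) < \<rho>) \<Longrightarrow>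
       norm (f (w + h) - (\<Sum>m<Suc d. \<Sum>is\<in>lists_of_length m. D is w / fact m * of_real (\<Prod>i\<leftarrow>is. h $ i)))
         \<le> C * norm h ^ Suc d * (c * norm w) powr (a - real (Suc d))"
proof -
  obtain D :: "'n list \<Rightarrow> real^'n \<Rightarrow> complex" and C :: real where D: "D [] = f" "0 \<le> C"
    "\<And>is y. length is < Suc d \<Longrightarrow> y \<noteq> 0 \<Longrightarrow> norm y < \<rho> \<Longrightarrow>
       (D is has_derivative (\<lambda>h. \<Sum>i\<in>UNIV. of_real (h $ i) * D (is @ [i]) y)) (at y)"
    "\<And>is y. length is \<le> Suc d \<Longrightarrow> y \<noteq> 0 \<Longrightarrow> norm y < \<rho> \<Longrightarrow>
       norm (D is y) \<le> C * norm y powr (a - real (length is))"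
    by (rule symbol_est_partials[OF assms(1)], rule that)
  \<comment> \<open>The number of terms in the derivative of order d + 1 along \<open>h\<close>. It
    is at least 1, so that \<open>N * C\<close> can serve both for the remainder and for the lower
    derivatives.\<close>
  define N where "N = real (CARD('n) ^ Suc d)"
  have "1 \<le> CARD('n) ^ Suc d" by (intro one_le_power) (simp add: Suc_leI)
  then have N1: "1 \<le> N" unfolding N_def by linarith
  show thesis
  proof (rule that[of "N * C" D])
    show "0 \<le> N * C" using N1 D(2) by simp
    fix "is" :: "'n list" and y :: "real^'n" assume l: "length is \<le> d" and y: "y \<noteq> 0" "norm y < \<rho>"
    show "isCont (D is) y" using D(3)[of "is" y] l y by (auto intro: has_derivative_continuous)
    have "norm (D is y) \<le> 1 * C * norm y powr (a - real (length is))" using D(4)[of "is" y] l y by simp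
    also have "\<dots> \<le> N * C * norm y powr (a - real (length is))"
      using N1 D(2) by (intro mult_right_mono) auto
    finally show "norm (D is y) \<le> N * C * norm y powr (a - real (length is))" .
  next
    fix w h :: "real^'n" and c :: real
    assume w: "w \<noteq> 0" and c: "0 < c" and
      seg': "\<forall>\<theta>\<in>{0..1}. c * norm w \<le> norm (w + \<theta> *\<^sub>R h) \<and> norm (w + \<theta> *\<^sub>R h) < \<rho>"
    have seg: "c * norm w \<le> norm (w + \<theta> *\<^sub>R h) \<and> norm (w + \<theta> *\<^sub>R h) < \<rho>" if "0 \<le> \<theta>" "\<theta> \<le> 1" for \<theta>
      using seg' that by simp
    have cw: "0 < c * norm w" using w c by simp
    have ne: "w + \<theta> *\<^sub>R h \<noteq> 0" if "0 \<le> \<theta>" "\<theta> \<le> 1" for \<theta>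
      using seg[OF that] cw by auto
    \<comment> \<open>The derivative of order \<open>m\<close> of the restriction of
      \<open>f\<close> to the segment. Lists enumerate its terms with multiplicity, so no
      multinomial coefficients appear and only 1 / m! remains in the Taylor sum.\<close>
    define Df where "Df m \<theta> = (\<Sum>is\<in>lists_of_length m. D is (w + \<theta> *\<^sub>R h) * of_real (\<Prod>i\<leftarrow>is. h $ i))" for m \<theta>
    have Df_der: "(Df m has_vector_derivative Df (Suc m) \<theta>) (at \<theta> within {0..1})"
      if m: "m < Suc d" and \<theta>: "0 \<le> \<theta>" "\<theta> \<le> 1" for m \<theta>
    proof -
      have "((\<lambda>\<theta>. D is (w + \<theta> *\<^sub>R h)) has_vector_derivative
         (\<Sum>i\<in>UNIV. of_real (h $ i) * D (is @ [i]) (w + \<theta> *\<^sub>R h))) (at \<theta> within {0..1})"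
        if l: "is \<in> lists_of_length m" for "is"
      proof -
        have 1: "((\<lambda>\<theta>. w + \<theta> *\<^sub>R h) has_derivative (\<lambda>s. s *\<^sub>R h)) (at \<theta> within {0..1})"
          by (auto intro!: derivative_eq_intros)
        have 2: "(D is has_derivative (\<lambda>k. \<Sum>i\<in>UNIV. of_real (k $ i) * D (is @ [i]) (w + \<theta> *\<^sub>R h))) (at (w + \<theta> *\<^sub>R h))"
          using D(3)[OF _ ne[OF \<theta>]] seg[OF \<theta>] l m by (simp add: lists_of_length_def)
        show ?thesis unfolding has_vector_derivative_def
          using has_derivative_compose[OF 1 2] by (simp add: scaleR_sum_right sum_distrib_left scaleR_conv_of_real[where 'a=complex] mult.assoc)
      qed
      then have "((\<lambda>\<theta>. D is (w + \<theta> *\<^sub>R h) * of_real (\<Prod>i\<leftarrow>is. h $ i)) has_vector_derivative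
         (\<Sum>i\<in>UNIV. of_real (h $ i) * D (is @ [i]) (w + \<theta> *\<^sub>R h)) * of_real (\<Prod>i\<leftarrow>is. h $ i)) (at \<theta> within {0..1})"
        if "is \<in> lists_of_length m" for "is"
        using that by (intro has_vector_derivative_mult_left) auto
      from has_vector_derivative_sum[OF this]
      have "(Df m has_vector_derivative (\<Sum>is\<in>lists_of_length m.
         (\<Sum>i\<in>UNIV. of_real (h $ i) * D (is @ [i]) (w + \<theta> *\<^sub>R h)) * of_real (\<Prod>i\<leftarrow>is. h $ i))) (at \<theta> within {0..1})"
        unfolding Df_def .
      also have "(\<Sum>is\<in>lists_of_length m.
         (\<Sum>i\<in>UNIV. of_real (h $ i) * D (is @ [i]) (w + \<theta> *\<^sub>R h)) * of_real (\<Prod>i\<leftarrow>is. h $ i)) = Df (Suc m) \<theta>"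
        unfolding Df_def sum_lists_of_length_Suc by (simp add: sum_distrib_left sum_distrib_right mult_ac)
      finally show ?thesis .
    qed
    have bound: "norm (Df (Suc d) \<theta>) \<le> N * C * norm h ^ Suc d * (c * norm w) powr (a - real (Suc d))"
      if \<theta>: "0 \<le> \<theta>" "\<theta> \<le> 1" for \<theta>
    proof -
      have "norm (Df (Suc d) \<theta>) \<le> (\<Sum>is\<in>(lists_of_length (Suc d) :: 'n list set).
          C * (c * norm w) powr (a - real (Suc d)) * norm h ^ Suc d)"
        unfolding Df_def
      proof (intro order_trans[OF norm_sum] sum_mono)
        fix "is" :: "'n list" assume "is \<in> lists_of_length (Suc d)"
        then have l: "length is = Suc d" by (simp add: lists_of_length_def)
        have "norm (D is (w + \<theta> *\<^sub>R h)) \<le> C * norm (w + \<theta> *\<^sub>R h) powr (a - real (Suc d))"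
          using D(4)[of "is", OF _ ne[OF \<theta>]] seg[OF \<theta>] l by simp
        also have "\<dots> \<le> C * (c * norm w) powr (a - real (Suc d))"
          using seg[OF \<theta>] cw assms(2) D(2) by (intro mult_left_mono powr_mono2') auto
        finally show "norm (D is (w + \<theta> *\<^sub>R h) * of_real (\<Prod>i\<leftarrow>is. h $ i))
            \<le> C * (c * norm w) powr (a - real (Suc d)) * norm h ^ Suc d"
          unfolding norm_mult norm_of_real using abs_prod_list_nth_le[of h "is"] l D(2)
          by (intro mult_mono) auto
      qed
      then show ?thesis by (simp add: card_lists_of_length N_def mult_ac)
    qed
    have "((\<lambda>\<theta>. ((1 - \<theta>) ^ (Suc d - 1) / fact (Suc d - 1)) *\<^sub>R Df (Suc d) \<theta>) has_integral
        Df 0 1 - (\<Sum>m<Suc d. ((1 - 0) ^ m / fact m) *\<^sub>R Df m 0)) {0..1}"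
      by (rule Taylor_has_integral[where Df=Df]) (use Df_der in auto)
    note hi = this
    have "norm (Df 0 1 - (\<Sum>m<Suc d. ((1 - 0) ^ m / fact m) *\<^sub>R Df m 0))
       \<le> N * C * norm h ^ Suc d * (c * norm w) powr (a - real (Suc d)) * measure lborel {0..1::real}"
    proof (rule has_integral_bound_real[OF _ finite.emptyI hi])
      show "0 \<le> N * C * norm h ^ Suc d * (c * norm w) powr (a - real (Suc d))" using N1 D(2) by simp
      fix \<theta> :: real assume \<theta>: "\<theta> \<in> {0..1} - {}"
      have "(1 - \<theta>) ^ d \<le> 1" using \<theta> by (intro power_le_one) auto
      also have "1 \<le> (fact d :: real)" by simp
      finally have "\<bar>(1 - \<theta>) ^ (Suc d - 1) / fact (Suc d - 1)\<bar> \<le> 1"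
        using \<theta> by simp
      then have "\<bar>(1 - \<theta>) ^ (Suc d - 1) / fact (Suc d - 1)\<bar> * norm (Df (Suc d) \<theta>) \<le> 1 * norm (Df (Suc d) \<theta>)"
        by (rule mult_right_mono) simp
      then show "norm (((1 - \<theta>) ^ (Suc d - 1) / fact (Suc d - 1)) *\<^sub>R Df (Suc d) \<theta>)
          \<le> N * C * norm h ^ Suc d * (c * norm w) powr (a - real (Suc d))"
        using bound[of \<theta>] \<theta> by simp
    qed
    moreover have "Df 0 1 = f (w + h)"
      by (simp add: Df_def lists_of_length_def D(1))
    moreover have "(\<Sum>m<Suc d. ((1 - 0) ^ m / fact m) *\<^sub>R Df m 0)
        = (\<Sum>m<Suc d. \<Sum>is\<in>lists_of_length m. D is w / fact m * of_real (\<Prod>i\<leftarrow>is. h $ i))"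
      unfolding Df_def by (intro sum.cong refl) (simp add: scaleR_conv_of_real sum_distrib_left mult_ac divide_inverse)
    ultimately show "norm (f (w + h) - (\<Sum>m<Suc d. \<Sum>is\<in>lists_of_length m. D is w / fact m * of_real (\<Prod>i\<leftarrow>is. h $ i)))
         \<le> N * C * norm h ^ Suc d * (c * norm w) powr (a - real (Suc d))"
      by simp
  qed
qed

subsection \<open>Integral inequalities\<close>

text \<open>Integrating this bound and optimising in \<open>c\<close> yields Holder's inequality up to a factor 2.\<close>

lemma powr_split_bound:
  fixes c g s :: real
  assumes "0 < c" "0 \<le> g" "1 < s"
  shows "g \<le> c + c powr (1 - s) * g powr s"
proof (cases "g \<le> c")
  case False
  then have g: "0 < g" using assms by simp
  have "g powr (1 - s) \<le> c powr (1 - s)" using False assms by (intro powr_mono2') auto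
  then have "g powr (1 - s) * g powr s \<le> c powr (1 - s) * g powr s" by (intro mult_right_mono) auto
  moreover have "g powr (1 - s) * g powr s = g" using g by (simp add: powr_add[symmetric])
  ultimately show ?thesis using assms by simp
qed (use assms in \<open>simp add: add_increasing2\<close>)

lemma nn_integral_holder:
  fixes k :: "'a \<Rightarrow> ennreal" and g :: "'a \<Rightarrow> real"
  assumes [measurable]: "k \<in> borel_measurable M" "g \<in> borel_measurable M"
    and g: "\<And>x. 0 \<le> g x" and "0 \<le> \<kappa>" "0 \<le> b" "1 < s"
    and 1: "(\<integral>\<^sup>+x. k x \<partial>M) \<le> ennreal \<kappa>"
    and 2: "(\<integral>\<^sup>+x. k x * ennreal (g x powr s) \<partial>M) \<le> ennreal (\<kappa> * b powr s)"
  shows "(\<integral>\<^sup>+x. k x * ennreal (g x) \<partial>M) \<le> ennreal (2 * \<kappa> * b)"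
proof -
  have main: "(\<integral>\<^sup>+x. k x * ennreal (g x) \<partial>M) \<le> ennreal (2 * \<kappa> * c)" if c: "0 < c" "b \<le> c" for c
  proof -
    have "k x * ennreal (g x) \<le> ennreal c * k x + ennreal (c powr (1 - s)) * (k x * ennreal (g x powr s))" for x
    proof -
      have "ennreal (g x) \<le> ennreal c + ennreal (c powr (1 - s)) * ennreal (g x powr s)"
        using powr_split_bound[OF c(1) g \<open>1 < s\<close>, of x] c
        by (simp add: ennreal_mult[symmetric] ennreal_plus[symmetric] ennreal_leI del: ennreal_plus)
      from mult_left_mono[OF this, of "k x"] show ?thesis by (simp add: distrib_left mult_ac)
    qed
    then have "(\<integral>\<^sup>+x. k x * ennreal (g x) \<partial>M)
        \<le> (\<integral>\<^sup>+x. ennreal c * k x + ennreal (c powr (1 - s)) * (k x * ennreal (g x powr s)) \<partial>M)"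
      by (rule nn_integral_mono)
    also have "\<dots> = ennreal c * (\<integral>\<^sup>+x. k x \<partial>M) + ennreal (c powr (1 - s)) * (\<integral>\<^sup>+x. k x * ennreal (g x powr s) \<partial>M)"
      by (simp add: nn_integral_add nn_integral_cmult)
    also have "\<dots> \<le> ennreal c * ennreal \<kappa> + ennreal (c powr (1 - s)) * ennreal (\<kappa> * b powr s)"
      by (intro add_mono mult_left_mono 1 2) auto
    also have "\<dots> = ennreal (c * \<kappa> + c powr (1 - s) * (\<kappa> * b powr s))"
      using assms c by (simp add: ennreal_mult[symmetric] ennreal_plus[symmetric] del: ennreal_plus)
    also have "\<dots> \<le> ennreal (2 * \<kappa> * c)"
    proof (rule ennreal_leI)
      have "b powr s \<le> c powr s" using assms c by (intro powr_mono2) auto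
      then have "c powr (1 - s) * (\<kappa> * b powr s) \<le> c powr (1 - s) * (\<kappa> * c powr s)"
        using assms by (intro mult_left_mono) auto
      also have "\<dots> = \<kappa> * (c powr (1 - s) * c powr s)" by simp
      also have "c powr (1 - s) * c powr s = c" using c by (simp add: powr_add[symmetric])
      finally show "c * \<kappa> + c powr (1 - s) * (\<kappa> * b powr s) \<le> 2 * \<kappa> * c" by simp
    qed
    finally show ?thesis .
  qed
  show ?thesis
  proof (rule ennreal_le_epsilon)
    fix e :: real assume e: "0 < e"
    \<comment> \<open>The natural choice is c = b, but \<open>b\<close> may be 0; the excess over
      \<open>b\<close> is scaled to cost at most \<open>e\<close> in the end.\<close>
    define c where "c = b + e / (2 * (\<kappa> + 1))"
    have c: "0 < c" "b \<le> c" using e assms by (auto simp: c_def add_nonneg_pos)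
    have "2 * \<kappa> * c = 2 * \<kappa> * b + e * (\<kappa> / (\<kappa> + 1))"
      using assms by (simp add: c_def field_simps)
    also have "\<dots> \<le> 2 * \<kappa> * b + e * 1"
      using e assms by (intro add_left_mono mult_left_mono) (auto simp: field_simps)
    finally have "ennreal (2 * \<kappa> * c) \<le> ennreal (2 * \<kappa> * b + e)" by (intro ennreal_leI) simp
    also have "\<dots> = ennreal (2 * \<kappa> * b) + ennreal e" using e assms by (intro ennreal_plus) auto
    finally show "(\<integral>\<^sup>+x. k x * ennreal (g x) \<partial>M) \<le> ennreal (2 * \<kappa> * b) + ennreal e"
      using main[OF c] by (rule order_trans[rotated])
  qed
qed

text \<open>Holder's inequality with the indicator of the cube as weight; the factor 2 is the one
  lost there.\<close>

lemma cube_L1_le_Ls: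
  fixes g :: "real^'n::finite \<Rightarrow> 'b::real_normed_vector"
  assumes [measurable]: "(\<lambda>y. norm (g y)) \<in> borel_measurable borel"
    and "0 \<le> t" "0 \<le> A" "1 < s"
    and "(\<integral>\<^sup>+y\<in>cube x t. ennreal (norm (g y) powr s) \<partial>lborel) \<le> ennreal (t ^ CARD('n) * A powr s)"
  shows "(\<integral>\<^sup>+y\<in>cube x t. ennreal (norm (g y)) \<partial>lborel) \<le> ennreal (2 * t ^ CARD('n) * A)"
proof -
  have "(\<integral>\<^sup>+y. indicator (cube x t) y * ennreal (norm (g y)) \<partial>lborel) \<le> ennreal (2 * t ^ CARD('n) * A)"
    by (rule nn_integral_holder[where s=s]) (use assms emeasure_cube[of t x] in \<open>auto simp: mult.commute\<close>)
  then show ?thesis by (simp add: mult.commute)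
qed

section \<open>Young's inequality for convolutions\<close>

lemma nn_integral_lborel_reflect:
  fixes f :: "real^'n::finite \<Rightarrow> ennreal"
  assumes "f \<in> borel_measurable borel"
  shows "(\<integral>\<^sup>+y. f (x - y) \<partial>lborel) = (\<integral>\<^sup>+y. f y \<partial>lborel)"
  using nn_integral_lborel_affine[OF assms, of "-1" x] by simp

text \<open>Holder's inequality for the measure k (x - y) dy, whose mass is at most \<kappa>. The
  convolution may be infinite while powers are taken of reals, so the claim is made for any real
  \<open>v\<close> below it.\<close>

lemma young_pointwise:
  fixes k g :: "real^'n::finite \<Rightarrow> real"
  assumes [measurable]: "k \<in> borel_measurable borel" "g \<in> borel_measurable borel"
    and g: "\<And>x. 0 \<le> g x" and "0 < \<kappa>" "1 < s" "0 \<le> v"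
    and k: "(\<integral>\<^sup>+y. ennreal (k y) \<partial>lborel) \<le> ennreal \<kappa>"
    and v: "ennreal v \<le> (\<integral>\<^sup>+y. ennreal (k (x - y)) * ennreal (g y) \<partial>lborel)"
  shows "ennreal (v powr s) \<le> ennreal (2 powr s * \<kappa> powr (s - 1)) *
           (\<integral>\<^sup>+y. ennreal (k (x - y)) * ennreal (g y powr s) \<partial>lborel)" (is "_ \<le> _ * ?H")
proof (cases "?H = \<infinity>")
  case True
  have "0 < ennreal (2 powr s * \<kappa> powr (s - 1))" using assms by simp
  then show ?thesis unfolding True using assms by (simp add: ennreal_mult_top)
next
  case False
  then obtain H where H: "?H = ennreal H" "0 \<le> H" by (cases ?H) auto
  \<comment> \<open>The s-mean of \<open>g\<close> for this measure, normalised by \<kappa> instead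
    of the actual mass.\<close>
  define b where "b = (H / \<kappa>) powr (1 / s)"
  have bs: "\<kappa> * b powr s = H" using assms H by (simp add: b_def powr_powr)
  have "(\<integral>\<^sup>+y. ennreal (k (x - y)) * ennreal (g y) \<partial>lborel) \<le> ennreal (2 * \<kappa> * b)"
  proof (rule nn_integral_holder[where s=s])
    show "(\<integral>\<^sup>+y. ennreal (k (x - y)) \<partial>lborel) \<le> ennreal \<kappa>"
      using k by (subst nn_integral_lborel_reflect[of "\<lambda>y. ennreal (k y)"]) auto
    show "(\<integral>\<^sup>+y. ennreal (k (x - y)) * ennreal (g y powr s) \<partial>lborel) \<le> ennreal (\<kappa> * b powr s)"
      unfolding bs H ..
  qed (use assms H in \<open>auto simp: b_def\<close>)
  with v have "ennreal v \<le> ennreal (2 * \<kappa> * b)" by (rule order_trans)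
  then have "v \<le> 2 * \<kappa> * b" using assms by (simp add: b_def)
  then have "v powr s \<le> (2 * \<kappa> * b) powr s" using assms by (intro powr_mono2) auto
  also have "\<dots> = 2 powr s * \<kappa> powr (s - 1) * (\<kappa> * b powr s)"
    using assms by (simp add: powr_mult powr_diff b_def)
  finally have "ennreal (v powr s) \<le> ennreal (2 powr s * \<kappa> powr (s - 1) * H)"
    unfolding bs by (rule ennreal_leI)
  then show ?thesis unfolding H using H(2) by (simp add: ennreal_mult)
qed

text \<open>Tonelli's theorem and translation invariance. Applied to the power g^s and combined with
  \<open>young_pointwise\<close>, this is Young's inequality on L^s with constant 2
  \<kappa>.\<close>

lemma young_integral:
  fixes k g :: "real^'n::finite \<Rightarrow> real"
  assumes [measurable]: "k \<in> borel_measurable borel" "g \<in> borel_measurable borel"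
    and k: "(\<integral>\<^sup>+y. ennreal (k y) \<partial>lborel) \<le> ennreal \<kappa>"
  shows "(\<integral>\<^sup>+x. (\<integral>\<^sup>+y. ennreal (k (x - y)) * ennreal (g y) \<partial>lborel) \<partial>lborel)
     \<le> ennreal \<kappa> * (\<integral>\<^sup>+y. ennreal (g y) \<partial>lborel)"
proof -
  have "(\<integral>\<^sup>+x. (\<integral>\<^sup>+y. ennreal (k (x - y)) * ennreal (g y) \<partial>lborel) \<partial>lborel)
     = (\<integral>\<^sup>+y. (\<integral>\<^sup>+x. ennreal (k (x - y)) * ennreal (g y) \<partial>lborel) \<partial>lborel)"
    by (rule lborel_pair.Fubini'[symmetric]) measurable
  also have "\<dots> = (\<integral>\<^sup>+y. (\<integral>\<^sup>+x. ennreal (k (x - y)) \<partial>lborel) * ennreal (g y) \<partial>lborel)"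
    by (simp add: nn_integral_multc)
  also have "\<dots> \<le> (\<integral>\<^sup>+y. ennreal \<kappa> * ennreal (g y) \<partial>lborel)"
  proof (intro nn_integral_mono mult_right_mono)
    fix y
    show "(\<integral>\<^sup>+x. ennreal (k (x - y)) \<partial>lborel) \<le> ennreal \<kappa>"
      using nn_integral_lborel_affine[of "\<lambda>x. ennreal (k (x - y))" 1 y] k by simp
  qed auto
  also have "\<dots> = ennreal \<kappa> * (\<integral>\<^sup>+y. ennreal (g y) \<partial>lborel)" by (rule nn_integral_cmult) simp
  finally show ?thesis .
qed

section \<open>Dyadic estimates of Riesz potentials\<close>

lemma geometric_suminf_ennreal:
  fixes c q :: real
  assumes "0 \<le> c" "0 \<le> q" "q < 1"
  shows "(\<Sum>j. ennreal (c * q ^ j)) = ennreal (c / (1 - q))"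
proof -
  have "(\<lambda>j. c * q ^ j) sums (c * (1 / (1 - q)))"
    using assms by (intro sums_mult geometric_sums) auto
  then show ?thesis using assms by (intro suminf_ennreal_eq) auto
qed

text \<open>Cut the cube into shells with sides between t_(j+1) and t_j = \<rho> / 2^j, on which |x
  - y| is at least t_j / 4. Shell \<open>j\<close> contributes at most 4^(-a) M t_j^(a + b), and
  \<delta> \<le> a + b makes the sum geometric with a ratio controlled by \<delta> alone, whatever
  the exponents are.\<close>

lemma riesz_integral_cube:
  fixes F :: "real^'n::finite \<Rightarrow> ennreal"
  assumes [measurable]: "F \<in> borel_measurable borel"
    and a: "a \<le> 0" and \<rho>: "0 < \<rho>" and M: "0 \<le> M" and \<delta>: "0 < \<delta>" "\<delta> \<le> a + b"
    and F: "\<And>t. 0 < t \<Longrightarrow> t \<le> \<rho> \<Longrightarrow> (\<integral>\<^sup>+y\<in>cube x t. F y \<partial>lborel) \<le> ennreal (M * t powr b)"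
  shows "(\<integral>\<^sup>+y\<in>cube x \<rho>. ennreal (norm (x - y) powr a) * F y \<partial>lborel)
     \<le> ennreal (4 powr (- a) / (1 - 2 powr (- \<delta>)) * M * \<rho> powr (a + b))"
proof -
  define t where "t j = \<rho> / 2 ^ j" for j :: nat
  have t: "0 < t j" "t j \<le> \<rho>" for j
    using \<rho> by (auto simp: t_def divide_le_eq)
  have pw: "ennreal (norm (x - y) powr a) * F y * indicator (cube x \<rho>) y
      \<le> (\<Sum>j. ennreal ((t j / 4) powr a) * (F y * indicator (cube x (t j)) y))" for y
  \<comment> \<open>At the pole \<open>0 powr a\<close> is 0, so the point y = x, which lies in no
    shell, contributes nothing.\<close>
  proof (cases "y = x \<or> y \<notin> cube x \<rho>")
    case True
    then show ?thesis by auto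
  next
    case False
    define m where "m = infnorm (y - x)"
    have m: "0 < m" "m \<le> \<rho> / 2" using False by (auto simp: m_def infnorm_pos_lt mem_cube_iff)
    have ex: "\<exists>j. t (Suc j) < 2 * m"
    proof -
      obtain j where "\<rho> / (2 * m) < 2 ^ j" using real_arch_pow[of 2 "\<rho> / (2 * m)"] by auto
      also have "\<dots> \<le> 2 ^ Suc j" by simp
      finally show ?thesis using m by (intro exI[of _ j]) (simp add: t_def field_simps)
    qed
    define j where "j = (LEAST j. t (Suc j) < 2 * m)"
    have j: "t (Suc j) < 2 * m" unfolding j_def by (rule LeastI_ex[OF ex])
    have j': "2 * m \<le> t j"
    proof (cases j)
      case 0
      then show ?thesis using m by (simp add: t_def)
    next
      case (Suc i)
      have "\<not> t (Suc i) < 2 * m" by (rule not_less_Least) (use Suc j_def in simp)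
      then show ?thesis using Suc by simp
    qed
    have "t j / 4 \<le> norm (x - y)"
      using j infnorm_le_norm[of "y - x"] by (simp add: t_def m_def norm_minus_commute)
    then have "norm (x - y) powr a \<le> (t j / 4) powr a"
      using t[of j] a by (intro powr_mono2') auto
    then have "ennreal (norm (x - y) powr a) * F y * indicator (cube x \<rho>) y
        \<le> ennreal ((t j / 4) powr a) * (F y * indicator (cube x (t j)) y)"
      using j' False by (auto simp: mem_cube_iff m_def intro!: mult_right_mono ennreal_leI)
    also have "\<dots> \<le> (\<Sum>j. ennreal ((t j / 4) powr a) * (F y * indicator (cube x (t j)) y))"
      using sum_le_suminf[of "\<lambda>j. ennreal ((t j / 4) powr a) * (F y * indicator (cube x (t j)) y)" "{j}"] by simp
    finally show ?thesis .
  qed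
  define q where "q = 2 powr (- \<delta>)"
  have q: "0 \<le> q" "q < 1" using \<delta> by (auto simp: q_def powr_less_one)
  define c where "c = 4 powr (- a) * M * \<rho> powr (a + b)"
  have "(\<integral>\<^sup>+y\<in>cube x \<rho>. ennreal (norm (x - y) powr a) * F y \<partial>lborel)
     \<le> (\<integral>\<^sup>+y. (\<Sum>j. ennreal ((t j / 4) powr a) * (F y * indicator (cube x (t j)) y)) \<partial>lborel)"
    using pw by (rule nn_integral_mono)
  also have "\<dots> = (\<Sum>j. \<integral>\<^sup>+y. ennreal ((t j / 4) powr a) * (F y * indicator (cube x (t j)) y) \<partial>lborel)"
    by (rule nn_integral_suminf) measurable
  also have "\<dots> = (\<Sum>j. ennreal ((t j / 4) powr a) * (\<integral>\<^sup>+y\<in>cube x (t j). F y \<partial>lborel))"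
    by (simp add: nn_integral_cmult)
  also have "\<dots> \<le> (\<Sum>j. ennreal (c * q ^ j))"
  proof (intro suminf_le summableI)
    fix j
    have "ennreal ((t j / 4) powr a) * (\<integral>\<^sup>+y\<in>cube x (t j). F y \<partial>lborel)
        \<le> ennreal ((t j / 4) powr a) * ennreal (M * t j powr b)"
      by (intro mult_left_mono F t) auto
    also have "\<dots> = ennreal ((t j / 4) powr a * (M * t j powr b))"
      using M by (simp add: ennreal_mult)
    also have "\<dots> \<le> ennreal (c * q ^ j)"
    proof (rule ennreal_leI)
      have "(t j / 4) powr a * (M * t j powr b) = 4 powr (- a) * M * t j powr (a + b)"
        using t[of j] by (simp add: powr_divide powr_minus powr_add field_simps)
      also have "t j powr (a + b) = \<rho> powr (a + b) * (2 powr (- (a + b))) ^ j"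
      proof -
        have "t j = \<rho> * 2 powr (- real j)"
          by (simp add: t_def powr_minus powr_realpow divide_inverse)
        then show ?thesis using \<rho> by (simp add: powr_mult powr_powr powr_power algebra_simps)
      qed
      also have "4 powr (- a) * M * (\<rho> powr (a + b) * (2 powr (- (a + b))) ^ j) \<le> c * q ^ j"
        unfolding c_def q_def mult.assoc using M \<delta>
        by (intro mult_left_mono power_mono) auto
      finally show "(t j / 4) powr a * (M * t j powr b) \<le> c * q ^ j" .
    qed
    finally show "ennreal ((t j / 4) powr a) * (\<integral>\<^sup>+y\<in>cube x (t j). F y \<partial>lborel) \<le> ennreal (c * q ^ j)" .
  qed
  also have "\<dots> = ennreal (c / (1 - q))"
    using M by (intro geometric_suminf_ennreal q) (simp add: c_def)
  finally show ?thesis by (simp add: c_def q_def)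
qed

text \<open>The counterpart away from the pole: the shells grow, and a + n + \<tau> has to be
  negative, where \<tau> is the rate at which the averages of \<open>F\<close> may grow with the
  scale. The bound is the same for every number \<open>J\<close> of shells.\<close>

lemma riesz_integral_annulus:
  fixes F :: "real^'n::finite \<Rightarrow> ennreal"
  assumes [measurable]: "F \<in> borel_measurable borel"
    and a: "a \<le> 0" and t: "0 < t" and M: "0 \<le> M" and \<delta>: "0 < \<delta>" "a + real CARD('n) + \<tau> \<le> - \<delta>"
    and F: "\<And>j. j \<le> J \<Longrightarrow> (\<integral>\<^sup>+y\<in>cube x (2 ^ j * t). F y \<partial>lborel)
              \<le> ennreal (M * 2 powr (real j * \<tau>) * (2 ^ j * t) ^ CARD('n))"
  shows "(\<integral>\<^sup>+y\<in>cube x (2 ^ J * t) - cube x t. ennreal (norm (x - y) powr a) * F y \<partial>lborel)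
     \<le> ennreal (4 powr (- a) / (1 - 2 powr (- \<delta>)) * M * t powr (a + real CARD('n)))"
proof -
  let ?n = "real CARD('n)"
  have pw: "ennreal (norm (x - y) powr a) * F y * indicator (cube x (2 ^ J * t) - cube x t) y
      \<le> (\<Sum>j<J. ennreal ((2 ^ j * t / 2) powr a) * (F y * indicator (cube x (2 ^ Suc j * t)) y))" for y
  proof (cases "y \<in> cube x (2 ^ J * t) - cube x t")
    case True
    define j where "j = (LEAST j. y \<in> cube x (2 ^ Suc j * t))"
    have J0: "J \<noteq> 0" using True by (cases J) auto
    then obtain J' where J': "J = Suc J'" by (cases J) auto
    have j1: "y \<in> cube x (2 ^ Suc j * t)" unfolding j_def by (rule LeastI[of _ J']) (use True J' in auto)
    have "j \<le> J'" unfolding j_def by (rule Least_le) (use True J' in auto)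
    then have jJ: "j < J" using J' by simp
    have j2: "y \<notin> cube x (2 ^ j * t)"
    proof (cases j)
      case (Suc i)
      show ?thesis using not_less_Least[of i "\<lambda>j. y \<in> cube x (2 ^ Suc j * t)"] Suc j_def by simp
    qed (use True in auto)
    then have "2 ^ j * t / 2 \<le> norm (x - y)"
      using infnorm_le_norm[of "y - x"] by (simp add: mem_cube_iff norm_minus_commute)
    then have "norm (x - y) powr a \<le> (2 ^ j * t / 2) powr a"
      using t a by (intro powr_mono2') auto
    then have "ennreal (norm (x - y) powr a) * F y * indicator (cube x (2 ^ J * t) - cube x t) y
        \<le> ennreal ((2 ^ j * t / 2) powr a) * (F y * indicator (cube x (2 ^ Suc j * t)) y)"
      using j1 True by (auto intro!: mult_right_mono ennreal_leI)
    also have "\<dots> \<le> (\<Sum>j<J. ennreal ((2 ^ j * t / 2) powr a) * (F y * indicator (cube x (2 ^ Suc j * t)) y))"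
      using jJ by (intro member_le_sum[where f="\<lambda>j. ennreal ((2 ^ j * t / 2) powr a) * (F y * indicator (cube x (2 ^ Suc j * t)) y)"]) auto
    finally show ?thesis .
  qed auto
  define q where "q = 2 powr (- \<delta>)"
  have q: "0 \<le> q" "q < 1" using \<delta> by (auto simp: q_def powr_less_one)
  define c where "c = 4 powr (- a) * M * t powr (a + ?n)"
  have "(\<integral>\<^sup>+y\<in>cube x (2 ^ J * t) - cube x t. ennreal (norm (x - y) powr a) * F y \<partial>lborel)
     \<le> (\<integral>\<^sup>+y. (\<Sum>j<J. ennreal ((2 ^ j * t / 2) powr a) * (F y * indicator (cube x (2 ^ Suc j * t)) y)) \<partial>lborel)"
    using pw by (rule nn_integral_mono)
  also have "\<dots> = (\<Sum>j<J. ennreal ((2 ^ j * t / 2) powr a) * (\<integral>\<^sup>+y\<in>cube x (2 ^ Suc j * t). F y \<partial>lborel))"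
    by (simp add: nn_integral_sum nn_integral_cmult)
  also have "\<dots> \<le> (\<Sum>j<J. ennreal (c * q ^ j))"
  proof (intro sum_mono)
    fix j assume j: "j \<in> {..<J}"
    have "ennreal ((2 ^ j * t / 2) powr a) * (\<integral>\<^sup>+y\<in>cube x (2 ^ Suc j * t). F y \<partial>lborel)
        \<le> ennreal ((2 ^ j * t / 2) powr a) * ennreal (M * 2 powr (real (Suc j) * \<tau>) * (2 ^ Suc j * t) ^ CARD('n))"
      using j by (intro mult_left_mono F) auto
    also have "\<dots> = ennreal ((2 ^ j * t / 2) powr a * (M * 2 powr (real (Suc j) * \<tau>) * (2 ^ Suc j * t) ^ CARD('n)))"
      using M t by (simp add: ennreal_mult)
    also have "\<dots> \<le> ennreal (c * q ^ j)"
    proof (rule ennreal_leI)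
      have e1: "(2 ^ j * t / 2) powr a = 2 powr (real j * a) * t powr a * 2 powr (- a)"
        using t by (simp add: powr_divide powr_mult powr_minus powr_realpow[symmetric] powr_powr field_simps)
      have e2: "(2 ^ Suc j * t) ^ CARD('n) = 2 powr (real (Suc j) * ?n) * t powr ?n"
        using t by (simp add: power_mult_distrib powr_realpow[symmetric] powr_powr powr_power powr_add powr_mult
            distrib_right distrib_left mult.commute)
      have "(2 ^ j * t / 2) powr a * (M * 2 powr (real (Suc j) * \<tau>) * (2 ^ Suc j * t) ^ CARD('n))
          = M * t powr (a + ?n) * (2 powr (real j * a) * 2 powr (- a) * 2 powr (real (Suc j) * \<tau>) * 2 powr (real (Suc j) * ?n))"
        unfolding e1 e2 by (simp add: powr_add)
      \<comment> \<open>The exponent is written as -2 a plus j + 1 copies of a + n + \<tau>. The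
        first part gives 4^(-a), one copy is dropped as negative, and the others give q^j.\<close>
      also have "2 powr (real j * a) * 2 powr (- a) * 2 powr (real (Suc j) * \<tau>) * 2 powr (real (Suc j) * ?n)
          = 2 powr (- 2 * a + (a + ?n + \<tau>) + real j * (a + ?n + \<tau>))"
        unfolding powr_add[symmetric] by (simp add: algebra_simps)
      also have "M * t powr (a + ?n) * \<dots> \<le> M * t powr (a + ?n) * 2 powr (- 2 * a + real j * (- \<delta>))"
      proof (intro mult_left_mono powr_mono)
        have "real j * (a + ?n + \<tau>) \<le> real j * (- \<delta>)" using \<delta> by (intro mult_left_mono) auto
        then show "- 2 * a + (a + ?n + \<tau>) + real j * (a + ?n + \<tau>) \<le> - 2 * a + real j * (- \<delta>)"
          using \<delta> by linarith
      qed (use M in auto)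
      also have "2 powr (- 2 * a + real j * (- \<delta>)) = 4 powr (- a) * q ^ j"
      proof -
        have "(4::real) powr (- a) = (2 powr 2) powr (- a)" by simp
        also have "\<dots> = 2 powr (- 2 * a)" unfolding powr_powr by simp
        finally show ?thesis by (simp only: powr_add q_def powr_power mult.commute)
      qed
      also have "M * t powr (a + ?n) * (4 powr (- a) * q ^ j) = c * q ^ j" by (simp add: c_def)
      finally show "(2 ^ j * t / 2) powr a * (M * 2 powr (real (Suc j) * \<tau>) * (2 ^ Suc j * t) ^ CARD('n)) \<le> c * q ^ j" .
    qed
    finally show "ennreal ((2 ^ j * t / 2) powr a) * (\<integral>\<^sup>+y\<in>cube x (2 ^ Suc j * t). F y \<partial>lborel) \<le> ennreal (c * q ^ j)" .
  qed
  also have "\<dots> \<le> (\<Sum>j. ennreal (c * q ^ j))" by (intro sum_le_suminf summableI) auto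
  also have "\<dots> = ennreal (c / (1 - q))"
    using M by (intro geometric_suminf_ennreal q) (simp add: c_def)
  finally show ?thesis by (simp add: c_def q_def)
qed

subsection \<open>Campanato chains\<close>

lemma cube_integral_bounded_le:
  fixes F :: "real^'n::finite \<Rightarrow> ennreal"
  assumes "0 \<le> t" "0 \<le> B" "\<And>y. y \<in> cube x t \<Longrightarrow> F y \<le> ennreal B"
  shows "(\<integral>\<^sup>+y\<in>cube x t. F y \<partial>lborel) \<le> ennreal (B * t ^ CARD('n))"
proof -
  have "(\<integral>\<^sup>+y\<in>cube x t. F y \<partial>lborel) \<le> (\<integral>\<^sup>+y. ennreal B * indicator (cube x t) y \<partial>lborel)"
    using assms(3) by (intro nn_integral_mono) (auto simp: indicator_def)
  also have "\<dots> = ennreal (B * t ^ CARD('n))"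
    using assms by (simp add: nn_integral_cmult_indicator emeasure_cube ennreal_mult)
  finally show ?thesis .
qed

lemma powr_add_le:
  fixes a b s :: real
  assumes "0 \<le> a" "0 \<le> b" "0 < s"
  shows "(a + b) powr s \<le> 2 powr s * (a powr s + b powr s)"
proof -
  have "(a + b) powr s \<le> (2 * max a b) powr s" using assms by (intro powr_mono2) auto
  also have "\<dots> = 2 powr s * max a b powr s" using assms by (simp add: powr_mult)
  also have "max a b powr s \<le> a powr s + b powr s" by (cases "a \<le> b") (auto simp: max_def)
  finally show ?thesis by simp
qed

text \<open>Expand the given polynomial on the cube of side \<open>2^j t\<close> about \<open>x\<close>, and let \<open>R\<close> consist of the terms
  with \<open>j = 0\<close> and degree at most \<open>\<sigma> + \<delta> / 2\<close>. The coefficients of the other terms are summed from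
  the top cube downwards, where the polynomial is zero, which is why they are small; those of the
  terms kept are compared by summing from \<open>j = 0\<close> upwards. Hence \<open>d'\<close> plays no role
  for the degree of \<open>R\<close>, and \<open>R\<close> does not grow too fast on the larger cubes.\<close>

lemma campanato_chain:
  fixes d d' :: nat and s \<delta> S :: real
  assumes s: "1 < s" and \<delta>: "0 < \<delta>"
  obtains C :: real where "0 \<le> C"
    "\<And>(f :: real^'n::finite \<Rightarrow> complex) x t J N \<sigma>.
      f \<in> borel_measurable borel \<Longrightarrow> 0 < t \<Longrightarrow> 0 \<le> N \<Longrightarrow> 0 \<le> \<sigma> \<Longrightarrow> \<sigma> \<le> S \<Longrightarrow> \<sigma> + \<delta> / 2 < real (Suc d) \<Longrightarrow>
      (\<And>j. j \<le> J \<Longrightarrow> \<exists>P\<in>poly_space d'. (j = J \<longrightarrow> P = (\<lambda>_. 0)) \<and>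
         (\<integral>\<^sup>+y\<in>cube x (2 ^ j * t). ennreal (norm (f y - P y) powr s) \<partial>lborel)
            \<le> ennreal ((2 ^ j * t) ^ CARD('n) * (N * (2 ^ j * t) powr \<sigma>) powr s)) \<Longrightarrow>
      \<exists>R\<in>poly_space d.
         (\<integral>\<^sup>+y\<in>cube x t. ennreal (norm (f y - R y) powr s) \<partial>lborel)
            \<le> ennreal (t ^ CARD('n) * (C * N * t powr \<sigma>) powr s) \<and>
         (\<forall>j\<le>J. (\<integral>\<^sup>+y\<in>cube x (2 ^ j * t). ennreal (norm (f y - R y)) \<partial>lborel)
            \<le> ennreal (C * N * t powr \<sigma> * 2 powr (real j * (\<sigma> + \<delta>)) * (2 ^ j * t) ^ CARD('n)))"
proof -
  obtain K :: real where K: "0 < K"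
    "\<And>(x::real^'n) t (c :: _ \<Rightarrow> complex) b. 0 < t \<Longrightarrow> b \<in> multi_indices d' \<Longrightarrow>
       ennreal (t ^ CARD('n) * norm (c b)) \<le> ennreal K * (\<integral>\<^sup>+y\<in>cube x t.
         ennreal (norm (\<Sum>\<beta>\<in>multi_indices d'. c \<beta> * of_real (mpow \<beta> ((1 / t) *\<^sub>R (y - x))))) \<partial>lborel)"
    by (rule poly_coefficient_bound[of d'], rule that)
  define n where "n = CARD('n)"
  \<comment> \<open>Two consecutive polynomials are compared on the smaller cube. The 2 is the mean
    deviation there after Holder's inequality; the other term is that of the doubled cube, with
    volume factor 2^n and 2^\<sigma> \<le> 2^S.\<close>
  define C1 where "C1 = 2 + 2 * 2 ^ n * 2 powr S"
  define C2 where "C2 = K * C1"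
  define q where "q = 2 powr (- (\<delta> / 2))"
  have q: "0 < q" "q < 1" using \<delta> by (auto simp: q_def powr_less_one)
  define p where "p = 2 powr (\<delta> / 2)"
  have p: "1 < p" using \<delta> by (auto simp: p_def)
  \<comment> \<open>\<open>G\<close> solves C2 + q G = G, and \<open>G'\<close> solves G' + C2 = p
    G'. These are the values for which the two inductions over the coefficients reproduce their own
    bounds.\<close>
  define G where "G = C2 / (1 - q)"
  define G' where "G' = C2 / (p - 1)"
  have C1: "2 \<le> C1" by (simp add: C1_def)
  have C2: "0 \<le> C2" using C1 K by (simp add: C2_def)
  have G: "0 \<le> G" "C2 + q * G = G" using q C2 by (auto simp: G_def field_simps)
  have G': "0 \<le> G'" "G' + C2 = p * G'" using p C2 by (auto simp: G'_def field_simps)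
  define B where "B = real (card (multi_indices d' :: ('n \<Rightarrow> nat) set)) * (G + G')"
  have B: "0 \<le> B" using G G' by (simp add: B_def)
  define C where "C = 4 * (1 + B)"
  show thesis
  proof (rule that[of C])
    show "0 \<le> C" using B by (simp add: C_def)
    fix f :: "real^'n \<Rightarrow> complex" and x and t N \<sigma> :: real and J :: nat
    assume f [measurable]: "f \<in> borel_measurable borel" and t: "0 < t" and N: "0 \<le> N" and \<sigma>: "0 \<le> \<sigma>" "\<sigma> \<le> S"
      and gap: "\<sigma> + \<delta> / 2 < real (Suc d)"
      and ex: "\<And>j. j \<le> J \<Longrightarrow> \<exists>P\<in>poly_space d'. (j = J \<longrightarrow> P = (\<lambda>_. 0)) \<and>
         (\<integral>\<^sup>+y\<in>cube x (2 ^ j * t). ennreal (norm (f y - P y) powr s) \<partial>lborel)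
            \<le> ennreal ((2 ^ j * t) ^ CARD('n) * (N * (2 ^ j * t) powr \<sigma>) powr s)"
    define \<rho> where "\<rho> j = 2 ^ j * t" for j :: nat
    have \<rho>: "0 < \<rho> j" for j using t by (simp add: \<rho>_def)
    have \<rho>_powr: "\<rho> j powr e = t powr e * 2 powr (real j * e)" for j e
      using t by (simp add: \<rho>_def powr_mult powr_realpow[symmetric] powr_powr mult.commute)
    have \<rho>_Suc: "\<rho> (Suc j) = 2 * \<rho> j" for j by (simp add: \<rho>_def)
    have "\<forall>j. \<exists>P. j \<le> J \<longrightarrow> P \<in> poly_space d' \<and> (j = J \<longrightarrow> P = (\<lambda>_. 0)) \<and>
         (\<integral>\<^sup>+y\<in>cube x (\<rho> j). ennreal (norm (f y - P y) powr s) \<partial>lborel)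
            \<le> ennreal (\<rho> j ^ n * (N * \<rho> j powr \<sigma>) powr s)"
      using ex unfolding \<rho>_def n_def by blast
    from choice[OF this] obtain P where P: "\<And>j. j \<le> J \<Longrightarrow> P j \<in> poly_space d'" "P J = (\<lambda>_. 0)"
      "\<And>j. j \<le> J \<Longrightarrow> (\<integral>\<^sup>+y\<in>cube x (\<rho> j). ennreal (norm (f y - P j y) powr s) \<partial>lborel)
            \<le> ennreal (\<rho> j ^ n * (N * \<rho> j powr \<sigma>) powr s)" by blast
    have P_meas: "(\<lambda>y. norm (f y - P j y)) \<in> borel_measurable borel" if "j \<le> J" for j
      using poly_space_borel[OF P(1)[OF that]] by measurable
    have L1: "(\<integral>\<^sup>+y\<in>cube x (\<rho> j). ennreal (norm (f y - P j y)) \<partial>lborel)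
            \<le> ennreal (2 * \<rho> j ^ n * (N * \<rho> j powr \<sigma>))" if "j \<le> J" for j
      unfolding n_def using P(3)[OF that] \<rho>[of j] N s
      by (intro cube_L1_le_Ls[where s=s] P_meas that) (auto simp: n_def)
    have "\<forall>j. \<exists>c. j \<le> J \<longrightarrow> (\<forall>y. P j y = (\<Sum>\<beta>\<in>multi_indices d'. c \<beta> * of_real (mpow \<beta> (y - x)))) \<and> (j = J \<longrightarrow> (\<forall>\<beta>. c \<beta> = 0))"
    proof
      fix j
      show "\<exists>c. j \<le> J \<longrightarrow> (\<forall>y. P j y = (\<Sum>\<beta>\<in>multi_indices d'. c \<beta> * of_real (mpow \<beta> (y - x)))) \<and> (j = J \<longrightarrow> (\<forall>\<beta>. c \<beta> = 0))"
      proof (cases "j < J")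
        case True
        then obtain c where "\<And>y. P j y = (\<Sum>\<beta>\<in>multi_indices d'. c \<beta> * of_real (mpow \<beta> (y - x)))"
          using poly_space_centered[OF P(1), of j x] by auto
        then show ?thesis using True by auto
      next
        case False
        then show ?thesis using P(2) by (intro exI[of _ "\<lambda>_. 0"]) auto
      qed
    qed
    from choice[OF this] obtain c where
      c: "\<And>j y. j \<le> J \<Longrightarrow> P j y = (\<Sum>\<beta>\<in>multi_indices d'. c j \<beta> * of_real (mpow \<beta> (y - x)))" and
      cJ: "\<And>\<beta>. c J \<beta> = 0" by auto
    \<comment> \<open>A mean bound for the difference of consecutive polynomials bounds its
      coefficients in the variable rescaled to side \<rho>_j; undoing the scaling turns
      \<rho>_j^\<sigma> into a power with exponent \<sigma> - |\<beta>|.\<close>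
    have step: "norm (c j \<beta> - c (Suc j) \<beta>) \<le> C2 * N * \<rho> j powr (\<sigma> - real (msize \<beta>))"
      if j: "j < J" and \<beta>: "\<beta> \<in> multi_indices d'" for j \<beta>
    proof -
      have [measurable]: "P j \<in> borel_measurable borel" "P (Suc j) \<in> borel_measurable borel"
        using j by (auto intro!: poly_space_borel P(1))
      define a where "a \<gamma> = (c j \<gamma> - c (Suc j) \<gamma>) * of_real (\<rho> j ^ msize \<gamma>)" for \<gamma>
      have diff: "P j y - P (Suc j) y = (\<Sum>\<gamma>\<in>multi_indices d'. a \<gamma> * of_real (mpow \<gamma> ((1 / \<rho> j) *\<^sub>R (y - x))))" for y
      proof -
        have "P j y - P (Suc j) y = (\<Sum>\<gamma>\<in>multi_indices d'. (c j \<gamma> - c (Suc j) \<gamma>) * of_real (mpow \<gamma> (y - x)))"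
          using j by (simp add: c sum_subtractf left_diff_distrib)
        also have "\<dots> = (\<Sum>\<gamma>\<in>multi_indices d'. a \<gamma> * of_real (mpow \<gamma> ((1 / \<rho> j) *\<^sub>R (y - x))))"
        proof (intro sum.cong refl)
          fix \<gamma>
          have "\<rho> j ^ msize \<gamma> * mpow \<gamma> ((1 / \<rho> j) *\<^sub>R (y - x)) = mpow \<gamma> (y - x)"
            using \<rho>[of j] unfolding mpow_scale[symmetric] by simp
          then show "(c j \<gamma> - c (Suc j) \<gamma>) * of_real (mpow \<gamma> (y - x)) = a \<gamma> * of_real (mpow \<gamma> ((1 / \<rho> j) *\<^sub>R (y - x)))"
            unfolding a_def by (metis mult.assoc of_real_mult)
        qed
        finally show ?thesis .
      qed
      have k1: "ennreal (\<rho> j ^ n * norm (a \<beta>)) \<le> ennreal K * (\<integral>\<^sup>+y\<in>cube x (\<rho> j). ennreal (norm (P j y - P (Suc j) y)) \<partial>lborel)"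
        unfolding diff n_def by (rule K(2)[OF \<rho> \<beta>])
      have "(\<integral>\<^sup>+y\<in>cube x (\<rho> j). ennreal (norm (P j y - P (Suc j) y)) \<partial>lborel)
         \<le> (\<integral>\<^sup>+y. ennreal (norm (f y - P j y)) * indicator (cube x (\<rho> j)) y
              + ennreal (norm (f y - P (Suc j) y)) * indicator (cube x (\<rho> (Suc j))) y \<partial>lborel)"
      proof (rule nn_integral_mono)
        fix y
        have "norm (P j y - P (Suc j) y) \<le> norm (f y - P j y) + norm (f y - P (Suc j) y)"
          using norm_triangle_ineq4[of "f y - P (Suc j) y" "f y - P j y"] by (simp add: add.commute)
        then have "ennreal (norm (P j y - P (Suc j) y)) \<le> ennreal (norm (f y - P j y)) + ennreal (norm (f y - P (Suc j) y))"
          by (simp add: ennreal_plus[symmetric] ennreal_leI del: ennreal_plus)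
        moreover have "y \<in> cube x (\<rho> (Suc j))" if "y \<in> cube x (\<rho> j)"
          using that cube_mono[of "\<rho> j" "\<rho> (Suc j)" x] \<rho>[of j] by (auto simp: \<rho>_Suc)
        ultimately show "ennreal (norm (P j y - P (Suc j) y)) * indicator (cube x (\<rho> j)) y
            \<le> ennreal (norm (f y - P j y)) * indicator (cube x (\<rho> j)) y
              + ennreal (norm (f y - P (Suc j) y)) * indicator (cube x (\<rho> (Suc j))) y"
          by (auto simp: indicator_def)
      qed
      also have "\<dots> = (\<integral>\<^sup>+y\<in>cube x (\<rho> j). ennreal (norm (f y - P j y)) \<partial>lborel)
            + (\<integral>\<^sup>+y\<in>cube x (\<rho> (Suc j)). ennreal (norm (f y - P (Suc j) y)) \<partial>lborel)"
        by (rule nn_integral_add) measurable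
      also have "\<dots> \<le> ennreal (2 * \<rho> j ^ n * (N * \<rho> j powr \<sigma>)) + ennreal (2 * \<rho> (Suc j) ^ n * (N * \<rho> (Suc j) powr \<sigma>))"
        using j by (intro add_mono L1) auto
      also have "\<dots> = ennreal (2 * \<rho> j ^ n * (N * \<rho> j powr \<sigma>) + 2 * \<rho> (Suc j) ^ n * (N * \<rho> (Suc j) powr \<sigma>))"
        using \<rho>[of j] \<rho>[of "Suc j"] N by (intro ennreal_plus[symmetric]) auto
      also have "\<dots> \<le> ennreal (C1 * (\<rho> j ^ n * (N * \<rho> j powr \<sigma>)))"
      proof (rule ennreal_leI)
        have "\<rho> (Suc j) powr \<sigma> = 2 powr \<sigma> * \<rho> j powr \<sigma>" using \<rho>[of j] by (simp add: \<rho>_Suc powr_mult)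
        also have "\<dots> \<le> 2 powr S * \<rho> j powr \<sigma>" using \<sigma> by (intro mult_right_mono) auto
        finally have "2 * \<rho> (Suc j) ^ n * (N * \<rho> (Suc j) powr \<sigma>) \<le> 2 * \<rho> (Suc j) ^ n * (N * (2 powr S * \<rho> j powr \<sigma>))"
          using \<rho>[of "Suc j"] N by (intro mult_left_mono) auto
        then show "2 * \<rho> j ^ n * (N * \<rho> j powr \<sigma>) + 2 * \<rho> (Suc j) ^ n * (N * \<rho> (Suc j) powr \<sigma>)
            \<le> C1 * (\<rho> j ^ n * (N * \<rho> j powr \<sigma>))"
          by (simp add: C1_def \<rho>_Suc power_mult_distrib algebra_simps)
      qed
      finally have "ennreal (\<rho> j ^ n * norm (a \<beta>)) \<le> ennreal K * ennreal (C1 * (\<rho> j ^ n * (N * \<rho> j powr \<sigma>)))"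
        by (intro order_trans[OF k1] mult_left_mono) auto
      also have "\<dots> = ennreal (\<rho> j ^ n * (C2 * N * \<rho> j powr \<sigma>))"
        using K(1) C1 \<rho>[of j] N by (simp add: ennreal_mult[symmetric] C2_def mult_ac)
      finally have "\<rho> j ^ n * norm (a \<beta>) \<le> \<rho> j ^ n * (C2 * N * \<rho> j powr \<sigma>)"
        using \<rho>[of j] N C2 by simp
      then have "norm (a \<beta>) \<le> C2 * N * \<rho> j powr \<sigma>" using \<rho>[of j] by simp
      then have "norm (c j \<beta> - c (Suc j) \<beta>) * \<rho> j ^ msize \<beta> \<le> C2 * N * \<rho> j powr \<sigma>"
        using \<rho>[of j] by (simp add: a_def norm_mult norm_power)
      moreover define m where "m = msize \<beta>"
      ultimately show ?thesis unfolding m_def[symmetric]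
        using \<rho>[of j] by (simp add: powr_diff powr_realpow field_simps)
    qed
    \<comment> \<open>Here \<sigma> - |\<beta>| < -\<delta> / 2, so doubling the side shrinks the
      bound at least by the factor \<open>q\<close>, and the increments above any level sum to a
      multiple of the one at that level.\<close>
    have dropped: "norm (c j \<beta>) \<le> G * N * \<rho> j powr (\<sigma> - real (msize \<beta>))"
      if "j \<le> J" and \<beta>: "\<beta> \<in> multi_indices d'" and big: "\<sigma> + \<delta> / 2 < real (msize \<beta>)" for j \<beta>
      using \<open>j \<le> J\<close>
    proof (induction rule: inc_induct)
      case base
      then show ?case using G N by (simp add: cJ)
    next
      case (step j)
      define e where "e = \<sigma> - real (msize \<beta>)"
      have "\<rho> (Suc j) powr e = 2 powr e * \<rho> j powr e" using \<rho>[of j] by (simp add: \<rho>_Suc powr_mult)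
      also have "\<dots> \<le> q * \<rho> j powr e" unfolding q_def using big by (intro mult_right_mono) (auto simp: e_def)
      finally have 1: "G * N * \<rho> (Suc j) powr e \<le> G * N * (q * \<rho> j powr e)"
        using G N by (intro mult_left_mono) auto
      have "norm (c j \<beta>) \<le> norm (c j \<beta> - c (Suc j) \<beta>) + norm (c (Suc j) \<beta>)"
        using norm_triangle_ineq[of "c j \<beta> - c (Suc j) \<beta>" "c (Suc j) \<beta>"] by simp
      also have "\<dots> \<le> C2 * N * \<rho> j powr e + G * N * (q * \<rho> j powr e)"
        using \<open>\<And>j \<beta>. j < J \<Longrightarrow> \<beta> \<in> multi_indices d' \<Longrightarrow> norm (c j \<beta> - c (Suc j) \<beta>) \<le> C2 * N * \<rho> j powr (\<sigma> - real (msize \<beta>))\<close>[OF step.hyps(2) \<beta>]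
          step.IH 1 unfolding e_def by (intro add_mono) linarith+
      also have "\<dots> = (C2 + q * G) * (N * \<rho> j powr e)" by (simp add: algebra_simps)
      also have "\<dots> = G * N * \<rho> j powr e" unfolding G(2) by simp
      finally show ?case by (simp add: e_def)
    qed
    \<comment> \<open>Here \<sigma> - |\<beta>| may be zero or slightly negative, and then the
      increments do not grow geometrically. The bound is weakened by 2^(j \<delta>), after which
      each step allows a growth of at least p = 2^(\<delta> / 2) > 1.\<close>
    have kept: "norm (c 0 \<beta> - c j \<beta>) \<le> G' * N * (t powr (\<sigma> - real (msize \<beta>)) * 2 powr (real j * (\<sigma> - real (msize \<beta>) + \<delta>)))"
      if "j \<le> J" and \<beta>: "\<beta> \<in> multi_indices d'" and small: "real (msize \<beta>) \<le> \<sigma> + \<delta> / 2" for j \<beta>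
      using \<open>j \<le> J\<close>
    proof (induction j)
      case 0
      then show ?case using G' N by simp
    next
      case (Suc j)
      define e where "e = \<sigma> - real (msize \<beta>)"
      define u where "u = t powr e * 2 powr (real j * (e + \<delta>))"
      have "2 powr (real j * e) \<le> 2 powr (real j * (e + \<delta>))"
        using \<delta> by (intro powr_mono mult_left_mono) auto
      then have "\<rho> j powr e \<le> u" unfolding \<rho>_powr u_def by (intro mult_left_mono) auto
      then have 1: "C2 * N * \<rho> j powr e \<le> C2 * N * u" using C2 N by (intro mult_left_mono) auto
      have "norm (c 0 \<beta> - c (Suc j) \<beta>) \<le> norm (c 0 \<beta> - c j \<beta>) + norm (c j \<beta> - c (Suc j) \<beta>)"
        using norm_triangle_ineq[of "c 0 \<beta> - c j \<beta>" "c j \<beta> - c (Suc j) \<beta>"] by simp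
      also have "\<dots> \<le> G' * N * u + C2 * N * u"
        using Suc.IH Suc.prems step[of j \<beta>] \<beta> 1 unfolding e_def u_def by (intro add_mono) auto
      also have "\<dots> = p * (G' * N * u)" using G'(2) by (simp add: distrib_right[symmetric] mult.assoc[symmetric])
      also have "\<dots> \<le> 2 powr (e + \<delta>) * (G' * N * u)"
        unfolding p_def using small G' N by (intro mult_right_mono powr_mono) (auto simp: e_def u_def)
      also have "\<dots> = G' * N * (t powr e * 2 powr (real (Suc j) * (e + \<delta>)))"
      proof -
        have "2 powr (real (Suc j) * (e + \<delta>)) = 2 powr (e + \<delta>) * 2 powr (real j * (e + \<delta>))"
          by (simp add: powr_add[symmetric] algebra_simps)
        then show ?thesis by (simp add: u_def)
      qed
      finally show ?case by (simp add: e_def)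
    qed
    define c' where "c' \<beta> = (if real (msize \<beta>) \<le> \<sigma> + \<delta> / 2 then c 0 \<beta> else 0)" for \<beta>
    define R where "R y = (\<Sum>\<beta>\<in>multi_indices d'. c' \<beta> * of_real (mpow \<beta> (y - x)))" for y
    have R_poly: "R \<in> poly_space d"
    proof (rule poly_space_centeredI[where a=x and c="\<lambda>\<beta>. if \<beta> \<in> multi_indices d' then c' \<beta> else 0"])
      fix y
      have z: "c' \<beta> = 0" if "\<beta> \<notin> multi_indices d" for \<beta>
      proof -
        have "real (Suc d) \<le> real (msize \<beta>)"
          using that unfolding multi_indices_iff by (intro of_nat_mono) linarith
        then have "\<not> real (msize \<beta>) \<le> \<sigma> + \<delta> / 2" using gap by linarith
        then show ?thesis unfolding c'_def by (rule if_not_P)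
      qed
      have "R y = (\<Sum>\<beta>\<in>multi_indices d' \<inter> multi_indices d. c' \<beta> * of_real (mpow \<beta> (y - x)))"
        unfolding R_def by (rule sum.mono_neutral_right) (auto simp: z)
      also have "\<dots> = (\<Sum>\<beta>\<in>multi_indices d. (if \<beta> \<in> multi_indices d' then c' \<beta> else 0) * of_real (mpow \<beta> (y - x)))"
        by (rule sum.mono_neutral_cong_left) auto
      finally show "R y = \<dots>" .
    qed
    have [measurable]: "R \<in> borel_measurable borel" by (rule poly_space_borel[OF R_poly])
    \<comment> \<open>On the cube of side \<rho>_j a monomial is at most \<rho>_j^|\<beta>|, which
      cancels the -|\<beta>| in both coefficient bounds; kept and dropped terms then share the rate
      t^\<sigma> 2^(j (\<sigma> + \<delta>)).\<close>
    have sup: "norm (R y - P j y) \<le> B * N * t powr \<sigma> * 2 powr (real j * (\<sigma> + \<delta>))"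
      if j: "j \<le> J" and y: "y \<in> cube x (\<rho> j)" for j y
    proof -
      define u where "u = N * t powr \<sigma> * 2 powr (real j * (\<sigma> + \<delta>))"
      have u: "0 \<le> u" using N by (simp add: u_def)
      have "norm (R y - P j y) \<le> (\<Sum>\<beta>\<in>multi_indices d'. norm ((c' \<beta> - c j \<beta>) * of_real (mpow \<beta> (y - x))))"
        unfolding R_def c[OF j] sum_subtractf[symmetric] left_diff_distrib[symmetric] by (rule norm_sum)
      also have "\<dots> \<le> (\<Sum>\<beta>\<in>(multi_indices d' :: ('n \<Rightarrow> nat) set). (G + G') * u)"
      proof (rule sum_mono)
        fix \<beta> :: "'n \<Rightarrow> nat" assume \<beta>: "\<beta> \<in> multi_indices d'"
        define e where "e = \<sigma> - real (msize \<beta>)"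
        have "\<bar>mpow \<beta> (y - x)\<bar> \<le> infnorm (y - x) ^ msize \<beta>" by (rule abs_mpow_le)
        also have "\<dots> \<le> \<rho> j ^ msize \<beta>"
          using y \<rho>[of j] by (intro power_mono infnorm_pos_le) (simp add: mem_cube_iff)
        finally have m: "\<bar>mpow \<beta> (y - x)\<bar> \<le> \<rho> j powr real (msize \<beta>)"
          unfolding powr_realpow[OF \<rho>] .
        show "norm ((c' \<beta> - c j \<beta>) * of_real (mpow \<beta> (y - x))) \<le> (G + G') * u"
        proof (cases "real (msize \<beta>) \<le> \<sigma> + \<delta> / 2")
          case True
          have "norm ((c' \<beta> - c j \<beta>) * of_real (mpow \<beta> (y - x)))
              \<le> (G' * N * (t powr e * 2 powr (real j * (e + \<delta>)))) * \<rho> j powr real (msize \<beta>)"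
            unfolding norm_mult norm_of_real e_def
            using kept[OF j \<beta> True] True m G' N by (intro mult_mono) (auto simp: c'_def)
          also have "\<dots> = G' * N * (t powr (e + real (msize \<beta>)) * 2 powr (real j * (e + \<delta>) + real j * real (msize \<beta>)))"
            unfolding \<rho>_powr by (simp add: powr_add mult_ac)
          also have "\<dots> = G' * u" by (simp add: e_def u_def algebra_simps)
          also have "\<dots> \<le> (G + G') * u" using G u by (intro mult_right_mono) auto
          finally show ?thesis .
        next
          case False
          have "norm ((c' \<beta> - c j \<beta>) * of_real (mpow \<beta> (y - x))) \<le> (G * N * \<rho> j powr e) * \<rho> j powr real (msize \<beta>)"
            unfolding norm_mult norm_of_real e_def
            using dropped[OF j \<beta>] False m G N by (intro mult_mono) (auto simp: c'_def)
          also have "\<dots> = G * N * \<rho> j powr \<sigma>" by (simp add: e_def powr_add[symmetric])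
          also have "\<dots> \<le> G * N * (t powr \<sigma> * 2 powr (real j * (\<sigma> + \<delta>)))"
            unfolding \<rho>_powr using \<delta> G N by (intro mult_left_mono powr_mono) auto
          also have "\<dots> = G * u" by (simp add: u_def mult_ac)
          also have "\<dots> \<le> (G + G') * u" using G' u by (intro mult_right_mono) auto
          finally show ?thesis .
        qed
      qed
      also have "\<dots> = B * N * t powr \<sigma> * 2 powr (real j * (\<sigma> + \<delta>))"
        by (simp add: B_def u_def)
      finally show ?thesis .
    qed
    have "(\<integral>\<^sup>+y\<in>cube x t. ennreal (norm (f y - R y) powr s) \<partial>lborel)
            \<le> ennreal (t ^ CARD('n) * (C * N * t powr \<sigma>) powr s)"
    proof -
      have [measurable]: "P 0 \<in> borel_measurable borel" by (auto intro!: poly_space_borel P(1))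
      define b where "b = B * N * t powr \<sigma>"
      have b: "0 \<le> b" using B N by (simp add: b_def)
      have "(\<integral>\<^sup>+y\<in>cube x t. ennreal (norm (f y - R y) powr s) \<partial>lborel)
         \<le> (\<integral>\<^sup>+y. ennreal (2 powr s) * (ennreal (norm (f y - P 0 y) powr s) * indicator (cube x t) y)
            + ennreal (2 powr s * b powr s) * indicator (cube x t) y \<partial>lborel)"
      proof (rule nn_integral_mono)
        fix y
        show "ennreal (norm (f y - R y) powr s) * indicator (cube x t) y
          \<le> ennreal (2 powr s) * (ennreal (norm (f y - P 0 y) powr s) * indicator (cube x t) y)
            + ennreal (2 powr s * b powr s) * indicator (cube x t) y"
        proof (cases "y \<in> cube x t")
          case True
          have "norm (f y - R y) \<le> norm (f y - P 0 y) + norm (R y - P 0 y)"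
            using norm_triangle_ineq4[of "f y - P 0 y" "R y - P 0 y"] by simp
          also have "\<dots> \<le> norm (f y - P 0 y) + b"
            using sup[of 0 y] True by (simp add: \<rho>_def b_def)
          finally have "norm (f y - R y) powr s \<le> (norm (f y - P 0 y) + b) powr s"
            using s by (intro powr_mono2) auto
          also have "\<dots> \<le> 2 powr s * (norm (f y - P 0 y) powr s + b powr s)"
            using s b by (intro powr_add_le) auto
          finally show ?thesis using True
            by (simp add: ennreal_mult[symmetric] ennreal_plus[symmetric] ennreal_leI distrib_left del: ennreal_plus)
        qed auto
      qed
      also have "\<dots> = ennreal (2 powr s) * (\<integral>\<^sup>+y\<in>cube x t. ennreal (norm (f y - P 0 y) powr s) \<partial>lborel)
          + ennreal (2 powr s * b powr s) * emeasure lborel (cube x t)"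
        by (simp add: nn_integral_add nn_integral_cmult)
      also have "\<dots> \<le> ennreal (2 powr s) * ennreal (t ^ n * (N * t powr \<sigma>) powr s) + ennreal (2 powr s * b powr s) * ennreal (t ^ n)"
        using P(3)[of 0] t by (intro add_mono mult_left_mono) (auto simp: \<rho>_def n_def emeasure_cube)
      also have "\<dots> = ennreal (t ^ n * (2 powr s * ((N * t powr \<sigma>) powr s + b powr s)))"
        using t by (simp add: ennreal_mult[symmetric] ennreal_plus[symmetric] algebra_simps del: ennreal_plus)
      also have "\<dots> \<le> ennreal (t ^ n * (C * N * t powr \<sigma>) powr s)"
      proof (intro ennreal_leI mult_left_mono)
        define v where "v = (1 + B) * (N * t powr \<sigma>)"
        have v: "N * t powr \<sigma> \<le> v" "b \<le> v" "0 \<le> v"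
          using N B by (auto simp: v_def b_def algebra_simps)
        have "(N * t powr \<sigma>) powr s + b powr s \<le> v powr s + v powr s"
          using v b N s by (intro add_mono powr_mono2) auto
        also have "\<dots> = 2 powr 1 * v powr s" by simp
        also have "\<dots> \<le> 2 powr s * v powr s" using s by (intro mult_right_mono powr_mono) auto
        finally have "2 powr s * ((N * t powr \<sigma>) powr s + b powr s) \<le> 2 powr s * (2 powr s * v powr s)"
          by (intro mult_left_mono) auto
        also have "\<dots> = (C * N * t powr \<sigma>) powr s"
        proof -
          have "C * N * t powr \<sigma> = 2 * (2 * v)" by (simp add: C_def v_def)
          then show ?thesis using v by (simp only: powr_mult)
        qed
        finally show "2 powr s * ((N * t powr \<sigma>) powr s + b powr s) \<le> (C * N * t powr \<sigma>) powr s" .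
      qed (use t in auto)
      finally show ?thesis by (simp add: n_def)
    qed
    moreover have "(\<integral>\<^sup>+y\<in>cube x (2 ^ j * t). ennreal (norm (f y - R y)) \<partial>lborel)
            \<le> ennreal (C * N * t powr \<sigma> * 2 powr (real j * (\<sigma> + \<delta>)) * (2 ^ j * t) ^ CARD('n))" if j: "j \<le> J" for j
    proof -
      have [measurable]: "P j \<in> borel_measurable borel" using j by (auto intro!: poly_space_borel P(1))
      define u where "u = N * t powr \<sigma> * 2 powr (real j * (\<sigma> + \<delta>))"
      have u: "0 \<le> u" using N by (simp add: u_def)
      have "(\<integral>\<^sup>+y\<in>cube x (\<rho> j). ennreal (norm (f y - R y)) \<partial>lborel)
         \<le> (\<integral>\<^sup>+y. ennreal (norm (f y - P j y)) * indicator (cube x (\<rho> j)) y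
            + ennreal (B * u) * indicator (cube x (\<rho> j)) y \<partial>lborel)"
      proof (rule nn_integral_mono)
        fix y
        show "ennreal (norm (f y - R y)) * indicator (cube x (\<rho> j)) y
          \<le> ennreal (norm (f y - P j y)) * indicator (cube x (\<rho> j)) y + ennreal (B * u) * indicator (cube x (\<rho> j)) y"
        proof (cases "y \<in> cube x (\<rho> j)")
          case True
          have "norm (f y - R y) \<le> norm (f y - P j y) + norm (R y - P j y)"
            using norm_triangle_ineq4[of "f y - P j y" "R y - P j y"] by simp
          also have "\<dots> \<le> norm (f y - P j y) + B * u"
            using sup[OF j True] by (simp add: u_def mult.assoc)
          finally show ?thesis using True B u
            by (simp add: ennreal_plus[symmetric] ennreal_leI del: ennreal_plus)
        qed auto
      qed
      also have "\<dots> = (\<integral>\<^sup>+y\<in>cube x (\<rho> j). ennreal (norm (f y - P j y)) \<partial>lborel) + ennreal (B * u) * emeasure lborel (cube x (\<rho> j))"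
        by (simp add: nn_integral_add nn_integral_cmult)
      also have "\<dots> \<le> ennreal (2 * \<rho> j ^ n * (N * \<rho> j powr \<sigma>)) + ennreal (B * u) * ennreal (\<rho> j ^ n)"
        using \<rho>[of j] by (intro add_mono L1[OF j] mult_left_mono) (auto simp: n_def emeasure_cube)
      also have "\<dots> = ennreal (2 * \<rho> j ^ n * (N * \<rho> j powr \<sigma>) + B * u * \<rho> j ^ n)"
        using \<rho>[of j] N B u by (simp add: ennreal_mult[symmetric] ennreal_plus[symmetric] del: ennreal_plus)
      also have "\<dots> \<le> ennreal (C * u * \<rho> j ^ n)"
      proof (rule ennreal_leI)
        have "N * \<rho> j powr \<sigma> \<le> u"
          unfolding \<rho>_powr u_def mult.assoc using N \<delta> by (intro mult_left_mono powr_mono) auto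
        moreover have "C * u = 4 * u + 4 * (B * u)" by (simp add: C_def algebra_simps)
        ultimately have "2 * (N * \<rho> j powr \<sigma>) + B * u \<le> C * u"
          using mult_nonneg_nonneg[OF B u] u by linarith
        from mult_right_mono[OF this, of "\<rho> j ^ n"] \<rho>[of j]
        show "2 * \<rho> j ^ n * (N * \<rho> j powr \<sigma>) + B * u * \<rho> j ^ n \<le> C * u * \<rho> j ^ n"
          by (simp add: algebra_simps)
      qed
      finally show ?thesis by (simp add: \<rho>_def u_def n_def mult.assoc)
    qed
    ultimately show "\<exists>R\<in>poly_space d.
         (\<integral>\<^sup>+y\<in>cube x t. ennreal (norm (f y - R y) powr s) \<partial>lborel)
            \<le> ennreal (t ^ CARD('n) * (C * N * t powr \<sigma>) powr s) \<and>
         (\<forall>j\<le>J. (\<integral>\<^sup>+y\<in>cube x (2 ^ j * t). ennreal (norm (f y - R y)) \<partial>lborel)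
            \<le> ennreal (C * N * t powr \<sigma> * 2 powr (real j * (\<sigma> + \<delta>)) * (2 ^ j * t) ^ CARD('n)))"
      using R_poly by blast
  qed
qed

subsection \<open>Local potentials\<close>

lemma poly_space_mono: "P \<in> poly_space d \<Longrightarrow> d \<le> e \<Longrightarrow> P \<in> poly_space e"
  using param_poly_section[OF param_poly_mono[OF param_poly_translate], of P d e 0] by simp

lemma poly_space_list: "(\<lambda>x. of_real (\<Prod>i\<leftarrow>is. (x - a) $ i)) \<in> poly_space (length is)"
  by (rule param_poly_section[OF param_poly_list])

lemma lborel_integral_reflect:
  fixes f :: "real^'n::finite \<Rightarrow> complex"
  assumes "f \<in> borel_measurable borel"
  shows "(LINT y|lborel. f (x - y)) = (LINT y|lborel. f y)"
  using integral_lborel_affine[OF assms, of "-1" x] by simp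

text \<open>What the proof uses of the truncated Riesz kernel. The derivative bounds hold on every
  punctured ball, also across the boundary of the support: smoothness of the cutoff allows Taylor's
  formula along segments that leave the support.\<close>

locale riesz_kernel =
  fixes k :: "real^'n::finite \<Rightarrow> complex" and \<alpha> Ck n :: real
  assumes n_def: "n = real CARD('n)"
    and \<alpha>: "0 < \<alpha>" "\<alpha> < n"
    and k_meas [measurable]: "k \<in> borel_measurable borel"
    and Ck: "0 < Ck" "\<And>y. norm (k y) \<le> Ck * norm y powr (\<alpha> - n)"
    and k_supp: "\<And>y. y \<notin> cube 0 2 \<Longrightarrow> k y = 0"
    and k_est: "\<And>N \<rho>. 0 < \<rho> \<Longrightarrow> symbol_est N (\<alpha> - n) \<rho> k"
begin

lemma norm_le_n_infnorm: "norm (x :: real^'n) \<le> n * infnorm x"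
  unfolding n_def by (rule norm_le_card_infnorm)

text \<open>Taken over \<open>lborel\<close> and applied to Borel functions, for which Tonelli's
  theorem is available. Where the integrand is not integrable the value is 0.\<close>

definition pot :: "(real^'n \<Rightarrow> complex) \<Rightarrow> real^'n \<Rightarrow> complex" where
  "pot f x = (LINT y|lborel. k (x - y) * f y)"

lemma kernel_cube_bound:
  fixes F :: "real^'n \<Rightarrow> ennreal"
  assumes F [measurable]: "F \<in> borel_measurable borel"
    and "0 < \<rho>" "0 \<le> M" "0 < \<delta>" "\<delta> \<le> \<alpha> - n + b"
    and bd: "\<And>t. 0 < t \<Longrightarrow> t \<le> \<rho> \<Longrightarrow> (\<integral>\<^sup>+y\<in>cube x t. F y \<partial>lborel) \<le> ennreal (M * t powr b)"
  shows "(\<integral>\<^sup>+y\<in>cube x \<rho>. ennreal (norm (k (x - y))) * F y \<partial>lborel)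
     \<le> ennreal (Ck * 4 powr n / (1 - 2 powr (- \<delta>)) * M * \<rho> powr (\<alpha> - n + b))"
proof -
  have q: "0 < 1 - 2 powr (- \<delta>)" using assms by (simp add: powr_less_one)
  have "(\<integral>\<^sup>+y\<in>cube x \<rho>. ennreal (norm (k (x - y))) * F y \<partial>lborel)
      \<le> (\<integral>\<^sup>+y. ennreal Ck * (ennreal (norm (x - y) powr (\<alpha> - n)) * F y * indicator (cube x \<rho>) y) \<partial>lborel)"
  proof (rule nn_integral_mono)
    fix y
    have "ennreal (norm (k (x - y))) \<le> ennreal Ck * ennreal (norm (x - y) powr (\<alpha> - n))"
      using Ck by (simp add: ennreal_mult[symmetric] ennreal_leI)
    from mult_right_mono[OF mult_right_mono[OF this], of "F y" "indicator (cube x \<rho>) y"]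
    show "ennreal (norm (k (x - y))) * F y * indicator (cube x \<rho>) y
       \<le> ennreal Ck * (ennreal (norm (x - y) powr (\<alpha> - n)) * F y * indicator (cube x \<rho>) y)"
      by (simp add: mult_ac)
  qed
  also have "\<dots> = ennreal Ck * (\<integral>\<^sup>+y\<in>cube x \<rho>. ennreal (norm (x - y) powr (\<alpha> - n)) * F y \<partial>lborel)"
    by (rule nn_integral_cmult) measurable
  also have "\<dots> \<le> ennreal Ck * ennreal (4 powr (- (\<alpha> - n)) / (1 - 2 powr (- \<delta>)) * M * \<rho> powr (\<alpha> - n + b))"
    using assms \<alpha> by (intro mult_left_mono riesz_integral_cube bd) auto
  also have "\<dots> = ennreal (Ck * (4 powr (- (\<alpha> - n)) / (1 - 2 powr (- \<delta>)) * M * \<rho> powr (\<alpha> - n + b)))"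
    using Ck q assms
    by (intro ennreal_mult[symmetric]) (auto intro!: mult_nonneg_nonneg divide_nonneg_nonneg)
  also have "\<dots> \<le> ennreal (Ck * (4 powr n / (1 - 2 powr (- \<delta>)) * M * \<rho> powr (\<alpha> - n + b)))"
  proof (intro ennreal_leI mult_left_mono mult_right_mono divide_right_mono)
    show "(4::real) powr (- (\<alpha> - n)) \<le> 4 powr n" using \<alpha> by (intro powr_mono) auto
  qed (use q assms Ck in auto)
  finally show ?thesis by (simp add: mult.assoc)
qed

text \<open>The constant of \<open>kernel_cube_bound\<close> for F = 1, where b = n and \<delta> =
  \<alpha>.\<close>

definition "K1 = Ck * 4 powr n / (1 - 2 powr (- \<alpha>))"

lemma K1: "0 < K1"
  using Ck \<alpha> by (auto simp: K1_def powr_less_one intro!: divide_pos_pos mult_pos_pos)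

lemma kernel_L1:
  assumes "0 < \<rho>"
  shows "(\<integral>\<^sup>+y\<in>cube x \<rho>. ennreal (norm (k (x - y))) \<partial>lborel) \<le> ennreal (K1 * \<rho> powr \<alpha>)"
proof -
  have "(\<integral>\<^sup>+y\<in>cube x \<rho>. ennreal (norm (k (x - y))) * 1 \<partial>lborel)
     \<le> ennreal (Ck * 4 powr n / (1 - 2 powr (- \<alpha>)) * 1 * \<rho> powr (\<alpha> - n + n))"
    by (rule kernel_cube_bound[where F="\<lambda>_. 1"])
       (use assms \<alpha> in \<open>auto simp: emeasure_cube powr_realpow n_def\<close>)
  then show ?thesis by (simp add: K1_def)
qed

lemma kernel_L1': 
  assumes "0 < \<rho>"
  shows "(\<integral>\<^sup>+y. ennreal (norm (k y) * indicator (cube 0 \<rho>) y) \<partial>lborel) \<le> ennreal (K1 * \<rho> powr \<alpha>)"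
proof -
  have i: "indicator (cube 0 \<rho>) (0 - y) = (indicator (cube 0 \<rho>) y :: real)" for y :: "real^'n"
    by (simp add: indicator_def mem_cube_iff infnorm_neg)
  have "(\<integral>\<^sup>+y. ennreal (norm (k y) * indicator (cube 0 \<rho>) y) \<partial>lborel)
     = (\<integral>\<^sup>+y. ennreal (norm (k (0 - y)) * indicator (cube 0 \<rho>) (0 - y)) \<partial>lborel)"
    by (rule nn_integral_lborel_reflect[symmetric, of "\<lambda>y. ennreal (norm (k y) * indicator (cube 0 \<rho>) y)"]) measurable
  also have "\<dots> = (\<integral>\<^sup>+y\<in>cube 0 \<rho>. ennreal (norm (k (0 - y))) \<partial>lborel)"
    unfolding i by (intro nn_integral_cong) (auto simp: indicator_def)
  finally show ?thesis using kernel_L1[OF assms, of 0] by simp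
qed

lemma kernel_integrable: "integrable lborel k"
proof (rule integrableI_bounded)
  have "(\<integral>\<^sup>+y. ennreal (norm (k y)) \<partial>lborel) = (\<integral>\<^sup>+y. ennreal (norm (k y) * indicator (cube 0 2) y) \<partial>lborel)"
    using k_supp by (intro nn_integral_cong) (auto simp: indicator_def)
  also have "\<dots> < \<infinity>" using kernel_L1'[of 2] by (simp add: le_less_trans)
  finally show "(\<integral>\<^sup>+y. ennreal (norm (k y)) \<partial>lborel) < \<infinity>" .
qed simp

lemma kernel_mult_integrable:
  assumes h: "continuous_on UNIV (h :: real^'n \<Rightarrow> complex)"
  shows "integrable lborel (\<lambda>y. k y * h y)"
proof -
  have [measurable]: "h \<in> borel_measurable borel" by (rule borel_measurable_continuous_onI[OF h])
  have "bounded (h ` cube 0 2)"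
    by (intro compact_imp_bounded compact_continuous_image compact_cube continuous_on_subset[OF h]) auto
  then obtain B where B: "\<And>y. y \<in> cube 0 2 \<Longrightarrow> norm (h y) \<le> B" by (auto simp: bounded_iff)
  show ?thesis
  proof (rule Bochner_Integration.integrable_bound)
    show "integrable lborel (\<lambda>y. of_real \<bar>B\<bar> * k y)" using kernel_integrable by simp
    show "AE y in lborel. norm (k y * h y) \<le> norm (of_real \<bar>B\<bar> * k y)"
    proof (rule AE_I2)
      fix y
      show "norm (k y * h y) \<le> norm (of_real \<bar>B\<bar> * k y)"
      proof (cases "y \<in> cube 0 2")
        case True
        have "norm (h y) \<le> \<bar>B\<bar>" using B[OF True] by simp
        then show ?thesis by (simp add: norm_mult mult.commute mult_right_mono)
      qed (use k_supp in auto)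
    qed
  qed simp
qed

text \<open>After the substitution that moves the kernel to \<open>k y\<close>, the factor R (x - y)
  is a polynomial in \<open>x\<close> with coefficients continuous in \<open>y\<close>, and the
  compactly supported kernel can be integrated against each of them.\<close>

lemma pot_poly:
  assumes "R \<in> poly_space d"
  shows "integrable lborel (\<lambda>y. k (x - y) * R y)" "pot R \<in> poly_space d"
proof -
  have R: "continuous_on S R" for S by (rule poly_space_continuous[OF assms])
  have [measurable]: "R \<in> borel_measurable borel" by (rule poly_space_borel[OF assms])
  have "continuous_on UNIV (\<lambda>y. R (x - y))"
    by (rule continuous_on_compose2[OF R[of UNIV]]) (auto intro!: continuous_intros)
  then have i: "integrable lborel (\<lambda>y. k y * R (x - y))" by (rule kernel_mult_integrable)
  have "(\<integral>\<^sup>+y. ennreal (norm (k (x - y) * R y)) \<partial>lborel) = (\<integral>\<^sup>+y. ennreal (norm (k y * R (x - y))) \<partial>lborel)"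
    by (subst nn_integral_lborel_reflect[symmetric, where x=x]) auto
  then show "integrable lborel (\<lambda>y. k (x - y) * R y)"
    using i unfolding integrable_iff_bounded by simp
  obtain h where h: "\<And>\<gamma>. continuous_on UNIV (h \<gamma>)"
    "\<And>x y. R (x - y) = (\<Sum>\<gamma>\<in>multi_indices d. h \<gamma> y * of_real (mpow \<gamma> x))"
    using param_poly_translate[OF assms] unfolding param_poly_def by blast
  have "pot R x = (\<Sum>\<gamma>\<in>multi_indices d. (LINT y|lborel. k y * h \<gamma> y) * of_real (mpow \<gamma> x))" for x
  proof -
    have "pot R x = (LINT y|lborel. k y * R (x - y))"
      unfolding pot_def by (subst lborel_integral_reflect[symmetric, where x=x]) auto
    also have "\<dots> = (LINT y|lborel. (\<Sum>\<gamma>\<in>multi_indices d. k y * h \<gamma> y * of_real (mpow \<gamma> x)))"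
      unfolding h(2) by (simp add: sum_distrib_left mult.assoc)
    also have "\<dots> = (\<Sum>\<gamma>\<in>multi_indices d. (LINT y|lborel. k y * h \<gamma> y) * of_real (mpow \<gamma> x))"
      using kernel_mult_integrable[OF h(1)] by (subst Bochner_Integration.integral_sum) auto
    finally show ?thesis .
  qed
  then show "pot R \<in> poly_space d" by (rule poly_spaceI)
qed

text \<open>\<open>T\<close> is the potential of \<open>R\<close> plus the Taylor polynomial at
  \<open>x0\<close> of the potential of f - R beyond the cube of side 4 l. The Taylor remainder
  brings l^(d + 1) times an annulus integral of order M (4 l)^(\<alpha> - d - 1), together M
  l^\<alpha> up to a constant. The near integral is left standing because it is bounded by Young's
  inequality in one application and pointwise in the other.\<close>

lemma pot_local:
  assumes \<delta>: "0 < \<delta>"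
  obtains C :: real where "0 \<le> C"
    "\<And>f R x0 l M \<tau> J. f \<in> borel_measurable borel \<Longrightarrow> R \<in> poly_space d \<Longrightarrow> 0 < l \<Longrightarrow> l \<le> 1 \<Longrightarrow> 0 \<le> M \<Longrightarrow>
       \<alpha> + \<tau> + \<delta> \<le> real (Suc d) \<Longrightarrow> 3 \<le> 2 ^ J * (4 * l) \<Longrightarrow>
       (\<And>j. j \<le> J \<Longrightarrow> (\<integral>\<^sup>+y\<in>cube x0 (2 ^ j * (4 * l)). ennreal (norm (f y - R y)) \<partial>lborel)
          \<le> ennreal (M * 2 powr (real j * \<tau>) * (2 ^ j * (4 * l)) ^ CARD('n))) \<Longrightarrow>
       \<exists>T\<in>poly_space d. \<forall>x\<in>cube x0 l.
         ennreal (norm (pot f x - T x))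
           \<le> (\<integral>\<^sup>+y\<in>cube x0 (4 * l). ennreal (norm (k (x - y))) * ennreal (norm (f y - R y)) \<partial>lborel)
             + ennreal (C * M * l powr \<alpha>)"
proof -
  define a where "a = \<alpha> - n"
  define a' where "a' = a - real (Suc d)"
  \<comment> \<open>Along the segments below the sup norm is at most 3/2 + 1/2, hence the Euclidean
    norm is at most 2 n, inside the ball of radius \<rho>.\<close>
  define \<rho> where "\<rho> = 2 * n + 1"
  have a: "a < 0" "a' < 0" using \<alpha> by (auto simp: a_def a'_def)
  have n1: "1 \<le> n" by (simp add: n_def)
  have \<rho>: "0 < \<rho>" using n1 by (simp add: \<rho>_def)
  have est: "symbol_est (Suc d) a \<rho> k" "a \<le> real (Suc d)"
    using k_est[OF \<rho>] a by (auto simp: a_def simp del: symbol_est.simps)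
  obtain D :: "'n list \<Rightarrow> real^'n \<Rightarrow> complex" and C :: real where C: "0 \<le> C" and
    D_cont: "\<And>is y. length is \<le> d \<Longrightarrow> y \<noteq> 0 \<Longrightarrow> norm y < \<rho> \<Longrightarrow> isCont (D is) y" and
    D_bd: "\<And>is y. length is \<le> d \<Longrightarrow> y \<noteq> 0 \<Longrightarrow> norm y < \<rho> \<Longrightarrow>
       norm (D is y) \<le> C * norm y powr (a - real (length is))" and
    taylor: "\<And>w h c. w \<noteq> 0 \<Longrightarrow> 0 < c \<Longrightarrow>
       (\<forall>\<theta>\<in>{0..1}. c * norm w \<le> norm (w + \<theta> *\<^sub>R h) \<and> norm (w + \<theta> *\<^sub>R h) < \<rho>) \<Longrightarrow>
       norm (k (w + h) - (\<Sum>m<Suc d. \<Sum>is\<in>lists_of_length m. D is w / fact m * of_real (\<Prod>i\<leftarrow>is. h $ i)))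
         \<le> C * norm h ^ Suc d * (c * norm w) powr (a - real (Suc d))"
    by (rule symbol_est_taylor[OF est], rule that)
  \<comment> \<open>For \<open>y\<close> in the far region the sup norm of x0 - y exceeds 2 l, and
    the displacement, at most l / 2, takes away less than a quarter of it. The remaining 3/4 is
    divided by \<open>n\<close> to return to the Euclidean norm.\<close>
  define c where "c = 3 / (4 * n)"
  have c: "0 < c" using n1 by (simp add: c_def)
  define E where "E = C * n ^ Suc d * c powr a'"
  have E: "0 \<le> E" using C n1 by (simp add: E_def)
  define Q where "Q = 4 powr (- a') / (1 - 2 powr (- \<delta>)) * 4 powr (\<alpha> - real (Suc d))"
  have Q: "0 \<le> Q" using \<delta> by (simp add: Q_def powr_less_one less_imp_le)
  show thesis
  proof (rule that[of "E * Q"])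
    show "0 \<le> E * Q" using E Q by simp
    fix f R and x0 :: "real^'n" and l M \<tau> :: real and J :: nat
    assume f [measurable]: "f \<in> borel_measurable borel" and R: "R \<in> poly_space d" and l: "0 < l" "l \<le> 1"
      and M: "0 \<le> M" and \<tau>: "\<alpha> + \<tau> + \<delta> \<le> real (Suc d)" and J: "3 \<le> 2 ^ J * (4 * l)"
      and bd: "\<And>j. j \<le> J \<Longrightarrow> (\<integral>\<^sup>+y\<in>cube x0 (2 ^ j * (4 * l)). ennreal (norm (f y - R y)) \<partial>lborel)
          \<le> ennreal (M * 2 powr (real j * \<tau>) * (2 ^ j * (4 * l)) ^ CARD('n))"
    have [measurable]: "R \<in> borel_measurable borel" by (rule poly_space_borel[OF R])
    define g where "g y = f y - R y" for y
    have g [measurable]: "g \<in> borel_measurable borel" unfolding g_def by measurable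
    \<comment> \<open>For \<open>x\<close> in the cube of side l \<le> 1, k (x - y) vanishes unless
      \<open>y\<close> lies in the cube of side 3, so \<open>A\<close> is all of the far region that
      matters. It is empty as soon as 4 l \<ge> 3.\<close>
    define A where "A = cube x0 3 - cube x0 (4 * l)"
    have A [measurable]: "A \<in> sets borel" by (simp add: A_def)
    have A_sub: "A \<subseteq> cube x0 (2 ^ J * (4 * l)) - cube x0 (4 * l)"
      using cube_mono[OF J, of x0] by (auto simp: A_def)
    have wA: "2 * l < infnorm (x0 - y)" "infnorm (x0 - y) \<le> 3 / 2" if "y \<in> A" for y
      using that by (auto simp: A_def mem_cube_iff infnorm_sub[of x0 y])
    have wA': "x0 - y \<noteq> 0" "norm (x0 - y) < \<rho>" "2 * l < norm (x0 - y)" if y: "y \<in> A" for y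
    proof -
      show "2 * l < norm (x0 - y)" using wA(1)[OF y] infnorm_le_norm[of "x0 - y"] by linarith
      then show "x0 - y \<noteq> 0" using l by auto
      have "norm (x0 - y) \<le> n * infnorm (x0 - y)" by (rule norm_le_n_infnorm)
      also have "\<dots> \<le> n * (3 / 2)" using wA(2)[OF y] n1 by (intro mult_left_mono) auto
      finally show "norm (x0 - y) < \<rho>" using n1 by (simp add: \<rho>_def)
    qed
    have g_fin: "(\<integral>\<^sup>+y\<in>A. ennreal (norm (g y)) \<partial>lborel) < \<infinity>"
    proof -
      have "(\<integral>\<^sup>+y\<in>A. ennreal (norm (g y)) \<partial>lborel) \<le> (\<integral>\<^sup>+y\<in>cube x0 (2 ^ J * (4 * l)). ennreal (norm (g y)) \<partial>lborel)"
        using A_sub by (intro nn_integral_mono) (auto simp: indicator_def)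
      also have "\<dots> < \<infinity>" using bd[of J] by (auto simp: g_def intro: le_less_trans)
      finally show ?thesis .
    qed
    define DA where "DA is y = indicator A y *\<^sub>R (D is (x0 - y) * g y)" for "is" y
    have DA_int: "integrable lborel (DA is)" if len: "length is \<le> d" for "is"
    proof -
      \<comment> \<open>The derivatives are controlled on the punctured ball \<open>U\<close> only.
        Cutting them off there makes them Borel measurable, and x0 - y lies in \<open>U\<close> for
        every \<open>y\<close> in \<open>A\<close>.\<close>
      define U where "U = {w::real^'n. w \<noteq> 0 \<and> norm w < \<rho>}"
      have "open U" unfolding U_def
        by (intro open_Collect_conj open_Collect_neq open_Collect_less continuous_intros)
      then have "(\<lambda>w. indicator U w *\<^sub>R D is w) \<in> borel_measurable borel"
        using D_cont[OF len]
        by (intro borel_measurable_continuous_on_indicator continuous_at_imp_continuous_on) (auto simp: U_def)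
      then have "(\<lambda>y. indicator U (x0 - y) *\<^sub>R D is (x0 - y)) \<in> borel_measurable borel"
        by (rule measurable_compose[rotated]) measurable
      then have "(\<lambda>y. indicator A y *\<^sub>R ((indicator U (x0 - y) *\<^sub>R D is (x0 - y)) * g y)) \<in> borel_measurable borel"
        by measurable
      also have "(\<lambda>y. indicator A y *\<^sub>R ((indicator U (x0 - y) *\<^sub>R D is (x0 - y)) * g y)) = DA is"
        using wA' by (auto simp: fun_eq_iff DA_def indicator_def U_def)
      finally have meas: "DA is \<in> borel_measurable borel" .
      define b where "b = C * (2 * l) powr (a - real (length is))"
      have "(\<integral>\<^sup>+y. ennreal (norm (DA is y)) \<partial>lborel) \<le> (\<integral>\<^sup>+y. ennreal b * (ennreal (norm (g y)) * indicator A y) \<partial>lborel)"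
      proof (rule nn_integral_mono)
        fix y
        show "ennreal (norm (DA is y)) \<le> ennreal b * (ennreal (norm (g y)) * indicator A y)"
        proof (cases "y \<in> A")
          case True
          have "norm (D is (x0 - y)) \<le> C * norm (x0 - y) powr (a - real (length is))"
            using D_bd[OF len wA'(1,2)[OF True]] .
          also have "\<dots> \<le> b" unfolding b_def
            using wA'(3)[OF True] l a C by (intro mult_left_mono powr_mono2') auto
          finally have "norm (D is (x0 - y)) * norm (g y) \<le> b * norm (g y)" by (rule mult_right_mono) simp
          then show ?thesis using True C
            by (simp add: DA_def norm_mult ennreal_mult[symmetric] ennreal_leI b_def)
        qed (simp add: DA_def)
      qed
      also have "\<dots> = ennreal b * (\<integral>\<^sup>+y\<in>A. ennreal (norm (g y)) \<partial>lborel)"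
        by (rule nn_integral_cmult) measurable
      also have "\<dots> < \<infinity>" using g_fin by (simp add: ennreal_mult_less_top)
      finally show ?thesis using meas by (intro integrableI_bounded) auto
    qed
    define hp where "hp x is = complex_of_real (\<Prod>i\<leftarrow>is. (x - x0) $ i)" for x "is"
    have hp_poly: "(\<lambda>x. hp x is) \<in> poly_space (length is)" for "is"
      unfolding hp_def by (rule poly_space_list)
    \<comment> \<open>The integral over \<open>A\<close> of the Taylor polynomial of the kernel at
      x0 - y against g = f - R. As \<open>x\<close> enters only through powers of x - x0, the
      integration acts on the coefficients.\<close>
    define T1 where "T1 x = (\<Sum>m<Suc d. \<Sum>is\<in>lists_of_length m.
        ((LINT y|lborel. DA is y) / fact m) * hp x is)" for x
    have T1: "T1 \<in> poly_space d"
      unfolding T1_def[abs_def]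
      by (intro poly_space_sum poly_space_cmult poly_space_mono[OF hp_poly])
         (auto simp: lists_of_length_def finite_lists_of_length[unfolded lists_of_length_def])
    define tay where "tay x y = (\<Sum>m<Suc d. \<Sum>is\<in>lists_of_length m.
        D is (x0 - y) / fact m * hp x is)" for x y
    have T1_eq: "T1 x = (LINT y|lborel. indicator A y *\<^sub>R (tay x y * g y))"
      and tay_int: "integrable lborel (\<lambda>y. indicator A y *\<^sub>R (tay x y * g y))" for x
    proof -
      have eq: "indicator A y *\<^sub>R (tay x y * g y)
         = (\<Sum>m<Suc d. \<Sum>is\<in>lists_of_length m. DA is y * (hp x is / fact m))" for y
        unfolding tay_def sum_distrib_right scaleR_sum_right by (intro sum.cong refl) (simp add: DA_def scaleR_conv_of_real mult_ac)
      have i: "integrable lborel (\<lambda>y. DA is y * (hp x is / fact m))"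
        if "m < Suc d" "is \<in> lists_of_length m" for m "is"
        using that by (intro integrable_mult_left DA_int) (simp add: lists_of_length_def)
      show "integrable lborel (\<lambda>y. indicator A y *\<^sub>R (tay x y * g y))"
        unfolding eq using i by (intro Bochner_Integration.integrable_sum) auto
      have "(LINT y|lborel. indicator A y *\<^sub>R (tay x y * g y))
         = (\<Sum>m<Suc d. LINT y|lborel. (\<Sum>is\<in>lists_of_length m. DA is y * (hp x is / fact m)))"
        unfolding eq using i by (intro Bochner_Integration.integral_sum Bochner_Integration.integrable_sum) auto
      also have "\<dots> = T1 x" unfolding T1_def
      proof (intro sum.cong refl)
        fix m assume m: "m \<in> {..<Suc d}"
        have "(LINT y|lborel. (\<Sum>is\<in>lists_of_length m. DA is y * (hp x is / fact m)))
           = (\<Sum>is\<in>lists_of_length m. LINT y|lborel. DA is y * (hp x is / fact m))"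
          using i m by (intro Bochner_Integration.integral_sum) auto
        then show "(LINT y|lborel. (\<Sum>is\<in>lists_of_length m. DA is y * (hp x is / fact m)))
           = (\<Sum>is\<in>lists_of_length m. ((LINT y|lborel. DA is y) / fact m) * hp x is)"
          by simp
      qed
      finally show "T1 x = (LINT y|lborel. indicator A y *\<^sub>R (tay x y * g y))" by simp
    qed
    have main: "ennreal (norm (pot f x - (pot R x + T1 x)))
           \<le> (\<integral>\<^sup>+y\<in>cube x0 (4 * l). ennreal (norm (k (x - y))) * ennreal (norm (g y)) \<partial>lborel)
             + ennreal (E * Q * M * l powr \<alpha>)" (is "_ \<le> ?near + _") if x: "x \<in> cube x0 l" for x
    \<comment> \<open>An infinite near integral makes the claim trivial. If it is finite,
      \<open>k (x - y) * g y\<close> is integrable in \<open>y\<close>, and only then does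
      \<open>pot f x\<close> split into \<open>pot R x\<close> and the potential of
      \<open>g\<close>.\<close>
    proof (cases "?near = \<infinity>")
      case True
      then show ?thesis by simp
    next
      case False
      have xl: "infnorm (x - x0) \<le> l / 2" using x by (simp add: mem_cube_iff)
      have out: "k (x - y) = 0" if "y \<notin> cube x0 3" for y
      proof (rule k_supp)
        have "infnorm (y - x0) \<le> infnorm (y - x) + infnorm (x - x0)"
          using infnorm_triangle[of "y - x" "x - x0"] by simp
        then show "x - y \<notin> cube 0 2"
          using that xl l infnorm_sub[of x y] by (simp add: mem_cube_iff)
      qed
      have kA: "norm (k (x - y)) \<le> Ck * l powr a" if y: "y \<in> A" for y
      proof -
        have "infnorm (x0 - y) \<le> infnorm (x0 - x) + infnorm (x - y)"
          using infnorm_triangle[of "x0 - x" "x - y"] by simp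
        then have "l \<le> norm (x - y)"
          using wA(1)[OF y] xl infnorm_sub[of x x0] infnorm_le_norm[of "x - y"] l by linarith
        then have "norm (x - y) powr a \<le> l powr a" using a l by (intro powr_mono2') auto
        then have "Ck * norm (x - y) powr a \<le> Ck * l powr a" using Ck(1) by simp
        then show ?thesis using Ck(2)[of "x - y"] unfolding a_def by (rule order_trans[rotated])
      qed
      have "integrable lborel (\<lambda>y. k (x - y) * g y)"
      proof (rule integrableI_bounded)
        have "(\<integral>\<^sup>+y. ennreal (norm (k (x - y) * g y)) \<partial>lborel)
          \<le> (\<integral>\<^sup>+y. ennreal (norm (k (x - y))) * ennreal (norm (g y)) * indicator (cube x0 (4 * l)) y
               + ennreal (Ck * l powr a) * (ennreal (norm (g y)) * indicator A y) \<partial>lborel)"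
        proof (rule nn_integral_mono)
          fix y
          show "ennreal (norm (k (x - y) * g y)) \<le> ennreal (norm (k (x - y))) * ennreal (norm (g y)) * indicator (cube x0 (4 * l)) y
               + ennreal (Ck * l powr a) * (ennreal (norm (g y)) * indicator A y)"
          proof (cases "y \<in> cube x0 (4 * l)")
            case True
            then show ?thesis by (simp add: norm_mult ennreal_mult)
          next
            case nin: False
            show ?thesis
            proof (cases "y \<in> A")
              case True
              have "norm (k (x - y)) * norm (g y) \<le> Ck * l powr a * norm (g y)"
                by (intro mult_right_mono kA[OF True]) simp
              then show ?thesis using True Ck nin by (simp add: norm_mult ennreal_mult[symmetric] ennreal_leI)
            next
              case False
              then show ?thesis using nin out[of y] by (auto simp: A_def)
            qed
          qed
        qed
        also have "\<dots> = ?near + ennreal (Ck * l powr a) * (\<integral>\<^sup>+y\<in>A. ennreal (norm (g y)) \<partial>lborel)"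
          by (simp add: nn_integral_add nn_integral_cmult)
        also have "\<dots> < \<infinity>"
          using False g_fin by (simp add: ennreal_mult_less_top less_top)
        finally show "(\<integral>\<^sup>+y. ennreal (norm (k (x - y) * g y)) \<partial>lborel) < \<infinity>" .
      qed simp
      note kg = this
      have "pot f x - (pot R x + T1 x) = (LINT y|lborel. k (x - y) * g y - indicator A y *\<^sub>R (tay x y * g y))"
      proof -
        have "pot f x = (LINT y|lborel. k (x - y) * R y + k (x - y) * g y)"
          unfolding pot_def by (intro Bochner_Integration.integral_cong refl) (simp add: g_def algebra_simps)
        also have "\<dots> = pot R x + (LINT y|lborel. k (x - y) * g y)"
          unfolding pot_def by (intro Bochner_Integration.integral_add kg pot_poly(1)[OF R])
        finally show ?thesis unfolding T1_eq by (simp add: Bochner_Integration.integral_diff[OF kg tay_int])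
      qed
      then have "ennreal (norm (pot f x - (pot R x + T1 x)))
        \<le> (\<integral>\<^sup>+y. ennreal (norm (k (x - y) * g y - indicator A y *\<^sub>R (tay x y * g y))) \<partial>lborel)"
        using integral_norm_bound_ennreal[OF Bochner_Integration.integrable_diff[OF kg tay_int[of x]]] by simp
      also have "\<dots> \<le> (\<integral>\<^sup>+y. ennreal (norm (k (x - y))) * ennreal (norm (g y)) * indicator (cube x0 (4 * l)) y
            + ennreal (E * l ^ Suc d) * (ennreal (norm (x0 - y) powr a') * ennreal (norm (g y))
                * indicator (cube x0 (2 ^ J * (4 * l)) - cube x0 (4 * l)) y) \<partial>lborel)"
      proof (rule nn_integral_mono)
        fix y
        let ?L = "ennreal (norm (k (x - y) * g y - indicator A y *\<^sub>R (tay x y * g y)))"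
        show "?L \<le> ennreal (norm (k (x - y))) * ennreal (norm (g y)) * indicator (cube x0 (4 * l)) y
            + ennreal (E * l ^ Suc d) * (ennreal (norm (x0 - y) powr a') * ennreal (norm (g y))
                * indicator (cube x0 (2 ^ J * (4 * l)) - cube x0 (4 * l)) y)"
        proof (cases "y \<in> A")
          case True
          define w where "w = x0 - y"
          define h where "h = x - x0"
          have hn: "norm h \<le> n * (l / 2)"
          proof -
            have "n * infnorm h \<le> n * (l / 2)" using xl n1 by (intro mult_left_mono) (auto simp: h_def)
            then show ?thesis using norm_le_n_infnorm[of h] by linarith
          qed
          have seg: "c * norm w \<le> norm (w + \<theta> *\<^sub>R h) \<and> norm (w + \<theta> *\<^sub>R h) < \<rho>"
            if \<theta>: "0 \<le> \<theta>" "\<theta> \<le> 1" for \<theta>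
          proof -
            have th: "infnorm (\<theta> *\<^sub>R h) \<le> l / 2"
            proof -
              have "infnorm (\<theta> *\<^sub>R h) = \<theta> * infnorm h" using \<theta> by (simp add: infnorm_mul)
              also have "\<dots> \<le> 1 * (l / 2)" using \<theta> xl by (intro mult_mono infnorm_pos_le) (auto simp: h_def)
              finally show ?thesis by simp
            qed
            have "infnorm w \<le> infnorm (w + \<theta> *\<^sub>R h) + infnorm (\<theta> *\<^sub>R h)"
              using infnorm_triangle[of "w + \<theta> *\<^sub>R h" "- (\<theta> *\<^sub>R h)"] by (simp add: infnorm_neg)
            then have "3 / 4 * infnorm w \<le> infnorm (w + \<theta> *\<^sub>R h)"
              using th wA(1)[OF True] by (simp add: w_def)
            then have "3 / 4 * infnorm w \<le> norm (w + \<theta> *\<^sub>R h)"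
              using infnorm_le_norm[of "w + \<theta> *\<^sub>R h"] by linarith
            moreover have "c * norm w \<le> c * (n * infnorm w)"
              using c by (intro mult_left_mono norm_le_n_infnorm) auto
            moreover have "c * (n * infnorm w) = 3 / 4 * infnorm w" using n1 by (simp add: c_def)
            ultimately have 1: "c * norm w \<le> norm (w + \<theta> *\<^sub>R h)" by linarith
            have "infnorm (w + \<theta> *\<^sub>R h) \<le> 2"
              using infnorm_triangle[of w "\<theta> *\<^sub>R h"] th wA(2)[OF True] l by (simp add: w_def)
            then have "n * infnorm (w + \<theta> *\<^sub>R h) \<le> n * 2" using n1 by (intro mult_left_mono) auto
            then have "norm (w + \<theta> *\<^sub>R h) < \<rho>"
              using norm_le_n_infnorm[of "w + \<theta> *\<^sub>R h"] by (simp add: \<rho>_def)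
            with 1 show ?thesis by simp
          qed
          have "norm (k (w + h) - tay x y) \<le> C * norm h ^ Suc d * (c * norm w) powr a'"
            unfolding tay_def hp_def a'_def h_def[symmetric] w_def[symmetric]
            using seg wA'(1)[OF True] by (intro taylor c) (auto simp: w_def)
          also have "\<dots> \<le> C * (n * l) ^ Suc d * (c * norm w) powr a'"
          proof (intro mult_right_mono mult_left_mono power_mono)
            have "n * (l / 2) \<le> n * l" using l n1 by (intro mult_left_mono) auto
            with hn show "norm h \<le> n * l" by linarith
          qed (use C in auto)
          also have "\<dots> = E * l ^ Suc d * norm w powr a'"
            using c by (simp add: E_def powr_mult power_mult_distrib mult_ac)
          finally have tb: "norm (k (x - y) - tay x y) \<le> E * l ^ Suc d * norm (x0 - y) powr a'"
            by (simp add: w_def h_def)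
          have "k (x - y) * g y - indicator A y *\<^sub>R (tay x y * g y) = (k (x - y) - tay x y) * g y"
            using True by (simp add: left_diff_distrib)
          then have "?L \<le> ennreal (E * l ^ Suc d * norm (x0 - y) powr a' * norm (g y))"
            using mult_right_mono[OF tb, of "norm (g y)"] by (simp only: norm_mult) (intro ennreal_leI, simp)
          also have "\<dots> = ennreal (E * l ^ Suc d) * (ennreal (norm (x0 - y) powr a') * ennreal (norm (g y))
                * indicator (cube x0 (2 ^ J * (4 * l)) - cube x0 (4 * l)) y)"
            using True A_sub E l by (auto simp: ennreal_mult[symmetric] mult_ac indicator_def)
          finally show ?thesis by (rule order_trans) simp
        next
          case False
          then have "y \<in> cube x0 (4 * l) \<or> k (x - y) = 0" using out[of y] by (auto simp: A_def)
          then show ?thesis using False by (auto simp: norm_mult ennreal_mult)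
        qed
      qed
      also have "\<dots> = ?near + ennreal (E * l ^ Suc d) *
          (\<integral>\<^sup>+y\<in>cube x0 (2 ^ J * (4 * l)) - cube x0 (4 * l). ennreal (norm (x0 - y) powr a') * ennreal (norm (g y)) \<partial>lborel)"
        by (simp add: nn_integral_add nn_integral_cmult)
      also have "\<dots> \<le> ?near + ennreal (E * l ^ Suc d) *
          ennreal (4 powr (- a') / (1 - 2 powr (- \<delta>)) * M * (4 * l) powr (a' + n))"
        unfolding n_def
      proof (intro add_left_mono mult_left_mono riesz_integral_annulus)
        show "a' + real CARD('n) + \<tau> \<le> - \<delta>" using \<tau> by (simp add: a'_def a_def n_def)
      qed (use a l M \<delta> bd in \<open>auto simp: g_def\<close>)
      also have "ennreal (E * l ^ Suc d) * ennreal (4 powr (- a') / (1 - 2 powr (- \<delta>)) * M * (4 * l) powr (a' + n))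
          = ennreal (E * Q * M * l powr \<alpha>)"
      proof -
        have e: "a' + n = \<alpha> - real (Suc d)" by (simp add: a'_def a_def)
        have "(4 * l) powr (a' + n) * l ^ Suc d = 4 powr (\<alpha> - real (Suc d)) * (l powr (\<alpha> - real (Suc d)) * l powr real (Suc d))"
          unfolding e using l by (simp add: powr_mult powr_realpow del: power_Suc of_nat_Suc)
        also have "l powr (\<alpha> - real (Suc d)) * l powr real (Suc d) = l powr \<alpha>"
          by (simp add: powr_add[symmetric] del: of_nat_Suc)
        finally have "E * l ^ Suc d * (4 powr (- a') / (1 - 2 powr (- \<delta>)) * M * (4 * l) powr (a' + n)) = E * Q * M * l powr \<alpha>"
          by (simp only: Q_def) (simp add: mult_ac)
        moreover have "0 < 1 - 2 powr (- \<delta>)" using \<delta> by (simp add: powr_less_one)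
        ultimately show ?thesis using E l M by (subst ennreal_mult[symmetric]) auto
      qed
      finally show ?thesis .
    qed
    show "\<exists>T\<in>poly_space d. \<forall>x\<in>cube x0 l.
         ennreal (norm (pot f x - T x))
           \<le> (\<integral>\<^sup>+y\<in>cube x0 (4 * l). ennreal (norm (k (x - y))) * ennreal (norm (f y - R y)) \<partial>lborel)
             + ennreal (E * Q * M * l powr \<alpha>)"
      using main poly_space_add[OF pot_poly(2)[OF R] T1] unfolding g_def
      by (intro bexI[of _ "\<lambda>x. pot R x + T1 x"]) auto
  qed
qed

end

subsection \<open>Norms of indicator functions\<close>

lemma nn_integral_indicator_powr:
  "(\<integral>\<^sup>+x. ennreal ((norm (indicat_real Q x) / t) powr e x) \<partial>lebesgue)
     = (\<integral>\<^sup>+x\<in>Q. ennreal ((1 / t) powr e x) \<partial>lebesgue)"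
  by (intro nn_integral_cong) (auto simp: indicator_def)

text \<open>As e \<ge> 1 / vb, enlarging the scale \<open>w\<close> by the factor E^vb divides the
  modular at least by \<open>E\<close>, which brings it down to 1.\<close>

lemma Lvar_norm_indicator_le:
  fixes e :: "real^'n::finite \<Rightarrow> real"
  assumes [measurable]: "e \<in> borel_measurable lebesgue" "Q \<in> sets lebesgue"
    and vb: "0 < vb" "\<And>x. 1 \<le> vb * e x" and w: "0 < w" and E: "1 \<le> E"
    and I: "(\<integral>\<^sup>+x\<in>Q. ennreal ((1 / w) powr e x) \<partial>lebesgue) \<le> ennreal E"
  shows "Lvar_norm e (indicat_real Q) \<le> ennreal (E powr vb * w)"
proof -
  define t where "t = E powr vb * w"
  have t: "0 < t" using w E by (simp add: t_def)
  have "(\<integral>\<^sup>+x\<in>Q. ennreal ((1 / t) powr e x) \<partial>lebesgue)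
      \<le> (\<integral>\<^sup>+x. ennreal (1 / E) * (ennreal ((1 / w) powr e x) * indicator Q x) \<partial>lebesgue)"
  proof (rule nn_integral_mono)
    fix x
    have "(1 / t) powr e x = E powr (- (vb * e x)) * (1 / w) powr e x"
    proof -
      have "1 / t = E powr (- vb) * (1 / w)" by (simp add: t_def powr_minus_divide)
      then show ?thesis using w by (simp only: powr_mult) (simp add: powr_powr)
    qed
    also have "\<dots> \<le> E powr (- 1) * (1 / w) powr e x"
      using vb(2)[of x] E by (intro mult_right_mono powr_mono) auto
    also have "\<dots> = 1 / E * (1 / w) powr e x" using E by (simp add: powr_minus divide_inverse)
    finally have "ennreal ((1 / t) powr e x) \<le> ennreal (1 / E) * ennreal ((1 / w) powr e x)"
      using E by (simp add: ennreal_mult[symmetric] ennreal_leI del: times_divide_eq_left)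
    from mult_right_mono[OF this, of "indicator Q x"]
    show "ennreal ((1 / t) powr e x) * indicator Q x \<le> ennreal (1 / E) * (ennreal ((1 / w) powr e x) * indicator Q x)"
      by (simp add: mult.assoc)
  qed
  also have "\<dots> = ennreal (1 / E) * (\<integral>\<^sup>+x\<in>Q. ennreal ((1 / w) powr e x) \<partial>lebesgue)"
    by (rule nn_integral_cmult) measurable
  also have "\<dots> \<le> ennreal (1 / E) * ennreal E" by (intro mult_left_mono I) auto
  also have "\<dots> = 1" using E by (simp add: ennreal_mult[symmetric])
  finally have "t \<in> {t. 0 < t \<and> (\<integral>\<^sup>+x. ennreal ((norm (indicat_real Q x) / t) powr e x) \<partial>lebesgue) \<le> 1}"
    unfolding nn_integral_indicator_powr using t by simp
  then show ?thesis unfolding Lvar_norm_def t_def[symmetric] by (intro Inf_lower imageI)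
qed

text \<open>Any scale smaller than w / (2 E)^vb would raise the modular at least by 2 E, that is to
  2 or more. The extra 2 makes the contradiction with the admissible value 1 strict.\<close>

lemma Lvar_norm_indicator_ge:
  fixes e :: "real^'n::finite \<Rightarrow> real"
  assumes [measurable]: "e \<in> borel_measurable lebesgue" "Q \<in> sets lebesgue"
    and vb: "0 < vb" "\<And>x. 1 \<le> vb * e x" and w: "0 < w" and E: "1 \<le> E"
    and I: "ennreal (1 / E) \<le> (\<integral>\<^sup>+x\<in>Q. ennreal ((1 / w) powr e x) \<partial>lebesgue)"
  shows "ennreal (w / (2 * E) powr vb) \<le> Lvar_norm e (indicat_real Q)"
  unfolding Lvar_norm_def
proof (rule Inf_greatest)
  fix z assume "z \<in> ennreal ` {t. 0 < t \<and> (\<integral>\<^sup>+x. ennreal ((norm (indicat_real Q x) / t) powr e x) \<partial>lebesgue) \<le> 1}"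
  then obtain t where z: "z = ennreal t" and t: "0 < t" and le1: "(\<integral>\<^sup>+x\<in>Q. ennreal ((1 / t) powr e x) \<partial>lebesgue) \<le> 1"
    unfolding nn_integral_indicator_powr by auto
  have "w / (2 * E) powr vb \<le> t"
  proof (rule ccontr)
    assume "\<not> w / (2 * E) powr vb \<le> t"
    then have tw: "t * (2 * E) powr vb < w" using E by (simp add: field_simps)
    have "(2::ennreal) = ennreal (2 * E) * ennreal (1 / E)"
      using E by (simp add: ennreal_mult[symmetric])
    also have "\<dots> \<le> ennreal (2 * E) * (\<integral>\<^sup>+x\<in>Q. ennreal ((1 / w) powr e x) \<partial>lebesgue)"
      by (intro mult_left_mono I) auto
    also have "\<dots> = (\<integral>\<^sup>+x. ennreal (2 * E) * (ennreal ((1 / w) powr e x) * indicator Q x) \<partial>lebesgue)"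
      by (rule nn_integral_cmult[symmetric]) measurable
    also have "\<dots> \<le> (\<integral>\<^sup>+x\<in>Q. ennreal ((1 / t) powr e x) \<partial>lebesgue)"
    proof (rule nn_integral_mono)
      fix x
      have "0 < vb * e x" using vb(2)[of x] by linarith
      then have e0: "0 \<le> e x" using vb(1) by (simp add: zero_less_mult_iff)
      have "2 * E * (1 / w) powr e x = (2 * E) powr 1 * (1 / w) powr e x" using E by simp
      also have "\<dots> \<le> (2 * E) powr (vb * e x) * (1 / w) powr e x"
        using vb(2)[of x] E by (intro mult_right_mono powr_mono) auto
      also have "\<dots> = ((2 * E) powr vb * (1 / w)) powr e x"
        using w by (simp add: powr_powr powr_mult powr_divide)
      also have "\<dots> \<le> (1 / t) powr e x"
      proof (rule powr_mono2[OF e0])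
        show "(2 * E) powr vb * (1 / w) \<le> 1 / t" using tw t w by (simp add: field_simps)
      qed (use w in simp)
      finally have "ennreal (2 * E) * ennreal ((1 / w) powr e x) \<le> ennreal ((1 / t) powr e x)"
        using E by (simp add: ennreal_mult[symmetric] ennreal_leI)
      from mult_right_mono[OF this, of "indicator Q x"]
      show "ennreal (2 * E) * (ennreal ((1 / w) powr e x) * indicator Q x) \<le> ennreal ((1 / t) powr e x) * indicator Q x"
        by (simp add: mult.assoc)
    qed
    also have "\<dots> \<le> 1" by (rule le1)
    finally show False by simp
  qed
  then show "ennreal (w / (2 * E) powr vb) \<le> z" unfolding z by (rule ennreal_leI)
qed

text \<open>The two conditions in \<open>LH\<close> with the constant made explicit, for functions
  that need not be exponents themselves. They are applied to the reciprocals 1 / p and 1 / q, which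
  differ by a constant.\<close>

definition log_holder :: "real \<Rightarrow> (real^'n::finite \<Rightarrow> real) \<Rightarrow> bool" where
  "log_holder K v \<longleftrightarrow> 0 \<le> K \<and>
     (\<forall>x y. 0 < norm (x - y) \<and> norm (x - y) \<le> 1 / 2 \<longrightarrow> \<bar>v x - v y\<bar> \<le> K / (- ln (norm (x - y)))) \<and>
     (\<forall>x y. norm x \<le> norm y \<longrightarrow> \<bar>v x - v y\<bar> \<le> K / ln (norm x + exp 1))"

text \<open>For small \<open>t\<close>, the logarithm of |x - y| is comparable with that of
  \<open>t\<close>, so local log-Holder continuity bounds the product. For \<open>t\<close> between
  a fixed \<open>t0\<close> and \<open>S\<close> the logarithm of \<open>t\<close> is bounded, and
  so is the oscillation of \<open>v\<close>.\<close>

lemma log_holder_small: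
  fixes v :: "real^'n::finite \<Rightarrow> real"
  assumes v: "log_holder K v" and ab: "\<And>x. va \<le> v x" "\<And>x. v x \<le> vb"
  obtains L where "0 \<le> L"
    "\<And>x y t. 0 < t \<Longrightarrow> t \<le> S \<Longrightarrow> norm (x - y) \<le> real CARD('n) * t \<Longrightarrow> \<bar>(v y - v x) * ln t\<bar> \<le> L"
proof -
  define n where "n = real CARD('n)"
  have n: "1 \<le> n" by (simp add: n_def)
  \<comment> \<open>For t \<le> t0 this gives n t \<le> 1/4, within the range of the local
    condition, and (n t)^2 \<le> t, so that ln (n t) is at most half of ln t.\<close>
  define t0 where "t0 = 1 / (4 * n\<^sup>2)"
  have t0: "0 < t0" using n by (simp add: t0_def)
  have W: "\<bar>v y - v x\<bar> \<le> vb - va" for x y using ab(1)[of x] ab(1)[of y] ab(2)[of x] ab(2)[of y] by linarith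
  have K: "0 \<le> K" using v by (simp add: log_holder_def)
  define L where "L = 2 * K + (vb - va) * (\<bar>ln t0\<bar> + \<bar>ln S\<bar>)"
  have W0: "0 \<le> vb - va" using W[of 0 0] by simp
  show thesis
  proof (rule that[of L])
    show "0 \<le> L" using K W0 by (simp add: L_def)
    fix x y :: "real^'n" and t :: real
    assume t: "0 < t" "t \<le> S" and xy: "norm (x - y) \<le> real CARD('n) * t"
    have "\<bar>(v y - v x) * ln t\<bar> \<le> 2 * K \<or> \<bar>ln t\<bar> \<le> \<bar>ln t0\<bar> + \<bar>ln S\<bar>"
    proof (cases "t \<le> t0")
      case False
      then have "ln t0 \<le> ln t" "ln t \<le> ln S" using t t0 by auto
      then show ?thesis by linarith
    next
      case True
      show ?thesis
      proof (cases "x = y")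
        case False
        then have pos: "0 < norm (x - y)" by simp
        have "n * t \<le> n * t0" using True n by (intro mult_left_mono) auto
        also have "n * t0 = 1 / (4 * n)" using n by (simp add: t0_def power2_eq_square)
        also have "\<dots> \<le> 1 / 4" using n by (simp add: field_simps)
        finally have nt: "n * t \<le> 1 / 4" .
        have le: "norm (x - y) \<le> 1 / 2" using xy nt by (simp add: n_def)
        have "(n * t)\<^sup>2 \<le> t"
        proof -
          have "(n * t)\<^sup>2 = t * (n\<^sup>2 * t)" by (simp add: power2_eq_square)
          also have "n\<^sup>2 * t \<le> n\<^sup>2 * t0" using True by (intro mult_left_mono) auto
          also have "n\<^sup>2 * t0 \<le> 1" using n by (simp add: t0_def)
          finally show ?thesis using t by simp
        qed
        then have "ln ((n * t)\<^sup>2) \<le> ln t" using t n by (subst ln_le_cancel_iff) auto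
        then have "2 * ln (n * t) \<le> ln t" using t n by (simp add: ln_realpow)
        moreover have "ln (norm (x - y)) \<le> ln (n * t)"
          using xy pos t n by (subst ln_le_cancel_iff) (auto simp: n_def)
        ultimately have lnn: "- ln t / 2 \<le> - ln (norm (x - y))" by linarith
        have "t \<le> 1 * t0" using True by simp
        also have "\<dots> < 1" using one_le_power[OF n, of 2] by (simp add: t0_def divide_less_eq)
        finally have lt: "0 < - ln t" using t by simp
        have "\<bar>v x - v y\<bar> \<le> K / (- ln (norm (x - y)))" using v pos le by (simp add: log_holder_def)
        also have "\<dots> \<le> K / (- ln t / 2)" using K lt lnn by (intro divide_left_mono mult_pos_pos) auto
        finally have "\<bar>v x - v y\<bar> * (- ln t) \<le> 2 * K" using lt by (simp add: field_simps)
        then show ?thesis using lt by (simp add: abs_mult abs_minus_commute)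
      qed (use K in simp)
    qed
    then show "\<bar>(v y - v x) * ln t\<bar> \<le> L"
    proof
      assume "\<bar>(v y - v x) * ln t\<bar> \<le> 2 * K"
      moreover have "0 \<le> (vb - va) * (\<bar>ln t0\<bar> + \<bar>ln S\<bar>)" using W0 by simp
      ultimately show ?thesis by (simp add: L_def)
    next
      assume "\<bar>ln t\<bar> \<le> \<bar>ln t0\<bar> + \<bar>ln S\<bar>"
      then have "\<bar>v y - v x\<bar> * \<bar>ln t\<bar> \<le> (vb - va) * (\<bar>ln t0\<bar> + \<bar>ln S\<bar>)"
        using W W0 by (intro mult_mono) auto
      then show ?thesis using K by (simp add: L_def abs_mult)
    qed
  qed
qed

lemma powr_le_exp:
  assumes "0 < t" "\<bar>b * ln t\<bar> \<le> (L::real)"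
  shows "t powr b \<le> exp L" "exp (- L) \<le> t powr b"
  using assms by (auto simp: powr_def abs_le_iff)

text \<open>With \<open>w = t powr (n * v x)\<close> and \<open>e = 1 / v\<close>, the integrand \<open>(1 / w) powr e y\<close> equals
  \<open>t powr (- n)\<close> up to a factor that the log-Holder condition bounds.\<close>

lemma indicator_integrand:
  fixes v :: "'a \<Rightarrow> real"
  assumes "0 < t" "0 < v y"
  shows "(1 / t powr (n * v x)) powr (1 / v y) = t powr (- n) * t powr (n / v y * (v y - v x))"
proof -
  have "(1 / t powr (n * v x)) powr (1 / v y) = t powr (- (n * v x) * (1 / v y))"
    unfolding powr_powr[symmetric] powr_minus_divide ..
  also have "- (n * v x) * (1 / v y) = - n + n / v y * (v y - v x)"
    using assms by (simp add: field_simps)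
  finally show ?thesis by (simp only: powr_add)
qed

text \<open>At the scale t^(n v(x)) the integrand of the modular is t^(-n) up to a bounded factor,
  and the cube has volume t^n, so the modular is comparable to 1. Sides up to any fixed
  \<open>S\<close> count as small. The bound on the modular itself is kept as a conclusion because
  (b) uses it directly.\<close>

lemma Lvar_norm_small_cube:
  fixes v e :: "real^'n::finite \<Rightarrow> real"
  assumes v: "log_holder K v" and va: "0 < va" and ab: "\<And>x. va \<le> v x" "\<And>x. v x \<le> vb"
    and e: "\<And>x. e x = 1 / v x" and [measurable]: "e \<in> borel_measurable lebesgue"
  obtains A where "1 \<le> A"
    "\<And>x t. 0 < t \<Longrightarrow> t \<le> S \<Longrightarrow> (\<integral>\<^sup>+y\<in>cube x t. ennreal ((1 / t powr (real CARD('n) * v x)) powr e y) \<partial>lebesgue) \<le> ennreal A"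
    "\<And>x t. 0 < t \<Longrightarrow> t \<le> S \<Longrightarrow> Lvar_norm e (indicat_real (cube x t)) \<le> ennreal (A * t powr (real CARD('n) * v x))"
    "\<And>x t. 0 < t \<Longrightarrow> t \<le> S \<Longrightarrow> ennreal (t powr (real CARD('n) * v x) / A) \<le> Lvar_norm e (indicat_real (cube x t))"
proof -
  define n where "n = real CARD('n)"
  have n: "1 \<le> n" by (simp add: n_def)
  have v0: "0 < v x" for x using va ab(1)[of x] by linarith
  have vb: "0 < vb" using v0[of 0] ab(2)[of 0] by linarith
  have vbe: "1 \<le> vb * e x" for x using ab(2)[of x] v0[of x] by (simp add: e)
  obtain L where L: "0 \<le> L"
    "\<And>x y t. 0 < t \<Longrightarrow> t \<le> S \<Longrightarrow> norm (x - y) \<le> real CARD('n) * t \<Longrightarrow> \<bar>(v y - v x) * ln t\<bar> \<le> L"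
    by (rule log_holder_small[OF v ab, where S=S], rule that)
  define E where "E = exp (n / va * L)"
  have E: "1 \<le> E" using n va L by (simp add: E_def)
  have pw: "t powr (- n) / E \<le> (1 / t powr (n * v x)) powr e y" "(1 / t powr (n * v x)) powr e y \<le> t powr (- n) * E"
    if t: "0 < t" "t \<le> S" and y: "y \<in> cube x t" for x y t
  proof -
    have "norm (x - y) \<le> n * infnorm (y - x)"
      unfolding n_def using norm_le_card_infnorm[of "y - x"] by (simp add: norm_minus_commute)
    also have "\<dots> \<le> n * t" using y t n by (intro mult_left_mono) (auto simp: mem_cube_iff)
    finally have "\<bar>(v y - v x) * ln t\<bar> \<le> L" using L(2) t by (simp add: n_def)
    then have "n / v y * \<bar>(v y - v x) * ln t\<bar> \<le> n / va * L"
      using n va ab(1)[of y] by (intro mult_mono divide_left_mono) auto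
    then have b: "\<bar>(n / v y * (v y - v x)) * ln t\<bar> \<le> n / va * L"
      using n v0[of y] by (simp add: abs_mult mult.assoc)
    have "exp (- (n / va * L)) = 1 / E" by (simp add: E_def exp_minus divide_inverse)
    with powr_le_exp[OF t(1) b]
    have "1 / E \<le> t powr (n / v y * (v y - v x))" "t powr (n / v y * (v y - v x)) \<le> E" by (auto simp: E_def)
    from this[THEN mult_left_mono[where c="t powr (- n)"]]
    show "t powr (- n) / E \<le> (1 / t powr (n * v x)) powr e y" "(1 / t powr (n * v x)) powr e y \<le> t powr (- n) * E"
      unfolding e indicator_integrand[of t v y n x, OF t(1) v0] by auto
  qed
  have tn: "t powr (- n) * t ^ CARD('n) = 1" if "0 < t" for t
    using that by (simp add: n_def powr_minus powr_realpow)
  have up: "(\<integral>\<^sup>+y\<in>cube x t. ennreal ((1 / t powr (n * v x)) powr e y) \<partial>lebesgue) \<le> ennreal E"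
    if t: "0 < t" "t \<le> S" for x t
  proof -
    have "(\<integral>\<^sup>+y\<in>cube x t. ennreal ((1 / t powr (n * v x)) powr e y) \<partial>lborel) \<le> ennreal (t powr (- n) * E * t ^ CARD('n))"
      using t E by (intro cube_integral_bounded_le ennreal_leI pw(2)) auto
    also have "t powr (- n) * E * t ^ CARD('n) = E" using tn[OF t(1)] by (simp add: mult_ac)
    finally show ?thesis by (simp add: nn_integral_completion)
  qed
  have low: "ennreal (1 / E) \<le> (\<integral>\<^sup>+y\<in>cube x t. ennreal ((1 / t powr (n * v x)) powr e y) \<partial>lebesgue)"
    if t: "0 < t" "t \<le> S" for x t
  proof -
    have "1 / E = t powr (- n) / E * t ^ CARD('n)" using tn[OF t(1)] by simp
    then have "ennreal (1 / E) = ennreal (t powr (- n) / E) * emeasure lebesgue (cube x t)"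
      using t E by (simp add: emeasure_cube ennreal_mult[symmetric])
    also have "\<dots> = (\<integral>\<^sup>+y. ennreal (t powr (- n) / E) * indicator (cube x t) y \<partial>lebesgue)"
      by (rule nn_integral_cmult_indicator[symmetric]) measurable
    also have "\<dots> \<le> (\<integral>\<^sup>+y\<in>cube x t. ennreal ((1 / t powr (n * v x)) powr e y) \<partial>lebesgue)"
      using pw(1)[OF t] by (intro nn_integral_mono) (auto simp: indicator_def intro!: ennreal_leI)
    finally show ?thesis .
  qed
  define A where "A = E + (2 * E) powr vb"
  have EA: "E powr vb \<le> A" "(2 * E) powr vb \<le> A" "0 < (2 * E) powr vb"
  proof -
    have "E powr vb \<le> (2 * E) powr vb" using E vb by (intro powr_mono2) auto
    then show "E powr vb \<le> A" using E by (simp add: A_def)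
  qed (use E in \<open>auto simp: A_def\<close>)
  then have A0: "0 < A" by linarith
  show thesis
  proof (rule that[of A])
    show "1 \<le> A" using E EA(3) unfolding A_def by linarith
    fix x :: "real^'n" and t :: real assume t: "0 < t" "t \<le> S"
    have "(\<integral>\<^sup>+y\<in>cube x t. ennreal ((1 / t powr (n * v x)) powr e y) \<partial>lebesgue) \<le> ennreal E" by (rule up[OF t])
    also have "\<dots> \<le> ennreal A" by (rule ennreal_leI) (simp add: A_def)
    finally show "(\<integral>\<^sup>+y\<in>cube x t. ennreal ((1 / t powr (real CARD('n) * v x)) powr e y) \<partial>lebesgue) \<le> ennreal A"
      by (simp add: n_def)
    have "Lvar_norm e (indicat_real (cube x t)) \<le> ennreal (E powr vb * t powr (n * v x))"
      using t by (intro Lvar_norm_indicator_le vb vbe E up) auto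
    also have "\<dots> \<le> ennreal (A * t powr (n * v x))" using EA by (intro ennreal_leI mult_right_mono) auto
    finally show "Lvar_norm e (indicat_real (cube x t)) \<le> ennreal (A * t powr (real CARD('n) * v x))" by (simp add: n_def)
    have "ennreal (t powr (n * v x) / A) \<le> ennreal (t powr (n * v x) / (2 * E) powr vb)"
      using EA A0 by (intro ennreal_leI divide_left_mono mult_pos_pos) auto
    also have "\<dots> \<le> Lvar_norm e (indicat_real (cube x t))"
      using t by (intro Lvar_norm_indicator_ge vb vbe E low) auto
    finally show "ennreal (t powr (real CARD('n) * v x) / A) \<le> Lvar_norm e (indicat_real (cube x t))" by (simp add: n_def)
  qed
qed

text \<open>The decay condition compares v(y) with v(z) to within K / ln (|y| + e), which is good
  enough unless |y| is less than a small power of \<open>l\<close>; there the crude ratio of the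
  bounds of \<open>v\<close> is used, on a set small enough to compensate. The point
  \<open>z\<close> dominates the cube but may lie outside it: a point chosen for an enlarged cube
  then serves for both cubes.\<close>

lemma Lvar_norm_large_cube:
  fixes v e :: "real^'n::finite \<Rightarrow> real"
  assumes v: "log_holder K v" and va: "0 < va" and ab: "\<And>x. va \<le> v x" "\<And>x. v x \<le> vb"
    and e: "\<And>x. e x = 1 / v x" and [measurable]: "e \<in> borel_measurable lebesgue"
  obtains A where "1 \<le> A"
    "\<And>x z l. 1 \<le> l \<Longrightarrow> \<forall>y\<in>cube x l. norm y \<le> norm z \<Longrightarrow>
        Lvar_norm e (indicat_real (cube x l)) \<le> ennreal (A * l powr (real CARD('n) * v z))"
    "\<And>x z l. 1 \<le> l \<Longrightarrow> \<forall>y\<in>cube x l. norm y \<le> norm z \<Longrightarrow>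
        ennreal (l powr (real CARD('n) * v z) / A) \<le> Lvar_norm e (indicat_real (cube x l))"
proof -
  define n where "n = real CARD('n)"
  have n: "1 \<le> n" by (simp add: n_def)
  have v0: "0 < v x" for x using va ab(1)[of x] by linarith
  have vb: "0 < vb" using v0[of 0] ab(2)[of 0] by linarith
  have vbe: "1 \<le> vb * e x" for x using ab(2)[of x] v0[of x] by (simp add: e)
  have K: "0 \<le> K" using v by (simp add: log_holder_def)
  \<comment> \<open>The least possible ratio v(z) / v(y). It fixes both the crude bound l^(-n c0) of
    the integrand near the origin and the size l^c0 of the exceptional set.\<close>
  define c0 where "c0 = va / vb"
  have c0: "0 < c0" using va vb by (simp add: c0_def)
  have far: "\<bar>(n / v y * (v y - v z)) * ln l\<bar> \<le> n / va * (K / c)"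
    if l: "1 \<le> l" and c: "0 < c" and yz: "norm y \<le> norm z" and lny: "c * ln l \<le> ln (norm y + exp 1)" for l c y z
  proof -
    have "0 < ln (norm y + exp 1)"
      using add_nonneg_pos[OF norm_ge_zero[of y], of "exp 1 - 1"] by (intro ln_gt_zero) simp
    then have "\<bar>v y - v z\<bar> * (c * ln l) \<le> K / ln (norm y + exp 1) * ln (norm y + exp 1)"
      using v yz lny l c K by (intro mult_mono) (auto simp: log_holder_def)
    also have "\<dots> = K" using \<open>0 < ln (norm y + exp 1)\<close> by simp
    finally have "\<bar>v y - v z\<bar> * ln l \<le> K / c" using c by (simp add: field_simps)
    then have "n / v y * (\<bar>v y - v z\<bar> * ln l) \<le> n / va * (K / c)"
      using n va ab(1)[of y] l by (intro mult_mono divide_left_mono) auto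
    then show ?thesis using n v0[of y] l by (simp add: abs_mult mult.assoc)
  qed
  define E1 where "E1 = exp (n / va * (K / c0))"
  define E2 where "E2 = exp (n / va * (K / (1/2)))"
  have E1: "1 \<le> E1" using n va K c0 by (simp add: E1_def)
  have E2: "1 \<le> E2" using n va K by (simp add: E2_def)
  \<comment> \<open>\<open>E1\<close> and 2^n are the two contributions to the upper bound; 2 E2
    comes from the lower bound, where only half of the volume is used.\<close>
  define E where "E = E1 + 2 ^ CARD('n) + 2 * E2"
  have E: "1 \<le> E" using E1 E2 by (simp add: E_def add_increasing2)
  have tn: "t powr (- n) * t ^ CARD('n) = 1" if "0 < t" for t
    using that by (simp add: n_def powr_minus powr_realpow)
  have up: "(\<integral>\<^sup>+y\<in>cube x l. ennreal ((1 / l powr (n * v z)) powr e y) \<partial>lebesgue) \<le> ennreal E"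
    if l: "1 \<le> l" and z: "\<forall>y\<in>cube x l. norm y \<le> norm z" for x z l
  proof -
    \<comment> \<open>On the cube of side 2 m about the origin the crude bound l^(-n c0) meets the
      volume 2^n l^(n c0), so that this part contributes at most 2^n; outside it ln (|y| + e) is at
      least c0 ln l.\<close>
    define m where "m = l powr c0"
    have m: "0 < m" using l by (simp add: m_def)
    have "(\<integral>\<^sup>+y\<in>cube x l. ennreal ((1 / l powr (n * v z)) powr e y) \<partial>lebesgue)
       \<le> (\<integral>\<^sup>+y. ennreal (l powr (- n) * E1) * indicator (cube x l) y + ennreal (l powr (- n * c0)) * indicator (cube 0 (2 * m)) y \<partial>lebesgue)"
    proof (rule nn_integral_mono)
      fix y
      show "ennreal ((1 / l powr (n * v z)) powr e y) * indicator (cube x l) y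
        \<le> ennreal (l powr (- n) * E1) * indicator (cube x l) y + ennreal (l powr (- n * c0)) * indicator (cube 0 (2 * m)) y"
      proof (cases "y \<in> cube x l")
        case True
        note yl = True
        show ?thesis
        proof (cases "y \<in> cube 0 (2 * m)")
          case True
          have "(1 / l powr (n * v z)) powr e y = l powr (- (n * v z) * (1 / v y))"
            unfolding e powr_powr[symmetric] powr_minus_divide ..
          also have "\<dots> \<le> l powr (- n * c0)"
          proof (rule powr_mono)
            have "va / vb \<le> v z / v y"
              by (rule frac_le[OF less_imp_le[OF v0] ab(1) v0 ab(2)])
            then have "c0 \<le> v z * (1 / v y)" by (simp add: c0_def)
            then have "n * c0 \<le> n * (v z * (1 / v y))" using n by (intro mult_left_mono) auto
            then show "- (n * v z) * (1 / v y) \<le> - n * c0" by simp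
          qed (use l in auto)
          finally show ?thesis using True yl by (intro add_increasing) (simp_all add: ennreal_leI)
        next
          case False
          then have "m < norm y" using infnorm_le_norm[of y] by (simp add: mem_cube_iff)
          moreover have "0 < (exp 1 :: real)" by simp
          ultimately have "m \<le> norm y + exp 1" by linarith
          then have "ln m \<le> ln (norm y + exp 1)" using m by (subst ln_le_cancel_iff) linarith+
          then have ln_le: "c0 * ln l \<le> ln (norm y + exp 1)" using l by (simp add: m_def ln_powr)
          have "norm y \<le> norm z" using z yl by blast
          have "0 < l" using l by simp
          have "l powr (n / v y * (v y - v z)) \<le> E1" unfolding E1_def
            by (rule powr_le_exp(1)[OF \<open>0 < l\<close> far[OF l c0 \<open>norm y \<le> norm z\<close> ln_le]])
          then have "l powr (- n) * l powr (n / v y * (v y - v z)) \<le> l powr (- n) * E1" by (intro mult_left_mono) auto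
          then have "(1 / l powr (n * v z)) powr e y \<le> l powr (- n) * E1"
            unfolding e indicator_integrand[where v=v and y=y, OF \<open>0 < l\<close> v0] .
          then show ?thesis using yl by (intro add_increasing2) (simp_all add: ennreal_leI)
        qed
      qed auto
    qed
    also have "\<dots> = ennreal (l powr (- n) * E1) * emeasure lebesgue (cube x l) + ennreal (l powr (- n * c0)) * emeasure lebesgue (cube (0::real^'n) (2 * m))"
      by (subst nn_integral_add) (auto simp: nn_integral_cmult_indicator)
    also have "\<dots> = ennreal (l powr (- n) * E1 * l ^ CARD('n) + l powr (- n * c0) * (2 * m) ^ CARD('n))"
      using l m E1 by (simp add: emeasure_cube ennreal_mult[symmetric] ennreal_plus[symmetric] del: ennreal_plus)
    also have "l powr (- n) * E1 * l ^ CARD('n) = E1" using tn[of l] l by (simp add: mult_ac)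
    also have "l powr (- n * c0) * (2 * m) ^ CARD('n) = 2 ^ CARD('n)"
    proof -
      have "m ^ CARD('n) = l powr (n * c0)" using l by (simp add: m_def powr_power n_def mult.commute)
      then show ?thesis using l by (simp add: power_mult_distrib powr_minus)
    qed
    also have "ennreal (E1 + 2 ^ CARD('n)) \<le> ennreal E" using E2 by (intro ennreal_leI) (simp add: E_def)
    finally show ?thesis .
  qed
  have low: "ennreal (1 / E) \<le> (\<integral>\<^sup>+y\<in>cube x l. ennreal ((1 / l powr (n * v z)) powr e y) \<partial>lebesgue)"
    if l: "1 \<le> l" and z: "\<forall>y\<in>cube x l. norm y \<le> norm z" for x z l
  proof -
    \<comment> \<open>Removing a cube of side l / 2 about the origin costs at most half of the
      volume and leaves points with |y| > l / 4, wherever the original cube is centred.\<close>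
    define X where "X = cube x l - cube 0 (l / 2)"
    have X [measurable]: "X \<in> sets lebesgue" unfolding X_def by measurable
    have "(l / 2) ^ CARD('n) \<le> l ^ CARD('n) / 2"
    proof -
      have "(2::real) ^ 1 \<le> 2 ^ CARD('n)" by (intro power_increasing) (auto simp: Suc_leI)
      then show ?thesis unfolding power_divide using l by (intro divide_left_mono) auto
    qed
    have "ennreal (l ^ CARD('n)) = emeasure lebesgue (cube x l)" using l by (simp add: emeasure_cube)
    also have "\<dots> \<le> emeasure lebesgue (X \<union> cube 0 (l / 2))"
      by (intro emeasure_mono) (auto simp: X_def)
    also have "\<dots> \<le> emeasure lebesgue X + emeasure lebesgue (cube (0::real^'n) (l / 2))"
      by (intro emeasure_subadditive) auto
    also have "\<dots> \<le> emeasure lebesgue X + ennreal (l ^ CARD('n) / 2)"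
      using l \<open>(l / 2) ^ CARD('n) \<le> l ^ CARD('n) / 2\<close> by (intro add_left_mono) (simp add: emeasure_cube ennreal_leI)
    finally have a: "ennreal (l ^ CARD('n)) \<le> emeasure lebesgue X + ennreal (l ^ CARD('n) / 2)" .
    have meas: "ennreal (l ^ CARD('n) / 2) \<le> emeasure lebesgue X"
    proof -
      have "ennreal (l ^ CARD('n)) = ennreal (l ^ CARD('n) / 2) + ennreal (l ^ CARD('n) / 2)"
        using l by (simp add: ennreal_plus[symmetric] del: ennreal_plus)
      with a have "ennreal (l ^ CARD('n) / 2) + ennreal (l ^ CARD('n) / 2) \<le> ennreal (l ^ CARD('n) / 2) + emeasure lebesgue X"
        by (simp only: add.commute)
      then show ?thesis unfolding ennreal_add_left_cancel_le by simp
    qed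
    have "1 / E \<le> 1 / (2 * E2)" using E1 E2 by (intro frac_le) (auto simp: E_def)
    also have "\<dots> = (l powr (- n) * l ^ CARD('n)) / (2 * E2)" using tn[of l] l by simp
    also have "\<dots> = l powr (- n) / E2 * (l ^ CARD('n) / 2)" by simp
    finally have "ennreal (1 / E) \<le> ennreal (l powr (- n) / E2 * (l ^ CARD('n) / 2))" by (rule ennreal_leI)
    also have "\<dots> = ennreal (l powr (- n) / E2) * ennreal (l ^ CARD('n) / 2)"
      using E2 l by (intro ennreal_mult) auto
    also have "\<dots> \<le> ennreal (l powr (- n) / E2) * emeasure lebesgue X" by (intro mult_left_mono meas) auto
    also have "\<dots> = (\<integral>\<^sup>+y. ennreal (l powr (- n) / E2) * indicator X y \<partial>lebesgue)"
      by (rule nn_integral_cmult_indicator[symmetric]) measurable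
    also have "\<dots> \<le> (\<integral>\<^sup>+y\<in>cube x l. ennreal ((1 / l powr (n * v z)) powr e y) \<partial>lebesgue)"
    proof (rule nn_integral_mono)
      fix y
      show "ennreal (l powr (- n) / E2) * indicator X y \<le> ennreal ((1 / l powr (n * v z)) powr e y) * indicator (cube x l) y"
      proof (cases "y \<in> X")
        case True
        then have yl: "y \<in> cube x l" and "l / 4 < norm y"
          using infnorm_le_norm[of y] by (auto simp: X_def mem_cube_iff)
        define c :: real where "c = exp 1"
        have c: "1 \<le> c" by (simp add: c_def)
        \<comment> \<open>The square of l / 4 - c is nonnegative. With c = exp 1 this makes l \<le>
          (|y| + c)^2 valid for all l \<ge> 1, hence ln l at most twice ln (|y| + c).\<close>
        have sq: "l * c \<le> (l / 4 + c)\<^sup>2"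
          using zero_le_power2[of "l / 4 - c"] by (simp add: power2_eq_square algebra_simps)
        have "l * 1 \<le> l * c" using l c by (intro mult_left_mono) auto
        moreover have "(l / 4 + c)\<^sup>2 \<le> (norm y + c)\<^sup>2"
          using \<open>l / 4 < norm y\<close> l c by (intro power_mono) auto
        ultimately have "l \<le> (norm y + c)\<^sup>2" using sq by linarith
        moreover have pos: "0 < norm y + c" using c by (intro add_nonneg_pos) auto
        ultimately have "ln l \<le> ln ((norm y + c)\<^sup>2)" using l by (subst ln_le_cancel_iff) auto
        also have "\<dots> = 2 * ln (norm y + c)" using pos by (simp add: ln_realpow)
        finally have ln_le: "1 / 2 * ln l \<le> ln (norm y + exp 1)" unfolding c_def[symmetric] by simp
        have "norm y \<le> norm z" using z yl by blast
        have "0 < l" using l by simp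
        have "exp (- (n / va * (K / (1/2)))) \<le> l powr (n / v y * (v y - v z))"
          by (rule powr_le_exp(2)[OF \<open>0 < l\<close> far[OF l _ \<open>norm y \<le> norm z\<close> ln_le]]) simp
        also have "exp (- (n / va * (K / (1/2)))) = 1 / E2" by (simp only: E2_def exp_minus inverse_eq_divide)
        finally have "l powr (- n) * (1 / E2) \<le> l powr (- n) * l powr (n / v y * (v y - v z))" by (intro mult_left_mono) auto
        then have "l powr (- n) / E2 \<le> (1 / l powr (n * v z)) powr e y"
          unfolding e indicator_integrand[where v=v and y=y, OF \<open>0 < l\<close> v0] by simp
        then show ?thesis using yl True by (simp add: ennreal_leI)
      qed auto
    qed
    finally show ?thesis .
  qed
  define A where "A = E + (2 * E) powr vb"
  have EA: "E powr vb \<le> A" "(2 * E) powr vb \<le> A" "0 < (2 * E) powr vb"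
  proof -
    have "E powr vb \<le> (2 * E) powr vb" using E vb by (intro powr_mono2) auto
    then show "E powr vb \<le> A" using E by (simp add: A_def)
  qed (use E in \<open>auto simp: A_def\<close>)
  then have A0: "0 < A" by linarith
  show thesis
  proof (rule that[of A])
    show "1 \<le> A" using E EA(3) unfolding A_def by linarith
    fix x z :: "real^'n" and l :: real assume l: "1 \<le> l" and z: "\<forall>y\<in>cube x l. norm y \<le> norm z"
    have "Lvar_norm e (indicat_real (cube x l)) \<le> ennreal (E powr vb * l powr (n * v z))"
      using l by (intro Lvar_norm_indicator_le vb vbe E up z) auto
    also have "\<dots> \<le> ennreal (A * l powr (n * v z))" using EA by (intro ennreal_leI mult_right_mono) auto
    finally show "Lvar_norm e (indicat_real (cube x l)) \<le> ennreal (A * l powr (real CARD('n) * v z))" by (simp add: n_def)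
    have "ennreal (l powr (n * v z) / A) \<le> ennreal (l powr (n * v z) / (2 * E) powr vb)"
      using EA A0 by (intro ennreal_leI divide_left_mono mult_pos_pos) auto
    also have "\<dots> \<le> Lvar_norm e (indicat_real (cube x l))"
      using l by (intro Lvar_norm_indicator_ge vb vbe E low z) auto
    finally show "ennreal (l powr (real CARD('n) * v z) / A) \<le> Lvar_norm e (indicat_real (cube x l))" by (simp add: n_def)
  qed
qed

lemma cube_farthest_point:
  fixes x :: "real^'n::finite"
  obtains z :: "real^'n" where "\<forall>y\<in>cube x l. norm y \<le> norm z"
proof (cases "cube x l = {}")
  case False
  have "\<exists>z\<in>cube x l. \<forall>y\<in>cube x l. norm y \<le> norm z"
    by (rule continuous_attains_sup[OF compact_cube False]) (intro continuous_intros)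
  then show thesis by (elim bexE) (rule that)
qed (use that[of 0] in auto)

subsection \<open>Mean oscillation on cubes\<close>

text \<open>Translates the mean norm into a bound on the integral of an s-th power, so that roots
  and \<open>ennreal_pow\<close> do not enter the estimates.\<close>

lemma mean_norm_le_iff:
  fixes g :: "real^'n::finite \<Rightarrow> complex"
  assumes "0 < l" "0 \<le> A" "0 < s"
  shows "mean_norm s (cube x l) g \<le> ennreal A \<longleftrightarrow>
     (\<integral>\<^sup>+y\<in>cube x l. ennreal (norm (g y) powr s) \<partial>lborel) \<le> ennreal (l ^ CARD('n) * A powr s)"
proof -
  define I where "I = (\<integral>\<^sup>+y\<in>cube x l. ennreal (norm (g y) powr s) \<partial>lborel)"
  have m: "mean_norm s (cube x l) g = ennreal_pow (I / ennreal (l ^ CARD('n))) (1 / s)"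
    using assms by (simp add: mean_norm_def I_def nn_integral_completion emeasure_cube)
  have ln: "0 < l ^ CARD('n)" using assms by simp
  show ?thesis
  proof (cases I)
    case (real i)
    have "I / ennreal (l ^ CARD('n)) = ennreal (i / l ^ CARD('n))"
      using real ln by (simp add: divide_ennreal)
    then have "mean_norm s (cube x l) g = ennreal ((i / l ^ CARD('n)) powr (1 / s))"
      unfolding m ennreal_pow_def using real ln by simp
    then have "mean_norm s (cube x l) g \<le> ennreal A \<longleftrightarrow> (i / l ^ CARD('n)) powr (1 / s) \<le> A"
      using assms by simp
    also have "\<dots> \<longleftrightarrow> i / l ^ CARD('n) \<le> A powr s"
    proof
      assume "(i / l ^ CARD('n)) powr (1 / s) \<le> A"
      then have "((i / l ^ CARD('n)) powr (1 / s)) powr s \<le> A powr s" using assms by (intro powr_mono2) auto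
      then show "i / l ^ CARD('n) \<le> A powr s" using assms real ln by (simp add: powr_powr)
    next
      assume "i / l ^ CARD('n) \<le> A powr s"
      then have "(i / l ^ CARD('n)) powr (1 / s) \<le> (A powr s) powr (1 / s)"
        using assms real ln by (intro powr_mono2) auto
      then show "(i / l ^ CARD('n)) powr (1 / s) \<le> A" using assms by (simp add: powr_powr)
    qed
    also have "\<dots> \<longleftrightarrow> i \<le> l ^ CARD('n) * A powr s" using ln by (simp add: field_simps)
    also have "\<dots> \<longleftrightarrow> I \<le> ennreal (l ^ CARD('n) * A powr s)" using real assms by simp
    finally show ?thesis by (simp add: I_def)
  next
    case top
    then have "mean_norm s (cube x l) g = \<infinity>"
      unfolding m ennreal_pow_def by (simp add: ennreal_top_divide)
    then show ?thesis using top by (simp add: I_def[symmetric] top_unique)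
  qed
qed

lemma powr_sum_le:
  fixes a b s :: real
  assumes "0 \<le> a" "0 \<le> b" "1 < s"
  shows "a powr s + b powr s \<le> (2 * (a + b)) powr s"
proof -
  have "a powr s + b powr s \<le> (a + b) powr s + (a + b) powr s"
    using assms by (intro add_mono powr_mono2) auto
  also have "\<dots> = 2 powr 1 * (a + b) powr s" by simp
  also have "\<dots> \<le> 2 powr s * (a + b) powr s" using assms by (intro mult_right_mono powr_mono) auto
  finally show ?thesis using assms by (subst powr_mult) auto
qed

text \<open>The triangle inequality in L^s over a cube for a sum with one bounded term, up to the
  factor 2. The other term enters as a measurable majorant \<open>F\<close> of its s-th power, as
  supplied by Young's inequality.\<close>

lemma nn_integral_powr_add_bound:
  fixes h :: "real^'n::finite \<Rightarrow> complex"
  assumes l: "0 < l" and s: "1 < s" and AB: "0 \<le> A" "0 \<le> B"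
    and F [measurable]: "F \<in> borel_measurable borel"
    and I: "(\<integral>\<^sup>+y\<in>cube x l. F y \<partial>lborel) \<le> ennreal (l ^ CARD('n) * A powr s)"
    and pw: "\<And>y. y \<in> cube x l \<Longrightarrow> ennreal (norm (h y) powr s) \<le> F y + ennreal (B powr s)"
  shows "(\<integral>\<^sup>+y\<in>cube x l. ennreal (norm (h y) powr s) \<partial>lborel) \<le> ennreal (l ^ CARD('n) * (2 * (A + B)) powr s)"
proof -
  have "(\<integral>\<^sup>+y\<in>cube x l. ennreal (norm (h y) powr s) \<partial>lborel)
     \<le> (\<integral>\<^sup>+y. F y * indicator (cube x l) y + ennreal (B powr s) * indicator (cube x l) y \<partial>lborel)"
    using pw by (intro nn_integral_mono) (auto simp: indicator_def)
  also have "\<dots> = (\<integral>\<^sup>+y\<in>cube x l. F y \<partial>lborel) + ennreal (B powr s) * emeasure lborel (cube x l)"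
    by (simp add: nn_integral_add nn_integral_cmult)
  also have "\<dots> \<le> ennreal (l ^ CARD('n) * A powr s) + ennreal (B powr s) * ennreal (l ^ CARD('n))"
    using l by (intro add_mono I) (simp add: emeasure_cube)
  also have "\<dots> = ennreal (l ^ CARD('n) * (A powr s + B powr s))"
    using l by (simp add: ennreal_mult[symmetric] ennreal_plus[symmetric] algebra_simps del: ennreal_plus)
  also have "\<dots> \<le> ennreal (l ^ CARD('n) * (2 * (A + B)) powr s)"
    using l AB s by (intro ennreal_leI mult_left_mono powr_sum_le) auto
  finally show ?thesis .
qed

text \<open>The projection approximates as well as any polynomial \<open>T\<close>, up to a
  constant: on the cube its distance from \<open>T\<close> is bounded by the mean of |h - T|. It
  therefore suffices to construct some good polynomial on each small cube.\<close>

lemma mean_norm_poly_proj_le: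
  assumes s: "1 < s"
  obtains C where "0 < C"
    "\<And>(h :: real^'n::finite \<Rightarrow> complex) T x l A. h \<in> borel_measurable borel \<Longrightarrow> 0 < l \<Longrightarrow> 0 \<le> A \<Longrightarrow>
       set_integrable lebesgue (cube x l) h \<Longrightarrow> T \<in> poly_space d \<Longrightarrow>
       (\<integral>\<^sup>+y\<in>cube x l. ennreal (norm (h y - T y) powr s) \<partial>lborel) \<le> ennreal (l ^ CARD('n) * A powr s) \<Longrightarrow>
       mean_norm s (cube x l) (\<lambda>y. h y - poly_proj d (cube x l) h y) \<le> ennreal (C * A)"
proof -
  obtain K :: real where K: "0 < K"
    "\<And>(x::real^'n) t g. 0 < t \<Longrightarrow> set_integrable lebesgue (cube x t) g \<Longrightarrow>
        poly_proj d (cube x t) g \<in> poly_space d"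
    "\<And>(x::real^'n) t g T y. 0 < t \<Longrightarrow> set_integrable lebesgue (cube x t) g \<Longrightarrow> T \<in> poly_space d \<Longrightarrow>
        y \<in> cube x t \<Longrightarrow>
        ennreal (t ^ CARD('n) * norm (poly_proj d (cube x t) g y - T y))
          \<le> ennreal K * (\<integral>\<^sup>+y\<in>cube x t. ennreal (norm (g y - T y)) \<partial>lborel)"
    by (rule poly_proj_bound[of d], rule that)
  show thesis
  proof (rule that[of "2 * (2 + 4 * K)"])
    show "0 < 2 * (2 + 4 * K)" using K by simp
    fix h :: "real^'n \<Rightarrow> complex" and T x and l A :: real
    assume [measurable]: "h \<in> borel_measurable borel" and l: "0 < l" and A: "0 \<le> A"
      and i: "set_integrable lebesgue (cube x l) h" and T: "T \<in> poly_space d"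
      and I: "(\<integral>\<^sup>+y\<in>cube x l. ennreal (norm (h y - T y) powr s) \<partial>lborel) \<le> ennreal (l ^ CARD('n) * A powr s)"
    have [measurable]: "T \<in> borel_measurable borel" by (rule poly_space_borel[OF T])
    let ?P = "poly_proj d (cube x l) h"
    have I1: "(\<integral>\<^sup>+y\<in>cube x l. ennreal (norm (h y - T y)) \<partial>lborel) \<le> ennreal (2 * l ^ CARD('n) * A)"
      using l A s I by (intro cube_L1_le_Ls) auto
    have PT: "norm (?P y - T y) \<le> 2 * K * A" if y: "y \<in> cube x l" for y
    proof -
      have "ennreal (l ^ CARD('n) * norm (?P y - T y)) \<le> ennreal K * ennreal (2 * l ^ CARD('n) * A)"
        using K(3)[OF l i T y] mult_left_mono[OF I1, of "ennreal K"] by (auto intro: order_trans)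
      also have "\<dots> = ennreal (l ^ CARD('n) * (2 * K * A))"
        using K(1) l A by (simp add: ennreal_mult[symmetric] mult_ac)
      finally show ?thesis using l K(1) A by simp
    qed
    have I': "(\<integral>\<^sup>+y\<in>cube x l. ennreal (2 powr s) * ennreal (norm (h y - T y) powr s) \<partial>lborel)
        \<le> ennreal (l ^ CARD('n) * (2 * A) powr s)"
    proof -
      have "(\<integral>\<^sup>+y\<in>cube x l. ennreal (2 powr s) * ennreal (norm (h y - T y) powr s) \<partial>lborel)
        = ennreal (2 powr s) * (\<integral>\<^sup>+y\<in>cube x l. ennreal (norm (h y - T y) powr s) \<partial>lborel)"
        by (simp add: nn_integral_cmult mult.assoc)
      also have "\<dots> \<le> ennreal (2 powr s) * ennreal (l ^ CARD('n) * A powr s)" by (intro mult_left_mono I) auto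
      finally show ?thesis using l A by (simp add: ennreal_mult[symmetric] powr_mult mult_ac)
    qed
    have "(\<integral>\<^sup>+y\<in>cube x l. ennreal (norm (h y - ?P y) powr s) \<partial>lborel)
        \<le> ennreal (l ^ CARD('n) * (2 * (2 * A + 4 * K * A)) powr s)"
    proof (rule nn_integral_powr_add_bound[OF l s _ _ _ I'])
      fix y assume y: "y \<in> cube x l"
      have "norm (h y - ?P y) \<le> norm (h y - T y) + norm (?P y - T y)"
        using norm_triangle_ineq4[of "h y - T y" "?P y - T y"] by simp
      also have "\<dots> \<le> norm (h y - T y) + 2 * K * A" using PT[OF y] by simp
      finally have "norm (h y - ?P y) powr s \<le> (norm (h y - T y) + 2 * K * A) powr s"
        using s by (intro powr_mono2) auto
      also have "\<dots> \<le> 2 powr s * (norm (h y - T y) powr s + (2 * K * A) powr s)"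
        using s K(1) A by (intro powr_add_le) auto
      also have "\<dots> = 2 powr s * norm (h y - T y) powr s + (2 * (2 * K * A)) powr s"
        using K(1) A by (simp only: powr_mult distrib_left)
      also have "2 * (2 * K * A) = 4 * K * A" by simp
      finally show "ennreal (norm (h y - ?P y) powr s)
          \<le> ennreal (2 powr s) * ennreal (norm (h y - T y) powr s) + ennreal ((4 * K * A) powr s)"
        by (simp add: ennreal_mult[symmetric] ennreal_plus[symmetric] ennreal_leI del: ennreal_plus)
    qed (use K(1) A in auto)
    also have "2 * (2 * A + 4 * K * A) = 2 * (2 + 4 * K) * A" by (simp add: algebra_simps)
    finally show "mean_norm s (cube x l) (\<lambda>y. h y - ?P y) \<le> ennreal (2 * (2 + 4 * K) * A)"
      using l K(1) A s by (subst mean_norm_le_iff) auto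
  qed
qed

section \<open>The potential in L^s\<close>

context riesz_kernel
begin

lemma pot_borel:
  assumes [measurable]: "f \<in> borel_measurable borel"
  shows "pot f \<in> borel_measurable borel"
  unfolding pot_def[abs_def] by (rule lborel.borel_measurable_lebesgue_integral) measurable

lemma norm_pot_le:
  assumes [measurable]: "f \<in> borel_measurable borel"
  shows "ennreal (norm (pot f x)) \<le> (\<integral>\<^sup>+y\<in>cube x 2. ennreal (norm (k (x - y))) * ennreal (norm (f y)) \<partial>lborel)"
proof -
  have "ennreal (norm (pot f x)) \<le> (\<integral>\<^sup>+y. ennreal (norm (k (x - y) * f y)) \<partial>lborel)"
  \<comment> \<open>If the integrand is not integrable, the potential is 0 by convention and the
    bound is trivial.\<close>
  proof (cases "integrable lborel (\<lambda>y. k (x - y) * f y)")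
    case True
    then show ?thesis unfolding pot_def by (rule integral_norm_bound_ennreal)
  qed (simp add: pot_def not_integrable_integral_eq)
  also have "\<dots> = (\<integral>\<^sup>+y\<in>cube x 2. ennreal (norm (k (x - y))) * ennreal (norm (f y)) \<partial>lborel)"
  proof (rule nn_integral_cong)
    fix y
    have "k (x - y) = 0" if "y \<notin> cube x 2"
      using that infnorm_sub[of x y] by (intro k_supp) (simp add: mem_cube_iff)
    then show "ennreal (norm (k (x - y) * f y)) = ennreal (norm (k (x - y))) * ennreal (norm (f y)) * indicator (cube x 2) y"
      by (cases "y \<in> cube x 2") (auto simp: norm_mult ennreal_mult)
  qed
  finally show ?thesis .
qed

text \<open>Young's inequality for the kernel cut off to the cube of side \<open>r\<close>, whose
  L^1 norm is at most K1 r^\<alpha>. For points of \<open>X\<close> and \<open>Y\<close> the cutoff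
  changes nothing. \<open>H\<close> is a measurable majorant of the s-th power of every real number
  below the convolution.\<close>

lemma kernel_convolution_Ls:
  fixes g :: "real^'n \<Rightarrow> complex"
  assumes [measurable]: "g \<in> borel_measurable borel" and s: "1 < s" and r: "0 < r"
    and sub: "\<And>x y. x \<in> X \<Longrightarrow> y \<in> Y \<Longrightarrow> infnorm (x - y) \<le> r / 2 \<or> k (x - y) = 0" and [measurable]: "Y \<in> sets borel"
  obtains H where "H \<in> borel_measurable borel"
    "\<And>x v. x \<in> X \<Longrightarrow> 0 \<le> v \<Longrightarrow> ennreal v \<le> (\<integral>\<^sup>+y\<in>Y. ennreal (norm (k (x - y))) * ennreal (norm (g y)) \<partial>lborel) \<Longrightarrow>
        ennreal (v powr s) \<le> H x"
    "(\<integral>\<^sup>+x. H x \<partial>lborel) \<le> ennreal ((2 * K1 * r powr \<alpha>) powr s) * (\<integral>\<^sup>+y\<in>Y. ennreal (norm (g y) powr s) \<partial>lborel)"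
proof -
  define \<kappa> where "\<kappa> = K1 * r powr \<alpha>"
  have \<kappa>: "0 < \<kappa>" using K1 r by (simp add: \<kappa>_def)
  define k1 where "k1 y = norm (k y) * indicator (cube 0 r) y" for y
  define g1 where "g1 y = norm (g y) * indicator Y y" for y
  have [measurable]: "k1 \<in> borel_measurable borel" "g1 \<in> borel_measurable borel"
    unfolding k1_def[abs_def] g1_def[abs_def] by measurable
  have k1: "(\<integral>\<^sup>+y. ennreal (k1 y) \<partial>lborel) \<le> ennreal \<kappa>"
    unfolding k1_def \<kappa>_def by (rule kernel_L1'[OF r])
  define H where "H x = ennreal (2 powr s * \<kappa> powr (s - 1)) * (\<integral>\<^sup>+y. ennreal (k1 (x - y)) * ennreal (g1 y powr s) \<partial>lborel)" for x
  have H [measurable]: "H \<in> borel_measurable borel"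
    unfolding H_def[abs_def] by measurable
  show thesis
  proof (rule that[OF H])
    fix x v assume x: "x \<in> X" and v: "0 \<le> v"
      and le: "ennreal v \<le> (\<integral>\<^sup>+y\<in>Y. ennreal (norm (k (x - y))) * ennreal (norm (g y)) \<partial>lborel)"
    have "(\<integral>\<^sup>+y\<in>Y. ennreal (norm (k (x - y))) * ennreal (norm (g y)) \<partial>lborel)
        = (\<integral>\<^sup>+y. ennreal (k1 (x - y)) * ennreal (g1 y) \<partial>lborel)"
    proof (rule nn_integral_cong)
      fix y
      have "x - y \<in> cube 0 r \<or> k (x - y) = 0" if "y \<in> Y" using sub[OF x that] by (simp add: mem_cube_iff)
      then show "ennreal (norm (k (x - y))) * ennreal (norm (g y)) * indicator Y y = ennreal (k1 (x - y)) * ennreal (g1 y)"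
        by (cases "y \<in> Y") (auto simp: k1_def g1_def)
    qed
    with le have "ennreal v \<le> (\<integral>\<^sup>+y. ennreal (k1 (x - y)) * ennreal (g1 y) \<partial>lborel)" by simp
    then show "ennreal (v powr s) \<le> H x" unfolding H_def
      using \<kappa> s v k1 by (intro young_pointwise) (auto simp: g1_def)
  next
    have "(\<integral>\<^sup>+x. H x \<partial>lborel) = ennreal (2 powr s * \<kappa> powr (s - 1)) *
        (\<integral>\<^sup>+x. (\<integral>\<^sup>+y. ennreal (k1 (x - y)) * ennreal (g1 y powr s) \<partial>lborel) \<partial>lborel)"
      unfolding H_def by (rule nn_integral_cmult) measurable
    also have "\<dots> \<le> ennreal (2 powr s * \<kappa> powr (s - 1)) * (ennreal \<kappa> * (\<integral>\<^sup>+y. ennreal (g1 y powr s) \<partial>lborel))"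
      by (intro mult_left_mono young_integral k1) auto
    also have "(\<integral>\<^sup>+y. ennreal (g1 y powr s) \<partial>lborel) = (\<integral>\<^sup>+y\<in>Y. ennreal (norm (g y) powr s) \<partial>lborel)"
      by (intro nn_integral_cong) (auto simp: g1_def indicator_def)
    also have "ennreal (2 powr s * \<kappa> powr (s - 1)) * (ennreal \<kappa> * (\<integral>\<^sup>+y\<in>Y. ennreal (norm (g y) powr s) \<partial>lborel))
       = ennreal (2 powr s * \<kappa> powr (s - 1) * \<kappa>) * (\<integral>\<^sup>+y\<in>Y. ennreal (norm (g y) powr s) \<partial>lborel)"
      using \<kappa> by (simp add: ennreal_mult mult.assoc)
    also have "2 powr s * \<kappa> powr (s - 1) * \<kappa> = (2 * K1 * r powr \<alpha>) powr s"
    proof -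
      have "\<kappa> powr (s - 1) * \<kappa> = \<kappa> powr s" using \<kappa> by (simp add: powr_diff)
      moreover have "2 * K1 * r powr \<alpha> = 2 * \<kappa>" by (simp add: \<kappa>_def)
      ultimately show ?thesis using \<kappa> by (simp only: powr_mult mult.assoc)
    qed
    finally show "(\<integral>\<^sup>+x. H x \<partial>lborel) \<le> ennreal ((2 * K1 * r powr \<alpha>) powr s) * (\<integral>\<^sup>+y\<in>Y. ennreal (norm (g y) powr s) \<partial>lborel)" .
  qed
qed

end

text \<open>A side of at least 3 contains the reach of the kernel from a cube of side at most 1,
  and, being at least 1, allows the zero polynomial. The upper limit 8 keeps the chain within the
  cubes to which the estimates at the centre apply.\<close>

lemma ex_dyadic_scale:
  assumes "0 < l" "l \<le> (1::real)"
  obtains J where "3 \<le> 2 ^ J * (4 * l)" "2 ^ J * (4 * l) \<le> 8"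
proof -
  define J where "J = (LEAST J. 3 \<le> 2 ^ J * (4 * l))"
  obtain i where "3 / (4 * l) < 2 ^ i" using real_arch_pow[of 2 "3 / (4 * l)"] by auto
  then have "3 \<le> 2 ^ i * (4 * l)" using assms by (simp add: field_simps)
  then have 1: "3 \<le> 2 ^ J * (4 * l)" unfolding J_def by (rule LeastI)
  moreover have "2 ^ J * (4 * l) \<le> 8"
  proof (cases J)
    case (Suc i)
    have "\<not> 3 \<le> 2 ^ i * (4 * l)" using not_less_Least[of i "\<lambda>J. 3 \<le> 2 ^ J * (4 * l)"] Suc J_def by simp
    then show ?thesis using Suc by simp
  qed (use assms in simp)
  ultimately show thesis by (rule that)
qed

section \<open>The potential on small and on large cubes\<close>

context riesz_kernel
begin

text \<open>The chain of polynomials on the cubes of sides 2^j 4 l gives \<open>R\<close> with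
  averages of |f - R| growing at the rate \<tau> = \<sigma> + \<delta>. The far part is then
  \<open>pot_local\<close> and the near part is Young's inequality. One \<delta> of the gap is spent
  on the growth of the averages, the other on the annulus sum.\<close>

lemma pot_small_cube_campanato:
  assumes s: "1 < s" and \<delta>: "0 < \<delta>"
  obtains C :: real where "0 \<le> C"
    "\<And>f N \<sigma> x0 l. f \<in> borel_measurable borel \<Longrightarrow> 0 < l \<Longrightarrow> l < 1 \<Longrightarrow> 0 \<le> N \<Longrightarrow> 0 \<le> \<sigma> \<Longrightarrow> \<sigma> \<le> S \<Longrightarrow>
       \<sigma> + \<alpha> + 2 * \<delta> \<le> real (Suc d) \<Longrightarrow>
       (\<forall>t. 0 < t \<and> t \<le> 8 \<longrightarrow> (\<exists>P\<in>poly_space d'. (1 \<le> t \<longrightarrow> P = (\<lambda>_. 0)) \<and>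
          (\<integral>\<^sup>+y\<in>cube x0 t. ennreal (norm (f y - P y) powr s) \<partial>lborel)
             \<le> ennreal (t ^ CARD('n) * (N * t powr \<sigma>) powr s))) \<Longrightarrow>
       \<exists>T\<in>poly_space d. (\<integral>\<^sup>+x\<in>cube x0 l. ennreal (norm (pot f x - T x) powr s) \<partial>lborel)
             \<le> ennreal (l ^ CARD('n) * (C * N * l powr (\<sigma> + \<alpha>)) powr s)"
proof -
  obtain C1 :: real where C1: "0 \<le> C1"
    "\<And>(f :: real^'n \<Rightarrow> complex) x t J N \<sigma>.
      f \<in> borel_measurable borel \<Longrightarrow> 0 < t \<Longrightarrow> 0 \<le> N \<Longrightarrow> 0 \<le> \<sigma> \<Longrightarrow> \<sigma> \<le> S \<Longrightarrow> \<sigma> + \<delta> / 2 < real (Suc d) \<Longrightarrow>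
      (\<And>j. j \<le> J \<Longrightarrow> \<exists>P\<in>poly_space d'. (j = J \<longrightarrow> P = (\<lambda>_. 0)) \<and>
         (\<integral>\<^sup>+y\<in>cube x (2 ^ j * t). ennreal (norm (f y - P y) powr s) \<partial>lborel)
            \<le> ennreal ((2 ^ j * t) ^ CARD('n) * (N * (2 ^ j * t) powr \<sigma>) powr s)) \<Longrightarrow>
      \<exists>R\<in>poly_space d.
         (\<integral>\<^sup>+y\<in>cube x t. ennreal (norm (f y - R y) powr s) \<partial>lborel)
            \<le> ennreal (t ^ CARD('n) * (C1 * N * t powr \<sigma>) powr s) \<and>
         (\<forall>j\<le>J. (\<integral>\<^sup>+y\<in>cube x (2 ^ j * t). ennreal (norm (f y - R y)) \<partial>lborel)
            \<le> ennreal (C1 * N * t powr \<sigma> * 2 powr (real j * (\<sigma> + \<delta>)) * (2 ^ j * t) ^ CARD('n)))"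
    by (rule campanato_chain[OF s \<delta>]) blast
  obtain C2 :: real where C2: "0 \<le> C2"
    "\<And>f R x0 l M \<tau> J. f \<in> borel_measurable borel \<Longrightarrow> R \<in> poly_space d \<Longrightarrow> 0 < l \<Longrightarrow> l \<le> 1 \<Longrightarrow> 0 \<le> M \<Longrightarrow>
       \<alpha> + \<tau> + \<delta> \<le> real (Suc d) \<Longrightarrow> 3 \<le> 2 ^ J * (4 * l) \<Longrightarrow>
       (\<And>j. j \<le> J \<Longrightarrow> (\<integral>\<^sup>+y\<in>cube x0 (2 ^ j * (4 * l)). ennreal (norm (f y - R y)) \<partial>lborel)
          \<le> ennreal (M * 2 powr (real j * \<tau>) * (2 ^ j * (4 * l)) ^ CARD('n))) \<Longrightarrow>
       \<exists>T\<in>poly_space d. \<forall>x\<in>cube x0 l.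
         ennreal (norm (pot f x - T x))
           \<le> (\<integral>\<^sup>+y\<in>cube x0 (4 * l). ennreal (norm (k (x - y))) * ennreal (norm (f y - R y)) \<partial>lborel)
             + ennreal (C2 * M * l powr \<alpha>)"
    by (rule pot_local[OF \<delta>]) blast
  define c1 where "c1 = 4 ^ CARD('n) * 2 * (2 * K1 * 5 powr \<alpha>) * C1 * 4 powr S"
  define c2 where "c2 = 2 * (C2 * C1 * 4 powr S)"
  have c: "0 \<le> c1" "0 \<le> c2" using K1 C1 C2 by (auto simp: c1_def c2_def)
  show thesis
  proof (rule that[of "2 * (c1 + c2)"])
    show "0 \<le> 2 * (c1 + c2)" using c by simp
    fix f and N \<sigma> and x0 :: "real^'n" and l :: real
    assume f [measurable]: "f \<in> borel_measurable borel" and l: "0 < l" "l < 1" and N: "0 \<le> N" and \<sigma>: "0 \<le> \<sigma>" "\<sigma> \<le> S"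
      and gap: "\<sigma> + \<alpha> + 2 * \<delta> \<le> real (Suc d)"
      and osc: "\<forall>t. 0 < t \<and> t \<le> 8 \<longrightarrow> (\<exists>P\<in>poly_space d'. (1 \<le> t \<longrightarrow> P = (\<lambda>_. 0)) \<and>
          (\<integral>\<^sup>+y\<in>cube x0 t. ennreal (norm (f y - P y) powr s) \<partial>lborel)
             \<le> ennreal (t ^ CARD('n) * (N * t powr \<sigma>) powr s))"
    obtain J where J: "3 \<le> 2 ^ J * (4 * l)" "2 ^ J * (4 * l) \<le> 8"
      using ex_dyadic_scale[of l] l by auto
    have "\<exists>R\<in>poly_space d.
         (\<integral>\<^sup>+y\<in>cube x0 (4 * l). ennreal (norm (f y - R y) powr s) \<partial>lborel)
            \<le> ennreal ((4 * l) ^ CARD('n) * (C1 * N * (4 * l) powr \<sigma>) powr s) \<and>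
         (\<forall>j\<le>J. (\<integral>\<^sup>+y\<in>cube x0 (2 ^ j * (4 * l)). ennreal (norm (f y - R y)) \<partial>lborel)
            \<le> ennreal (C1 * N * (4 * l) powr \<sigma> * 2 powr (real j * (\<sigma> + \<delta>)) * (2 ^ j * (4 * l)) ^ CARD('n)))"
    proof (rule C1(2)[OF f _ N \<sigma>])
      show "\<sigma> + \<delta> / 2 < real (Suc d)" using gap \<alpha> \<delta> by linarith
      fix j assume j: "j \<le> J"
      have "2 ^ j * (4 * l) \<le> 2 ^ J * (4 * l)" using j l by (intro mult_right_mono power_increasing) auto
      then have "2 ^ j * (4 * l) \<le> 8" using J(2) by linarith
      then have "0 < 2 ^ j * (4 * l) \<and> 2 ^ j * (4 * l) \<le> 8" using l by simp
      then obtain P where P: "P \<in> poly_space d'" "1 \<le> 2 ^ j * (4 * l) \<longrightarrow> P = (\<lambda>_. 0)"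
          "(\<integral>\<^sup>+y\<in>cube x0 (2 ^ j * (4 * l)). ennreal (norm (f y - P y) powr s) \<partial>lborel)
             \<le> ennreal ((2 ^ j * (4 * l)) ^ CARD('n) * (N * (2 ^ j * (4 * l)) powr \<sigma>) powr s)"
        using osc by blast
      have "j = J \<longrightarrow> P = (\<lambda>_. 0)" using P(2) J by auto
      with P show "\<exists>P\<in>poly_space d'. (j = J \<longrightarrow> P = (\<lambda>_. 0)) \<and>
         (\<integral>\<^sup>+y\<in>cube x0 (2 ^ j * (4 * l)). ennreal (norm (f y - P y) powr s) \<partial>lborel)
            \<le> ennreal ((2 ^ j * (4 * l)) ^ CARD('n) * (N * (2 ^ j * (4 * l)) powr \<sigma>) powr s)" by blast
    qed (use l in simp)
    then obtain R where R: "R \<in> poly_space d"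
      and R1: "(\<integral>\<^sup>+y\<in>cube x0 (4 * l). ennreal (norm (f y - R y) powr s) \<partial>lborel)
            \<le> ennreal ((4 * l) ^ CARD('n) * (C1 * N * (4 * l) powr \<sigma>) powr s)"
      and R2: "\<And>j. j \<le> J \<Longrightarrow> (\<integral>\<^sup>+y\<in>cube x0 (2 ^ j * (4 * l)). ennreal (norm (f y - R y)) \<partial>lborel)
            \<le> ennreal (C1 * N * (4 * l) powr \<sigma> * 2 powr (real j * (\<sigma> + \<delta>)) * (2 ^ j * (4 * l)) ^ CARD('n))"
      by blast
    have [measurable]: "R \<in> borel_measurable borel" by (rule poly_space_borel[OF R])
    define M where "M = C1 * N * (4 * l) powr \<sigma>"
    have M: "0 \<le> M" using C1 N by (simp add: M_def)
    define b where "b = C2 * M * l powr \<alpha>"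
    have b: "0 \<le> b" using C2 M by (simp add: b_def)
    obtain T where T: "T \<in> poly_space d" and near: "\<And>x. x \<in> cube x0 l \<Longrightarrow>
         ennreal (norm (pot f x - T x))
           \<le> (\<integral>\<^sup>+y\<in>cube x0 (4 * l). ennreal (norm (k (x - y))) * ennreal (norm (f y - R y)) \<partial>lborel) + ennreal b"
      using C2(2)[OF f R l(1) less_imp_le[OF l(2)] M _ J(1), of "\<sigma> + \<delta>" x0] R2 gap by (auto simp: M_def b_def)
    \<comment> \<open>The sup distance is at most l / 2 + 2 l, so the near part sees the kernel only
      on a cube of side 5 l; its mass there supplies the factor l^\<alpha>.\<close>
    have sub: "infnorm (x - y) \<le> 5 * l / 2 \<or> k (x - y) = 0" if "x \<in> cube x0 l" "y \<in> cube x0 (4 * l)" for x y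
      using that infnorm_triangle[of "x - x0" "x0 - y"] infnorm_sub[of x0 y] l by (auto simp: mem_cube_iff)
    have gm: "(\<lambda>y. f y - R y) \<in> borel_measurable borel" by measurable
    obtain H where H [measurable]: "H \<in> borel_measurable borel" and
      H1: "\<And>x v. x \<in> cube x0 l \<Longrightarrow> 0 \<le> v \<Longrightarrow>
         ennreal v \<le> (\<integral>\<^sup>+y\<in>cube x0 (4 * l). ennreal (norm (k (x - y))) * ennreal (norm (f y - R y)) \<partial>lborel) \<Longrightarrow>
         ennreal (v powr s) \<le> H x" and
      H2: "(\<integral>\<^sup>+x. H x \<partial>lborel) \<le> ennreal ((2 * K1 * (5 * l) powr \<alpha>) powr s) *
         (\<integral>\<^sup>+y\<in>cube x0 (4 * l). ennreal (norm (f y - R y) powr s) \<partial>lborel)"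
      by (rule kernel_convolution_Ls[OF gm s _ sub, of "cube x0 l" "cube x0 (4 * l)"]) (use l in auto)
    define A where "A = 4 ^ CARD('n) * (2 * ((2 * K1 * (5 * l) powr \<alpha>) * M))"
    have A: "0 \<le> A" using K1 M by (simp add: A_def)
    have "(\<integral>\<^sup>+x\<in>cube x0 l. ennreal (norm (pot f x - T x) powr s) \<partial>lborel)
        \<le> ennreal (l ^ CARD('n) * (2 * (A + 2 * b)) powr s)"
    proof (rule nn_integral_powr_add_bound[OF l(1) s A])
      show "(\<lambda>x. ennreal (2 powr s) * H x) \<in> borel_measurable borel" by measurable
      have "(\<integral>\<^sup>+x\<in>cube x0 l. ennreal (2 powr s) * H x \<partial>lborel) \<le> (\<integral>\<^sup>+x. ennreal (2 powr s) * H x \<partial>lborel)"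
        by (intro nn_integral_mono) (auto simp: indicator_def)
      also have "\<dots> = ennreal (2 powr s) * (\<integral>\<^sup>+x. H x \<partial>lborel)" by (rule nn_integral_cmult) measurable
      also have "\<dots> \<le> ennreal (2 powr s) * (ennreal ((2 * K1 * (5 * l) powr \<alpha>) powr s) * ennreal ((4 * l) ^ CARD('n) * M powr s))"
        using R1 by (intro mult_left_mono order_trans[OF H2]) (auto simp: M_def)
      also have "\<dots> = ennreal (l ^ CARD('n) * (4 ^ CARD('n) * (2 powr s * ((2 * K1 * (5 * l) powr \<alpha>) powr s * M powr s))))"
        using l by (simp add: ennreal_mult[symmetric] power_mult_distrib mult_ac)
      also have "\<dots> \<le> ennreal (l ^ CARD('n) * A powr s)"
      proof (intro ennreal_leI mult_left_mono)
        \<comment> \<open>The ratio 4^n of the volumes is at least 1 and s > 1, so it can be moved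
          inside the s-th power.\<close>
        have "(4::real) ^ CARD('n) = (4 ^ CARD('n)) powr 1" by simp
        also have "\<dots> \<le> (4 ^ CARD('n)) powr s" using s by (intro powr_mono) auto
        finally have "4 ^ CARD('n) * (2 powr s * ((2 * K1 * (5 * l) powr \<alpha>) powr s * M powr s))
           \<le> (4 ^ CARD('n)) powr s * (2 powr s * ((2 * K1 * (5 * l) powr \<alpha>) powr s * M powr s))"
          by (intro mult_right_mono) auto
        also have "\<dots> = A powr s" unfolding A_def using K1 M by (simp only: powr_mult)
        finally show "4 ^ CARD('n) * (2 powr s * ((2 * K1 * (5 * l) powr \<alpha>) powr s * M powr s)) \<le> A powr s" .
      qed (use l in simp)
      finally show "(\<integral>\<^sup>+x\<in>cube x0 l. ennreal (2 powr s) * H x \<partial>lborel) \<le> ennreal (l ^ CARD('n) * A powr s)" .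
      fix x assume x: "x \<in> cube x0 l"
      define v where "v = norm (pot f x - T x)"
      have v: "0 \<le> v" by (simp add: v_def)
      show "ennreal (norm (pot f x - T x) powr s) \<le> ennreal (2 powr s) * H x + ennreal ((2 * b) powr s)"
      \<comment> \<open>If the far error \<open>b\<close> does not account for half of
        \<open>v\<close>, the near integral is at least v / 2, and Young's inequality is applied to
        this real number instead of the possibly infinite integral.\<close>
      proof (cases "v \<le> 2 * b")
        case True
        then have "v powr s \<le> (2 * b) powr s" using v s by (intro powr_mono2) auto
        then show ?thesis unfolding v_def[symmetric] by (intro add_increasing ennreal_leI) auto
      next
        case False
        have "ennreal (v / 2) \<le> (\<integral>\<^sup>+y\<in>cube x0 (4 * l). ennreal (norm (k (x - y))) * ennreal (norm (f y - R y)) \<partial>lborel)"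
          (is "_ \<le> ?I")
        proof (rule ccontr)
          assume "\<not> ennreal (v / 2) \<le> ?I"
          then have lt: "?I < ennreal (v / 2)" by simp
          then obtain i where i: "?I = ennreal i" "0 \<le> i" by (cases ?I) auto
          then have "i < v / 2" using lt v by (simp add: ennreal_less_iff)
          moreover have "v \<le> i + b" using near[OF x] i b v_def by (simp add: ennreal_plus[symmetric] del: ennreal_plus)
          ultimately show False using False by simp
        qed
        from H1[OF x _ this] v have "ennreal ((v / 2) powr s) \<le> H x" by simp
        from mult_left_mono[OF this, of "ennreal (2 powr s)"]
        have "ennreal (2 powr s * (v / 2) powr s) \<le> ennreal (2 powr s) * H x" by (simp add: ennreal_mult)
        also have "2 powr s * (v / 2) powr s = v powr s" using v by (simp add: powr_divide)
        finally show ?thesis unfolding v_def[symmetric] by (intro add_increasing2) auto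
      qed
    qed (use b in simp)
    also have "\<dots> \<le> ennreal (l ^ CARD('n) * (2 * (c1 + c2) * N * l powr (\<sigma> + \<alpha>)) powr s)"
    proof (intro ennreal_leI mult_left_mono powr_mono2)
      have "4 powr \<sigma> \<le> 4 powr S" using \<sigma> by (intro powr_mono) auto
      then have M_le: "M \<le> C1 * N * (4 powr S * l powr \<sigma>)"
        unfolding M_def using C1 N l by (intro mult_left_mono) (auto simp: powr_mult intro!: mult_right_mono)
      have "A \<le> 4 ^ CARD('n) * (2 * ((2 * K1 * (5 * l) powr \<alpha>) * (C1 * N * (4 powr S * l powr \<sigma>))))"
        unfolding A_def using K1 by (intro mult_left_mono M_le) auto
      also have "\<dots> = c1 * N * l powr (\<sigma> + \<alpha>)" using l by (simp add: c1_def powr_mult powr_add mult_ac)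
      finally have 1: "A \<le> c1 * N * l powr (\<sigma> + \<alpha>)" .
      have "b \<le> C2 * (C1 * N * (4 powr S * l powr \<sigma>)) * l powr \<alpha>"
        unfolding b_def using C2 by (intro mult_right_mono mult_left_mono M_le) auto
      then have 2: "2 * b \<le> c2 * N * l powr (\<sigma> + \<alpha>)" by (simp add: c2_def powr_add mult_ac)
      show "2 * (A + 2 * b) \<le> 2 * (c1 + c2) * N * l powr (\<sigma> + \<alpha>)"
        using add_mono[OF 1 2] by (simp add: algebra_simps)
    qed (use A b s l in auto)
    finally show "\<exists>T\<in>poly_space d. (\<integral>\<^sup>+x\<in>cube x0 l. ennreal (norm (pot f x - T x) powr s) \<partial>lborel)
             \<le> ennreal (l ^ CARD('n) * (2 * (c1 + c2) * N * l powr (\<sigma> + \<alpha>)) powr s)"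
      using T by blast
  qed
qed

text \<open>The kernel reaches a sup distance of 1, so the potential on a cube of side
  \<open>l\<close> depends on \<open>f\<close> only in the cube of side l + 2. For l \<ge> 1 the two
  volumes differ at most by 3^n.\<close>

lemma pot_large_cube:
  assumes f [measurable]: "f \<in> borel_measurable borel" and s: "1 < s" and l: "1 \<le> l" and B: "0 \<le> B"
    and I: "(\<integral>\<^sup>+y\<in>cube x0 (l + 2). ennreal (norm (f y) powr s) \<partial>lborel) \<le> ennreal ((l + 2) ^ CARD('n) * B powr s)"
  shows "(\<integral>\<^sup>+x\<in>cube x0 l. ennreal (norm (pot f x) powr s) \<partial>lborel)
     \<le> ennreal (l ^ CARD('n) * (3 ^ CARD('n) * (2 * K1 * 2 powr \<alpha>) * B) powr s)"
proof -
  have sub: "infnorm (x - y) \<le> 2 / 2 \<or> k (x - y) = 0" for x y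
    using k_supp[of "x - y"] by (auto simp: mem_cube_iff)
  obtain H where H [measurable]: "H \<in> borel_measurable borel" and
      H1: "\<And>x v. x \<in> cube x0 l \<Longrightarrow> 0 \<le> v \<Longrightarrow>
         ennreal v \<le> (\<integral>\<^sup>+y\<in>cube x0 (l + 2). ennreal (norm (k (x - y))) * ennreal (norm (f y)) \<partial>lborel) \<Longrightarrow>
         ennreal (v powr s) \<le> H x" and
      H2: "(\<integral>\<^sup>+x. H x \<partial>lborel) \<le> ennreal ((2 * K1 * 2 powr \<alpha>) powr s) *
         (\<integral>\<^sup>+y\<in>cube x0 (l + 2). ennreal (norm (f y) powr s) \<partial>lborel)"
    by (rule kernel_convolution_Ls[OF f s _ sub, where X="cube x0 l" and Y="cube x0 (l + 2)"]) auto
  have "(\<integral>\<^sup>+x\<in>cube x0 l. ennreal (norm (pot f x) powr s) \<partial>lborel) \<le> (\<integral>\<^sup>+x. H x \<partial>lborel)"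
  proof (rule nn_integral_mono)
    fix x
    show "ennreal (norm (pot f x) powr s) * indicator (cube x0 l) x \<le> H x"
    proof (cases "x \<in> cube x0 l")
      case True
      have "cube x 2 \<subseteq> cube x0 (l + 2)"
      proof
        fix y assume "y \<in> cube x 2"
        then show "y \<in> cube x0 (l + 2)"
          using True infnorm_triangle[of "y - x" "x - x0"] by (auto simp: mem_cube_iff)
      qed
      then have "ennreal (norm (pot f x)) \<le> (\<integral>\<^sup>+y\<in>cube x0 (l + 2). ennreal (norm (k (x - y))) * ennreal (norm (f y)) \<partial>lborel)"
        by (intro order_trans[OF norm_pot_le[OF f]] nn_integral_mono) (auto simp: indicator_def)
      from H1[OF True _ this] show ?thesis using True by simp
    qed simp
  qed
  also have "\<dots> \<le> ennreal ((2 * K1 * 2 powr \<alpha>) powr s) * ennreal ((l + 2) ^ CARD('n) * B powr s)"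
    by (intro order_trans[OF H2] mult_left_mono I) auto
  also have "\<dots> = ennreal ((l + 2) ^ CARD('n) * ((2 * K1 * 2 powr \<alpha>) powr s * B powr s))"
    using l by (simp add: ennreal_mult[symmetric] mult_ac)
  also have "\<dots> \<le> ennreal (l ^ CARD('n) * ((3 ^ CARD('n)) powr s * ((2 * K1 * 2 powr \<alpha>) powr s * B powr s)))"
  proof (rule ennreal_leI)
    have "(l + 2) ^ CARD('n) \<le> (3 * l) ^ CARD('n)" using l by (intro power_mono) auto
    also have "\<dots> = l ^ CARD('n) * (3 ^ CARD('n)) powr 1" by (simp add: power_mult_distrib)
    also have "\<dots> \<le> l ^ CARD('n) * (3 ^ CARD('n)) powr s" using s l by (intro mult_left_mono powr_mono) auto
    finally have "(l + 2) ^ CARD('n) * ((2 * K1 * 2 powr \<alpha>) powr s * B powr s)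
      \<le> l ^ CARD('n) * (3 ^ CARD('n)) powr s * ((2 * K1 * 2 powr \<alpha>) powr s * B powr s)"
      by (rule mult_right_mono) auto
    then show "(l + 2) ^ CARD('n) * ((2 * K1 * 2 powr \<alpha>) powr s * B powr s)
      \<le> l ^ CARD('n) * ((3 ^ CARD('n)) powr s * ((2 * K1 * 2 powr \<alpha>) powr s * B powr s))" by (simp only: mult.assoc)
  qed
  also have "(3 ^ CARD('n)) powr s * ((2 * K1 * 2 powr \<alpha>) powr s * B powr s)
      = (3 ^ CARD('n) * ((2 * K1 * 2 powr \<alpha>) * B)) powr s"
    using K1 B by (simp only: powr_mult)
  finally show ?thesis by (simp only: mult.assoc)
qed

text \<open>A Morrey bound at every centre makes the potential finite at every point, with the
  positive exponent \<alpha> - n + n v(x) at the centre \<open>x\<close>. The approximating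
  polynomial \<open>R\<close> in \<open>pot_local\<close> is 0, and the averages of |f| grow at the
  rate \<tau> = n v(x0) - n.\<close>

lemma pot_bounds_morrey:
  assumes \<gamma>: "0 < \<gamma>" and \<delta>: "0 < \<delta>" and L: "0 \<le> L"
  obtains C :: real where "0 \<le> C"
    "\<And>f N v. f \<in> borel_measurable borel \<Longrightarrow> 0 \<le> N \<Longrightarrow>
       (\<forall>x t. 0 < t \<and> t \<le> 8 \<longrightarrow> (\<integral>\<^sup>+y\<in>cube x t. ennreal (norm (f y)) \<partial>lborel) \<le> ennreal (N * t powr (n * v x))) \<Longrightarrow>
       (\<forall>x. \<gamma> \<le> \<alpha> - n + n * v x \<and> \<alpha> - n + n * v x \<le> S \<and> \<alpha> - n + n * v x + \<delta> \<le> real (Suc d)) \<Longrightarrow>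
       (\<forall>x y t. 0 < t \<and> t \<le> 8 \<and> norm (x - y) \<le> n * t \<longrightarrow> \<bar>(v y - v x) * ln t\<bar> \<le> L) \<Longrightarrow>
       (\<forall>x. norm (pot f x) \<le> C * N) \<and>
       (\<forall>x0 l. 0 < l \<and> l < 1 \<longrightarrow> (\<exists>T\<in>poly_space d. \<forall>x\<in>cube x0 l. norm (pot f x - T x) \<le> C * N * l powr (\<alpha> - n + n * v x0)))"
proof -
  obtain C2 :: real where C2: "0 \<le> C2"
    "\<And>f R x0 l M \<tau> J. f \<in> borel_measurable borel \<Longrightarrow> R \<in> poly_space d \<Longrightarrow> 0 < l \<Longrightarrow> l \<le> 1 \<Longrightarrow> 0 \<le> M \<Longrightarrow>
       \<alpha> + \<tau> + \<delta> \<le> real (Suc d) \<Longrightarrow> 3 \<le> 2 ^ J * (4 * l) \<Longrightarrow>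
       (\<And>j. j \<le> J \<Longrightarrow> (\<integral>\<^sup>+y\<in>cube x0 (2 ^ j * (4 * l)). ennreal (norm (f y - R y)) \<partial>lborel)
          \<le> ennreal (M * 2 powr (real j * \<tau>) * (2 ^ j * (4 * l)) ^ CARD('n))) \<Longrightarrow>
       \<exists>T\<in>poly_space d. \<forall>x\<in>cube x0 l.
         ennreal (norm (pot f x - T x))
           \<le> (\<integral>\<^sup>+y\<in>cube x0 (4 * l). ennreal (norm (k (x - y))) * ennreal (norm (f y - R y)) \<partial>lborel)
             + ennreal (C2 * M * l powr \<alpha>)"
    by (rule pot_local[OF \<delta>]) blast
  define D where "D = Ck * 4 powr n / (1 - 2 powr (- \<gamma>))"
  have D: "0 < D" using Ck \<gamma> by (auto simp: D_def powr_less_one intro!: divide_pos_pos mult_pos_pos)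
  define C where "C = D * 5 powr S * exp (n * L) + C2 * 4 powr S"
  have n0: "0 < n" using \<alpha> by simp
  have C: "D * 5 powr S \<le> C"
  proof -
    have "D * 5 powr S * 1 \<le> D * 5 powr S * exp (n * L)" using D n0 L by (intro mult_left_mono) auto
    then show ?thesis using C2(1) by (simp add: C_def add_increasing2)
  qed
  show thesis
  proof (rule that[of C])
    show "0 \<le> C" using D C2(1) by (simp add: C_def)
    fix f :: "real^'n \<Rightarrow> complex" and N and v :: "real^'n \<Rightarrow> real"
    assume f [measurable]: "f \<in> borel_measurable borel" and N: "0 \<le> N"
      and If: "\<forall>x t. 0 < t \<and> t \<le> 8 \<longrightarrow> (\<integral>\<^sup>+y\<in>cube x t. ennreal (norm (f y)) \<partial>lborel) \<le> ennreal (N * t powr (n * v x))"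
      and v: "\<forall>x. \<gamma> \<le> \<alpha> - n + n * v x \<and> \<alpha> - n + n * v x \<le> S \<and> \<alpha> - n + n * v x + \<delta> \<le> real (Suc d)"
      and osc: "\<forall>x y t. 0 < t \<and> t \<le> 8 \<and> norm (x - y) \<le> n * t \<longrightarrow> \<bar>(v y - v x) * ln t\<bar> \<le> L"
    define \<beta> where "\<beta> x = \<alpha> - n + n * v x" for x
    have \<beta>: "\<gamma> \<le> \<beta> x" "\<beta> x \<le> S" "\<beta> x + \<delta> \<le> real (Suc d)" for x using v by (auto simp: \<beta>_def)
    have near: "(\<integral>\<^sup>+y\<in>cube x \<rho>. ennreal (norm (k (x - y))) * ennreal (norm (f y)) \<partial>lborel) \<le> ennreal (D * N * \<rho> powr \<beta> x)"
      if "0 < \<rho>" "\<rho> \<le> 8" for x \<rho>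
      unfolding D_def \<beta>_def
      by (rule kernel_cube_bound[where F="\<lambda>y. ennreal (norm (f y))" and b="n * v x"])
         (use that N \<gamma> \<beta>[of x] If in \<open>auto simp: \<beta>_def\<close>)
    have "norm (pot f x) \<le> C * N" for x
    proof -
      have "ennreal (norm (pot f x)) \<le> ennreal (D * N * 2 powr \<beta> x)"
        using norm_pot_le[OF f, of x] near[of 2 x] by (auto intro: order_trans)
      then have "norm (pot f x) \<le> D * N * 2 powr \<beta> x" using D N by simp
      also have "\<dots> \<le> D * N * 5 powr S"
      proof (intro mult_left_mono)
        have "(2::real) powr \<beta> x \<le> 2 powr S" using \<beta> by (intro powr_mono) auto
        also have "\<dots> \<le> 5 powr S" using \<gamma> \<beta>[of x] by (intro powr_mono2) auto
        finally show "(2::real) powr \<beta> x \<le> 5 powr S" .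
      qed (use D N in auto)
      also have "\<dots> = D * 5 powr S * N" by simp
      also have "\<dots> \<le> C * N" using C N by (rule mult_right_mono)
      finally show ?thesis .
    qed
    moreover have "\<exists>T\<in>poly_space d. \<forall>x\<in>cube x0 l. norm (pot f x - T x) \<le> C * N * l powr \<beta> x0"
      if l: "0 < l" "l < 1" for x0 l
    proof -
      obtain J where J: "3 \<le> 2 ^ J * (4 * l)" "2 ^ J * (4 * l) \<le> 8"
        using ex_dyadic_scale[of l] l by auto
      define \<tau> where "\<tau> = n * v x0 - n"
      define M where "M = N * (4 * l) powr \<tau>"
      have M: "0 \<le> M" using N by (simp add: M_def)
      have "\<exists>T\<in>poly_space d. \<forall>x\<in>cube x0 l.
         ennreal (norm (pot f x - T x))
           \<le> (\<integral>\<^sup>+y\<in>cube x0 (4 * l). ennreal (norm (k (x - y))) * ennreal (norm (f y - 0)) \<partial>lborel)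
             + ennreal (C2 * M * l powr \<alpha>)"
      proof (rule C2(2)[OF f poly_space_zero l(1) less_imp_le[OF l(2)] M _ J(1)])
        show "\<alpha> + \<tau> + \<delta> \<le> real (Suc d)" using \<beta>(3)[of x0] by (simp add: \<tau>_def \<beta>_def)
        fix j assume j: "j \<le> J"
        define t where "t = 2 ^ j * (4 * l)"
        have "t \<le> 2 ^ J * (4 * l)" unfolding t_def using j l by (intro mult_right_mono power_increasing) auto
        then have t: "t \<le> 8" "0 < t" using J(2) l by (linarith, simp add: t_def)
        then have "(\<integral>\<^sup>+y\<in>cube x0 t. ennreal (norm (f y)) \<partial>lborel) \<le> ennreal (N * t powr (n * v x0))" using If by blast
        also have "t powr (n * v x0) = t powr \<tau> * t ^ CARD('n)"
        proof -
          have "t ^ CARD('n) = t powr n" using t by (simp add: n_def powr_realpow)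
          then show ?thesis by (simp add: powr_add[symmetric] \<tau>_def)
        qed
        also have "t powr \<tau> = 2 powr (real j * \<tau>) * (4 * l) powr \<tau>"
          using l by (simp add: t_def powr_mult powr_realpow[symmetric] powr_powr)
        finally show "(\<integral>\<^sup>+y\<in>cube x0 (2 ^ j * (4 * l)). ennreal (norm (f y - 0)) \<partial>lborel)
          \<le> ennreal (M * 2 powr (real j * \<tau>) * (2 ^ j * (4 * l)) ^ CARD('n))"
          by (simp add: t_def M_def mult_ac)
      qed
      then obtain T where T: "T \<in> poly_space d" and Tb: "\<And>x. x \<in> cube x0 l \<Longrightarrow>
         ennreal (norm (pot f x - T x))
           \<le> (\<integral>\<^sup>+y\<in>cube x0 (4 * l). ennreal (norm (k (x - y))) * ennreal (norm (f y)) \<partial>lborel)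
             + ennreal (C2 * M * l powr \<alpha>)" by auto
      have "norm (pot f x - T x) \<le> C * N * l powr \<beta> x0" if x: "x \<in> cube x0 l" for x
      proof -
        \<comment> \<open>The near bound is for cubes centred at the pole of the kernel, so the cube
          is recentred at \<open>x\<close>. This yields the exponent at \<open>x\<close>, which
          log-Holder continuity exchanges for that at \<open>x0\<close> at the cost of exp (n
          L).\<close>
        have "cube x0 (4 * l) \<subseteq> cube x (5 * l)"
        proof
          fix y assume "y \<in> cube x0 (4 * l)"
          then show "y \<in> cube x (5 * l)"
            using x infnorm_triangle[of "y - x0" "x0 - x"] infnorm_sub[of x x0] by (auto simp: mem_cube_iff)
        qed
        then have "(\<integral>\<^sup>+y\<in>cube x0 (4 * l). ennreal (norm (k (x - y))) * ennreal (norm (f y)) \<partial>lborel)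
           \<le> (\<integral>\<^sup>+y\<in>cube x (5 * l). ennreal (norm (k (x - y))) * ennreal (norm (f y)) \<partial>lborel)"
          by (intro nn_integral_mono) (auto simp: indicator_def)
        also have "\<dots> \<le> ennreal (D * N * (5 * l) powr \<beta> x)" using l by (intro near) auto
        finally have "ennreal (norm (pot f x - T x)) \<le> ennreal (D * N * (5 * l) powr \<beta> x) + ennreal (C2 * M * l powr \<alpha>)"
          by (intro order_trans[OF Tb[OF x]] add_right_mono)
        then have b1: "norm (pot f x - T x) \<le> D * N * (5 * l) powr \<beta> x + C2 * M * l powr \<alpha>"
          using D N C2(1) M by (simp add: ennreal_plus[symmetric] del: ennreal_plus)
        have "norm (x0 - x) \<le> n * l"
        proof -
          have "norm (x0 - x) \<le> n * infnorm (x0 - x)" by (rule norm_le_n_infnorm)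
          also have "\<dots> \<le> n * l" using x infnorm_sub[of x x0] l n0 by (intro mult_left_mono) (auto simp: mem_cube_iff)
          finally show ?thesis .
        qed
        then have "\<bar>(v x - v x0) * ln l\<bar> \<le> L" using osc l by simp
        then have "\<bar>(n * (v x - v x0)) * ln l\<bar> \<le> n * L" using n0 by (simp add: abs_mult mult.assoc)
        from powr_le_exp(1)[OF l(1) this] have e: "l powr (n * (v x - v x0)) \<le> exp (n * L)" .
        have "(5 * l) powr \<beta> x = 5 powr \<beta> x * (l powr \<beta> x0 * l powr (n * (v x - v x0)))"
          using l by (simp add: powr_mult powr_add[symmetric] \<beta>_def algebra_simps)
        also have "\<dots> \<le> 5 powr S * (l powr \<beta> x0 * exp (n * L))"
          using \<beta> e by (intro mult_mono mult_left_mono powr_mono) auto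
        finally have "D * N * (5 * l) powr \<beta> x \<le> D * N * (5 powr S * (l powr \<beta> x0 * exp (n * L)))"
          using D N by (intro mult_left_mono) auto
        moreover have "C2 * M * l powr \<alpha> \<le> C2 * (N * (4 powr S * l powr \<beta> x0))"
        proof -
          have "M * l powr \<alpha> = N * (4 powr \<tau> * l powr \<beta> x0)"
            using l by (simp add: M_def powr_mult powr_add[symmetric] \<tau>_def \<beta>_def algebra_simps)
          also have "\<dots> \<le> N * (4 powr S * l powr \<beta> x0)"
            using N \<beta>(2)[of x0] \<alpha> by (intro mult_left_mono mult_right_mono powr_mono) (auto simp: \<tau>_def \<beta>_def)
          finally show ?thesis using C2(1) by (simp add: mult_left_mono mult.assoc)
        qed
        ultimately have "norm (pot f x - T x) \<le> D * N * (5 powr S * (l powr \<beta> x0 * exp (n * L))) + C2 * (N * (4 powr S * l powr \<beta> x0))"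
          using b1 by linarith
        also have "\<dots> = C * N * l powr \<beta> x0" by (simp add: C_def algebra_simps)
        finally show ?thesis .
      qed
      then show ?thesis using T by blast
    qed
    ultimately show "(\<forall>x. norm (pot f x) \<le> C * N) \<and>
       (\<forall>x0 l. 0 < l \<and> l < 1 \<longrightarrow> (\<exists>T\<in>poly_space d. \<forall>x\<in>cube x0 l. norm (pot f x - T x) \<le> C * N * l powr (\<alpha> - n + n * v x0)))"
      unfolding \<beta>_def by blast
  qed
qed

end

subsection \<open>Reduction to the potential estimates\<close>

lemma ennreal_inverse_antimono:
  assumes "a \<le> b"
  shows "inverse b \<le> inverse (a :: ennreal)"
proof (cases b)
  case b: (real s)
  show ?thesis
  proof (cases "a = 0")
    case False
    obtain r where r: "a = ennreal r" "0 \<le> r" using assms b by (cases a) (auto simp: top_unique)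
    have "0 < r" "r \<le> s" using False assms b r by (auto simp: order_less_le)
    then show ?thesis using b r by (simp add: inverse_ennreal ennreal_leI le_imp_inverse_le)
  qed simp
qed simp

lemma ennreal_ratio_le:
  assumes "ennreal w \<le> L" "0 < w" "0 \<le> m" "X \<le> ennreal B" "0 \<le> B"
  shows "ennreal m / L * X \<le> ennreal (m / w * B)"
proof -
  have "ennreal m / L \<le> ennreal m / ennreal w"
    unfolding divide_ennreal_def using assms(1) by (intro mult_left_mono ennreal_inverse_antimono) auto
  also have "\<dots> = ennreal (m / w)" using assms by (simp add: divide_ennreal)
  finally have "ennreal m / L * X \<le> ennreal (m / w) * ennreal B" using assms(4) by (intro mult_mono) auto
  then show ?thesis using assms by (simp add: ennreal_mult[symmetric])
qed

lemma ennreal_le_of_ratio_le: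
  assumes "L \<le> ennreal w" "0 < w" "0 < m" "ennreal m / L * X \<le> ennreal B" "0 \<le> B"
  shows "X \<le> ennreal (w / m * B)"
proof -
  have "ennreal (m / w) = ennreal m / ennreal w" using assms by (simp add: divide_ennreal)
  also have "\<dots> \<le> ennreal m / L"
    unfolding divide_ennreal_def using assms(1) by (intro mult_left_mono ennreal_inverse_antimono) auto
  finally have "ennreal (m / w) * X \<le> ennreal m / L * X" by (rule mult_right_mono) simp
  then have "ennreal (m / w) * X \<le> ennreal B" using assms(4) by (rule order_trans)
  then have "ennreal (w / m) * (ennreal (m / w) * X) \<le> ennreal (w / m) * ennreal B" by (rule mult_left_mono) simp
  moreover have "ennreal (w / m) * (ennreal (m / w) * X) = X"
    using assms by (simp add: mult.assoc[symmetric] ennreal_mult[symmetric])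
  ultimately show ?thesis using assms by (simp add: ennreal_mult[symmetric])
qed

lemma small_cube_side:
  assumes "Q \<in> cubes" "emeasure lebesgue (Q :: (real^'n::finite) set) < 1"
  obtains x l where "Q = cube x l" "0 < l" "l < 1"
proof -
  obtain x l where Q: "Q = cube x l" "0 < l" using assms(1) by (auto simp: cubes_def)
  have "l ^ CARD('n) < 1"
    using assms(2) Q by (simp add: emeasure_cube ennreal_less_one_iff)
  then have "l < 1" by (rule power_less1_D)
  then show thesis using that Q by blast
qed

lemma large_cube_side:
  assumes "Q \<in> cubes" "1 \<le> emeasure lebesgue (Q :: (real^'n::finite) set)"
  obtains x l where "Q = cube x l" "1 \<le> l"
proof -
  obtain x l where Q: "Q = cube x l" "0 < l" using assms(1) by (auto simp: cubes_def)
  have "1 \<le> l ^ CARD('n)"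
    using assms(2) Q by (simp add: emeasure_cube)
  moreover have "l ^ CARD('n) < 1" if "l < 1" using Q that by (simp add: power_less_one_iff)
  ultimately have "1 \<le> l" by linarith
  then show thesis using that Q by blast
qed

lemma set_integrable_lebesgue_borel:
  fixes h :: "real^'n::finite \<Rightarrow> complex"
  assumes [measurable]: "h \<in> borel_measurable borel" "Q \<in> sets borel"
    and fin: "(\<integral>\<^sup>+y\<in>Q. ennreal (norm (h y)) \<partial>lborel) < \<infinity>"
  shows "set_integrable lebesgue Q h"
  unfolding set_integrable_def
proof (subst integrable_completion)
  have "(\<integral>\<^sup>+y. ennreal (norm (indicator Q y *\<^sub>R h y)) \<partial>lborel) = (\<integral>\<^sup>+y\<in>Q. ennreal (norm (h y)) \<partial>lborel)"
    by (intro nn_integral_cong) (auto simp: indicator_def)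
  with fin show "integrable lborel (\<lambda>y. indicator Q y *\<^sub>R h y)" by (intro integrableI_bounded) auto
qed measurable

text \<open>The lower bounds for the norms of indicators turn the weight |Q| / ||\<chi>_Q|| into at
  most a multiple of l^(n - n u), which the assumed powers cancel. Any polynomial \<open>T\<close>
  may be used on a small cube, by \<open>mean_norm_poly_proj_le\<close>, and the condition on large
  cubes also gives local integrability.\<close>

lemma bmo_norm_le:
  fixes p u :: "real^'n::finite \<Rightarrow> real"
  assumes u: "log_holder K u" and ab: "\<And>x. 1 \<le> u x" "\<And>x. u x \<le> ub"
    and p: "\<And>x. p x = 1 / u x" and pm: "p \<in> borel_measurable lebesgue" and r: "1 < r"
  obtains C where "0 < C"
    "\<And>h B. h \<in> borel_measurable borel \<Longrightarrow> 0 \<le> B \<Longrightarrow>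
       (\<forall>x l. 0 < l \<and> l < 1 \<longrightarrow> (\<exists>T\<in>poly_space d.
          (\<integral>\<^sup>+y\<in>cube x l. ennreal (norm (h y - T y) powr (r / (r - 1))) \<partial>lborel)
            \<le> ennreal (l ^ CARD('n) * (B * l powr (real CARD('n) * u x - real CARD('n))) powr (r / (r - 1))))) \<Longrightarrow>
       (\<forall>x l. 1 \<le> l \<longrightarrow> (\<exists>z. (\<forall>y\<in>cube x l. norm y \<le> norm z) \<and>
          (\<integral>\<^sup>+y\<in>cube x l. ennreal (norm (h y) powr (r / (r - 1))) \<partial>lborel)
            \<le> ennreal (l ^ CARD('n) * (B * l powr (real CARD('n) * u z - real CARD('n))) powr (r / (r - 1))))) \<Longrightarrow>
       h \<in> L1_loc \<and> bmo_norm p r d h \<le> ennreal (C * B)"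
proof -
  define n where "n = real CARD('n)"
  define s where "s = r / (r - 1)"
  have s: "1 < s" using r by (simp add: s_def)
  obtain A1 where A1: "1 \<le> A1"
    "\<And>x t. 0 < t \<Longrightarrow> t \<le> 1 \<Longrightarrow> ennreal (t powr (real CARD('n) * u x) / A1) \<le> Lvar_norm p (indicat_real (cube x t))"
    by (rule Lvar_norm_small_cube[OF u zero_less_one ab p pm, where S=1], rule that)
  obtain A2 where A2: "1 \<le> A2"
    "\<And>x z l. 1 \<le> l \<Longrightarrow> \<forall>y\<in>cube x l. norm y \<le> norm z \<Longrightarrow>
        ennreal (l powr (real CARD('n) * u z) / A2) \<le> Lvar_norm p (indicat_real (cube x l))"
    by (rule Lvar_norm_large_cube[OF u zero_less_one ab p pm], rule that)
  obtain CP where CP: "0 < CP"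
    "\<And>(h :: real^'n \<Rightarrow> complex) T x l A. h \<in> borel_measurable borel \<Longrightarrow> 0 < l \<Longrightarrow> 0 \<le> A \<Longrightarrow>
       set_integrable lebesgue (cube x l) h \<Longrightarrow> T \<in> poly_space d \<Longrightarrow>
       (\<integral>\<^sup>+y\<in>cube x l. ennreal (norm (h y - T y) powr s) \<partial>lborel) \<le> ennreal (l ^ CARD('n) * A powr s) \<Longrightarrow>
       mean_norm s (cube x l) (\<lambda>y. h y - poly_proj d (cube x l) h y) \<le> ennreal (CP * A)"
    by (rule mean_norm_poly_proj_le[OF s, where d=d], rule that)
  have ratio: "l ^ CARD('n) / (l powr (n * w) / A) * (c * l powr (n * w - n)) = A * c" if "0 < l" "0 < A" for l A c w
  proof -
    have "l powr (n * w - n) = l powr (n * w) / l ^ CARD('n)" using that by (simp add: powr_diff n_def powr_realpow)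
    then show ?thesis using that by simp
  qed
  define C where "C = A1 * CP + A2"
  show thesis
  proof (rule that[of C])
    show "0 < C" using A1(1) A2(1) CP(1) by (simp add: C_def add_pos_pos)
    fix h :: "real^'n \<Rightarrow> complex" and B :: real
    assume h: "h \<in> borel_measurable borel" and B: "0 \<le> B" and
      small: "\<forall>x l. 0 < l \<and> l < 1 \<longrightarrow> (\<exists>T\<in>poly_space d.
          (\<integral>\<^sup>+y\<in>cube x l. ennreal (norm (h y - T y) powr (r / (r - 1))) \<partial>lborel)
            \<le> ennreal (l ^ CARD('n) * (B * l powr (real CARD('n) * u x - real CARD('n))) powr (r / (r - 1))))" and
      large: "\<forall>x l. 1 \<le> l \<longrightarrow> (\<exists>z. (\<forall>y\<in>cube x l. norm y \<le> norm z) \<and>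
          (\<integral>\<^sup>+y\<in>cube x l. ennreal (norm (h y) powr (r / (r - 1))) \<partial>lborel)
            \<le> ennreal (l ^ CARD('n) * (B * l powr (real CARD('n) * u z - real CARD('n))) powr (r / (r - 1))))"
    have loc: "set_integrable lebesgue K h" if K: "compact K" for K
    proof -
      obtain l where l: "1 \<le> l" "K \<subseteq> cube 0 l" by (rule bounded_imp_subset_cube[OF compact_imp_bounded[OF K]])
      obtain z where I: "(\<integral>\<^sup>+y\<in>cube 0 l. ennreal (norm (h y) powr s) \<partial>lborel)
            \<le> ennreal (l ^ CARD('n) * (B * l powr (real CARD('n) * u z - real CARD('n))) powr s)"
        using large l(1) unfolding s_def by blast
      have "(\<integral>\<^sup>+y\<in>cube 0 l. ennreal (norm (h y)) \<partial>lborel) \<le> ennreal (2 * l ^ CARD('n) * (B * l powr (real CARD('n) * u z - real CARD('n))))"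
        using l B s I h by (intro cube_L1_le_Ls[where s=s]) auto
      then have "set_integrable lebesgue (cube 0 l) h"
        by (intro set_integrable_lebesgue_borel h) (auto intro: le_less_trans)
      then show ?thesis by (rule set_integrable_subset) (use l lmeasurable_compact[OF K] in auto)
    qed
    then have L1: "h \<in> L1_loc" by (simp add: L1_loc_def)
    have S1: "(SUP Q\<in>{Q\<in>cubes. emeasure lebesgue Q < 1}. emeasure lebesgue Q / Lvar_norm p (indicat_real Q)
          * mean_norm s Q (\<lambda>x. h x - poly_proj d Q h x)) \<le> ennreal (A1 * (CP * B))"
    proof (rule SUP_least)
      fix Q :: "(real^'n) set" assume "Q \<in> {Q \<in> cubes. emeasure lebesgue Q < 1}"
      then have "Q \<in> cubes" "emeasure lebesgue Q < 1" by auto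
      then obtain x l where Q: "Q = cube x l" "0 < l" "l < 1" by (rule small_cube_side)
      obtain T where T: "T \<in> poly_space d" "(\<integral>\<^sup>+y\<in>cube x l. ennreal (norm (h y - T y) powr s) \<partial>lborel)
            \<le> ennreal (l ^ CARD('n) * (B * l powr (n * u x - n)) powr s)"
        using small Q unfolding s_def n_def by blast
      have "mean_norm s Q (\<lambda>y. h y - poly_proj d Q h y) \<le> ennreal (CP * (B * l powr (n * u x - n)))"
        unfolding Q(1) using T B h Q by (intro CP(2) loc compact_cube) auto
      then have le: "ennreal (l ^ CARD('n)) / Lvar_norm p (indicat_real Q) * mean_norm s Q (\<lambda>x. h x - poly_proj d Q h x)
         \<le> ennreal (l ^ CARD('n) / (l powr (n * u x) / A1) * (CP * (B * l powr (n * u x - n))))"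
        using A1 Q CP(1) B by (intro ennreal_ratio_le) (auto simp: n_def)
      then show "emeasure lebesgue Q / Lvar_norm p (indicat_real Q)
          * mean_norm s Q (\<lambda>x. h x - poly_proj d Q h x) \<le> ennreal (A1 * (CP * B))"
      proof -
        have "l ^ CARD('n) / (l powr (n * u x) / A1) * (CP * (B * l powr (n * u x - n))) = A1 * (CP * B)"
          using ratio[where l=l and A=A1 and c="CP * B" and w="u x"] Q A1(1) by (simp only: mult.assoc)
        then show ?thesis using le Q by (simp add: emeasure_cube)
      qed
    qed
    have S2: "(SUP Q\<in>{Q\<in>cubes. emeasure lebesgue Q \<ge> 1}. emeasure lebesgue Q / Lvar_norm p (indicat_real Q)
          * mean_norm s Q h) \<le> ennreal (A2 * B)"
    proof (rule SUP_least)
      fix Q :: "(real^'n) set" assume "Q \<in> {Q \<in> cubes. 1 \<le> emeasure lebesgue Q}"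
      then have "Q \<in> cubes" "1 \<le> emeasure lebesgue Q" by auto
      then obtain x l where Q: "Q = cube x l" "1 \<le> l" by (rule large_cube_side)
      obtain z where z: "\<forall>y\<in>cube x l. norm y \<le> norm z" "(\<integral>\<^sup>+y\<in>cube x l. ennreal (norm (h y) powr s) \<partial>lborel)
            \<le> ennreal (l ^ CARD('n) * (B * l powr (n * u z - n)) powr s)"
        using large Q unfolding s_def n_def by blast
      have "mean_norm s Q h \<le> ennreal (B * l powr (n * u z - n))"
        unfolding Q(1) using z B Q s by (subst mean_norm_le_iff) auto
      then have le: "ennreal (l ^ CARD('n)) / Lvar_norm p (indicat_real Q) * mean_norm s Q h
         \<le> ennreal (l ^ CARD('n) / (l powr (n * u z) / A2) * (B * l powr (n * u z - n)))"
        using A2(1) A2(2)[OF Q(2) z(1)] Q B by (intro ennreal_ratio_le) (auto simp: n_def)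
      then show "emeasure lebesgue Q / Lvar_norm p (indicat_real Q) * mean_norm s Q h \<le> ennreal (A2 * B)"
        using le ratio[where l=l and A=A2 and c=B and w="u z"] Q A2(1) by (simp add: emeasure_cube)
    qed
    have "bmo_norm p r d h \<le> ennreal (A1 * (CP * B)) + ennreal (A2 * B)"
      unfolding bmo_norm_def Let_def s_def[symmetric] by (intro add_mono S1 S2)
    also have "\<dots> = ennreal (C * B)"
      using A1(1) A2(1) CP(1) B by (simp add: ennreal_plus[symmetric] C_def algebra_simps del: ennreal_plus)
    finally show "h \<in> L1_loc \<and> bmo_norm p r d h \<le> ennreal (C * B)" using L1 by simp
  qed
qed

text \<open>The converse reading of the norm, with the upper bounds for the norms of indicators. For
  1 \<le> t \<le> 8 the second supremum applies and gives P = 0, yet the power of \<open>t\<close>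
  is still governed by the exponent at the centre. The projection is that of \<open>f\<close>
  itself; only the final integral passes to the Borel version \<open>f0\<close>.\<close>

lemma bmo_cube_bounds:
  fixes q v :: "real^'n::finite \<Rightarrow> real"
  assumes v: "log_holder K v" and ab: "\<And>x. 1 \<le> v x" "\<And>x. v x \<le> vb"
    and q: "\<And>x. q x = 1 / v x" and qm: "q \<in> borel_measurable lebesgue" and r: "1 < r"
  obtains A where "1 \<le> A"
    "\<And>f f0 N. f \<in> L1_loc \<Longrightarrow> (AE x in lebesgue. f x = f0 x) \<Longrightarrow> bmo_norm q r d f \<le> ennreal N \<Longrightarrow> 0 \<le> N \<Longrightarrow>
       (\<forall>x t. 0 < t \<and> t \<le> 8 \<longrightarrow> (\<exists>P\<in>poly_space d. (1 \<le> t \<longrightarrow> P = (\<lambda>_. 0)) \<and>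
          (\<integral>\<^sup>+y\<in>cube x t. ennreal (norm (f0 y - P y) powr (r / (r - 1))) \<partial>lborel)
             \<le> ennreal (t ^ CARD('n) * (A * N * t powr (real CARD('n) * v x - real CARD('n))) powr (r / (r - 1))))) \<and>
       (\<forall>x l z. 1 \<le> l \<and> (\<forall>y\<in>cube x l. norm y \<le> norm z) \<longrightarrow>
          (\<integral>\<^sup>+y\<in>cube x l. ennreal (norm (f0 y) powr (r / (r - 1))) \<partial>lborel)
             \<le> ennreal (l ^ CARD('n) * (A * N * l powr (real CARD('n) * v z - real CARD('n))) powr (r / (r - 1))))"
proof -
  define n where "n = real CARD('n)"
  define s where "s = r / (r - 1)"
  have s: "1 < s" using r by (simp add: s_def)
  obtain A1 where A1: "1 \<le> A1"
    "\<And>x t. 0 < t \<Longrightarrow> t \<le> 8 \<Longrightarrow> Lvar_norm q (indicat_real (cube x t)) \<le> ennreal (A1 * t powr (real CARD('n) * v x))"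
    by (rule Lvar_norm_small_cube[OF v zero_less_one ab q qm, where S=8], rule that)
  obtain A2 where A2: "1 \<le> A2"
    "\<And>x z l. 1 \<le> l \<Longrightarrow> \<forall>y\<in>cube x l. norm y \<le> norm z \<Longrightarrow>
        Lvar_norm q (indicat_real (cube x l)) \<le> ennreal (A2 * l powr (real CARD('n) * v z))"
    by (rule Lvar_norm_large_cube[OF v zero_less_one ab q qm], rule that)
  define A where "A = A1 + A2"
  have A: "A1 \<le> A" "A2 \<le> A" "1 \<le> A" using A1(1) A2(1) by (auto simp: A_def)
  show thesis
  proof (rule that[OF A(3)])
    fix f f0 and N :: real
    assume f: "f \<in> L1_loc" and ae: "AE x in lebesgue. f x = f0 x" and fN: "bmo_norm q r d f \<le> ennreal N" and N: "0 \<le> N"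
    have key: "(\<integral>\<^sup>+y\<in>cube x l. ennreal (norm (f0 y - P y) powr s) \<partial>lborel)
        \<le> ennreal (l ^ CARD('n) * (A * N * l powr (n * w - n)) powr s)"
      if l: "0 < l" and le: "emeasure lebesgue (cube x l) / Lvar_norm q (indicat_real (cube x l)) * mean_norm s (cube x l) (\<lambda>y. f y - P y) \<le> ennreal N"
        and Lv: "Lvar_norm q (indicat_real (cube x l)) \<le> ennreal (a * l powr (n * w))" and a: "0 < a" "a \<le> A" for x l w P a
    proof -
      have "mean_norm s (cube x l) (\<lambda>y. f y - P y) \<le> ennreal (a * l powr (n * w) / l ^ CARD('n) * N)"
        using le l a N by (intro ennreal_le_of_ratio_le[OF Lv]) (auto simp: emeasure_cube)
      also have "a * l powr (n * w) / l ^ CARD('n) * N = a * N * l powr (n * w - n)"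
        using l by (simp add: powr_diff n_def powr_realpow)
      also have "ennreal (a * N * l powr (n * w - n)) \<le> ennreal (A * N * l powr (n * w - n))"
        using a N by (intro ennreal_leI mult_right_mono) auto
      finally have "(\<integral>\<^sup>+y\<in>cube x l. ennreal (norm (f y - P y) powr s) \<partial>lborel)
          \<le> ennreal (l ^ CARD('n) * (A * N * l powr (n * w - n)) powr s)"
        using l A N s by (subst (asm) mean_norm_le_iff) auto
      also have "(\<integral>\<^sup>+y\<in>cube x l. ennreal (norm (f y - P y) powr s) \<partial>lborel) = (\<integral>\<^sup>+y\<in>cube x l. ennreal (norm (f0 y - P y) powr s) \<partial>lborel)"
        using ae unfolding AE_completion_iff by (intro nn_integral_cong_AE) auto
      finally show ?thesis .
    qed
    have small: "\<exists>P\<in>poly_space d. emeasure lebesgue (cube x l) / Lvar_norm q (indicat_real (cube x l)) * mean_norm s (cube x l) (\<lambda>y. f y - P y) \<le> ennreal N"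
      if l: "0 < l" "l < 1" for x l
    proof -
      let ?P = "poly_proj d (cube x l) f"
      have i: "set_integrable lebesgue (cube x l) f" using f compact_cube by (auto simp: L1_loc_def)
      have P: "?P \<in> poly_space d"
      proof -
        obtain K :: real where "\<And>(x::real^'n) t g. 0 < t \<Longrightarrow> set_integrable lebesgue (cube x t) g \<Longrightarrow>
            poly_proj d (cube x t) g \<in> poly_space d"
          by (rule poly_proj_bound[of d], rule that)
        then show ?thesis using i l by simp
      qed
      have "l ^ CARD('n) < 1" using l by (simp add: power_less_one_iff)
      then have "cube x l \<in> {Q\<in>cubes. emeasure lebesgue Q < 1}"
        using l by (auto simp: cubes_def emeasure_cube ennreal_less_one_iff)
      from SUP_upper[OF this, of "\<lambda>Q. emeasure lebesgue Q / Lvar_norm q (indicat_real Q) * mean_norm s Q (\<lambda>x. f x - poly_proj d Q f x)"]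
      have "emeasure lebesgue (cube x l) / Lvar_norm q (indicat_real (cube x l)) * mean_norm s (cube x l) (\<lambda>y. f y - ?P y) \<le> bmo_norm q r d f"
        unfolding bmo_norm_def Let_def s_def[symmetric] by (rule order_trans) simp
      then show ?thesis using P fN by (meson order_trans)
    qed
    have large: "emeasure lebesgue (cube x l) / Lvar_norm q (indicat_real (cube x l)) * mean_norm s (cube x l) (\<lambda>y. f y - 0) \<le> ennreal N"
      if l: "1 \<le> l" for x l
    proof -
      have "cube x l \<in> {Q\<in>cubes. 1 \<le> emeasure lebesgue Q}"
        using l by (auto simp: cubes_def emeasure_cube one_le_power intro!: exI[of _ x] exI[of _ l])
      from SUP_upper[OF this, of "\<lambda>Q. emeasure lebesgue Q / Lvar_norm q (indicat_real Q) * mean_norm s Q f"]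
      have "emeasure lebesgue (cube x l) / Lvar_norm q (indicat_real (cube x l)) * mean_norm s (cube x l) f \<le> bmo_norm q r d f"
        unfolding bmo_norm_def Let_def s_def[symmetric] by (rule order_trans) simp
      then show ?thesis using fN by simp
    qed
    show "(\<forall>x t. 0 < t \<and> t \<le> 8 \<longrightarrow> (\<exists>P\<in>poly_space d. (1 \<le> t \<longrightarrow> P = (\<lambda>_. 0)) \<and>
          (\<integral>\<^sup>+y\<in>cube x t. ennreal (norm (f0 y - P y) powr (r / (r - 1))) \<partial>lborel)
             \<le> ennreal (t ^ CARD('n) * (A * N * t powr (real CARD('n) * v x - real CARD('n))) powr (r / (r - 1))))) \<and>
       (\<forall>x l z. 1 \<le> l \<and> (\<forall>y\<in>cube x l. norm y \<le> norm z) \<longrightarrow>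
          (\<integral>\<^sup>+y\<in>cube x l. ennreal (norm (f0 y) powr (r / (r - 1))) \<partial>lborel)
             \<le> ennreal (l ^ CARD('n) * (A * N * l powr (real CARD('n) * v z - real CARD('n))) powr (r / (r - 1))))"
    proof (intro conjI allI impI)
      fix x :: "real^'n" and t :: real assume t: "0 < t \<and> t \<le> 8"
      then have Lv: "Lvar_norm q (indicat_real (cube x t)) \<le> ennreal (A1 * t powr (n * v x))" using A1(2) by (simp add: n_def)
      show "\<exists>P\<in>poly_space d. (1 \<le> t \<longrightarrow> P = (\<lambda>_. 0)) \<and>
          (\<integral>\<^sup>+y\<in>cube x t. ennreal (norm (f0 y - P y) powr (r / (r - 1))) \<partial>lborel)
             \<le> ennreal (t ^ CARD('n) * (A * N * t powr (real CARD('n) * v x - real CARD('n))) powr (r / (r - 1)))"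
      proof (cases "t < 1")
        case True
        then obtain P where "P \<in> poly_space d" "emeasure lebesgue (cube x t) / Lvar_norm q (indicat_real (cube x t)) * mean_norm s (cube x t) (\<lambda>y. f y - P y) \<le> ennreal N"
          using small t by blast
        then show ?thesis using key[OF _ _ Lv, of P] t True A A1(1) unfolding s_def n_def by (intro bexI[of _ P]) auto
      next
        case False
        then show ?thesis using key[OF _ large Lv] t A A1(1) unfolding s_def n_def
          by (intro bexI[OF _ poly_space_zero]) auto
      qed
    next
      fix x z :: "real^'n" and l :: real assume lz: "1 \<le> l \<and> (\<forall>y\<in>cube x l. norm y \<le> norm z)"
      then have Lv: "Lvar_norm q (indicat_real (cube x l)) \<le> ennreal (A2 * l powr (n * v z))" using A2(2) by (simp add: n_def)
      show "(\<integral>\<^sup>+y\<in>cube x l. ennreal (norm (f0 y) powr (r / (r - 1))) \<partial>lborel)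
             \<le> ennreal (l ^ CARD('n) * (A * N * l powr (real CARD('n) * v z - real CARD('n))) powr (r / (r - 1)))"
        using key[OF _ large Lv] lz A A2(1) unfolding s_def n_def by auto
    qed
  qed
qed

section \<open>Borel versions and the kernel of the local fractional integral\<close>

lemma L1_loc_measurable:
  assumes "f \<in> L1_loc"
  shows "f \<in> borel_measurable lebesgue"
proof (rule borel_measurable_LIMSEQ_metric)
  fix m :: nat
  show "(\<lambda>x. indicator (cube 0 (real m)) x *\<^sub>R f x) \<in> borel_measurable lebesgue"
    using assms compact_cube[of 0 "real m"] unfolding L1_loc_def set_integrable_def by auto
next
  fix x :: "real^'a"
  obtain M :: nat where M: "2 * infnorm x \<le> real M" using real_arch_simple by blast
  have "indicator (cube 0 (real m)) x *\<^sub>R f x = f x" if "M \<le> m" for m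
    using M that by (simp add: mem_cube_iff)
  then have "eventually (\<lambda>m. indicator (cube 0 (real m)) x *\<^sub>R f x = f x) sequentially"
    unfolding eventually_sequentially by blast
  then show "(\<lambda>m. indicator (cube 0 (real m)) x *\<^sub>R f x) \<longlonglongrightarrow> f x" by (rule tendsto_eventually)
qed

lemma lebesgue_borel_version:
  fixes f :: "real^'n::finite \<Rightarrow> complex"
  assumes f: "f \<in> borel_measurable lebesgue"
  obtains f0 where "f0 \<in> borel_measurable borel" "AE x in lebesgue. f x = f0 x"
proof -
  have "(\<lambda>x. Re (f x)) \<in> borel_measurable lebesgue" "(\<lambda>x. Im (f x)) \<in> borel_measurable lebesgue"
    using f by (auto intro: measurable_compose[OF f] borel_measurable_continuous_onI continuous_intros)
  then obtain a b where [measurable]: "a \<in> borel_measurable lborel" "b \<in> borel_measurable lborel" and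
    ae: "AE x in lborel. Re (f x) = a x" "AE x in lborel. Im (f x) = b x"
    using completion_ex_borel_measurable_real[of "\<lambda>x. Re (f x)" lborel]
      completion_ex_borel_measurable_real[of "\<lambda>x. Im (f x)" lborel] by blast
  show thesis
  proof (rule that[of "\<lambda>x. of_real (a x) + \<i> * of_real (b x)"])
    show "(\<lambda>x. of_real (a x) + \<i> * of_real (b x)) \<in> borel_measurable borel" by measurable
    show "AE x in lebesgue. f x = of_real (a x) + \<i> * of_real (b x)"
      unfolding AE_completion_iff using ae by eventually_elim (simp add: complex_eq_iff)
  qed
qed

text \<open>Composing a Lebesgue measurable \<open>f\<close> with the reflection needs preimages of
  null sets to be null, hence measurability with \<open>lebesgue\<close> on both sides.\<close>

lemma lebesgue_reflect_measurable: "(\<lambda>y. x - y) \<in> lebesgue \<rightarrow>\<^sub>M (lebesgue :: (real^'n::finite) measure)"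
proof -
  have "(\<lambda>y. x + (\<Sum>j\<in>Basis. (- 1 * (y \<bullet> j)) *\<^sub>R j)) \<in> lebesgue \<rightarrow>\<^sub>M (lebesgue :: (real^'n) measure)"
    by (rule lebesgue_affine_measurable) simp
  also have "(\<lambda>y. x + (\<Sum>j\<in>Basis. (- 1 * (y \<bullet> j)) *\<^sub>R j)) = (\<lambda>y. x - y)"
    by (simp add: fun_eq_iff sum_negf euclidean_representation)
  finally show ?thesis .
qed

lemma AE_lborel_reflect:
  assumes "AE y in lborel. P (y :: real^'n::finite)"
  shows "AE y in lborel. P (x - y)"
proof -
  obtain N where N: "{y. \<not> P y} \<subseteq> N" "N \<in> sets borel" "emeasure lborel N = 0"
    using AE_E[OF assms] by auto
  have [measurable]: "N \<in> sets borel" by fact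
  have "(\<integral>\<^sup>+y. indicator N (x - y) \<partial>lborel) = (\<integral>\<^sup>+y. indicator N y \<partial>lborel)"
    by (rule nn_integral_lborel_reflect) measurable
  also have "\<dots> = 0" using N by simp
  finally have "AE y in lborel. indicator N (x - y) = (0 :: ennreal)"
    by (subst (asm) nn_integral_0_iff_AE) auto
  then show ?thesis by eventually_elim (use N in \<open>auto simp: indicator_def split: if_splits\<close>)
qed

definition frac_kernel :: "(real^'n::finite \<Rightarrow> complex) \<Rightarrow> real \<Rightarrow> real^'n \<Rightarrow> complex" where
  "frac_kernel \<phi> \<alpha> y = \<phi> y / of_real (norm y powr (real CARD('n) - \<alpha>))"

text \<open>The kernel is a smooth function, a symbol of order 0 on every ball, times a power of the
  norm, a symbol of order \<alpha> - n.\<close>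

lemma frac_kernel_riesz:
  fixes \<phi> :: "real^'n::finite \<Rightarrow> complex"
  assumes \<phi>: "local_cutoff \<phi>" and \<alpha>: "0 < \<alpha>" "\<alpha> < real CARD('n)"
  obtains Ck where "riesz_kernel (frac_kernel \<phi> \<alpha>) \<alpha> Ck (real CARD('n))"
proof -
  define n where "n = real CARD('n)"
  have smooth: "C_k N \<phi>" for N using \<phi> by (simp add: local_cutoff_def C_infinity_def)
  have cont: "continuous_on S \<phi>" for S using smooth[of 0] by (auto intro: continuous_on_subset)
  have [measurable]: "\<phi> \<in> borel_measurable borel" by (rule borel_measurable_continuous_onI[OF cont])
  have supp: "\<phi> y = 0" if "y \<notin> cube 0 2" for y
    using \<phi> that closure_subset[of "{x. \<phi> x \<noteq> 0}"] by (auto simp: local_cutoff_def)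
  have "bounded (\<phi> ` cube 0 2)"
    by (intro compact_imp_bounded compact_continuous_image compact_cube cont)
  then obtain B where B: "\<And>y. y \<in> cube 0 2 \<Longrightarrow> norm (\<phi> y) \<le> B" by (auto simp: bounded_iff)
  have B': "norm (\<phi> y) \<le> \<bar>B\<bar> + 1" for y using B[of y] supp[of y] by (cases "y \<in> cube 0 2") auto
  \<comment> \<open>This holds at y = 0 too, where both sides are 0 by the conventions for
    \<open>powr\<close> and for division.\<close>
  have k: "frac_kernel \<phi> \<alpha> y = \<phi> y * of_real (norm y powr (\<alpha> - n))" for y
    using powr_minus[of "norm y" "n - \<alpha>"] by (simp add: frac_kernel_def n_def divide_inverse)
  show thesis
  proof (rule that, unfold_locales)
    show "0 < \<alpha>" "\<alpha> < real CARD('n)" by fact+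
    show "frac_kernel \<phi> \<alpha> \<in> borel_measurable borel" unfolding frac_kernel_def[abs_def] by measurable
    show "0 < \<bar>B\<bar> + 1" by simp
    show "norm (frac_kernel \<phi> \<alpha> y) \<le> (\<bar>B\<bar> + 1) * norm y powr (\<alpha> - real CARD('n))" for y
      using B'[of y] by (simp add: k n_def norm_mult mult_right_mono)
    show "frac_kernel \<phi> \<alpha> y = 0" if "y \<notin> cube 0 2" for y using supp[OF that] by (simp add: frac_kernel_def)
    fix N \<rho> assume \<rho>: "(0::real) < \<rho>"
    have "symbol_est N 0 \<rho> \<phi>" using C_k_symbol_est[OF smooth \<rho>, of N 0] by simp
    from symbol_est_mult[OF this symbol_est_norm_powr]
    have "symbol_est N (0 + (\<alpha> - n)) \<rho> (\<lambda>y. \<phi> y * of_real (norm y powr (\<alpha> - n)))" .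
    then show "symbol_est N (\<alpha> - real CARD('n)) \<rho> (frac_kernel \<phi> \<alpha>)"
      by (simp add: k[abs_def] n_def[symmetric] del: symbol_est.simps)
  qed simp
qed

text \<open>For each fixed \<open>x\<close> the reflected exceptional set is still null, so the two
  integrals agree at every \<open>x\<close>, also where neither integrand is integrable.\<close>

lemma (in riesz_kernel) I_loc_eq_pot:
  assumes f: "f \<in> borel_measurable lebesgue" and f0 [measurable]: "f0 \<in> borel_measurable borel"
    and ae: "AE x in lebesgue. f x = f0 x" and k: "k = frac_kernel \<phi> \<alpha>"
  shows "I_loc \<phi> \<alpha> f = pot f0"
proof
  fix x
  have "I_loc \<phi> \<alpha> f x = (LINT y|lebesgue. k y * f (x - y))"
    by (simp add: I_loc_def k frac_kernel_def)
  also have "\<dots> = (LINT y|lebesgue. k y * f0 (x - y))"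
  proof (rule integral_cong_AE)
    show "(\<lambda>y. k y * f (x - y)) \<in> borel_measurable lebesgue"
      by (intro borel_measurable_times lebesgue_borel_measurable[OF k_meas]
          measurable_compose[OF lebesgue_reflect_measurable f])
    show "(\<lambda>y. k y * f0 (x - y)) \<in> borel_measurable lebesgue"
      by (rule lebesgue_borel_measurable) measurable
    have "AE y in lborel. f (x - y) = f0 (x - y)"
      using ae unfolding AE_completion_iff by (rule AE_lborel_reflect)
    then show "AE y in lebesgue. k y * f (x - y) = k y * f0 (x - y)"
      unfolding AE_completion_iff by eventually_elim simp
  qed
  also have "\<dots> = (LINT y|lborel. k y * f0 (x - y))" by (rule integral_completion) measurable
  also have "\<dots> = pot f0 x"
    unfolding pot_def using lborel_integral_reflect[of "\<lambda>y. k (x - y) * f0 y" x] by simp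
  finally show "I_loc \<phi> \<alpha> f x = pot f0 x" .
qed

subsection \<open>Boundedness of the local fractional integral\<close>

lemma exp_inf_leD:
  fixes p :: "real^'n::finite \<Rightarrow> real"
  assumes "ereal c \<le> exp_inf p" 
  shows "c \<le> p x"
proof -
  have "exp_inf p \<le> ereal (p x)" unfolding exp_inf_def by (rule INF_lower) simp
  with assms have "ereal c \<le> ereal (p x)" by (rule order_trans)
  then show ?thesis by simp
qed

lemma exp_inf_real:
  fixes p :: "real^'n::finite \<Rightarrow> real"
  assumes "0 < exp_inf p"
  obtains m where "exp_inf p = ereal m" "0 < m"
proof -
  have "exp_inf p \<le> ereal (p 0)" unfolding exp_inf_def by (rule INF_lower) simp
  then show thesis using assms that by (cases "exp_inf p") auto
qed

lemma exp_sup_leD: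
  fixes p :: "real^'n::finite \<Rightarrow> real"
  assumes "exp_sup p \<le> ereal c"
  shows "p x \<le> c"
proof -
  have "ereal (p x) \<le> exp_sup p" unfolding exp_sup_def by (rule SUP_upper) simp
  from order_trans[OF this assms] have "ereal (p x) \<le> ereal c" .
  then show ?thesis by simp
qed

lemma exp_sup_real:
  fixes p :: "real^'n::finite \<Rightarrow> real"
  assumes "exp_sup p < \<infinity>"
  obtains M where "exp_sup p = ereal M"
proof -
  have "ereal (p 0) \<le> exp_sup p" unfolding exp_sup_def by (rule SUP_upper) simp
  then show thesis using assms that by (cases "exp_sup p") auto
qed

text \<open>The inequality m (n + d + 1) > n that defines an admissible degree, rearranged. Some
  degree satisfies it because m > 0, and it passes to every larger one.\<close>

lemma min_degree_gap:
  fixes p :: "real^'n::finite \<Rightarrow> real"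
  assumes p: "exp_inf p = ereal m" "0 < m" and d: "min_degree p \<le> d"
  shows "real CARD('n) * (1 / m - 1) < real (Suc d)"
proof -
  let ?G = "\<lambda>d. exp_inf p * ereal (real (CARD('n) + d + 1)) > ereal (real CARD('n))"
  obtain e :: nat where "real CARD('n) / m < real e" using reals_Archimedean2 by blast
  then have "real CARD('n) < m * real e" using p(2) by (simp add: field_simps)
  also have "\<dots> \<le> m * real (CARD('n) + e + 1)" using p(2) by (intro mult_left_mono) auto
  finally have "real CARD('n) < m * real (CARD('n) + e + 1)" .
  then have "?G e" by (simp add: p(1))
  then have "?G (min_degree p)" unfolding min_degree_def by (rule LeastI)
  then have "real CARD('n) < m * real (CARD('n) + min_degree p + 1)" by (simp add: p(1))
  also have "\<dots> \<le> m * real (CARD('n) + d + 1)" using d p(2) by (intro mult_left_mono) auto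
  finally have "real CARD('n) / m < real (CARD('n) + d + 1)" using p(2) by (simp add: field_simps)
  then show ?thesis by (simp add: right_diff_distrib)
qed

text \<open>Since p \<ge> m, differences of 1 / p are at most those of \<open>p\<close> divided by
  m^2. With c = \<alpha> / n the same statement covers 1 / q, so log-Holder continuity on the side
  of \<open>q\<close> is inherited from \<open>p\<close>.\<close>

lemma LH_reciprocal:
  fixes p :: "real^'n::finite \<Rightarrow> real"
  assumes p: "p \<in> LH" and m: "0 < m" "\<And>x. m \<le> p x"
  obtains K where "log_holder K (\<lambda>x. 1 / p x - c)"
proof -
  obtain C where C: "0 < C"
    "\<And>x y. 0 < norm (x - y) \<Longrightarrow> norm (x - y) \<le> 1 / 2 \<Longrightarrow> \<bar>p x - p y\<bar> \<le> C / (- ln (norm (x - y)))"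
    "\<And>x y. norm x \<le> norm y \<Longrightarrow> \<bar>p x - p y\<bar> \<le> C / ln (norm x + exp 1)"
    using p by (auto simp: LH_def)
  have rec: "\<bar>(1 / p x - c) - (1 / p y - c)\<bar> \<le> (C / m\<^sup>2) / D" if "\<bar>p x - p y\<bar> \<le> C / D" for x y D
  proof -
    have pos: "0 < p x" "0 < p y" using m by (auto intro: less_le_trans)
    have mm: "m\<^sup>2 \<le> p x * p y" unfolding power2_eq_square using m by (intro mult_mono) (auto intro: less_imp_le order_trans)
    have "\<bar>(1 / p x - c) - (1 / p y - c)\<bar> = \<bar>p x - p y\<bar> / (p x * p y)"
    proof -
      have "(1 / p x - c) - (1 / p y - c) = (p y - p x) / (p x * p y)" using pos by (simp add: field_simps)
      then show ?thesis using pos by (simp add: abs_divide abs_minus_commute)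
    qed
    also have "\<dots> \<le> \<bar>p x - p y\<bar> / m\<^sup>2" using mm m pos by (intro divide_left_mono) auto
    also have "\<dots> \<le> (C / D) / m\<^sup>2" using that by (intro divide_right_mono) auto
    finally show ?thesis by (simp add: mult.commute)
  qed
  show thesis
  proof (rule that[of "C / m\<^sup>2"])
    show "log_holder (C / m\<^sup>2) (\<lambda>x. 1 / p x - c)"
      unfolding log_holder_def
    proof (intro conjI allI impI)
      show "0 \<le> C / m\<^sup>2" using C(1) by simp
    qed (rule rec, rule C; simp)+
  qed
qed

text \<open>As e \<ge> 1, dividing by the extra factor 1 + I divides a modular of value
  \<open>I\<close> at least by 1 + I. An admissible scale is what gives membership in
  \<open>bmo\<close>: over an empty set the infimum would be infinite and the norm inequality
  void.\<close>

lemma Lvar_scale_nonempty: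
  fixes f :: "real^'n::finite \<Rightarrow> complex"
  assumes f: "f \<in> Lvar e" and e: "\<And>x. 1 \<le> e x" and [measurable]: "e \<in> borel_measurable lebesgue"
  obtains t where "0 < t" "(\<integral>\<^sup>+x. ennreal ((norm (f x) / t) powr e x) \<partial>lebesgue) \<le> 1"
proof -
  have [measurable]: "f \<in> borel_measurable lebesgue" using f by (simp add: Lvar_def)
  obtain \<epsilon> where \<epsilon>: "0 < \<epsilon>" "(\<integral>\<^sup>+x. ennreal ((\<epsilon> * norm (f x)) powr e x) \<partial>lebesgue) < \<infinity>"
    using f by (auto simp: Lvar_def)
  define I where "I = enn2real (\<integral>\<^sup>+x. ennreal ((\<epsilon> * norm (f x)) powr e x) \<partial>lebesgue)"
  have I: "(\<integral>\<^sup>+x. ennreal ((\<epsilon> * norm (f x)) powr e x) \<partial>lebesgue) = ennreal I" "0 \<le> I"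
    using \<epsilon> by (auto simp: I_def)
  define t where "t = (1 + I) / \<epsilon>"
  have t: "0 < t" using \<epsilon> I by (simp add: t_def)
  have "(\<integral>\<^sup>+x. ennreal ((norm (f x) / t) powr e x) \<partial>lebesgue)
      \<le> (\<integral>\<^sup>+x. ennreal (1 / (1 + I)) * ennreal ((\<epsilon> * norm (f x)) powr e x) \<partial>lebesgue)"
  proof (rule nn_integral_mono)
    fix x
    have "norm (f x) / t = (1 / (1 + I)) * (\<epsilon> * norm (f x))" using I by (simp add: t_def field_simps)
    then have "(norm (f x) / t) powr e x = (1 / (1 + I)) powr e x * (\<epsilon> * norm (f x)) powr e x"
      by (simp only: powr_mult)
    also have "\<dots> \<le> (1 / (1 + I)) powr 1 * (\<epsilon> * norm (f x)) powr e x"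
      using I e[of x] by (intro mult_right_mono powr_mono') auto
    also have "(1 / (1 + I)) powr 1 = 1 / (1 + I)" using I by simp
    finally show "ennreal ((norm (f x) / t) powr e x) \<le> ennreal (1 / (1 + I)) * ennreal ((\<epsilon> * norm (f x)) powr e x)"
      using I by (simp add: ennreal_mult[symmetric] ennreal_leI del: times_divide_eq_left)
  qed
  also have "\<dots> = ennreal (1 / (1 + I)) * ennreal I" unfolding I(1)[symmetric]
    by (rule nn_integral_cmult) measurable
  also have "\<dots> \<le> 1" using I by (simp add: ennreal_mult[symmetric] ennreal_le_1)
  finally show thesis using that t by blast
qed

text \<open>Young's inequality for products at each point, with factors |f| / \<mu> and 1 / w and
  the conjugate exponents at that point, then integrated. With \<open>w\<close> the size of the norm
  of the indicator this is the Morrey bound used in (b).\<close>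

lemma holder_cube:
  fixes f f0 :: "real^'n::finite \<Rightarrow> complex"
  assumes [measurable]: "f \<in> borel_measurable lebesgue" "q \<in> borel_measurable lebesgue" "q' \<in> borel_measurable lebesgue"
    and ae: "AE x in lebesgue. f x = f0 x"
    and q: "\<And>x. 1 < q x" "\<And>x. 1 < q' x" "\<And>x. 1 / q x + 1 / q' x = 1"
    and \<mu>: "0 < \<mu>" "(\<integral>\<^sup>+x. ennreal ((norm (f x) / \<mu>) powr q' x) \<partial>lebesgue) \<le> 1"
    and w: "0 < w" and A: "0 \<le> A" "(\<integral>\<^sup>+y\<in>cube x t. ennreal ((1 / w) powr q y) \<partial>lebesgue) \<le> ennreal A"
  shows "(\<integral>\<^sup>+y\<in>cube x t. ennreal (norm (f0 y)) \<partial>lborel) \<le> ennreal ((1 + A) * \<mu> * w)"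
proof -
  have "(\<integral>\<^sup>+y\<in>cube x t. ennreal (norm (f0 y)) \<partial>lborel) = (\<integral>\<^sup>+y\<in>cube x t. ennreal (norm (f y)) \<partial>lborel)"
    using ae unfolding AE_completion_iff by (intro nn_integral_cong_AE) auto
  also have "\<dots> = (\<integral>\<^sup>+y\<in>cube x t. ennreal (norm (f y)) \<partial>lebesgue)" by (simp add: nn_integral_completion)
  also have "\<dots> \<le> (\<integral>\<^sup>+y. ennreal (\<mu> * w) * (ennreal ((norm (f y) / \<mu>) powr q' y)
      + ennreal ((1 / w) powr q y) * indicator (cube x t) y) \<partial>lebesgue)"
  proof (rule nn_integral_mono)
    fix y
    show "ennreal (norm (f y)) * indicator (cube x t) y \<le> ennreal (\<mu> * w) * (ennreal ((norm (f y) / \<mu>) powr q' y)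
      + ennreal ((1 / w) powr q y) * indicator (cube x t) y)"
    proof (cases "y \<in> cube x t")
      case True
      have "norm (f y) / \<mu> * (1 / w) \<le> (norm (f y) / \<mu>) powr q' y / q' y + (1 / w) powr q y / q y"
        using q \<mu> w by (intro Youngs_inequality) (auto simp: add.commute)
      also have "\<dots> \<le> (norm (f y) / \<mu>) powr q' y + (1 / w) powr q y"
        using q(1,2)[of y] by (intro add_mono) (auto simp: divide_le_eq mult_le_cancel_left1)
      finally have "norm (f y) \<le> \<mu> * w * ((norm (f y) / \<mu>) powr q' y + (1 / w) powr q y)"
        using \<mu>(1) w by (simp add: field_simps)
      then have "ennreal (norm (f y)) \<le> ennreal (\<mu> * w * ((norm (f y) / \<mu>) powr q' y + (1 / w) powr q y))" by (rule ennreal_leI)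
      also have "\<dots> = ennreal (\<mu> * w) * (ennreal ((norm (f y) / \<mu>) powr q' y) + ennreal ((1 / w) powr q y))"
        using \<mu>(1) w by (simp add: ennreal_mult)
      finally show ?thesis using True by simp
    qed simp
  qed
  also have "\<dots> = ennreal (\<mu> * w) * (\<integral>\<^sup>+y. ennreal ((norm (f y) / \<mu>) powr q' y)
      + ennreal ((1 / w) powr q y) * indicator (cube x t) y \<partial>lebesgue)"
    by (rule nn_integral_cmult) measurable
  also have "(\<integral>\<^sup>+y. ennreal ((norm (f y) / \<mu>) powr q' y) + ennreal ((1 / w) powr q y) * indicator (cube x t) y \<partial>lebesgue)
      = (\<integral>\<^sup>+y. ennreal ((norm (f y) / \<mu>) powr q' y) \<partial>lebesgue) + (\<integral>\<^sup>+y\<in>cube x t. ennreal ((1 / w) powr q y) \<partial>lebesgue)"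
    by (rule nn_integral_add) measurable
  also have "ennreal (\<mu> * w) * \<dots> \<le> ennreal (\<mu> * w) * (1 + ennreal A)"
    by (intro mult_left_mono add_mono \<mu>(2) A(2)) auto
  also have "\<dots> = ennreal ((1 + A) * \<mu> * w)"
    using \<mu>(1) w A(1) by (simp add: ennreal_1[symmetric] ennreal_plus[symmetric] ennreal_mult[symmetric] mult_ac del: ennreal_plus ennreal_1)
  finally show ?thesis .
qed

text \<open>With v = 1 / q \<ge> 1 the exponent \<sigma> = n v - n is nonnegative, as the Campanato
  estimate demands; the potential raises it by \<alpha> to n u - n with u = 1 / p, the exponent that
  the target norm measures.\<close>

lemma I_loc_bmo:
  fixes p q :: "real^'n::finite \<Rightarrow> real" and \<phi>\<^sub>0 :: "real^'n \<Rightarrow> complex"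
  assumes \<alpha>: "0 < \<alpha>" "\<alpha> < real CARD('n)" and \<phi>: "local_cutoff \<phi>\<^sub>0"
    and p: "p \<in> LH" "0 < exp_inf p" "exp_sup p \<le> 1"
    and q: "var_exponent q" "\<forall>x. 1 / q x = 1 / p x - \<alpha> / real CARD('n)" "exp_sup q \<le> 1"
    and r: "1 < r" and d: "min_degree p \<le> d"
  shows "\<exists>C::real. \<forall>f\<in>bmo q r d'. I_loc \<phi>\<^sub>0 \<alpha> f \<in> bmo p r d \<and>
           bmo_norm p r d (I_loc \<phi>\<^sub>0 \<alpha> f) \<le> ennreal C * bmo_norm q r d' f"
proof -
  define n where "n = real CARD('n)"
  have n: "0 < n" using \<alpha> by (simp add: n_def)
  define s where "s = r / (r - 1)"
  have s: "1 < s" using r by (simp add: s_def)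
  obtain m where m: "exp_inf p = ereal m" "0 < m" by (rule exp_inf_real[OF p(2)])
  have pm: "m \<le> p x" for x by (rule exp_inf_leD) (simp add: m)
  have p1: "p x \<le> 1" for x by (rule exp_sup_leD) (use p(3) in \<open>simp add: one_ereal_def\<close>)
  have q1: "q x \<le> 1" for x by (rule exp_sup_leD) (use q(3) in \<open>simp add: one_ereal_def\<close>)
  have q0: "0 < q x" for x using q(1) by (simp add: var_exponent_def)
  define u where "u x = 1 / p x" for x
  define v where "v x = 1 / p x - \<alpha> / n" for x
  have vq: "v x = 1 / q x" for x using q(2) by (simp add: v_def n_def)
  have nv: "n * v x = n * u x - \<alpha>" for x using n by (simp add: v_def u_def right_diff_distrib)
  have u: "1 \<le> u x" "u x \<le> 1 / m" for x
    using p1[of x] pm[of x] m(2) less_le_trans[OF m(2) pm[of x]] by (auto simp: u_def frac_le)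
  have v: "1 \<le> v x" "v x \<le> 1 / m" for x
  proof -
    show "1 \<le> v x" using q1[of x] q0[of x] by (simp add: vq)
    have "0 \<le> \<alpha> / n" using \<alpha> n by simp
    then show "v x \<le> 1 / m" using u(2)[of x] by (simp add: u_def v_def)
  qed
  obtain K where K: "log_holder K u"
    using LH_reciprocal[OF p(1) m(2) pm, of 0] by (auto simp: u_def[abs_def])
  obtain K' where K': "log_holder K' v"
    using LH_reciprocal[OF p(1) m(2) pm, of "\<alpha> / n"] by (auto simp: v_def[abs_def])
  have gap: "n * (1 / m - 1) < real (Suc d)" unfolding n_def by (rule min_degree_gap[OF m d])
  \<comment> \<open>Half of the gap between d + 1 and the largest possible \<sigma> + \<alpha>,
    since the estimate on small cubes spends \<delta> twice.\<close>
  define \<delta> where "\<delta> = (real (Suc d) - n * (1 / m - 1)) / 2"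
  have \<delta>: "0 < \<delta>" using gap by (simp add: \<delta>_def)
  define S where "S = n / m"
  obtain Ck where "riesz_kernel (frac_kernel \<phi>\<^sub>0 \<alpha>) \<alpha> Ck (real CARD('n))"
    by (rule frac_kernel_riesz[OF \<phi> \<alpha>])
  then interpret k: riesz_kernel "frac_kernel \<phi>\<^sub>0 \<alpha>" \<alpha> Ck n unfolding n_def .
  obtain C1 where C1: "0 < C1"
    "\<And>h B. h \<in> borel_measurable borel \<Longrightarrow> 0 \<le> B \<Longrightarrow>
       (\<forall>x l. 0 < l \<and> l < 1 \<longrightarrow> (\<exists>T\<in>poly_space d.
          (\<integral>\<^sup>+y\<in>cube x l. ennreal (norm (h y - T y) powr (r / (r - 1))) \<partial>lborel)
            \<le> ennreal (l ^ CARD('n) * (B * l powr (real CARD('n) * u x - real CARD('n))) powr (r / (r - 1))))) \<Longrightarrow>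
       (\<forall>x l. 1 \<le> l \<longrightarrow> (\<exists>z. (\<forall>y\<in>cube x l. norm y \<le> norm z) \<and>
          (\<integral>\<^sup>+y\<in>cube x l. ennreal (norm (h y) powr (r / (r - 1))) \<partial>lborel)
            \<le> ennreal (l ^ CARD('n) * (B * l powr (real CARD('n) * u z - real CARD('n))) powr (r / (r - 1))))) \<Longrightarrow>
       h \<in> L1_loc \<and> bmo_norm p r d h \<le> ennreal (C1 * B)"
  proof (rule bmo_norm_le[OF K u _ _ r, where p=p and d=d])
    show "p x = 1 / u x" for x by (simp add: u_def)
    show "p \<in> borel_measurable lebesgue" using p(1) by (simp add: LH_def var_exponent_def)
  qed (rule that)
  obtain A where A: "1 \<le> A"
    "\<And>f f0 N. f \<in> L1_loc \<Longrightarrow> (AE x in lebesgue. f x = f0 x) \<Longrightarrow> bmo_norm q r d' f \<le> ennreal N \<Longrightarrow> 0 \<le> N \<Longrightarrow>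
       (\<forall>x t. 0 < t \<and> t \<le> 8 \<longrightarrow> (\<exists>P\<in>poly_space d'. (1 \<le> t \<longrightarrow> P = (\<lambda>_. 0)) \<and>
          (\<integral>\<^sup>+y\<in>cube x t. ennreal (norm (f0 y - P y) powr (r / (r - 1))) \<partial>lborel)
             \<le> ennreal (t ^ CARD('n) * (A * N * t powr (real CARD('n) * v x - real CARD('n))) powr (r / (r - 1))))) \<and>
       (\<forall>x l z. 1 \<le> l \<and> (\<forall>y\<in>cube x l. norm y \<le> norm z) \<longrightarrow>
          (\<integral>\<^sup>+y\<in>cube x l. ennreal (norm (f0 y) powr (r / (r - 1))) \<partial>lborel)
             \<le> ennreal (l ^ CARD('n) * (A * N * l powr (real CARD('n) * v z - real CARD('n))) powr (r / (r - 1))))"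
  proof (rule bmo_cube_bounds[OF K' v _ _ r, where q=q and d=d'])
    show "q x = 1 / v x" for x by (simp add: vq)
    show "q \<in> borel_measurable lebesgue" using q(1) by (simp add: var_exponent_def)
  qed (rule that)
  obtain C2 :: real where C2: "0 \<le> C2"
    "\<And>f N \<sigma> x0 l. f \<in> borel_measurable borel \<Longrightarrow> 0 < l \<Longrightarrow> l < 1 \<Longrightarrow> 0 \<le> N \<Longrightarrow> 0 \<le> \<sigma> \<Longrightarrow> \<sigma> \<le> S \<Longrightarrow>
       \<sigma> + \<alpha> + 2 * \<delta> \<le> real (Suc d) \<Longrightarrow>
       (\<forall>t. 0 < t \<and> t \<le> 8 \<longrightarrow> (\<exists>P\<in>poly_space d'. (1 \<le> t \<longrightarrow> P = (\<lambda>_. 0)) \<and>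
          (\<integral>\<^sup>+y\<in>cube x0 t. ennreal (norm (f y - P y) powr s) \<partial>lborel)
             \<le> ennreal (t ^ CARD('n) * (N * t powr \<sigma>) powr s))) \<Longrightarrow>
       \<exists>T\<in>poly_space d. (\<integral>\<^sup>+x\<in>cube x0 l. ennreal (norm (k.pot f x - T x) powr s) \<partial>lborel)
             \<le> ennreal (l ^ CARD('n) * (C2 * N * l powr (\<sigma> + \<alpha>)) powr s)"
    by (rule k.pot_small_cube_campanato[OF s \<delta>, where d=d and d'=d' and S=S], rule that)
  define C3 where "C3 = 3 ^ CARD('n) * (2 * k.K1 * 2 powr \<alpha>) * 3 powr S"
  have C3: "0 \<le> C3" using k.K1 by (simp add: C3_def)
  define C where "C = C1 * ((C2 + C3) * A)"
  have C0: "0 \<le> C" using C1(1) C2(1) C3 A(1) by (simp add: C_def)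
  show ?thesis
  proof (intro exI[of _ C] ballI)
    fix f assume "f \<in> bmo q r d'"
    then have f: "f \<in> L1_loc" and fin: "bmo_norm q r d' f < \<infinity>" by (auto simp: bmo_def)
    define N where "N = enn2real (bmo_norm q r d' f)"
    have N: "bmo_norm q r d' f = ennreal N" "0 \<le> N" using fin by (auto simp: N_def)
    have fm: "f \<in> borel_measurable lebesgue" by (rule L1_loc_measurable[OF f])
    obtain f0 where f0: "f0 \<in> borel_measurable borel" "AE x in lebesgue. f x = f0 x"
      by (rule lebesgue_borel_version[OF fm])
    have If: "I_loc \<phi>\<^sub>0 \<alpha> f = k.pot f0" by (rule k.I_loc_eq_pot[OF fm f0 refl])
    have cubes: "\<forall>x t. 0 < t \<and> t \<le> 8 \<longrightarrow> (\<exists>P\<in>poly_space d'. (1 \<le> t \<longrightarrow> P = (\<lambda>_. 0)) \<and>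
          (\<integral>\<^sup>+y\<in>cube x t. ennreal (norm (f0 y - P y) powr s) \<partial>lborel)
             \<le> ennreal (t ^ CARD('n) * (A * N * t powr (n * v x - n)) powr s))"
       "\<forall>x l z. 1 \<le> l \<and> (\<forall>y\<in>cube x l. norm y \<le> norm z) \<longrightarrow>
          (\<integral>\<^sup>+y\<in>cube x l. ennreal (norm (f0 y) powr s) \<partial>lborel)
             \<le> ennreal (l ^ CARD('n) * (A * N * l powr (n * v z - n)) powr s)"
      using A(2)[OF f f0(2) _ N(2)] N(1) unfolding s_def n_def by auto
    have AN: "0 \<le> A * N" using A(1) N(2) by simp
    define B where "B = (C2 + C3) * A * N"
    have B: "0 \<le> B" using C2(1) C3 AN by (simp add: B_def mult.assoc)
    have "k.pot f0 \<in> L1_loc \<and> bmo_norm p r d (k.pot f0) \<le> ennreal (C1 * B)"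
    proof (rule C1(2)[OF k.pot_borel[OF f0(1)] B]; intro allI impI)
      fix x :: "real^'n" and l :: real assume l: "0 < l \<and> l < 1"
      define \<sigma> where "\<sigma> = n * v x - n"
      have "n * 1 \<le> n * v x" using v n by (intro mult_left_mono) auto
      moreover have "n * v x \<le> n * (1 / m)" using v n by (intro mult_left_mono) auto
      ultimately have \<sigma>: "0 \<le> \<sigma>" "\<sigma> \<le> S" using n by (auto simp: \<sigma>_def S_def)
      have "n * u x \<le> n * (1 / m)" using u n by (intro mult_left_mono) auto
      moreover have "2 * \<delta> = real (Suc d) - n * (1 / m) + n" by (simp add: \<delta>_def right_diff_distrib)
      moreover have "\<sigma> + \<alpha> = n * u x - n" by (simp add: \<sigma>_def nv)
      ultimately have "\<sigma> + \<alpha> + 2 * \<delta> \<le> real (Suc d)" by linarith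
      from C2(2)[OF f0(1) _ _ AN \<sigma> this, of l x] l cubes(1)
      obtain T where T: "T \<in> poly_space d" "(\<integral>\<^sup>+y\<in>cube x l. ennreal (norm (k.pot f0 y - T y) powr s) \<partial>lborel)
             \<le> ennreal (l ^ CARD('n) * (C2 * (A * N) * l powr (\<sigma> + \<alpha>)) powr s)"
        unfolding \<sigma>_def by blast
      have "(C2 * (A * N) * l powr (\<sigma> + \<alpha>)) powr s \<le> (B * l powr (n * u x - n)) powr s"
      proof (intro powr_mono2)
        have "C2 * (A * N) \<le> B" using mult_nonneg_nonneg[OF C3 AN] by (simp add: B_def algebra_simps)
        moreover have "\<sigma> + \<alpha> = n * u x - n" by (simp add: \<sigma>_def nv)
        ultimately show "C2 * (A * N) * l powr (\<sigma> + \<alpha>) \<le> B * l powr (n * u x - n)" by (simp add: mult_right_mono)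
      qed (use s C2(1) AN in auto)
      then have "ennreal (l ^ CARD('n) * (C2 * (A * N) * l powr (\<sigma> + \<alpha>)) powr s) \<le> ennreal (l ^ CARD('n) * (B * l powr (n * u x - n)) powr s)"
        using l by (intro ennreal_leI mult_left_mono) auto
      with T show "\<exists>T\<in>poly_space d.
          (\<integral>\<^sup>+y\<in>cube x l. ennreal (norm (k.pot f0 y - T y) powr (r / (r - 1))) \<partial>lborel)
            \<le> ennreal (l ^ CARD('n) * (B * l powr (real CARD('n) * u x - real CARD('n))) powr (r / (r - 1)))"
        unfolding s_def[symmetric] n_def[symmetric] by (meson order_trans)
    next
      fix x :: "real^'n" and l :: real assume l: "1 \<le> l"
      \<comment> \<open>The point is chosen for the enlarged cube, on which the bound for
        \<open>f0\<close> is used; it dominates the cube of side \<open>l\<close> as well, so both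
        sides of the estimate carry the exponent at one and the same point.\<close>
      obtain z where z: "\<forall>y\<in>cube x (l + 2). norm y \<le> norm (z :: real^'n)" by (rule cube_farthest_point)
      define b where "b = A * N * (l + 2) powr (n * v z - n)"
      have b: "0 \<le> b" using AN by (simp add: b_def)
      have "(\<integral>\<^sup>+y\<in>cube x (l + 2). ennreal (norm (f0 y) powr s) \<partial>lborel) \<le> ennreal ((l + 2) ^ CARD('n) * b powr s)"
        using cubes(2) z l unfolding b_def by auto
      from k.pot_large_cube[OF f0(1) s l b this]
      have I: "(\<integral>\<^sup>+y\<in>cube x l. ennreal (norm (k.pot f0 y) powr s) \<partial>lborel)
         \<le> ennreal (l ^ CARD('n) * (3 ^ CARD('n) * (2 * k.K1 * 2 powr \<alpha>) * b) powr s)" .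
      have "(l + 2) powr (n * v z - n) \<le> (3 * l) powr (n * v z - n)"
        using l v(1)[of z] n by (intro powr_mono2) auto
      also have "\<dots> = 3 powr (n * v z - n) * l powr (n * v z - n)" using l by (simp add: powr_mult)
      \<comment> \<open>As l \<ge> 1, the exponent can be raised by \<alpha> for free: on large
        cubes no smoothing by the potential is involved.\<close>
      also have "\<dots> \<le> 3 powr S * l powr (n * u z - n)"
      proof (intro mult_mono powr_mono)
        have "n * v z \<le> n * (1 / m)" using v n by (intro mult_left_mono) auto
        then show "n * v z - n \<le> S" using n by (simp add: S_def)
        show "n * v z - n \<le> n * u z - n" using \<alpha> by (simp add: nv)
      qed (use l in auto)
      finally have "3 ^ CARD('n) * (2 * k.K1 * 2 powr \<alpha>) * b \<le> 3 ^ CARD('n) * (2 * k.K1 * 2 powr \<alpha>) * (A * N * (3 powr S * l powr (n * u z - n)))"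
        unfolding b_def using AN k.K1 by (intro mult_left_mono) auto
      also have "\<dots> = C3 * (A * N) * l powr (n * u z - n)" by (simp add: C3_def mult_ac)
      also have "\<dots> \<le> B * l powr (n * u z - n)"
        using mult_nonneg_nonneg[OF C2(1) AN] by (intro mult_right_mono) (auto simp: B_def algebra_simps)
      finally have "(3 ^ CARD('n) * (2 * k.K1 * 2 powr \<alpha>) * b) powr s \<le> (B * l powr (n * u z - n)) powr s"
        using s b k.K1 by (intro powr_mono2) auto
      then have "ennreal (l ^ CARD('n) * (3 ^ CARD('n) * (2 * k.K1 * 2 powr \<alpha>) * b) powr s) \<le> ennreal (l ^ CARD('n) * (B * l powr (n * u z - n)) powr s)"
        using l by (intro ennreal_leI mult_left_mono) auto
      with I have "(\<integral>\<^sup>+y\<in>cube x l. ennreal (norm (k.pot f0 y) powr s) \<partial>lborel)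
         \<le> ennreal (l ^ CARD('n) * (B * l powr (n * u z - n)) powr s)" by (rule order_trans)
      moreover have "\<forall>y\<in>cube x l. norm y \<le> norm z" using z cube_mono[of l "l + 2" x] by auto
      ultimately show "\<exists>z. (\<forall>y\<in>cube x l. norm y \<le> norm z) \<and>
          (\<integral>\<^sup>+y\<in>cube x l. ennreal (norm (k.pot f0 y) powr (r / (r - 1))) \<partial>lborel)
            \<le> ennreal (l ^ CARD('n) * (B * l powr (real CARD('n) * u z - real CARD('n))) powr (r / (r - 1)))"
        unfolding s_def n_def by blast
    qed
    moreover have "ennreal (C1 * B) = ennreal C * bmo_norm q r d' f"
      using C0 N(2) by (simp add: N(1) ennreal_mult[symmetric] C_def B_def mult_ac)
    moreover have "ennreal (C1 * B) < \<infinity>" by simp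
    ultimately show "I_loc \<phi>\<^sub>0 \<alpha> f \<in> bmo p r d \<and> bmo_norm p r d (I_loc \<phi>\<^sub>0 \<alpha> f) \<le> ennreal C * bmo_norm q r d' f"
      unfolding If bmo_def by (auto intro: le_less_trans)
  qed
qed

text \<open>Conjugacy of \<open>q\<close> and \<open>q'\<close> turns the norm of \<open>f\<close>
  into a Morrey bound with exponent n / q(x), to which the pointwise potential estimates apply. They
  hold for every admissible scale \<mu> of \<open>f\<close>, hence for the infimum of these scales,
  which is the norm.\<close>

lemma I_loc_Lvar:
  fixes p q q' :: "real^'n::finite \<Rightarrow> real" and \<phi>\<^sub>0 :: "real^'n \<Rightarrow> complex"
  assumes \<alpha>: "0 < \<alpha>" "\<alpha> < real CARD('n)" and \<phi>: "local_cutoff \<phi>\<^sub>0"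
    and p: "p \<in> LH" "0 < exp_inf p" "exp_sup p < 1"
    and q: "var_exponent q" "\<forall>x. 1 / q x = 1 / p x - \<alpha> / real CARD('n)" "1 < exp_inf q" "exp_sup q < \<infinity>"
    and q': "\<forall>x. 1 / q x + 1 / q' x = 1"
    and r: "1 < r" and d: "min_degree p \<le> d"
  shows "\<exists>C::real. \<forall>f\<in>Lvar q'. I_loc \<phi>\<^sub>0 \<alpha> f \<in> bmo p r d \<and>
           bmo_norm p r d (I_loc \<phi>\<^sub>0 \<alpha> f) \<le> ennreal C * Lvar_norm q' f"
proof -
  define n where "n = real CARD('n)"
  have n: "0 < n" using \<alpha> by (simp add: n_def)
  define s where "s = r / (r - 1)"
  have s: "1 < s" using r by (simp add: s_def)
  obtain m where m: "exp_inf p = ereal m" "0 < m" by (rule exp_inf_real[OF p(2)])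
  have pm: "m \<le> p x" for x by (rule exp_inf_leD) (simp add: m)
  have p0: "0 < p x" for x using m(2) pm[of x] by linarith
  have "exp_sup p < \<infinity>" using p(3) by (rule less_trans) simp
  then obtain M where M: "exp_sup p = ereal M" by (rule exp_sup_real)
  have pM: "p x \<le> M" for x by (rule exp_sup_leD) (simp add: M)
  have M01: "0 < M" "M < 1" using p0[of 0] pM[of 0] p(3) by (auto simp: M one_ereal_def)
  have "0 < exp_inf q" using q(3) by (rule less_trans[rotated]) simp
  then obtain qi where qi: "exp_inf q = ereal qi" by (rule exp_inf_real)
  have q1: "1 < q x" for x using exp_inf_leD[of qi q x] q(3) by (simp add: qi one_ereal_def)
  obtain qM where qM: "exp_sup q = ereal qM" by (rule exp_sup_real[OF q(4)])
  have qMx: "q x \<le> qM" for x by (rule exp_sup_leD) (simp add: qM)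
  have qM0: "0 < qM" using qMx[of 0] q1[of 0] by linarith
  have qm [measurable]: "q \<in> borel_measurable lebesgue" using q(1) by (simp add: var_exponent_def)
  have q'_eq: "q' x = 1 / (1 - 1 / q x)" for x
  proof -
    have "1 / q' x = 1 - 1 / q x" using q'[rule_format, of x] by linarith
    then show ?thesis by (metis div_by_1 divide_divide_eq_right mult_1)
  qed
  have q'1: "1 < q' x" for x
  proof -
    have "1 / q x < 1" "0 < 1 / q x" using q1[of x] by (auto simp: divide_less_eq)
    then show ?thesis unfolding q'_eq by (simp add: less_divide_eq)
  qed
  have q'm [measurable]: "q' \<in> borel_measurable lebesgue" unfolding q'_eq[abs_def] by measurable
  define u where "u x = 1 / p x" for x
  define v where "v x = 1 / p x - \<alpha> / n" for x
  have vq: "v x = 1 / q x" for x using q(2) by (simp add: v_def n_def)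
  have nv: "n * v x = n * u x - \<alpha>" for x using n by (simp add: v_def u_def right_diff_distrib)
  have u: "1 / M \<le> u x" "u x \<le> 1 / m" for x
    using pM[of x] pm[of x] m(2) p0[of x] by (auto simp: u_def frac_le)
  have u1: "1 \<le> u x" for x
  proof -
    have "1 \<le> 1 / M" using M01 by simp
    then show ?thesis using u(1)[of x] by linarith
  qed
  have v: "1 / qM \<le> v x" "v x \<le> 1 / m" for x
  proof -
    show "1 / qM \<le> v x" using q1[of x] qMx[of x] by (auto simp: vq frac_le)
    have "0 \<le> \<alpha> / n" using \<alpha> n by simp
    then show "v x \<le> 1 / m" using u(2)[of x] by (simp add: u_def v_def)
  qed
  obtain K where K: "log_holder K u"
    using LH_reciprocal[OF p(1) m(2) pm, of 0] by (auto simp: u_def[abs_def])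
  obtain K' where K': "log_holder K' v"
    using LH_reciprocal[OF p(1) m(2) pm, of "\<alpha> / n"] by (auto simp: v_def[abs_def])
  have gap: "n * (1 / m - 1) < real (Suc d)" unfolding n_def by (rule min_degree_gap[OF m d])
  define \<delta> where "\<delta> = real (Suc d) - n * (1 / m - 1)"
  have \<delta>: "0 < \<delta>" using gap by (simp add: \<delta>_def)
  \<comment> \<open>The least value of n u - n, the exponent of the potential. It is positive
    because the supremum \<open>M\<close> of \<open>p\<close> is less than 1, and it governs the
    convergence of the dyadic sum at the pole.\<close>
  define \<gamma> where "\<gamma> = n * (1 / M - 1)"
  have \<gamma>: "0 < \<gamma>" using n M01 by (simp add: \<gamma>_def)
  define S where "S = n / m"
  obtain Ck where "riesz_kernel (frac_kernel \<phi>\<^sub>0 \<alpha>) \<alpha> Ck (real CARD('n))"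
    by (rule frac_kernel_riesz[OF \<phi> \<alpha>])
  then interpret k: riesz_kernel "frac_kernel \<phi>\<^sub>0 \<alpha>" \<alpha> Ck n unfolding n_def .
  obtain C1 where C1: "0 < C1"
    "\<And>h B. h \<in> borel_measurable borel \<Longrightarrow> 0 \<le> B \<Longrightarrow>
       (\<forall>x l. 0 < l \<and> l < 1 \<longrightarrow> (\<exists>T\<in>poly_space d.
          (\<integral>\<^sup>+y\<in>cube x l. ennreal (norm (h y - T y) powr (r / (r - 1))) \<partial>lborel)
            \<le> ennreal (l ^ CARD('n) * (B * l powr (real CARD('n) * u x - real CARD('n))) powr (r / (r - 1))))) \<Longrightarrow>
       (\<forall>x l. 1 \<le> l \<longrightarrow> (\<exists>z. (\<forall>y\<in>cube x l. norm y \<le> norm z) \<and>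
          (\<integral>\<^sup>+y\<in>cube x l. ennreal (norm (h y) powr (r / (r - 1))) \<partial>lborel)
            \<le> ennreal (l ^ CARD('n) * (B * l powr (real CARD('n) * u z - real CARD('n))) powr (r / (r - 1))))) \<Longrightarrow>
       h \<in> L1_loc \<and> bmo_norm p r d h \<le> ennreal (C1 * B)"
  proof (rule bmo_norm_le[OF K u1 u(2) _ _ r, where p=p and d=d])
    show "p x = 1 / u x" for x by (simp add: u_def)
    show "p \<in> borel_measurable lebesgue" using p(1) by (simp add: LH_def var_exponent_def)
  qed (rule that)
  obtain A where A: "1 \<le> A"
    "\<And>x t. 0 < t \<Longrightarrow> t \<le> 8 \<Longrightarrow> (\<integral>\<^sup>+y\<in>cube x t. ennreal ((1 / t powr (real CARD('n) * v x)) powr q y) \<partial>lebesgue) \<le> ennreal A"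
  proof (rule Lvar_norm_small_cube[OF K' _ v, where e=q and S=8])
    show "0 < 1 / qM" using qM0 by simp
    show "q x = 1 / v x" for x by (simp add: vq)
  qed (use that qm in auto)
  obtain L where L: "0 \<le> L"
    "\<And>x y t. 0 < t \<Longrightarrow> t \<le> 8 \<Longrightarrow> norm (x - y) \<le> real CARD('n) * t \<Longrightarrow> \<bar>(v y - v x) * ln t\<bar> \<le> L"
    by (rule log_holder_small[OF K' v, where S=8], rule that)
  obtain C2 :: real where C2: "0 \<le> C2"
    "\<And>f N v. f \<in> borel_measurable borel \<Longrightarrow> 0 \<le> N \<Longrightarrow>
       (\<forall>x t. 0 < t \<and> t \<le> 8 \<longrightarrow> (\<integral>\<^sup>+y\<in>cube x t. ennreal (norm (f y)) \<partial>lborel) \<le> ennreal (N * t powr (n * v x))) \<Longrightarrow>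
       (\<forall>x. \<gamma> \<le> \<alpha> - n + n * v x \<and> \<alpha> - n + n * v x \<le> S \<and> \<alpha> - n + n * v x + \<delta> \<le> real (Suc d)) \<Longrightarrow>
       (\<forall>x y t. 0 < t \<and> t \<le> 8 \<and> norm (x - y) \<le> n * t \<longrightarrow> \<bar>(v y - v x) * ln t\<bar> \<le> L) \<Longrightarrow>
       (\<forall>x. norm (k.pot f x) \<le> C2 * N) \<and>
       (\<forall>x0 l. 0 < l \<and> l < 1 \<longrightarrow> (\<exists>T\<in>poly_space d. \<forall>x\<in>cube x0 l. norm (k.pot f x - T x) \<le> C2 * N * l powr (\<alpha> - n + n * v x0)))"
    by (rule k.pot_bounds_morrey[OF \<gamma> \<delta> L(1), where S=S and d=d], rule that)
  have exps: "\<forall>x. \<gamma> \<le> \<alpha> - n + n * v x \<and> \<alpha> - n + n * v x \<le> S \<and> \<alpha> - n + n * v x + \<delta> \<le> real (Suc d)"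
  proof
    fix x
    have "n * (1 / M) \<le> n * u x" "n * u x \<le> n * (1 / m)"
      by (rule mult_left_mono[OF u(1) less_imp_le[OF n]], rule mult_left_mono[OF u(2) less_imp_le[OF n]])
    then show "\<gamma> \<le> \<alpha> - n + n * v x \<and> \<alpha> - n + n * v x \<le> S \<and> \<alpha> - n + n * v x + \<delta> \<le> real (Suc d)"
      using n by (simp add: nv \<gamma>_def S_def \<delta>_def right_diff_distrib del: of_nat_Suc)
  qed
  have osc: "\<forall>x y t. 0 < t \<and> t \<le> 8 \<and> norm (x - y) \<le> n * t \<longrightarrow> \<bar>(v y - v x) * ln t\<bar> \<le> L"
    using L(2) by (simp add: n_def)
  define C where "C = C1 * (C2 * (1 + A))"
  have C0: "0 \<le> C" using C1(1) C2(1) A(1) by (simp add: C_def)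
  show ?thesis
  \<comment> \<open>\<open>C\<close> may be 0; C + 1 can be inverted, which is how the estimate is
    passed to the infimum below.\<close>
  proof (intro exI[of _ "C + 1"] ballI)
    fix f assume f: "f \<in> Lvar q'"
    have fm: "f \<in> borel_measurable lebesgue" using f by (simp add: Lvar_def)
    obtain f0 where f0: "f0 \<in> borel_measurable borel" "AE x in lebesgue. f x = f0 x"
      by (rule lebesgue_borel_version[OF fm])
    have If: "I_loc \<phi>\<^sub>0 \<alpha> f = k.pot f0" by (rule k.I_loc_eq_pot[OF fm f0 refl])
    define \<Lambda> where "\<Lambda> = {t. 0 < t \<and> (\<integral>\<^sup>+x. ennreal ((norm (f x) / t) powr q' x) \<partial>lebesgue) \<le> 1}"
    have bound: "k.pot f0 \<in> L1_loc \<and> bmo_norm p r d (k.pot f0) \<le> ennreal (C * \<mu>)" if "\<mu> \<in> \<Lambda>" for \<mu>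
    proof -
      have \<mu>: "0 < \<mu>" "(\<integral>\<^sup>+x. ennreal ((norm (f x) / \<mu>) powr q' x) \<partial>lebesgue) \<le> 1" using that by (auto simp: \<Lambda>_def)
      define N where "N = (1 + A) * \<mu>"
      have N: "0 \<le> N" using A(1) \<mu>(1) by (simp add: N_def)
      have "\<forall>x t. 0 < t \<and> t \<le> 8 \<longrightarrow> (\<integral>\<^sup>+y\<in>cube x t. ennreal (norm (f0 y)) \<partial>lborel) \<le> ennreal (N * t powr (n * v x))"
      proof (intro allI impI)
        fix x :: "real^'n" and t :: real assume t: "0 < t \<and> t \<le> 8"
        show "(\<integral>\<^sup>+y\<in>cube x t. ennreal (norm (f0 y)) \<partial>lborel) \<le> ennreal (N * t powr (n * v x))"
          unfolding N_def
          by (rule holder_cube[OF fm qm q'm f0(2) q1 q'1 _ \<mu>]) (use t q' A in \<open>auto simp: n_def\<close>)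
      qed
      from C2(2)[OF f0(1) N this exps osc]
      have pt: "\<And>x. norm (k.pot f0 x) \<le> C2 * N"
        and sm: "\<And>x0 l. 0 < l \<Longrightarrow> l < 1 \<Longrightarrow> \<exists>T\<in>poly_space d. \<forall>x\<in>cube x0 l. norm (k.pot f0 x - T x) \<le> C2 * N * l powr (n * u x0 - n)"
        by (auto simp: nv)
      have CN: "0 \<le> C2 * N" using C2(1) N by simp
      have "k.pot f0 \<in> L1_loc \<and> bmo_norm p r d (k.pot f0) \<le> ennreal (C1 * (C2 * N))"
      proof (rule C1(2)[OF k.pot_borel[OF f0(1)] CN]; intro allI impI)
        fix x :: "real^'n" and l :: real assume l: "0 < l \<and> l < 1"
        then obtain T where T: "T \<in> poly_space d" "\<And>y. y \<in> cube x l \<Longrightarrow> norm (k.pot f0 y - T y) \<le> C2 * N * l powr (n * u x - n)"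
          using sm by blast
        have "(\<integral>\<^sup>+y\<in>cube x l. ennreal (norm (k.pot f0 y - T y) powr s) \<partial>lborel)
            \<le> ennreal ((C2 * N * l powr (n * u x - n)) powr s * l ^ CARD('n))"
          using l s T(2) by (intro cube_integral_bounded_le ennreal_leI powr_mono2) auto
        then show "\<exists>T\<in>poly_space d.
          (\<integral>\<^sup>+y\<in>cube x l. ennreal (norm (k.pot f0 y - T y) powr (r / (r - 1))) \<partial>lborel)
            \<le> ennreal (l ^ CARD('n) * (C2 * N * l powr (real CARD('n) * u x - real CARD('n))) powr (r / (r - 1)))"
          using T(1) unfolding s_def n_def by (auto simp: mult.commute)
      next
        fix x :: "real^'n" and l :: real assume l: "1 \<le> l"
        obtain z where z: "\<forall>y\<in>cube x l. norm y \<le> norm (z :: real^'n)" by (rule cube_farthest_point)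
        \<comment> \<open>On a large cube the uniform bound is enough: n u(z) - n \<ge> 0 and l
          \<ge> 1 make the power of \<open>l\<close> at least 1.\<close>
        have "norm (k.pot f0 y) \<le> C2 * N * l powr (n * u z - n)" for y
        proof -
          have "n * 1 \<le> n * u z" using u1 n by (intro mult_left_mono) auto
          then have "C2 * N * 1 \<le> C2 * N * l powr (n * u z - n)"
            using l CN by (intro mult_left_mono ge_one_powr_ge_zero) auto
          then show ?thesis using pt[of y] by linarith
        qed
        then have "(\<integral>\<^sup>+y\<in>cube x l. ennreal (norm (k.pot f0 y) powr s) \<partial>lborel)
            \<le> ennreal ((C2 * N * l powr (n * u z - n)) powr s * l ^ CARD('n))"
          using l s by (intro cube_integral_bounded_le ennreal_leI powr_mono2) auto
        then show "\<exists>z. (\<forall>y\<in>cube x l. norm y \<le> norm z) \<and>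
          (\<integral>\<^sup>+y\<in>cube x l. ennreal (norm (k.pot f0 y) powr (r / (r - 1))) \<partial>lborel)
            \<le> ennreal (l ^ CARD('n) * (C2 * N * l powr (real CARD('n) * u z - real CARD('n))) powr (r / (r - 1)))"
          using z unfolding s_def n_def by (auto simp: mult.commute)
      qed
      then show ?thesis by (simp add: C_def N_def mult.assoc)
    qed
    have ne: "\<exists>\<mu>. \<mu> \<in> \<Lambda>"
      by (rule Lvar_scale_nonempty[OF f _ q'm]) (use q'1 in \<open>auto simp: \<Lambda>_def less_imp_le\<close>)
    then obtain \<mu>0 where "\<mu>0 \<in> \<Lambda>" by blast
    then have mem: "k.pot f0 \<in> bmo p r d"
      using bound[of \<mu>0] by (auto simp: bmo_def intro: le_less_trans)
    define X where "X = bmo_norm p r d (k.pot f0)"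
    \<comment> \<open>The constant is moved to the left, so that what has to be shown is a lower
      bound for an infimum, which can be checked scale by scale.\<close>
    have "ennreal (1 / (C + 1)) * X \<le> Lvar_norm q' f"
      unfolding Lvar_norm_def \<Lambda>_def[symmetric]
    proof (rule Inf_greatest)
      fix z assume "z \<in> ennreal ` \<Lambda>"
      then obtain \<mu> where \<mu>: "z = ennreal \<mu>" "\<mu> \<in> \<Lambda>" by auto
      then have l0: "0 < \<mu>" by (simp add: \<Lambda>_def)
      have "ennreal (1 / (C + 1)) * X \<le> ennreal (1 / (C + 1)) * ennreal (C * \<mu>)"
        using bound[OF \<mu>(2)] by (intro mult_left_mono) (auto simp: X_def)
      also have "\<dots> = ennreal (C / (C + 1) * \<mu>)" using C0 l0 by (simp add: ennreal_mult[symmetric])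
      also have "\<dots> \<le> ennreal (1 * \<mu>)" using C0 l0 by (intro ennreal_leI mult_right_mono) auto
      finally show "ennreal (1 / (C + 1)) * X \<le> z" by (simp add: \<mu>)
    qed
    then have "ennreal (C + 1) * (ennreal (1 / (C + 1)) * X) \<le> ennreal (C + 1) * Lvar_norm q' f" by (rule mult_left_mono) simp
    moreover have "ennreal (C + 1) * (ennreal (1 / (C + 1)) * X) = X"
      using C0 by (simp add: mult.assoc[symmetric] ennreal_mult[symmetric] del: ennreal_plus)
    ultimately show "I_loc \<phi>\<^sub>0 \<alpha> f \<in> bmo p r d \<and> bmo_norm p r d (I_loc \<phi>\<^sub>0 \<alpha> f) \<le> ennreal (C + 1) * Lvar_norm q' f"
      unfolding If using mem by (simp add: X_def)
  qed
qed

theorem corollary6p2: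
  fixes p q :: "real^'n::finite \<Rightarrow> real" and \<alpha> r :: real and d :: nat
    and \<phi>\<^sub>0 :: "real^'n \<Rightarrow> complex"
  assumes "0 < \<alpha>" and "\<alpha> < real CARD('n)"
    and "local_cutoff \<phi>\<^sub>0"
    and "p \<in> LH" and "0 < exp_inf p" and "exp_sup p \<le> 1"
    and "var_exponent q" and "\<forall>x. 1 / q x = 1 / p x - \<alpha> / real CARD('n)"
    and "1 < r" and "min_degree p \<le> d"
  shows
    "(0 < exp_inf q \<and> exp_sup q \<le> 1 \<longrightarrow>
        (\<forall>d'\<ge>min_degree q. \<exists>C::real. \<forall>f\<in>bmo q r d'.
           I_loc \<phi>\<^sub>0 \<alpha> f \<in> bmo p r d \<and>
           bmo_norm p r d (I_loc \<phi>\<^sub>0 \<alpha> f) \<le> ennreal C * bmo_norm q r d' f))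
     \<and>
     (exp_sup p < 1 \<and> 1 < exp_inf q \<and> exp_sup q < \<infinity> \<longrightarrow>
        (\<forall>q'. (\<forall>x. 1 / q x + 1 / q' x = 1) \<longrightarrow>
           (\<exists>C::real. \<forall>f\<in>Lvar q'.
              I_loc \<phi>\<^sub>0 \<alpha> f \<in> bmo p r d \<and>
              bmo_norm p r d (I_loc \<phi>\<^sub>0 \<alpha> f) \<le> ennreal C * Lvar_norm q' f)))"
  using assms I_loc_bmo[of \<alpha> \<phi>\<^sub>0 p q r d] I_loc_Lvar[of \<alpha> \<phi>\<^sub>0 p q _ r d] by blast

end
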